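(* Let $\mathfrak g$ be a finite-dimensional complex Lie algebra without proper semi-invariants, with $\operatorname{ind}\mathfrak g=1$ and with nonconstant fundamental semi-invariant $p_{\mathfrak g}$. Put $k=\tfrac12(\dim\mathfrak g+\operatorname{ind}\mathfrak g)-\deg p_{\mathfrak g}$. Then: (1) the algebra of invariant polynomials is a polynomial algebra $\mathbb C[\mathfrak g^*]^{\mathfrak g}=\mathbb C[f]$ with $\deg f=k$, and $p_{\mathfrak g}=c f^d$ for some $c\in\mathbb C$, $d\in\mathbb N$; (2) the Jordan–Kronecker invariants of $\mathfrak g$ consist of one Kronecker $(2k-1)\times(2k-1)$ block and $k$ equal Jordan tuples $J_{\lambda_i}(2n_1,\dots,2n_s)$, $i=1,\dots,k$, where $n_1+\dots+n_s=d=\deg p_{\mathfrak g}/\deg f$.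
   Context: Identify the symmetric algebra $S(\mathfrak g)$ with polynomials on $\mathfrak g^*$, with Lie–Poisson bracket $\{f,g\}(x)=\langle x,[df(x),dg(x)]\rangle$. A nonzero $f\in S(\mathfrak g)$ is a semi-invariant of weight $\chi_f\in\mathfrak g^*$ if $\{g,f\}(x)=\chi_f(dg(x))f(x)$ for all $g$; it is an invariant if $\chi_f=0$, and $\mathfrak g$ has no proper semi-invariants if every semi-invariant is an invariant. $\mathbb C[\mathfrak g^*]^{\mathfrak g}$ is the algebra of invariant polynomials. For $x\in\mathfrak g^*$ let $\mathcal A_x=(\sum_kc^k_{ij}x_k)$ be the matrix of $(\xi,\eta)\mapsto\langle x,[\xi,\eta]\rangle$ in a basis with structure constants $c^k_{ij}$. The index $\operatorname{ind}\mathfrak g=\dim\mathfrak g-\max_x\operatorname{rk}\mathcal A_x$. The fundamental semi-invariant $p_{\mathfrak g}$ is the greatest common divisor of the Pfaffians of all principal submatrices of $\mathcal A_x$ of order $\dim\mathfrak g-\operatorname{ind}\mathfrak g$ (a polynomial in $x$, defined up to a scalar). JK invariants: by the Jordan–Kronecker theorem a pair of skew forms on a finite-dimensional complex space decomposes into Jordan $2n\times2n$ blocks with eigenvalues $\mu\in\mathbb C\cup\{\infty\}$ and Kronecker $(2k-1)\times(2k-1)$ blocks, uniquely up to order; the JK invariants of $\mathfrak g$ are the Kronecker sizes and Jordan tuples $J_{\lambda_i}(2n_{i1},\dots,2n_{is_i})$ (sizes of Jordan blocks with common eigenvalue $\lambda_i$) of $(\mathcal A_x,\mathcal A_a)$ for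 $(x,a)$ in a nonempty Zariski open subset of $\mathfrak g^*\times\mathfrak g^*$. Two Jordan tuples are equal if they have the same list of sizes. *)

theory Defs
  imports "HOL-Analysis.Analysis" "Jordan_Normal_Form.Matrix" "Jordan_Normal_Form.Determinant"
    "Jordan_Normal_Form.DL_Submatrix" "Jordan_Normal_Form.DL_Rank"
begin

text \<open>A complex Lie algebra of dimension n is given by structure constants c i j k
  (w.r.t. a basis e_0..e_(n-1): [e_i,e_j] = sum_k c i j k e_k), skew-symmetric and
  satisfying the Jacobi identity. Points of g* are x :: nat => complex (coordinates
  x k = <x, e_k>, only k < n matter).\<close>

definition lie_sc :: "nat \<Rightarrow> (nat \<Rightarrow> nat \<Rightarrow> nat \<Rightarrow> complex) \<Rightarrow> bool" where
  "lie_sc n c \<longleftrightarrow>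
     (\<forall>i<n. \<forall>j<n. \<forall>k<n. c i j k = - c j i k) \<and>
     (\<forall>i<n. \<forall>j<n. \<forall>l<n. \<forall>s<n.
        (\<Sum>m<n. c i j m * c m l s + c j l m * c m i s + c l i m * c m j s) = 0)"

inductive polyfun :: "nat \<Rightarrow> ((nat \<Rightarrow> complex) \<Rightarrow> complex) \<Rightarrow> bool" for n where
  pf_const: "polyfun n (\<lambda>x. a)"
| pf_var: "i < n \<Longrightarrow> polyfun n (\<lambda>x. x i)"
| pf_add: "polyfun n f \<Longrightarrow> polyfun n g \<Longrightarrow> polyfun n (\<lambda>x. f x + g x)"
| pf_mult: "polyfun n f \<Longrightarrow> polyfun n g \<Longrightarrow> polyfun n (\<lambda>x. f x * g x)"

inductive polyfun_le :: "nat \<Rightarrow> nat \<Rightarrow> ((nat \<Rightarrow> complex) \<Rightarrow> complex) \<Rightarrow> bool" for n where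
  pfl_const: "polyfun_le n d (\<lambda>x. a)"
| pfl_var: "i < n \<Longrightarrow> 1 \<le> d \<Longrightarrow> polyfun_le n d (\<lambda>x. x i)"
| pfl_add: "polyfun_le n d f \<Longrightarrow> polyfun_le n d g \<Longrightarrow> polyfun_le n d (\<lambda>x. f x + g x)"
| pfl_mult: "polyfun_le n d1 f \<Longrightarrow> polyfun_le n d2 g \<Longrightarrow> d1 + d2 \<le> d
              \<Longrightarrow> polyfun_le n d (\<lambda>x. f x * g x)"

definition polydeg :: "nat \<Rightarrow> ((nat \<Rightarrow> complex) \<Rightarrow> complex) \<Rightarrow> nat" where
  "polydeg n f = (LEAST d. polyfun_le n d f)"

definition polydvd :: "nat \<Rightarrow> ((nat \<Rightarrow> complex) \<Rightarrow> complex) \<Rightarrow> ((nat \<Rightarrow> complex) \<Rightarrow> complex) \<Rightarrow> bool" where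
  "polydvd n f g \<longleftrightarrow> (\<exists>h. polyfun n h \<and> g = (\<lambda>x. f x * h x))"

definition is_polygcd :: "nat \<Rightarrow> ((nat \<Rightarrow> complex) \<Rightarrow> complex) set \<Rightarrow> ((nat \<Rightarrow> complex) \<Rightarrow> complex) \<Rightarrow> bool" where
  "is_polygcd n S p \<longleftrightarrow> polyfun n p \<and> (\<forall>f\<in>S. polydvd n p f) \<and>
     (\<forall>q. polyfun n q \<longrightarrow> (\<forall>f\<in>S. polydvd n q f) \<longrightarrow> polydvd n q p)"

definition pdiff :: "nat \<Rightarrow> ((nat \<Rightarrow> complex) \<Rightarrow> complex) \<Rightarrow> (nat \<Rightarrow> complex) \<Rightarrow> complex" where
  "pdiff i f x = deriv (\<lambda>t. f (x(i := x i + t))) 0"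

text \<open>Lie--Poisson bracket {f,g}(x) = <x,[df(x),dg(x)]>.\<close>
definition lp_bracket :: "nat \<Rightarrow> (nat \<Rightarrow> nat \<Rightarrow> nat \<Rightarrow> complex) \<Rightarrow>
    ((nat \<Rightarrow> complex) \<Rightarrow> complex) \<Rightarrow> ((nat \<Rightarrow> complex) \<Rightarrow> complex) \<Rightarrow> (nat \<Rightarrow> complex) \<Rightarrow> complex" where
  "lp_bracket n c f g x = (\<Sum>i<n. \<Sum>j<n. (\<Sum>k<n. c i j k * x k) * pdiff i f x * pdiff j g x)"

definition semi_invariant_wt :: "nat \<Rightarrow> (nat \<Rightarrow> nat \<Rightarrow> nat \<Rightarrow> complex) \<Rightarrow>
    ((nat \<Rightarrow> complex) \<Rightarrow> complex) \<Rightarrow> (nat \<Rightarrow> complex) \<Rightarrow> bool" where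
  "semi_invariant_wt n c f chi \<longleftrightarrow> polyfun n f \<and> f \<noteq> (\<lambda>x. 0) \<and>
     (\<forall>g. polyfun n g \<longrightarrow> (\<forall>x. lp_bracket n c g f x = (\<Sum>i<n. chi i * pdiff i g x) * f x))"

definition no_proper_semi_invariants :: "nat \<Rightarrow> (nat \<Rightarrow> nat \<Rightarrow> nat \<Rightarrow> complex) \<Rightarrow> bool" where
  "no_proper_semi_invariants n c \<longleftrightarrow>
     (\<forall>f chi. semi_invariant_wt n c f chi \<longrightarrow> (\<forall>i<n. chi i = 0))"

definition invariant_polys :: "nat \<Rightarrow> (nat \<Rightarrow> nat \<Rightarrow> nat \<Rightarrow> complex) \<Rightarrow> ((nat \<Rightarrow> complex) \<Rightarrow> complex) set" where
  "invariant_polys n c = {f. polyfun n f \<and> (\<forall>g. polyfun n g \<longrightarrow> (\<forall>x. lp_bracket n c g f x = 0))}"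

definition Amat :: "nat \<Rightarrow> (nat \<Rightarrow> nat \<Rightarrow> nat \<Rightarrow> complex) \<Rightarrow> (nat \<Rightarrow> complex) \<Rightarrow> complex mat" where
  "Amat n c x = mat n n (\<lambda>(i,j). \<Sum>k<n. c i j k * x k)"

definition lie_index :: "nat \<Rightarrow> (nat \<Rightarrow> nat \<Rightarrow> nat \<Rightarrow> complex) \<Rightarrow> nat" where
  "lie_index n c = n - Max (range (\<lambda>x. vec_space.rank n (Amat n c x)))"

definition pfaffian :: "complex mat \<Rightarrow> complex" where
  "pfaffian M = (let m = dim_row M div 2 in
     (\<Sum>\<sigma> | \<sigma> permutes {..<2*m}. of_int (sign \<sigma>) * (\<Prod>i<m. M $$ (\<sigma> (2*i), \<sigma> (2*i+1))))
       / (2 ^ m * of_nat (fact m)))"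

definition principal_pfaffians :: "nat \<Rightarrow> (nat \<Rightarrow> nat \<Rightarrow> nat \<Rightarrow> complex) \<Rightarrow> ((nat \<Rightarrow> complex) \<Rightarrow> complex) set" where
  "principal_pfaffians n c =
     {(\<lambda>x. pfaffian (submatrix (Amat n c x) I I)) | I. I \<subseteq> {..<n} \<and> card I = n - lie_index n c}"

definition fundamental_semi_invariant :: "nat \<Rightarrow> (nat \<Rightarrow> nat \<Rightarrow> nat \<Rightarrow> complex) \<Rightarrow> ((nat \<Rightarrow> complex) \<Rightarrow> complex) \<Rightarrow> bool" where
  "fundamental_semi_invariant n c p \<longleftrightarrow> is_polygcd n (principal_pfaffians n c) p"

text \<open>Jord mu m: Jordan block of size 2m x 2m with eigenvalue mu (None = infinity);
  Kron m: Kronecker block of size (2m-1) x (2m-1).\<close>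
datatype jk_block = Jord "complex option" nat | Kron nat

definition jordan_cell :: "complex \<Rightarrow> nat \<Rightarrow> complex mat" where
  "jordan_cell lam m = mat m m (\<lambda>(i,j). if i = j then lam else if j = i + 1 then 1 else 0)"

definition skew_pair_block :: "complex mat \<Rightarrow> complex mat" where
  "skew_pair_block K = four_block_mat (0\<^sub>m (dim_row K) (dim_row K)) K
      (- transpose_mat K) (0\<^sub>m (dim_col K) (dim_col K))"

text \<open>The canonical pair (A,B) of each block; a Jordan block with finite eigenvalue lam
  means A - lam B degenerates on the block.\<close>
fun jk_pair :: "jk_block \<Rightarrow> complex mat \<times> complex mat" where
  "jk_pair (Jord (Some lam) m) = (skew_pair_block (jordan_cell lam m), skew_pair_block (1\<^sub>m m))"
| "jk_pair (Jord None m) = (skew_pair_block (1\<^sub>m m), skew_pair_block (jordan_cell 0 m))"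
| "jk_pair (Kron m) =
     (skew_pair_block (mat (m - 1) m (\<lambda>(i,j). if j = i then 1 else 0)),
      skew_pair_block (mat (m - 1) m (\<lambda>(i,j). if j = i + 1 then 1 else 0)))"

fun block_diag :: "complex mat list \<Rightarrow> complex mat" where
  "block_diag [] = 0\<^sub>m 0 0"
| "block_diag (M # Ms) = (let R = block_diag Ms in
     four_block_mat M (0\<^sub>m (dim_row M) (dim_col R)) (0\<^sub>m (dim_row R) (dim_col M)) R)"

definition has_jk_decomposition :: "nat \<Rightarrow> complex mat \<Rightarrow> complex mat \<Rightarrow> jk_block list \<Rightarrow> bool" where
  "has_jk_decomposition n A B bs \<longleftrightarrow>
     (\<exists>P. P \<in> carrier_mat n n \<and> invertible_mat P \<and>
        transpose_mat P * A * P = block_diag (map (fst \<circ> jk_pair) bs) \<and>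
        transpose_mat P * B * P = block_diag (map (snd \<circ> jk_pair) bs))"

definition join_pt :: "nat \<Rightarrow> (nat \<Rightarrow> complex) \<Rightarrow> (nat \<Rightarrow> complex) \<Rightarrow> nat \<Rightarrow> complex" where
  "join_pt n x a = (\<lambda>i. if i < n then x i else a (i - n))"

definition zariski_open_pairs :: "nat \<Rightarrow> ((nat \<Rightarrow> complex) \<times> (nat \<Rightarrow> complex)) set \<Rightarrow> bool" where
  "zariski_open_pairs n U \<longleftrightarrow> (\<exists>S. (\<forall>h\<in>S. polyfun (2*n) h) \<and>
      U = {(x,a). \<exists>h\<in>S. h (join_pt n x a) \<noteq> 0})"

end

theory Submission
  imports Defs "HOL-Library.Function_Algebras"
    "Jordan_Normal_Form.Jordan_Normal_Form_Uniqueness"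
    "HOL-Computational_Algebra.Computational_Algebra"
begin

text \<open>
  Since the index is one, the kernel of the structure matrix over the rational functions is spanned by one coprime
  vector \<open>Q\<close> of homogeneous polynomials of degree \<open>m\<close>, and the cofactors are \<open>k Q\<^sub>i Q\<^sub>j\<close>, where \<open>k\<close> is a multiple of \<open>p\<^sup>2\<close>.
  Jacobi's formula for the derivative of a determinant shows that \<open>k\<close> is a semi-invariant, so \<open>p\<close> is an invariant. Gradients of
  invariants are multiples of \<open>Q\<close>, and \<open>f = \<Sum> x\<^sub>i Q\<^sub>i\<close> is an invariant with gradient \<open>(m + 1) Q\<close> by Euler's identity. Every
  homogeneous invariant is a multiple of a power of \<open>f\<close>, and \<open>f\<close> is irreducible because irreducible factors of an
  invariant are semi-invariants.

  For generic \<open>(x, a)\<close> the coefficients in \<open>t\<close> of \<open>Q(x - t a)\<close> are independent and carry the Kronecker block. Bordering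
  both forms makes \<open>A\<^sub>a\<close> nondegenerate; the self-adjoint operator of the bordered pair has characteristic polynomial
  proportional to \<open>t\<^sup>2 f(x - t a)\<^bsup>2d\<^esup> Q\<^sub>i(x - t a)\<^sup>2\<close>, and its Jordan blocks at the \<open>m + 1\<close> simple roots of \<open>f(x - t a)\<close> already live on
  the unbordered space, orthogonally to the Kronecker block. Their sizes are determined by ranks of polynomial matrices
  on the irreducible hypersurface \<open>f(x - t a) = 0\<close>, so generically they are the same at all roots.
\<close>

section \<open>Polynomial functions as an integral domain\<close>

text \<open>Two obstacles shape the proof. The dimension is odd, so neither form of the pair is
  invertible and there is no operator \<open>B^-1 A\<close> to decompose. Bordering by a unit vector
  repairs this at the price of foreign eigenvalues, namely 0 and the zeros of one \<open>Q_i\<close>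
  on the line; a generic line keeps these away from the zeros of \<open>f\<close>, and only
  therefore do the blocks at the latter descend to the original space. The tuples at different roots
  must coincide although the roots cannot be told apart rationally. A polynomial inequation that
  holds at one point of the irreducible hypersurface \<open>f(x - t a) = 0\<close> holds, after
  \<open>t\<close> is eliminated, at every root for generic \<open>(x, a)\<close>. The same
  elimination, in the last of \<open>n + 1\<close> variables, is also what makes irreducible
  polynomials prime. The number \<open>k\<close> of the statement arises from degrees: the cofactors
  have degree \<open>n - 1 = 2 deg p + 2 m\<close>, so \<open>m + 1 = (n + 1)/2 - deg p\<close>, and
  \<open>m + 1\<close> is at once the degree of \<open>f\<close>, the number of roots and the
  parameter of the Kronecker block.\<close>

lemma polyfun_mono: "polyfun n f \<Longrightarrow> n \<le> m \<Longrightarrow> polyfun m f"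
  by (induction rule: polyfun.induct) (auto intro: polyfun.intros)

text \<open>Polynomials are kept as functions, the form they have in the statement, but as a type of
  their own so that ring classes apply. The number of variables is left open, since the arguments
  below pass between \<open>n\<close>, \<open>2 n\<close> and \<open>2 n + 1\<close>
  variables.\<close>

typedef mp = "{f :: (nat \<Rightarrow> complex) \<Rightarrow> complex. \<exists>n. polyfun n f}"
  morphisms ev Abs_mp
  by (rule exI[of _ "\<lambda>_. 0"]) (auto intro: pf_const)

setup_lifting type_definition_mp

lemma ev_inject_fun: "(\<And>x. ev f x = ev g x) \<Longrightarrow> f = g"
  by (metis ev_inject ext)

lemma polyfun_common:
  assumes "polyfun n f" "polyfun m g"
  obtains k where "polyfun k f" "polyfun k g"
  using polyfun_mono[OF assms(1), of "max n m"] polyfun_mono[OF assms(2), of "max n m"] by auto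

instantiation mp :: comm_ring_1
begin
lift_definition zero_mp :: mp is "\<lambda>_. 0" by (auto intro: pf_const)
lift_definition one_mp :: mp is "\<lambda>_. 1" by (auto intro: pf_const)
lift_definition plus_mp :: "mp \<Rightarrow> mp \<Rightarrow> mp" is "\<lambda>f g x. f x + g x"
  by (metis pf_add polyfun_common)
lift_definition times_mp :: "mp \<Rightarrow> mp \<Rightarrow> mp" is "\<lambda>f g x. f x * g x"
  by (metis pf_mult polyfun_common)
lift_definition uminus_mp :: "mp \<Rightarrow> mp" is "\<lambda>f x. - f x"
proof -
  fix f :: "(nat \<Rightarrow> complex) \<Rightarrow> complex" assume "\<exists>n. polyfun n f"
  then obtain n where "polyfun n f" by blast
  from pf_mult[OF pf_const[of n "-1"] this] show "\<exists>n. polyfun n (\<lambda>x. - f x)" by auto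
qed
definition minus_mp :: "mp \<Rightarrow> mp \<Rightarrow> mp" where "minus_mp f g = f + - g"
instance
proof
  fix a b c :: mp
  show "a + b + c = a + (b + c)" by transfer (simp add: add.assoc)
  show "a + b = b + a" by transfer (simp add: add.commute)
  show "0 + a = a" by transfer simp
  show "- a + a = 0" by transfer simp
  show "a - b = a + - b" by (rule minus_mp_def)
  show "a * b * c = a * (b * c)" by transfer (simp add: mult.assoc)
  show "a * b = b * a" by transfer (simp add: mult.commute)
  show "1 * a = a" by transfer simp
  show "(a + b) * c = a * c + b * c" by transfer (simp add: distrib_right)
  show "(0::mp) \<noteq> 1" by transfer (simp add: fun_eq_iff)
qed
end

lift_definition mconst :: "complex \<Rightarrow> mp" is "\<lambda>a _. a" by (auto intro: pf_const)
lift_definition mvar :: "nat \<Rightarrow> mp" is "\<lambda>i x. x i" by (auto intro: pf_var[OF lessI])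

lemma ev_simps [simp]:
  "ev 0 x = 0" "ev 1 x = 1" "ev (f + g) x = ev f x + ev g x" "ev (f * g) x = ev f x * ev g x"
  "ev (- f) x = - ev f x" "ev (mconst a) x = a" "ev (mvar i) x = x i"
  by (transfer, simp)+

lemma ev_diff [simp]: "ev (f - g) x = ev f x - ev g x"
  using ev_simps(3)[of f "- g" x] ev_simps(5)[of g x] by simp

lemma ev_power [simp]: "ev (f ^ k) x = ev f x ^ k"
  by (induction k) auto

lemma ev_sum [simp]: "ev (sum f A) x = (\<Sum>i\<in>A. ev (f i) x)"
  by (induction A rule: infinite_finite_induct) auto

lemma ev_prod [simp]: "ev (prod f A) x = (\<Prod>i\<in>A. ev (f i) x)"
  by (induction A rule: infinite_finite_induct) auto

lemma ev_of_nat [simp]: "ev (of_nat k) x = of_nat k"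
  by (induction k) auto

lemma ev_of_int [simp]: "ev (of_int k) x = of_int k"
  by (cases k rule: int_diff_cases) auto

lemma ev_numeral [simp]: "ev (numeral k) x = numeral k"
  using ev_of_nat[of "numeral k" x] by simp

lemma mconst_hom: "mconst 0 = 0" "mconst 1 = 1" "mconst (a + b) = mconst a + mconst b" "mconst (a * b) = mconst a * mconst b"
  "mconst (- a) = - mconst a" "mconst (a - b) = mconst a - mconst b"
  by (rule ev_inject_fun; simp)+

lemma mconst_power: "mconst (a ^ k) = mconst a ^ k"
  by (rule ev_inject_fun) simp

lemma mconst_eq_iff [simp]: "mconst a = mconst b \<longleftrightarrow> a = b"
  by (metis ev_simps(6))

lemma mconst_eq_0_iff [simp]: "mconst a = 0 \<longleftrightarrow> a = 0"
  using mconst_eq_iff[of a 0] by (simp add: mconst_hom)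

definition polys :: "nat \<Rightarrow> mp set" where "polys n = {f. polyfun n (ev f)}"

lemma polys_ex: "\<exists>n. f \<in> polys n"
  using ev[of f] by (simp add: polys_def)

lemma polys_mono: "f \<in> polys n \<Longrightarrow> n \<le> m \<Longrightarrow> f \<in> polys m"
  by (auto simp: polys_def intro: polyfun_mono)

lemma polyfun_ex_polys: "polyfun n f \<Longrightarrow> \<exists>g\<in>polys n. ev g = f"
proof -
  assume "polyfun n f"
  then have "ev (Abs_mp f) = f" by (intro Abs_mp_inverse) auto
  with \<open>polyfun n f\<close> show ?thesis by (intro bexI[of _ "Abs_mp f"]) (auto simp: polys_def)
qed

lemma polys_K [simp, intro]: "mconst a \<in> polys n" by (auto simp: polys_def mconst.rep_eq intro: pf_const)
lemma polys_X [intro]: "i < n \<Longrightarrow> mvar i \<in> polys n" by (auto simp: polys_def mvar.rep_eq intro: pf_var)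
lemma polys_add [intro]: "f \<in> polys n \<Longrightarrow> g \<in> polys n \<Longrightarrow> f + g \<in> polys n"
  using pf_add[of n "ev f" "ev g"] by (auto simp: polys_def plus_mp.rep_eq)
lemma polys_mult [intro]: "f \<in> polys n \<Longrightarrow> g \<in> polys n \<Longrightarrow> f * g \<in> polys n"
  using pf_mult[of n "ev f" "ev g"] by (auto simp: polys_def times_mp.rep_eq)
lemma polys_0 [simp, intro]: "0 \<in> polys n" using polys_K[of 0 n] by (simp add: mconst_hom)
lemma polys_1 [simp, intro]: "1 \<in> polys n" using polys_K[of 1 n] by (simp add: mconst_hom)
lemma polys_uminus [intro]: "f \<in> polys n \<Longrightarrow> - f \<in> polys n"
  using polys_mult[OF polys_K[of "-1"], of f n] by (simp add: mconst_hom)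
lemma polys_diff [intro]: "f \<in> polys n \<Longrightarrow> g \<in> polys n \<Longrightarrow> f - g \<in> polys n"
  using polys_add[OF _ polys_uminus, of f n g] by simp
lemma polys_power [intro]: "f \<in> polys n \<Longrightarrow> f ^ k \<in> polys n"
  by (induction k) auto
lemma polys_sum [intro]: "(\<And>i. i \<in> A \<Longrightarrow> f i \<in> polys n) \<Longrightarrow> sum f A \<in> polys n"
  by (induction A rule: infinite_finite_induct) auto
lemma polys_prod [intro]: "(\<And>i. i \<in> A \<Longrightarrow> f i \<in> polys n) \<Longrightarrow> prod f A \<in> polys n"
  by (induction A rule: infinite_finite_induct) auto

lemma polys_induct [consumes 1, case_names mconst mvar add mult]:
  assumes "f \<in> polys n" and "\<And>a. P (mconst a)" and "\<And>i. i < n \<Longrightarrow> P (mvar i)"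
    and "\<And>f g. f \<in> polys n \<Longrightarrow> g \<in> polys n \<Longrightarrow> P f \<Longrightarrow> P g \<Longrightarrow> P (f + g)"
    and "\<And>f g. f \<in> polys n \<Longrightarrow> g \<in> polys n \<Longrightarrow> P f \<Longrightarrow> P g \<Longrightarrow> P (f * g)"
  shows "P f"
proof -
  have "\<exists>g\<in>polys n. ev g = h \<and> P g" if "polyfun n h" for h
    using that
  proof (induction rule: polyfun.induct)
    case (pf_const a)
    show ?case by (rule bexI[of _ "mconst a"]) (auto simp: fun_eq_iff assms)
  next
    case (pf_var i)
    then show ?case by (intro bexI[of _ "mvar i"]) (auto simp: fun_eq_iff assms)
  next
    case (pf_add f g)
    then obtain f' g' where "f'\<in>polys n" "g'\<in>polys n" "ev f' = f" "ev g' = g" "P f'" "P g'" by blast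
    then show ?case by (intro bexI[of _ "f' + g'"]) (auto simp: fun_eq_iff assms)
  next
    case (pf_mult f g)
    then obtain f' g' where "f'\<in>polys n" "g'\<in>polys n" "ev f' = f" "ev g' = g" "P f'" "P g'" by blast
    then show ?case by (intro bexI[of _ "f' * g'"]) (auto simp: fun_eq_iff assms)
  qed
  from this[of "ev f"] assms(1) show ?thesis by (auto simp: polys_def ev_inject)
qed

lemma mp_induct [case_names mconst mvar add mult]:
  assumes "\<And>a. P (mconst a)" "\<And>i. P (mvar i)" "\<And>f g. P f \<Longrightarrow> P g \<Longrightarrow> P (f + g)"
    "\<And>f g. P f \<Longrightarrow> P g \<Longrightarrow> P (f * g)"
  shows "P f"
proof -
  obtain n where "f \<in> polys n" using polys_ex by blast
  then show ?thesis by (induction rule: polys_induct) (use assms in blast)+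
qed

section \<open>Restriction to lines and substitution homomorphisms\<close>

lemma ev_line:
  "\<exists>q. \<forall>t. ev f (\<lambda>i. x i + t * v i) = poly q t"
proof (induction f rule: mp_induct)
  case (mconst a)
  show ?case by (rule exI[of _ "[:a:]"]) simp
next
  case (mvar i)
  show ?case by (rule exI[of _ "[:x i, v i:]"]) simp
next
  case (add f g)
  then obtain p q where "\<forall>t. ev f (\<lambda>i. x i + t * v i) = poly p t" "\<forall>t. ev g (\<lambda>i. x i + t * v i) = poly q t" by blast
  then show ?case by (intro exI[of _ "p + q"]) simp
next
  case (mult f g)
  then obtain p q where "\<forall>t. ev f (\<lambda>i. x i + t * v i) = poly p t" "\<forall>t. ev g (\<lambda>i. x i + t * v i) = poly q t" by blast
  then show ?case by (intro exI[of _ "p * q"]) simp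
qed

instance mp :: idom
proof
  fix f g :: mp assume f: "f \<noteq> 0" and g: "g \<noteq> 0"
  obtain x where x: "ev f x \<noteq> 0" using f by (metis ev_inject_fun ev_simps(1))
  obtain y where y: "ev g y \<noteq> 0" using g by (metis ev_inject_fun ev_simps(1))
  \<comment> \<open>On the line from a nonzero of \<open>f\<close> to a nonzero of \<open>g\<close>
    both restrict to nonzero polynomials in one variable.\<close>
  obtain p where p: "\<And>t. ev f (\<lambda>i. x i + t * (y i - x i)) = poly p t"
    using ev_line[of f x "\<lambda>i. y i - x i"] by blast
  obtain q where q: "\<And>t. ev g (\<lambda>i. x i + t * (y i - x i)) = poly q t"
    using ev_line[of g x "\<lambda>i. y i - x i"] by blast
  have "poly p 0 \<noteq> 0" using p[of 0] x by simp
  moreover have "poly q 1 \<noteq> 0" using q[of 1] y by simp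
  ultimately have "p * q \<noteq> 0" by auto
  then obtain t where "poly (p * q) t \<noteq> 0" using poly_all_0_iff_0 by blast
  then have "ev (f * g) (\<lambda>i. x i + t * (y i - x i)) \<noteq> 0" using p q by simp
  then show "f * g \<noteq> 0" by (metis ev_simps(1))
qed

lemma mp_nonzero_ex: "f \<noteq> 0 \<Longrightarrow> \<exists>x. ev f x \<noteq> 0"
  by (metis ev_inject_fun ev_simps(1))

lemma inj_K: "inj mconst" by (auto intro: injI)

text \<open>Constants already give infinitely many test points in the domain \<open>mp\<close>, so a
  polynomial over \<open>mp\<close> is known from its values there.\<close>

lemma mp_poly_eq_0:
  assumes "\<And>t. poly q (mconst t) = 0" shows "q = 0"
proof (rule ccontr)
  assume "q \<noteq> 0"
  then have "finite {x. poly q x = 0}" by (rule poly_roots_finite)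
  moreover have "range mconst \<subseteq> {x. poly q x = 0}" using assms by auto
  ultimately have "finite (range mconst)" using finite_subset by blast
  then show False using finite_imageD[OF _ inj_K] infinite_UNIV_char_0 by blast
qed

lemma mp_poly_eqI:
  assumes "\<And>x t. ev (poly p (mconst t)) x = ev (poly q (mconst t)) x" shows "p = q"
  using mp_poly_eq_0[of "p - q"] assms by (metis ev_inject_fun poly_diff right_minus_eq)

text \<open>The ring homomorphism from \<open>mp\<close> to \<open>mp poly\<close> sending variable
  \<open>i\<close> to \<open>s i\<close>. Elements of \<open>mp\<close> carry no expression to
  recurse on, so it is pinned down by its values; substitution, expansion in one variable and
  homogeneous components are all instances.\<close>

definition expand :: "(nat \<Rightarrow> mp poly) \<Rightarrow> mp \<Rightarrow> mp poly" where
  "expand s f = (THE q. \<forall>x t. ev f (\<lambda>i. ev (poly (s i) (mconst t)) x) = ev (poly q (mconst t)) x)"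

lemma expand_ex:
  "\<exists>q. \<forall>x t. ev f (\<lambda>i. ev (poly (s i) (mconst t)) x) = ev (poly q (mconst t)) x"
proof (induction f rule: mp_induct)
  case (mconst a)
  show ?case by (rule exI[of _ "[:mconst a:]"]) simp
next
  case (mvar i)
  show ?case by (rule exI[of _ "s i"]) simp
next
  case (add f g)
  then obtain p q where "\<forall>x t. ev f (\<lambda>i. ev (poly (s i) (mconst t)) x) = ev (poly p (mconst t)) x"
    "\<forall>x t. ev g (\<lambda>i. ev (poly (s i) (mconst t)) x) = ev (poly q (mconst t)) x" by blast
  then show ?case by (intro exI[of _ "p + q"]) simp
next
  case (mult f g)
  then obtain p q where "\<forall>x t. ev f (\<lambda>i. ev (poly (s i) (mconst t)) x) = ev (poly p (mconst t)) x"
    "\<forall>x t. ev g (\<lambda>i. ev (poly (s i) (mconst t)) x) = ev (poly q (mconst t)) x" by blast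
  then show ?case by (intro exI[of _ "p * q"]) simp
qed

lemma ev_expand:
  "ev (poly (expand s f) (mconst t)) x = ev f (\<lambda>i. ev (poly (s i) (mconst t)) x)"
proof -
  have "\<exists>!q. \<forall>x t. ev f (\<lambda>i. ev (poly (s i) (mconst t)) x) = ev (poly q (mconst t)) x"
  proof (rule ex_ex1I[OF expand_ex])
    fix p q
    assume a: "\<forall>x t. ev f (\<lambda>i. ev (poly (s i) (mconst t)) x) = ev (poly p (mconst t)) x"
      and b: "\<forall>x t. ev f (\<lambda>i. ev (poly (s i) (mconst t)) x) = ev (poly q (mconst t)) x"
    show "p = q" by (rule mp_poly_eqI) (simp add: a[rule_format, symmetric] b[rule_format, symmetric])
  qed
  from theI'[OF this, folded expand_def] show ?thesis by metis
qed

lemma expand_simps [simp]: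
  "expand s (mconst a) = [:mconst a:]" "expand s (mvar i) = s i"
  "expand s (f + g) = expand s f + expand s g" "expand s (f * g) = expand s f * expand s g"
  by (rule mp_poly_eqI; simp add: ev_expand)+

lemma expand_0_1 [simp]: "expand s 0 = 0" "expand s 1 = 1"
  using expand_simps(1)[of s 0] expand_simps(1)[of s 1] by (simp_all add: mconst_hom one_pCons)

lemma expand_uminus [simp]: "expand s (- f) = - expand s f"
  by (rule mp_poly_eqI) (simp add: ev_expand)

lemma expand_diff [simp]: "expand s (f - g) = expand s f - expand s g"
  by (rule mp_poly_eqI) (simp add: ev_expand)

lemma expand_sum [simp]: "expand s (sum f A) = (\<Sum>i\<in>A. expand s (f i))"
  by (induction A rule: infinite_finite_induct) auto

lemma expand_power [simp]: "expand s (f ^ k) = expand s f ^ k"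
  by (induction k) auto

definition subst :: "(nat \<Rightarrow> mp) \<Rightarrow> mp \<Rightarrow> mp" where
  "subst s f = coeff (expand (\<lambda>i. [:s i:]) f) 0"

lemma ev_subst [simp]: "ev (subst s f) x = ev f (\<lambda>i. ev (s i) x)"
proof -
  have "ev (subst s f) x = ev (poly (expand (\<lambda>i. [:s i:]) f) (mconst 0)) x"
    unfolding subst_def by (simp add: mconst_hom poly_0_coeff_0)
  then show ?thesis by (simp add: ev_expand)
qed

lemma subst_simps [simp]:
  "subst s (mconst a) = mconst a" "subst s (mvar i) = s i" "subst s (f + g) = subst s f + subst s g"
  "subst s (f * g) = subst s f * subst s g" "subst s (- f) = - subst s f" "subst s (f - g) = subst s f - subst s g"
  "subst s 0 = 0" "subst s 1 = 1" "subst s (f ^ k) = subst s f ^ k" "subst s (sum h A) = (\<Sum>i\<in>A. subst s (h i))"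
  by (rule ev_inject_fun; simp)+

lemma polys_subst:
  assumes "f \<in> polys n" "\<And>i. i < n \<Longrightarrow> s i \<in> polys m" shows "subst s f \<in> polys m"
  using assms by (induction rule: polys_induct) auto

lemma ev_polys_cong:
  assumes "f \<in> polys n" "\<And>i. i < n \<Longrightarrow> x i = y i" shows "ev f x = ev f y"
  using assms by (induction rule: polys_induct) auto

text \<open>Retraction onto the first \<open>n\<close> variables; it puts a quotient back into
  \<open>polys n\<close> where a divisibility of the statement demands it.\<close>

definition rt :: "nat \<Rightarrow> mp \<Rightarrow> mp" where "rt n = subst (\<lambda>i. if i < n then mvar i else 0)"

lemma rt_polys [simp]: "rt n f \<in> polys n"
proof -
  obtain m where m: "f \<in> polys m" using polys_ex by blast
  show ?thesis unfolding rt_def by (rule polys_subst[OF m]) auto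
qed

lemma rt_id: "f \<in> polys n \<Longrightarrow> rt n f = f"
  unfolding rt_def by (rule ev_inject_fun) (auto intro: ev_polys_cong)

text \<open>\<open>f\<close> as a polynomial in variable \<open>v\<close> over the remaining ones,
  the setting for Gauss's lemma.\<close>

definition vexpand :: "nat \<Rightarrow> mp \<Rightarrow> mp poly" where
  "vexpand v = expand (\<lambda>i. if i = v then [:0, 1:] else [:mvar i:])"

lemma vexpand_simps [simp]:
  "vexpand v (mconst a) = [:mconst a:]" "vexpand v (mvar i) = (if i = v then [:0, 1:] else [:mvar i:])"
  "vexpand v (f + g) = vexpand v f + vexpand v g" "vexpand v (f * g) = vexpand v f * vexpand v g" "vexpand v (- f) = - vexpand v f" "vexpand v (f - g) = vexpand v f - vexpand v g"
  "vexpand v 0 = 0" "vexpand v 1 = 1" "vexpand v (f ^ k) = vexpand v f ^ k" "vexpand v (sum h A) = (\<Sum>i\<in>A. vexpand v (h i))"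
  by (simp_all add: vexpand_def)

lemma poly_vexpand [simp]: "poly (vexpand v f) (mvar v) = f"
  by (induction f rule: mp_induct) auto

lemma vexpand_eq_0_iff [simp]: "vexpand v f = 0 \<longleftrightarrow> f = 0"
  by (metis vexpand_simps(7) poly_0 poly_vexpand)

definition dg :: "nat \<Rightarrow> mp \<Rightarrow> nat" where "dg v f = degree (vexpand v f)"

lemma dg_mult: "f \<noteq> 0 \<Longrightarrow> g \<noteq> 0 \<Longrightarrow> dg v (f * g) = dg v f + dg v g"
  by (simp add: dg_def degree_mult_eq)

lemma vexpand_coeff_R: "f \<in> polys (Suc n) \<Longrightarrow> coeff (vexpand n f) i \<in> polys n"
proof (induction arbitrary: i rule: polys_induct)
  case (mconst a)
  then show ?case by (cases i) auto
next
  case (mvar j)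
  then show ?case by (auto simp: coeff_pCons split: nat.splits)
next
  case (mult f g)
  then show ?case by (auto simp: coeff_mult)
qed auto

lemma vexpand_const: "f \<in> polys v \<Longrightarrow> vexpand v f = [:f:]"
  by (induction rule: polys_induct) auto

lemma dg_polys: "f \<in> polys v \<Longrightarrow> dg v f = 0"
  by (simp add: dg_def vexpand_const)

lemma dg_0_polys: assumes "f \<in> polys (Suc n)" "dg n f = 0" shows "f \<in> polys n"
proof -
  obtain c where c: "vexpand n f = [:c:]" using assms(2) unfolding dg_def by (meson degree_eq_zeroE)
  then have "f = c" using poly_vexpand[of n f] by simp
  with vexpand_coeff_R[OF assms(1), of 0] c show ?thesis by simp
qed

text \<open>Degrees in each variable add up in a product, so a divisor cannot contain a variable
  that the product lacks.\<close>

lemma polys_factor: assumes "f \<in> polys n" "f \<noteq> 0" "g dvd f" shows "g \<in> polys n"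
proof -
  obtain h where h: "f = g * h" using assms by blast
  then have nz: "g \<noteq> 0" "h \<noteq> 0" using assms by auto
  have dg: "dg v g = 0" if "v \<ge> n" for v
  proof -
    have "dg v f = 0" using dg_polys polys_mono assms(1) that by blast
    then show ?thesis using dg_mult[OF nz] h by auto
  qed
  obtain m where m: "g \<in> polys m" using polys_ex by blast
  have "g \<in> polys (max n m)" using polys_mono m by auto
  have "g \<in> polys (n + k) \<Longrightarrow> g \<in> polys n" for k
    by (induction k) (use dg_0_polys dg in auto)
  moreover have "g \<in> polys (n + m)" using polys_mono m by auto
  ultimately show ?thesis by blast
qed

lemma polys_dvd_coeffs:
  assumes "p \<in> polys n" shows "p dvd f \<longleftrightarrow> (\<forall>i. p dvd coeff (vexpand n f) i)"
proof
  assume "p dvd f"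
  then obtain h where "f = p * h" by blast
  then show "\<forall>i. p dvd coeff (vexpand n f) i" using vexpand_const[OF assms] by simp
next
  assume *: "\<forall>i. p dvd coeff (vexpand n f) i"
  have "p dvd poly (vexpand n f) (mvar n)" unfolding poly_altdef by (rule dvd_sum) (use * in auto)
  then show "p dvd f" by simp
qed

text \<open>Homogeneous components are the coefficients of the scaling homomorphism.\<close>

definition hc :: "mp \<Rightarrow> mp poly" where "hc = expand (\<lambda>i. [:0, mvar i:])"

lemma hc_simps [simp]:
  "hc (mconst a) = [:mconst a:]" "hc (mvar i) = [:0, mvar i:]"
  "hc (f + g) = hc f + hc g" "hc (f * g) = hc f * hc g" "hc (- f) = - hc f" "hc (f - g) = hc f - hc g"
  "hc 0 = 0" "hc 1 = 1" "hc (f ^ k) = hc f ^ k" "hc (sum h A) = (\<Sum>i\<in>A. hc (h i))"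
  by (simp_all add: hc_def)

lemma ev_hc: "ev (poly (hc f) (mconst t)) x = ev f (\<lambda>i. t * x i)"
  unfolding hc_def ev_expand by simp

lemma poly_hc_1 [simp]: "poly (hc f) 1 = f"
  by (induction f rule: mp_induct) auto

lemma hc_eq_0_iff [simp]: "hc f = 0 \<longleftrightarrow> f = 0"
  by (metis hc_simps(7) poly_0 poly_hc_1)

definition mdeg :: "mp \<Rightarrow> nat" where "mdeg f = degree (hc f)"

lemma mdeg_mult: "f \<noteq> 0 \<Longrightarrow> g \<noteq> 0 \<Longrightarrow> mdeg (f * g) = mdeg f + mdeg g"
  by (simp add: mdeg_def degree_mult_eq)

lemma mdeg_0_const: assumes "mdeg f = 0" shows "f = mconst (ev f (\<lambda>_. 0))"
proof -
  obtain c where c: "hc f = [:c:]" using assms unfolding mdeg_def by (meson degree_eq_zeroE)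
  have "ev f x = ev f (\<lambda>_. 0)" for x
    using ev_hc[of f 1 x] ev_hc[of f 0 x] c by simp
  then show ?thesis by (intro ev_inject_fun) simp
qed

lemma mdeg_K [simp]: "mdeg (mconst a) = 0" by (simp add: mdeg_def)

text \<open>Total degree is additive, so a unit has degree 0.\<close>

lemma mp_unit_iff: "f dvd 1 \<longleftrightarrow> (\<exists>a. a \<noteq> 0 \<and> f = mconst a)"
proof
  assume "f dvd 1"
  then obtain g where g: "f * g = 1" by (metis dvdE)
  then have "f \<noteq> 0" "g \<noteq> 0" by auto
  from mdeg_mult[OF this] g have "mdeg f = 0" by (simp add: mdeg_def)
  with mdeg_0_const \<open>f \<noteq> 0\<close> show "\<exists>a. a \<noteq> 0 \<and> f = mconst a" by (metis mconst_eq_0_iff)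
next
  assume "\<exists>a. a \<noteq> 0 \<and> f = mconst a"
  then obtain a where a: "a \<noteq> 0" "f = mconst a" by auto
  then have "f * mconst (1/a) = 1" by (simp flip: mconst_hom)
  then show "f dvd 1" by (metis dvdI)
qed

lemma mp_unit_iff_mdeg: "f \<noteq> 0 \<Longrightarrow> f dvd 1 \<longleftrightarrow> mdeg f = 0"
  by (metis mconst_eq_0_iff mdeg_0_const mdeg_K mp_unit_iff)

lemma mdeg_dvd: "f dvd g \<Longrightarrow> g \<noteq> 0 \<Longrightarrow> mdeg f \<le> mdeg g"
  by (metis dvd_mult_left dvdE le_add1 mdeg_mult mult_zero_left mult_zero_right)

lemma ex_irreducible_dvd:
  fixes f :: mp
  assumes "f \<noteq> 0" "\<not> f dvd 1" shows "\<exists>p. irreducible p \<and> p dvd f"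
  using assms
proof (induction "mdeg f" arbitrary: f rule: less_induct)
  case less
  show ?case
  proof (cases "irreducible f")
    case False
    then obtain a b where ab: "f = a * b" "\<not> a dvd 1" "\<not> b dvd 1"
      using less.prems by (auto simp: irreducible_def)
    then have nz: "a \<noteq> 0" "b \<noteq> 0" using less.prems by auto
    then have "mdeg b > 0" using ab mp_unit_iff_mdeg by auto
    then have "mdeg a < mdeg f" using mdeg_mult[OF nz] ab by simp
    from less.hyps[OF this nz(1) ab(2)] ab(1) show ?thesis by auto
  qed auto
qed

text \<open>Existence of factorizations, packaged as an induction: total degree drops when an
  irreducible factor is removed.\<close>

lemma mp_factor_induct [consumes 1, case_names unit mult]:
  fixes f :: mp
  assumes "f \<noteq> 0" and "\<And>u. u dvd 1 \<Longrightarrow> P u"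
    and "\<And>p f. irreducible p \<Longrightarrow> f \<noteq> 0 \<Longrightarrow> P f \<Longrightarrow> P (p * f)"
  shows "P f"
  using assms(1)
proof (induction "mdeg f" arbitrary: f rule: less_induct)
  case less
  show ?case
  proof (cases "f dvd 1")
    case False
    then obtain p g where p: "irreducible p" "f = p * g" using ex_irreducible_dvd less.prems by (metis dvdE)
    then have nz: "p \<noteq> 0" "g \<noteq> 0" using less.prems by auto
    have "mdeg p > 0" using p nz mp_unit_iff_mdeg by (auto simp: irreducible_def)
    then have "mdeg g < mdeg f" using mdeg_mult[OF nz] p by simp
    from less.hyps[OF this nz(2)] assms(3)[OF p(1) nz(2)] p show ?thesis by simp
  qed (use assms(2) in auto)
qed

section \<open>Unique factorization\<close>

text \<open>Gauss's lemma for a prime of the coefficient ring: at the sum of the two lowest indices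
  whose coefficients escape \<open>p\<close>, all but one summand of the product coefficient is
  divisible by \<open>p\<close>.\<close>

lemma irreducible_lift_dvd_mult:
  assumes prime: "\<And>p g h. p \<in> polys n \<Longrightarrow> g \<in> polys n \<Longrightarrow> h \<in> polys n \<Longrightarrow> irreducible p \<Longrightarrow> p dvd g * h \<Longrightarrow> p dvd g \<or> p dvd h"
    and p: "p \<in> polys n" "irreducible p" and g: "g \<in> polys (Suc n)" and h: "h \<in> polys (Suc n)" and dvd: "p dvd g * h"
  shows "p dvd g \<or> p dvd h"
proof (rule ccontr)
  assume "\<not> ?thesis"
  then have ex: "\<exists>i. \<not> p dvd coeff (vexpand n g) i" "\<exists>i. \<not> p dvd coeff (vexpand n h) i"
    using polys_dvd_coeffs[OF p(1)] by blast+
  define i where "i = (LEAST i. \<not> p dvd coeff (vexpand n g) i)"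
  define j where "j = (LEAST i. \<not> p dvd coeff (vexpand n h) i)"
  have i: "\<not> p dvd coeff (vexpand n g) i" "\<And>i'. i' < i \<Longrightarrow> p dvd coeff (vexpand n g) i'"
    unfolding i_def using LeastI_ex[OF ex(1)] not_less_Least by blast+
  have j: "\<not> p dvd coeff (vexpand n h) j" "\<And>i'. i' < j \<Longrightarrow> p dvd coeff (vexpand n h) i'"
    unfolding j_def using LeastI_ex[OF ex(2)] not_less_Least by blast+
  have "p dvd coeff (vexpand n g * vexpand n h) (i + j)"
    using dvd polys_dvd_coeffs[OF p(1), of "g * h"] by simp
  also have "coeff (vexpand n g * vexpand n h) (i + j) = (\<Sum>k\<le>i + j. coeff (vexpand n g) k * coeff (vexpand n h) (i + j - k))"
    by (simp add: coeff_mult)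
  also have "\<dots> = coeff (vexpand n g) i * coeff (vexpand n h) (i + j - i) + (\<Sum>k\<in>{..i + j} - {i}. coeff (vexpand n g) k * coeff (vexpand n h) (i + j - k))"
    by (subst sum.remove[of _ i]) auto
  finally have *: "p dvd coeff (vexpand n g) i * coeff (vexpand n h) j + (\<Sum>k\<in>{..i + j} - {i}. coeff (vexpand n g) k * coeff (vexpand n h) (i + j - k))"
    by simp
  have "p dvd (\<Sum>k\<in>{..i + j} - {i}. coeff (vexpand n g) k * coeff (vexpand n h) (i + j - k))"
  proof (rule dvd_sum)
    fix k assume k: "k \<in> {..i + j} - {i}"
    show "p dvd coeff (vexpand n g) k * coeff (vexpand n h) (i + j - k)"
    proof (cases "k < i")
      case True
      then show ?thesis using i(2) by (simp add: dvd_mult2)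
    next
      case False
      then have "i + j - k < j" using k by auto
      then show ?thesis using j(2) by (simp add: dvd_mult)
    qed
  qed
  with * have "p dvd coeff (vexpand n g) i * coeff (vexpand n h) j" using dvd_add_left_iff by blast
  then show False using prime[OF p(1) vexpand_coeff_R[OF g] vexpand_coeff_R[OF h] p(2)] i j by blast
qed

text \<open>Division with remainder in the variable \<open>n\<close>, multiplying by the leading
  coefficient of \<open>h\<close> at each step instead of passing to fractions. The last alternative
  makes no claim about the remainder when \<open>h\<close> is free of that variable.\<close>

lemma dg_pseudo_div:
  assumes h: "h \<in> polys (Suc n)" "h \<noteq> 0" and f: "f \<in> polys (Suc n)"
  shows "\<exists>c\<in>polys n. c \<noteq> 0 \<and> (\<exists>q\<in>polys (Suc n). \<exists>r\<in>polys (Suc n). c * f = q * h + r \<and> (r = 0 \<or> dg n r < dg n h \<or> dg n h = 0))"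
  using f
proof (induction "dg n f" arbitrary: f rule: less_induct)
  case less
  let ?lf = "lead_coeff (vexpand n f)" and ?lh = "lead_coeff (vexpand n h)"
  have lR: "?lf \<in> polys n" "?lh \<in> polys n" using vexpand_coeff_R h less.prems by auto
  have l0: "?lh \<noteq> 0" using h by simp
  consider "f = 0 \<or> dg n f < dg n h \<or> dg n h = 0" | "f \<noteq> 0" "dg n f \<ge> dg n h" "dg n h > 0" by fastforce
  then show ?case
  proof cases
    case 1
    then have "1 * f = 0 * h + f \<and> (f = 0 \<or> dg n f < dg n h \<or> dg n h = 0)" by simp
    then show ?thesis using less.prems polys_0[of "Suc n"] polys_1[of n] one_neq_zero by blast
  next
    case 2
    define s where "s = mvar n ^ (dg n f - dg n h)"
    define g where "g = ?lh * f - ?lf * s * h"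
    have sR: "s \<in> polys (Suc n)" unfolding s_def by auto
    have gR: "g \<in> polys (Suc n)" unfolding g_def using sR h less.prems lR polys_mono[of _ n "Suc n"] by auto
    have Vg: "vexpand n g = Polynomial.smult ?lh (vexpand n f) - Polynomial.smult ?lf (monom 1 (dg n f - dg n h) * vexpand n h)"
      unfolding g_def s_def using lR by (simp add: vexpand_const monom_altdef)
    have "degree (vexpand n g) < degree (vexpand n f) \<or> vexpand n g = 0"
    proof -
      have d: "degree (vexpand n g) \<le> degree (vexpand n f)" unfolding Vg
      proof (rule degree_diff_le)
        show "degree (Polynomial.smult ?lh (vexpand n f)) \<le> degree (vexpand n f)" by simp
        have "degree (Polynomial.smult ?lf (monom 1 (dg n f - dg n h) * vexpand n h)) \<le> degree (monom (1::mp) (dg n f - dg n h) * vexpand n h)" by simp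
        also have "\<dots> \<le> (dg n f - dg n h) + degree (vexpand n h)" by (metis degree_mult_le degree_monom_le add_right_mono le_trans)
        also have "\<dots> = degree (vexpand n f)" using 2 by (simp add: dg_def)
        finally show "degree (Polynomial.smult ?lf (monom 1 (dg n f - dg n h) * vexpand n h)) \<le> degree (vexpand n f)" .
      qed
      have "coeff (vexpand n g) (degree (vexpand n f)) = ?lh * ?lf - ?lf * coeff (monom 1 (dg n f - dg n h) * vexpand n h) (degree (vexpand n f))"
        unfolding Vg by simp
      also have "coeff (monom 1 (dg n f - dg n h) * vexpand n h) (degree (vexpand n f)) = ?lh"
        using 2 by (simp add: coeff_monom_mult dg_def)
      finally have "coeff (vexpand n g) (degree (vexpand n f)) = 0" by (simp add: mult.commute)
      then show ?thesis using d by (metis le_neq_implies_less leading_coeff_0_iff)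
    qed
    then have cases: "dg n g < dg n f \<or> g = 0" by (simp add: dg_def)
    have "\<exists>c\<in>polys n. c \<noteq> 0 \<and> (\<exists>q\<in>polys (Suc n). \<exists>r\<in>polys (Suc n). c * g = q * h + r \<and> (r = 0 \<or> dg n r < dg n h \<or> dg n h = 0))"
    proof (cases "g = 0")
      case True
      then show ?thesis by (intro bexI[of _ 1]) (auto intro!: bexI[of _ 0])
    next
      case False
      then show ?thesis using less.hyps[OF _ gR] cases by blast
    qed
    then obtain c q r where c: "c \<in> polys n" "c \<noteq> 0" "q \<in> polys (Suc n)" "r \<in> polys (Suc n)" "c * g = q * h + r"
      "r = 0 \<or> dg n r < dg n h \<or> dg n h = 0" by blast
    have "(c * ?lh) * f = (q + c * ?lf * s) * h + r" using c(5) unfolding g_def by (simp add: algebra_simps)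
    moreover have "c * ?lh \<in> polys n" "c * ?lh \<noteq> 0" using c lR l0 by auto
    moreover have "q + c * ?lf * s \<in> polys (Suc n)" using c lR sR polys_mono[of _ n "Suc n"] by auto
    ultimately show ?thesis using c by blast
  qed
qed

text \<open>The hypothesis of the induction on the number of variables: irreducible elements are
  prime.\<close>

locale polys_prime =
  fixes n :: nat
  assumes prime: "p \<in> polys n \<Longrightarrow> g \<in> polys n \<Longrightarrow> h \<in> polys n \<Longrightarrow> irreducible p \<Longrightarrow> p dvd g * h \<Longrightarrow> p dvd g \<or> p dvd h"
begin

text \<open>The irreducible factors of \<open>c\<close> are stripped one by one: by Gauss's lemma
  each divides \<open>p\<close> or the quotient of \<open>c * g\<close> by \<open>p\<close>, and it
  cannot divide \<open>p\<close>, which is irreducible and contains the variable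
  \<open>n\<close>.\<close>

lemma cancel_lower:
  assumes c: "c \<noteq> 0" "c \<in> polys n" and p: "p \<in> polys (Suc n)" "irreducible p" "dg n p > 0" and g: "g \<in> polys (Suc n)" and d: "p dvd c * g"
  shows "p dvd g"
  using c d g
proof (induction c arbitrary: g rule: mp_factor_induct)
  case (unit u)
  then obtain a where a: "u = mconst a" "a \<noteq> 0" using mp_unit_iff by blast
  have "g = mconst (1/a) * (u * g)" using a by (simp add: mconst_hom(4)[symmetric] mconst_hom(2) flip: mult.assoc)
  then show ?case using unit by (metis dvd_mult)
next
  case (mult q c)
  have qc: "q \<in> polys n" "c \<in> polys n" using polys_factor[OF mult(4)] mult(1,2) by (auto simp: irreducible_def)
  show ?case
  proof (cases "g = 0")
    case False
    obtain y where y: "q * c * g = p * y" using mult by blast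
    have "q * c \<in> polys (Suc n)" using mult(4) polys_mono by auto
    then have "q * c * g \<in> polys (Suc n)" "q * c * g \<noteq> 0" using mult(1,2,6) False by (auto simp: irreducible_def)
    then have yR: "y \<in> polys (Suc n)" using polys_factor[of "q * c * g" "Suc n" y] y by auto
    have "q dvd p * y" using y by (metis dvd_triv_left mult.assoc)
    then have "q dvd p \<or> q dvd y" using irreducible_lift_dvd_mult[OF prime qc(1) mult(1) p(1) yR] by blast
    moreover have "\<not> q dvd p"
    proof
      assume "q dvd p"
      then obtain w where w: "p = q * w" by blast
      have "\<not> q dvd 1" using mult by (simp add: irreducible_def)
      then have "w dvd 1" using p(2) w by (auto simp: irreducible_def)
      then obtain a where "w = mconst a" using mp_unit_iff by blast
      then have "p \<in> polys n" using w qc by auto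
      then show False using dg_polys p by auto
    qed
    ultimately obtain y' where "y = q * y'" by blast
    then have "q * (c * g) = q * (p * y')" using y by (simp add: algebra_simps)
    then have "c * g = p * y'" using mult by (auto simp: irreducible_def)
    then show ?thesis using mult(3)[of g] qc mult(6) by auto
  qed simp
qed

text \<open>Stands in for irreducibility over the field of fractions. Factors of \<open>c\<close>
  are cancelled against \<open>q\<close> or \<open>h\<close> until \<open>p = q * h\<close> up to a
  unit with \<open>h\<close> not constant; then \<open>q\<close> is a unit.\<close>

lemma descend_lower:
  assumes c: "c \<noteq> 0" "c \<in> polys n" and p: "p \<in> polys (Suc n)" "irreducible p" "dg n p > 0"
    and h: "h \<in> polys (Suc n)" "dg n h > 0" and q: "c * p = q * h"
  shows "p dvd h"
  using c q h
proof (induction c arbitrary: h q rule: mp_factor_induct)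
  case (unit u)
  then obtain a where a: "u = mconst a" "a \<noteq> 0" using mp_unit_iff by blast
  have "p = mconst (1/a) * (u * p)" using a by (simp add: mconst_hom(4)[symmetric] mconst_hom(2) flip: mult.assoc)
  then have *: "p = (mconst (1/a) * q) * h" using unit by (simp add: mult.assoc)
  then have "mconst (1/a) * q dvd 1 \<or> h dvd 1" using p(2) unfolding irreducible_def by blast
  moreover have "\<not> h dvd 1" using unit(5) mp_unit_iff dg_polys[of h n] by auto
  ultimately have "mconst (1/a) * q dvd 1" by blast
  then show ?case using * by (metis dvd_refl mult.commute mult_unit_dvd_iff)
next
  case (mult r c)
  have rc: "r \<in> polys n" "c \<in> polys n" using polys_factor[OF mult(4)] mult(1,2) by (auto simp: irreducible_def)
  have p0: "p \<noteq> 0" using p by (auto simp: irreducible_def)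
  have "r * c \<in> polys (Suc n)" using mult(4) polys_mono by auto
  then have nz: "r * c * p \<noteq> 0" "r * c * p \<in> polys (Suc n)" using mult(1,2) p p0 by (auto simp: irreducible_def)
  then have qR: "q \<in> polys (Suc n)" using polys_factor[OF nz(2,1), of q] mult(5) by simp
  have "r dvd q * h" using mult(5) by (metis dvd_triv_left mult.assoc)
  then have "r dvd q \<or> r dvd h" using irreducible_lift_dvd_mult[OF prime rc(1) mult(1) qR mult(6)] by blast
  then show ?case
  proof
    assume "r dvd q"
    then obtain q' where "q = r * q'" by blast
    then have "r * (c * p) = r * (q' * h)" using mult by (simp add: algebra_simps)
    then have "c * p = q' * h" using mult by (auto simp: irreducible_def)
    then show ?case using mult(3) rc mult(6,7) by blast
  next
    assume "r dvd h"
    then obtain h' where h': "h = r * h'" by blast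
    then have "r * (c * p) = r * (q * h')" using mult by (simp add: algebra_simps)
    then have e: "c * p = q * h'" using mult by (auto simp: irreducible_def)
    have h0: "h \<noteq> 0" using mult nz by auto
    then have "h' \<in> polys (Suc n)" using polys_factor[OF mult(6)] h' by auto
    moreover have "dg n h' > 0" using dg_mult[of r h' n] h' h0 mult(7) dg_polys[OF rc(1)] by auto
    ultimately have "p dvd h'" using mult(3) rc e by blast
    then show ?case using h' by auto
  qed
qed

text \<open>Take an element of least degree in the variable \<open>n\<close> in the ideal of
  \<open>p\<close> and \<open>g\<close>. If it still contained that variable, it would divide both
  up to lower factors, whence \<open>p\<close> would divide \<open>g\<close>. Besides giving
  primality, the lemma later serves as a resultant that eliminates \<open>t\<close>.\<close>

lemma elimination:
  assumes p: "p \<in> polys (Suc n)" "irreducible p" "dg n p > 0" and g: "g \<in> polys (Suc n)" "\<not> p dvd g"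
  shows "\<exists>u v c. u * p + v * g = c \<and> c \<in> polys n \<and> c \<noteq> 0"
proof -
  define I where "I = {u * p + v * g | u v. u \<in> polys (Suc n) \<and> v \<in> polys (Suc n)}"
  have p0: "p \<noteq> 0" using p by (auto simp: irreducible_def)
  have "p = 1 * p + 0 * g" "g = 0 * p + 1 * g" by simp_all
  then have pI: "p \<in> I" and gI: "g \<in> I" unfolding I_def using polys_0 polys_1 by blast+
  have I: "y - q * z \<in> I" "c * y \<in> I" if "y \<in> I" "z \<in> I" "q \<in> polys (Suc n)" "c \<in> polys (Suc n)" for y z q c
  proof -
    from that obtain u v u' v' where *: "y = u * p + v * g" "z = u' * p + v' * g"
      "u \<in> polys (Suc n)" "v \<in> polys (Suc n)" "u' \<in> polys (Suc n)" "v' \<in> polys (Suc n)" unfolding I_def by blast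
    have "y - q * z = (u - q * u') * p + (v - q * v') * g" using * by (simp add: algebra_simps)
    then show "y - q * z \<in> I" unfolding I_def using * that by blast
    have "c * y = (c * u) * p + (c * v) * g" using * by (simp add: algebra_simps)
    then show "c * y \<in> I" unfolding I_def using * that by blast
  qed
  have IR: "I \<subseteq> polys (Suc n)" unfolding I_def using p g by auto
  define d where "d = (LEAST d. \<exists>h\<in>I. h \<noteq> 0 \<and> dg n h = d)"
  have "\<exists>d. \<exists>h\<in>I. h \<noteq> 0 \<and> dg n h = d" using pI p0 by blast
  then have "\<exists>h\<in>I. h \<noteq> 0 \<and> dg n h = d" unfolding d_def by (rule LeastI_ex)
  then obtain h where h: "h \<in> I" "h \<noteq> 0" "dg n h = d" by blast
  have min: "dg n y \<ge> dg n h" if "y \<in> I" "y \<noteq> 0" for y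
    unfolding h(3) d_def by (rule Least_le) (use that in blast)
  show ?thesis
  proof (cases "dg n h = 0")
    case True
    then have "h \<in> polys n" using dg_0_polys h IR by blast
    then show ?thesis using h unfolding I_def by blast
  next
    case False
    have hR: "h \<in> polys (Suc n)" using h IR by blast
    have div: "\<exists>c\<in>polys n. c \<noteq> 0 \<and> (\<exists>q\<in>polys (Suc n). c * y = q * h)" if "y \<in> I" for y
    proof -
      have "y \<in> polys (Suc n)" using that IR by blast
      from dg_pseudo_div[OF hR h(2) this] obtain c q r where c: "c \<in> polys n" "c \<noteq> 0" "q \<in> polys (Suc n)" "c * y = q * h + r" "r = 0 \<or> dg n r < dg n h"
        using False by auto
      have "c \<in> polys (Suc n)" by (rule polys_mono[OF c(1)]) simp
      then have "c * y \<in> I" using I(2)[OF that that c(3)] by blast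
      from I(1)[OF this h(1) c(3) polys_0] have "r \<in> I" using c(4) by simp
      then have "r = 0" using min[of r] c(5) by linarith
      then show ?thesis using c by auto
    qed
    obtain c q where c: "c \<in> polys n" "c \<noteq> 0" "c * p = q * h" using div[OF pI] by blast
    obtain c' q' where c': "c' \<in> polys n" "c' \<noteq> 0" "c' * g = q' * h" using div[OF gI] by blast
    have "p dvd h" using descend_lower[OF c(2,1) p hR _ c(3)] False by simp
    then have "p dvd c' * g" using c' by simp
    then have "p dvd g" using cancel_lower[OF c'(2,1) p g(1)] by blast
    then show ?thesis using g by simp
  qed
qed

text \<open>If \<open>p\<close> does not divide \<open>h\<close>, then
  \<open>u * p + v * h = c\<close> with \<open>c\<close> free of the last variable; multiplying by
  \<open>g\<close> shows \<open>p dvd c * g\<close>, and \<open>c\<close> can be cancelled.\<close>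

lemma polys_prime_Suc: "polys_prime (Suc n)"
proof
  fix p g h assume *: "p \<in> polys (Suc n)" "g \<in> polys (Suc n)" "h \<in> polys (Suc n)" "irreducible p" "p dvd g * h"
  show "p dvd g \<or> p dvd h"
  proof (cases "dg n p = 0")
    case True
    then have "p \<in> polys n" using dg_0_polys * by blast
    then show ?thesis using irreducible_lift_dvd_mult[OF prime] * by blast
  next
    case False
    show ?thesis
    proof (rule disjCI)
      assume "\<not> p dvd h"
      then obtain u v c where c: "u * p + v * h = c" "c \<in> polys n" "c \<noteq> 0"
        using elimination[of p h] * False by auto
      have "c * g = (u * g) * p + v * (g * h)" using c(1) by (simp add: algebra_simps flip: c(1))
      then have "p dvd c * g" using *(5) by (metis dvd_add dvd_mult dvd_triv_right)
      then show "p dvd g" using cancel_lower[of c p g] c * False by auto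
    qed
  qed
qed

end

lemma polys_prime: "polys_prime n"
proof (induction n)
  case 0
  show ?case
  proof
    fix p g h assume p: "p \<in> polys 0" and i: "irreducible p"
    have "ev p x = ev p (\<lambda>_. 0)" for x by (rule ev_polys_cong[OF p]) simp
    then have "p = mconst (ev p (\<lambda>_. 0))" by (intro ev_inject_fun) simp
    then have "p = 0 \<or> p dvd 1" by (metis mconst_eq_0_iff mp_unit_iff)
    then have False using i by (auto simp: irreducible_def)
    then show "p dvd g \<or> p dvd h" ..
  qed
qed (rule polys_prime.polys_prime_Suc)

lemma irreducible_dvd_mult:
  fixes p :: mp
  assumes "irreducible p" "p dvd g * h" shows "p dvd g \<or> p dvd h"
proof -
  obtain a b c where "p \<in> polys a" "g \<in> polys b" "h \<in> polys c" using polys_ex by meson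
  then have "p \<in> polys (a + b + c)" "g \<in> polys (a + b + c)" "h \<in> polys (a + b + c)" using polys_mono by auto
  then show ?thesis using polys_prime.prime[OF polys_prime] assms by blast
qed

lemmas elimination = polys_prime.elimination[OF polys_prime]

lemma irreducible_dvd_power: "irreducible (p::mp) \<Longrightarrow> p dvd g ^ k \<Longrightarrow> p dvd g"
proof (induction k)
  case 0
  then show ?case by (auto simp: irreducible_def)
next
  case (Suc k)
  then show ?case using irreducible_dvd_mult[of p g "g ^ k"] by auto
qed

text \<open>Only a common divisor of the whole family is excluded. The case \<open>d = 0\<close>
  shows that the family is not identically zero.\<close>

definition coprime_family :: "nat \<Rightarrow> (nat \<Rightarrow> mp) \<Rightarrow> bool" where
  "coprime_family n Q \<longleftrightarrow> (\<forall>d. (\<forall>i<n. d dvd Q i) \<longrightarrow> d dvd 1)"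

text \<open>Every irreducible factor of \<open>k\<close> misses some \<open>Q i\<close>, hence
  divides \<open>D\<close>; removing the factors in turn exhausts \<open>k\<close>.\<close>

lemma coprime_family_dvd:
  assumes cop: "coprime_family n Q" and nz: "k \<noteq> 0" and d: "\<And>i. i < n \<Longrightarrow> k dvd D * Q i"
  shows "k dvd D"
  using nz d
proof (induction k arbitrary: D rule: mp_factor_induct)
  case (unit u)
  then show ?case using dvd_trans one_dvd by blast
next
  case (mult p f)
  have "\<not> p dvd 1" using mult(1) by (simp add: irreducible_def)
  then obtain i where i: "i < n" "\<not> p dvd Q i" using cop unfolding coprime_family_def by blast
  have "p dvd D * Q i" using mult(4)[OF i(1)] by (metis dvd_mult_left)
  then have "p dvd D" using irreducible_dvd_mult[OF mult(1)] i by blast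
  then obtain D' where D': "D = p * D'" by blast
  have "f dvd D' * Q i" if "i < n" for i
  proof -
    have "p * f dvd p * (D' * Q i)" using mult(4)[OF that] unfolding D' by (simp only: mult.assoc)
    then show ?thesis using mult(1) by (simp add: irreducible_def)
  qed
  then have "f dvd D'" by (rule mult(3))
  then show ?case unfolding D' by (rule mult_dvd_mono[OF dvd_refl])
qed

text \<open>An irreducible common divisor of the squares would divide the \<open>Q i\<close>
  themselves, so the squares are coprime again.\<close>

lemma coprime_family_square_dvd:
  assumes cop: "coprime_family n Q" and nz: "k \<noteq> 0" and d: "\<And>i. i < n \<Longrightarrow> k dvd D * Q i ^ 2"
  shows "k dvd D"
proof -
  have "coprime_family n (\<lambda>i. Q i ^ 2)"
    unfolding coprime_family_def
  proof (intro allI impI)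
    fix d assume d: "\<forall>i<n. d dvd Q i ^ 2"
    show "d dvd 1"
    proof (rule ccontr)
      assume nu: "\<not> d dvd 1"
      show False
      proof (cases "d = 0")
        case True
        then have "\<forall>i<n. 0 dvd Q i" using d by auto
        then have "(0::mp) dvd 1" using cop unfolding coprime_family_def by blast
        then show False by simp
      next
        case False
        then obtain p where p: "irreducible p" "p dvd d" using ex_irreducible_dvd nu by blast
        then have "\<forall>i<n. p dvd Q i" using d irreducible_dvd_power dvd_trans by blast
        then have "p dvd 1" using cop unfolding coprime_family_def by blast
        then show False using p by (simp add: irreducible_def)
      qed
    qed
  qed
  from coprime_family_dvd[OF this nz d] show ?thesis .
qed

lemma square_dvd_square_mp:
  assumes "Q \<noteq> 0" "Q ^ 2 dvd g ^ 2" shows "(Q::mp) dvd g"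
  using assms
proof (induction Q arbitrary: g rule: mp_factor_induct)
  case (unit u)
  then show ?case using dvd_trans one_dvd by blast
next
  case (mult p f)
  have "p dvd g ^ 2" using mult(4) by (metis dvd_mult_left power2_eq_square mult.assoc)
  then have "p dvd g" using mult(1) irreducible_dvd_power by blast
  then obtain g' where g': "g = p * g'" by blast
  have "p ^ 2 * f ^ 2 dvd p ^ 2 * g' ^ 2" using mult(4) by (simp add: g' power_mult_distrib)
  then have "f ^ 2 dvd g' ^ 2" using mult(1) by (auto simp: irreducible_def)
  then show ?case using mult(3) g' by auto
qed

text \<open>The greatest common divisor is found as a common divisor of maximal total degree, which
  is bounded by that of a nonzero member.\<close>

lemma coprime_family_ex:
  assumes "\<exists>i<n. a i \<noteq> 0"
  shows "\<exists>d Q. d \<noteq> 0 \<and> (\<forall>i<n. a i = d * Q i) \<and> coprime_family n Q"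
proof -
  obtain i0 where i0: "i0 < n" "a i0 \<noteq> 0" using assms by blast
  let ?P = "\<lambda>d. (\<forall>i<n. d dvd a i)"
  have b: "\<forall>y. ?P y \<longrightarrow> mdeg y \<le> mdeg (a i0)" using i0 mdeg_dvd by blast
  have "\<exists>d. ?P d \<and> (\<forall>y. ?P y \<longrightarrow> mdeg y \<le> mdeg d)"
    by (rule ex_has_greatest_nat[of ?P 1 mdeg "Suc (mdeg (a i0))"]) (use b in \<open>auto simp: less_Suc_eq_le\<close>)
  then obtain d where d: "?P d" "\<And>y. ?P y \<Longrightarrow> mdeg y \<le> mdeg d" by blast
  have d0: "d \<noteq> 0" using d(1) i0 by auto
  have "\<forall>i. \<exists>q. i < n \<longrightarrow> a i = d * q" using d(1) by (auto simp: dvd_def)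
  then obtain Q where Q: "\<And>i. i < n \<Longrightarrow> a i = d * Q i" by metis
  have "coprime_family n Q" unfolding coprime_family_def
  proof (intro allI impI)
    fix e assume e: "\<forall>i<n. e dvd Q i"
    then have "?P (d * e)" using Q by auto
    from d(2)[OF this] have le: "mdeg (d * e) \<le> mdeg d" .
    have "e dvd Q i0" using e i0 by blast
    then have "e \<noteq> 0" using i0 Q[OF i0(1)] by auto
    then have "mdeg e = 0" using le mdeg_mult[OF d0] by auto
    then show "e dvd 1" using mp_unit_iff_mdeg \<open>e \<noteq> 0\<close> by blast
  qed
  then show ?thesis using d0 Q by blast
qed

text \<open>A vector proportional to a primitive one over the field of fractions is a polynomial
  multiple of it: \<open>Q i\<close> divides \<open>h i * Q j\<close> for all \<open>j\<close>,
  hence \<open>h i\<close>.\<close>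

lemma parallel_coprime:
  assumes cop: "coprime_family n Q" and par: "\<And>i j. i < n \<Longrightarrow> j < n \<Longrightarrow> Q i * h j = Q j * h i"
  shows "\<exists>r. \<forall>i<n. h i = r * Q i"
proof -
  have "\<exists>i<n. Q i \<noteq> 0"
  proof (rule ccontr)
    assume "\<not> ?thesis"
    then have "\<forall>i<n. 0 dvd Q i" by auto
    then have "(0::mp) dvd 1" using cop unfolding coprime_family_def by blast
    then show False by simp
  qed
  then obtain i where i: "i < n" "Q i \<noteq> 0" by blast
  have "Q i dvd h i * Q j" if "j < n" for j
    using par[OF i(1) that] by (metis dvd_triv_left mult.commute)
  then have "Q i dvd h i" using coprime_family_dvd[OF cop i(2)] by blast
  then obtain r where r: "h i = Q i * r" by blast
  have "h j = r * Q j" if "j < n" for j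
  proof -
    have "Q i * h j = Q i * (r * Q j)" using par[OF i(1) that] r by (simp add: algebra_simps)
    then show ?thesis using i by simp
  qed
  then show ?thesis by blast
qed

section \<open>Jordan bases of self-adjoint operators on symplectic spaces\<close>

text \<open>For a pair of skew forms with \<open>B\<close> invertible, \<open>b\<close> is
  \<open>B\<close> and \<open>S\<close> is \<open>B^-1 A\<close>; then \<open>b v (S w)\<close> is
  the form \<open>A\<close>, and its skewness is the self-adjointness of \<open>S\<close>.
  Nondegeneracy is asked for only on the subspace being decomposed.\<close>

locale skew_selfadjoint = vector_space scale
  for scale :: "complex \<Rightarrow> 'v::ab_group_add \<Rightarrow> 'v" (infixr "*s" 75) +
  fixes S :: "'v \<Rightarrow> 'v" and b :: "'v \<Rightarrow> 'v \<Rightarrow> complex"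
  assumes S_add: "S (x + y) = S x + S y" and S_scale: "S (c *s x) = c *s S x"
    and b_add: "b (x + y) z = b x z + b y z" and b_scale: "b (c *s x) z = c * b x z"
    and b_skew: "b y x = - b x y" and b_S: "b (S x) y = b x (S y)"
begin

lemma b_add_right: "b z (x + y) = b z x + b z y"
  using b_skew[of z "x + y"] b_skew[of z x] b_skew[of z y] b_add by simp
lemma b_scale_right: "b z (c *s x) = c * b z x"
  using b_skew[of z "c *s x"] b_skew[of z x] b_scale by simp
lemma b_zero [simp]: "b 0 z = 0" "b z 0 = 0"
  using b_scale[of 0 0 z] b_scale_right[of z 0 0] by simp_all
lemma b_minus: "b (- x) z = - b x z" "b z (- x) = - b z x"
  using b_add[of x "- x" z] b_add_right[of z x "- x"] by (auto simp: eq_neg_iff_add_eq_0 add.commute)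
lemma b_diff: "b (x - y) z = b x z - b y z" "b z (x - y) = b z x - b z y"
  using b_add[of x "- y" z] b_add_right[of z x "- y"] b_minus by auto
lemma b_sum: "b (sum f A) z = (\<Sum>i\<in>A. b (f i) z)" "b z (sum f A) = (\<Sum>i\<in>A. b z (f i))"
  by (induction A rule: infinite_finite_induct) (auto simp: b_add b_add_right)

lemma S_zero [simp]: "S 0 = 0" using S_scale[of 0 0] by simp
definition T :: "complex \<Rightarrow> 'v \<Rightarrow> 'v" where "T l x = S x - l *s x"

lemma S_T: "S x = T l x + l *s x" by (simp add: T_def)
lemma T_zero [simp]: "T l 0 = 0" by (simp add: T_def)
lemma T_pow_zero [simp]: "(T l ^^ i) 0 = 0" by (induction i) auto
lemma T_add: "T l (x + y) = T l x + T l y"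
  by (simp add: T_def S_add scale_right_distrib)
lemma T_scale: "T l (c *s x) = c *s T l x"
  by (simp add: T_def S_scale scale_right_diff_distrib mult.commute)
lemma T_pow_add: "(T l ^^ i) (x + y) = (T l ^^ i) x + (T l ^^ i) y"
  by (induction i) (auto simp: T_add)
lemma T_pow_scale: "(T l ^^ i) (c *s x) = c *s (T l ^^ i) x"
  by (induction i) (auto simp: T_scale)
lemma T_pow_diff: "(T l ^^ i) (x - y) = (T l ^^ i) x - (T l ^^ i) y"
  using T_pow_add[of i l "x - y" y] by simp
lemma b_T: "b (T l x) y = b x (T l y)"
  by (simp add: T_def b_diff b_S b_scale b_scale_right)
lemma b_T_pow: "b ((T l ^^ i) x) y = b x ((T l ^^ i) y)"
  by (induction i arbitrary: y) (simp, simp add: b_T, simp add: funpow_swap1)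
lemma b_T_pow2: "b ((T l ^^ i) x) ((T l ^^ j) y) = b x ((T l ^^ (i + j)) y)"
  by (simp add: b_T_pow funpow_add)
text \<open>\<open>b x ((T l ^^ i) y)\<close> is skew-symmetric in \<open>x\<close> and
  \<open>y\<close>, so each Jordan chain is isotropic and must be paired with a second one.\<close>

lemma b_T_same: "b x ((T l ^^ i) x) = 0"
  using b_T_pow[of i l x x] b_skew[of x "(T l ^^ i) x"] by simp
lemma T_pow_ge: "(T l ^^ m) x = 0 \<Longrightarrow> m \<le> i \<Longrightarrow> (T l ^^ i) x = 0"
  using funpow_add[of "i - m" m "T l"] by simp

text \<open>The vector \<open>q(S) x\<close>, by Horner's scheme.\<close>

definition pact :: "'v \<Rightarrow> complex poly \<Rightarrow> 'v" where
  "pact x q = fold_coeffs (\<lambda>a y. a *s x + S y) q 0"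

lemma pact_0 [simp]: "pact x 0 = 0" by (simp add: pact_def)
lemma pact_pCons [simp]: "pact x (pCons a q) = a *s x + S (pact x q)"
  by (cases "q = 0 \<and> a = 0") (auto simp: pact_def)
lemma pact_add: "pact x (p + q) = pact x p + pact x q"
proof (induction p arbitrary: q)
  case (pCons a p)
  obtain c r where q: "q = pCons c r" by (cases q)
  show ?case unfolding q by (simp add: pCons.IH S_add scale_left_distrib algebra_simps)
qed simp
lemma pact_diff: "pact x (p - q) = pact x p - pact x q"
  using pact_add[of x "p - q" q] by simp
lemma pact_S: "pact (S x) q = S (pact x q)"
proof (induction q arbitrary: x)
  case (pCons a q)
  then show ?case by (simp add: S_add S_scale)
qed simp
lemma pact_smult: "pact x (Polynomial.smult c p) = c *s pact x p"
  by (induction p) (simp_all add: S_scale scale_right_distrib)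
lemma pact_mult: "pact x (p * q) = pact (pact x q) p"
  by (induction p) (simp_all add: pact_add pact_smult)
lemma pact_1 [simp]: "pact x 1 = x" by (simp add: one_pCons)
lemma pact_monom: "pact x (monom c i) = c *s (S ^^ i) x"
  by (induction i) (simp_all add: monom_0 monom_Suc S_scale)
lemma pact_sum: "pact x (sum f A) = (\<Sum>i\<in>A. pact x (f i))"
  by (induction A rule: infinite_finite_induct) (auto simp: pact_add)
lemma pact_T: "pact x ([:- l, 1:] ^ i) = (T l ^^ i) x"
  by (induction i) (simp_all add: pact_mult T_def algebra_simps del: mult_pCons_left)
lemma pact_eigen: "T l x = 0 \<Longrightarrow> pact x q = poly q l *s x"
  by (induction q) (simp_all add: T_def S_scale scale_left_distrib mult.commute)
lemma b_pact: "b (pact x q) y = b x (pact y q)"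
  by (induction q arbitrary: x y) (simp_all add: b_add b_add_right b_scale b_scale_right b_S pact_S)
text \<open>Finite dimension expressed by a bound on independent sets. It passes to subspaces and
  serves as the induction measure.\<close>

definition indep_bound :: "'v set \<Rightarrow> nat \<Rightarrow> bool" where
  "indep_bound W N \<longleftrightarrow> (\<forall>s. independent s \<longrightarrow> s \<subseteq> W \<longrightarrow> finite s \<and> card s \<le> N)"

context
  fixes W :: "'v set"
  assumes sub: "subspace W" and SW: "\<And>x. x \<in> W \<Longrightarrow> S x \<in> W"
begin

lemma W_T: "x \<in> W \<Longrightarrow> (T l ^^ i) x \<in> W"
  by (induction i) (auto simp: T_def intro!: subspace_diff[OF sub] subspace_scale[OF sub] SW)
lemma W_S: "x \<in> W \<Longrightarrow> (S ^^ i) x \<in> W"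
  by (induction i) (auto simp: SW)
lemma W_pact: "x \<in> W \<Longrightarrow> pact x q \<in> W"
  by (induction q) (auto intro!: subspace_add[OF sub] subspace_scale[OF sub] SW subspace_0[OF sub])

text \<open>The \<open>N + 1\<close> vectors \<open>y, S y, ...\<close> either repeat or are
  linearly dependent; a repetition needs its own polynomial because a set of vectors does not record
  it.\<close>

lemma annihilator:
  assumes bd: "indep_bound W N" and y: "y \<in> W"
  shows "\<exists>q. q \<noteq> 0 \<and> degree q \<le> N \<and> pact y q = 0"
proof (cases "inj_on (\<lambda>i. (S ^^ i) y) {..N}")
  case True
  let ?v = "\<lambda>i. (S ^^ i) y"
  have "card (?v ` {..N}) = Suc N" using card_image[OF True] by simp
  moreover have "?v ` {..N} \<subseteq> W" using W_S[OF y] by auto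
  ultimately have "dependent (?v ` {..N})" using bd unfolding indep_bound_def by fastforce
  then obtain u where u: "\<exists>v\<in>?v ` {..N}. u v \<noteq> 0" "(\<Sum>v\<in>?v ` {..N}. u v *s v) = 0"
    using dependent_finite[of "?v ` {..N}"] by auto
  define q where "q = (\<Sum>i\<le>N. monom (u (?v i)) i)"
  have co: "coeff q i = u (?v i)" if "i \<le> N" for i
    unfolding q_def using that by (simp add: coeff_sum if_distrib sum.delta)
  from u(1) co have "q \<noteq> 0" by (metis (no_types, lifting) atMost_iff coeff_0 imageE)
  moreover have "degree q \<le> N" unfolding q_def
    by (rule degree_sum_le) (auto intro: order.trans[OF degree_monom_le])
  moreover have "pact y q = 0" unfolding q_def pact_sum pact_monom
    using u(2) by (simp add: sum.reindex[OF True])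
  ultimately show ?thesis by blast
next
  case False
  then obtain i j where ij: "i \<le> N" "j \<le> N" "i \<noteq> j" "(S ^^ i) y = (S ^^ j) y" by (auto simp: inj_on_def)
  let ?q = "monom 1 i - monom 1 j :: complex poly"
  have "coeff ?q i = 1" using ij by simp
  then have "?q \<noteq> 0" by (metis coeff_0 zero_neq_one)
  moreover have "degree ?q \<le> N" using ij by (intro degree_diff_le) (auto simp: degree_monom_eq)
  moreover have "pact y ?q = 0"
    using ij by (simp add: pact_diff pact_monom)
  ultimately show ?thesis by blast
qed

text \<open>In an annihilating polynomial of \<open>y\<close> of least degree, removing a linear
  factor leaves a polynomial that does not kill \<open>y\<close>; the resulting vector is an
  eigenvector.\<close>

lemma eigenvector:
  assumes bd: "indep_bound W N" and y: "y \<in> W" "y \<noteq> 0"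
  shows "\<exists>l. \<exists>x\<in>W. x \<noteq> 0 \<and> T l x = 0"
proof -
  let ?P = "\<lambda>q. q \<noteq> 0 \<and> pact y q = 0"
  have ex: "\<exists>q. ?P q" using annihilator[OF bd y(1)] by blast
  obtain q where q: "?P q" "\<And>q'. ?P q' \<Longrightarrow> degree q \<le> degree q'"
    using ex_has_least_nat[of ?P _ degree] ex by blast
  have "degree q \<noteq> 0"
  proof
    assume "degree q = 0"
    then obtain c where "q = [:c:]" using degree_eq_zeroE by blast
    then show False using q(1) y(2) by simp
  qed
  then obtain l where "poly q l = 0"
    using fundamental_theorem_of_algebra[of q] by (auto simp: constant_degree)
  then obtain r where r: "q = [:-l, 1:] * r" by (metis dvdE poly_eq_0_iff_dvd)
  have r0: "r \<noteq> 0" using q r by auto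
  then have "degree r < degree q" unfolding r by (subst degree_mult_eq) auto
  then have "pact y r \<noteq> 0" using q(2)[of r] r0 by auto
  moreover have "T l (pact y r) = 0"
    using q(1) pact_T[of "pact y r" l 1] unfolding r pact_mult by simp
  ultimately show ?thesis using W_pact[OF y(1)] by blast
qed

text \<open>The full power of \<open>X - l\<close> is split off from an annihilator of
  \<open>y\<close>. Applying \<open>r(S)\<close> then plays the role of projecting \<open>y\<close>
  to the generalized eigenspace of \<open>l\<close>.\<close>

lemma annihilator_split:
  assumes bd: "indep_bound W N" and y: "y \<in> W"
  shows "\<exists>r j. poly r l \<noteq> 0 \<and> j \<le> N \<and> (T l ^^ j) (pact y r) = 0"
proof -
  obtain q where q: "q \<noteq> 0" "degree q \<le> N" "pact y q = 0" using annihilator[OF bd y] by blast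
  obtain r where r: "q = [:-l, 1:] ^ Polynomial.order l q * r" "\<not> [:-l, 1:] dvd r" using order_decomp[OF q(1)] by blast
  have "Polynomial.order l q \<le> N" using order_degree[OF q(1)] q(2) by (rule order.trans)
  moreover have "(T l ^^ Polynomial.order l q) (pact y r) = 0"
    using q(3) r(1) by (metis pact_T pact_mult)
  moreover have "poly r l \<noteq> 0" using r(2) poly_eq_0_iff_dvd by blast
  ultimately show ?thesis by blast
qed

text \<open>Take a root vector \<open>x\<close> of maximal height \<open>m\<close> for an eigenvalue
  \<open>l\<close>. Its eigenvector \<open>T^(m-1) x\<close> pairs with something by nondegeneracy,
  and a partner can be moved into the same generalized eigenspace and then adjusted until its chain
  is dual to that of \<open>x\<close>.\<close>

lemma chain_pair:
  assumes bd: "indep_bound W N" and nd: "\<And>x. x \<in> W \<Longrightarrow> (\<And>y. y \<in> W \<Longrightarrow> b x y = 0) \<Longrightarrow> x = 0"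
    and ne: "z \<in> W" "z \<noteq> 0"
  shows "\<exists>l m x y. m \<ge> 1 \<and> x \<in> W \<and> y \<in> W \<and> (T l ^^ m) x = 0 \<and> (T l ^^ m) y = 0 \<and>
    (\<forall>i. b x ((T l ^^ i) y) = (if i = m - 1 then 1 else 0))"
proof -
  obtain l x0 where x0: "x0 \<in> W" "x0 \<noteq> 0" "T l x0 = 0" using eigenvector[OF bd ne] by blast
  let ?P = "\<lambda>m. \<exists>x\<in>W. (T l ^^ m) x = 0 \<and> (T l ^^ (m - 1)) x \<noteq> 0 \<and> m \<ge> 1"
  have P1: "?P 1" using x0 by (intro bexI[of _ x0]) auto
  \<comment> \<open>A height above \<open>N\<close> is impossible: \<open>T^(m-1) x\<close> is an
    eigenvector, on which \<open>r(S)\<close> acts by the nonzero scalar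
    \<open>poly r l\<close>.\<close>
  have bound: "m \<le> N" if m: "?P m" for m
  proof -
    obtain x where x: "x \<in> W" "(T l ^^ m) x = 0" "(T l ^^ (m - 1)) x \<noteq> 0" "m \<ge> 1" using m by blast
    obtain r j where r: "poly r l \<noteq> 0" "j \<le> N" "(T l ^^ j) (pact x r) = 0"
      using annihilator_split[OF bd x(1)] by blast
    show ?thesis
    proof (rule ccontr)
      assume "\<not> m \<le> N"
      then have "j \<le> m - 1" using r(2) by auto
      then have "(T l ^^ (m - 1)) (pact x r) = 0" using T_pow_ge[OF r(3)] by blast
      also have "(T l ^^ (m - 1)) (pact x r) = pact ((T l ^^ (m - 1)) x) r"
        by (metis pact_T pact_mult mult.commute)
      also have "\<dots> = poly r l *s (T l ^^ (m - 1)) x"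
        by (rule pact_eigen) (use x(2,4) in \<open>metis One_nat_def Suc_pred comp_apply funpow.simps(2) less_eq_Suc_le\<close>)
      finally show False using r(1) x(3) by simp
    qed
  qed
  define m where "m = (GREATEST m. ?P m)"
  have Pm: "?P m" unfolding m_def by (rule GreatestI_nat[where P = ?P, OF P1]) (use bound in blast)
  have mmax: "m' \<le> m" if "?P m'" for m' unfolding m_def by (rule Greatest_le_nat[where P = ?P, OF that]) (use bound in blast)
  have killed: "(T l ^^ m) x = 0" if x: "x \<in> W" "(T l ^^ j) x = 0" for x j
  proof (rule ccontr)
    assume nz: "(T l ^^ m) x \<noteq> 0"
    define j' where "j' = (LEAST j. (T l ^^ j) x = 0)"
    have j': "(T l ^^ j') x = 0" unfolding j'_def using x(2) by (rule LeastI)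
    have "j' > m" using nz T_pow_ge[OF j'] by (meson not_le)
    moreover have "(T l ^^ (j' - 1)) x \<noteq> 0"
      using not_less_Least[of "j' - 1" "\<lambda>j. (T l ^^ j) x = 0"] \<open>j' > m\<close> unfolding j'_def by auto
    ultimately have "?P j'" using x(1) j' by auto
    then show False using mmax \<open>j' > m\<close> by force
  qed
  obtain x where x: "x \<in> W" "(T l ^^ m) x = 0" "(T l ^^ (m - 1)) x \<noteq> 0" "m \<ge> 1" using Pm by blast
  have eig: "T l ((T l ^^ (m - 1)) x) = 0"
    using x(2,4) by (metis One_nat_def Suc_pred comp_apply funpow.simps(2) less_eq_Suc_le)
  obtain y0 where y0: "y0 \<in> W" "b ((T l ^^ (m - 1)) x) y0 \<noteq> 0" using nd[OF W_T[OF x(1)]] x(3) by blast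
  obtain r j where r: "poly r l \<noteq> 0" "(T l ^^ j) (pact y0 r) = 0" using annihilator_split[OF bd y0(1)] by blast
  \<comment> \<open>Passing to \<open>r(S) y0\<close> multiplies the pairing with the eigenvector by
    \<open>poly r l\<close>, which is nonzero, and puts the partner among the root vectors of
    \<open>l\<close>.\<close>
  define y1 where "y1 = pact y0 r"
  have y1: "y1 \<in> W" "(T l ^^ m) y1 = 0" using killed[OF _ r(2)] W_pact[OF y0(1)] unfolding y1_def by auto
  have "b ((T l ^^ (m - 1)) x) y1 = poly r l * b ((T l ^^ (m - 1)) x) y0"
    unfolding y1_def b_pact[symmetric] pact_eigen[OF eig] b_scale ..
  then have h1: "b x ((T l ^^ (m - 1)) y1) \<noteq> 0" using r(1) y0(2) by (simp add: b_T_pow)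
  \<comment> \<open>Pairings are cleared downwards from index \<open>m - 2\<close>: subtracting a
    multiple of \<open>T^(j+1) y\<close> corrects the next index and leaves the higher ones alone,
    because there it only contributes powers of at least \<open>m\<close>.\<close>
  have "\<exists>y\<in>W. (T l ^^ m) y = 0 \<and> b x ((T l ^^ (m - 1)) y) = 1 \<and> (\<forall>i. m - 1 - j \<le> i \<longrightarrow> i < m - 1 \<longrightarrow> b x ((T l ^^ i) y) = 0)" for j
  proof (induction j)
    case 0
    let ?y = "(1 / b x ((T l ^^ (m - 1)) y1)) *s y1"
    show ?case using y1 h1 by (intro bexI[of _ ?y]) (auto simp: T_pow_scale b_scale_right intro: subspace_scale[OF sub])
  next
    case (Suc j)
    then obtain y where y: "y \<in> W" "(T l ^^ m) y = 0" "b x ((T l ^^ (m - 1)) y) = 1"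
      "\<And>i. m - 1 - j \<le> i \<Longrightarrow> i < m - 1 \<Longrightarrow> b x ((T l ^^ i) y) = 0" by blast
    show ?case
    proof (cases "j < m - 1")
      case False
      then show ?thesis using y by (intro bexI[of _ y]) auto
    next
      case True
      define h where "h = b x ((T l ^^ (m - 1 - Suc j)) y)"
      define y' where "y' = y - h *s (T l ^^ Suc j) y"
      have by': "b x ((T l ^^ i) y') = b x ((T l ^^ i) y) - h * b x ((T l ^^ (i + Suc j)) y)" for i
        unfolding y'_def T_pow_diff T_pow_scale b_diff b_scale_right funpow_add comp_apply ..
      have z: "(T l ^^ (i + Suc j)) y = 0" if "m - 1 - j \<le> i" for i
        by (rule T_pow_ge[OF y(2)]) (use that in auto)
      have "y' \<in> W" unfolding y'_def using y(1) W_T by (auto intro!: subspace_diff[OF sub] subspace_scale[OF sub] simp del: funpow.simps)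
      moreover have "(T l ^^ m) y' = 0" unfolding y'_def T_pow_diff T_pow_scale
      proof -
        have "(T l ^^ m) ((T l ^^ Suc j) y) = (T l ^^ (m + Suc j)) y" by (simp only: funpow_add comp_apply)
        then show "(T l ^^ m) y - h *s (T l ^^ m) ((T l ^^ Suc j) y) = 0"
          using y(2) T_pow_ge[OF y(2), of "m + Suc j"] by (simp del: funpow.simps)
      qed
      moreover have "b x ((T l ^^ (m - 1)) y') = 1" using by'[of "m - 1"] z[of "m - 1"] y(3) by simp
      moreover have "b x ((T l ^^ i) y') = 0" if i: "m - 1 - Suc j \<le> i" "i < m - 1" for i
      proof (cases "i = m - 1 - Suc j")
        case True
        have "i + Suc j = m - 1" using True \<open>j < m - 1\<close> by auto
        then have "b x ((T l ^^ i) y') = h - h * 1" using by'[of i] by (simp only: y(3) True h_def)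
        then show ?thesis by simp
      next
        case False
        then have "m - 1 - j \<le> i" using i by auto
        then show ?thesis using by'[of i] z[of i] y(4)[of i] i by simp
      qed
      ultimately show ?thesis by blast
    qed
  qed
  from this[of m] obtain y where y: "y \<in> W" "(T l ^^ m) y = 0" "b x ((T l ^^ (m - 1)) y) = 1"
    "\<And>i. i < m - 1 \<Longrightarrow> b x ((T l ^^ i) y) = 0" by auto
  have "b x ((T l ^^ i) y) = (if i = m - 1 then 1 else 0)" for i
  proof (cases "i < m")
    case True
    then show ?thesis using y(3) y(4)[of i] by (cases "i = m - 1") auto
  next
    case False
    then show ?thesis using T_pow_ge[OF y(2), of i] x(4) by auto
  qed
  then show ?thesis using x y by blast
qed

end

text \<open>Data of one block: eigenvalue, half of its size, and the tops of two chains that are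
  dual to each other.\<close>

definition good_block :: "complex \<times> nat \<times> 'v \<times> 'v \<Rightarrow> bool" where
  "good_block = (\<lambda>(l, m, x, y). m \<ge> 1 \<and> (T l ^^ m) x = 0 \<and> (T l ^^ m) y = 0 \<and>
    (\<forall>i. b x ((T l ^^ i) y) = (if i = m - 1 then 1 else 0)))"

definition uvecs :: "complex \<times> nat \<times> 'v \<times> 'v \<Rightarrow> 'v list" where
  "uvecs = (\<lambda>(l, m, x, y). map (\<lambda>i. (T l ^^ i) x) [0..<m])"

text \<open>Run backwards, so that the Gram matrix against \<open>uvecs\<close> is the
  identity.\<close>

definition wvecs :: "complex \<times> nat \<times> 'v \<times> 'v \<Rightarrow> 'v list" where
  "wvecs = (\<lambda>(l, m, x, y). map (\<lambda>i. (T l ^^ (m - 1 - i)) y) [0..<m])"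

definition bvecs :: "complex \<times> nat \<times> 'v \<times> 'v \<Rightarrow> 'v list" where
  "bvecs B = uvecs B @ wvecs B"

lemma set_bvecs: "set (bvecs (l, m, x, y)) = (\<lambda>i. (T l ^^ i) x) ` {..<m} \<union> (\<lambda>i. (T l ^^ i) y) ` {..<m}"
proof -
  have "(\<lambda>i. (T l ^^ (m - 1 - i)) y) ` {..<m} = (\<lambda>i. (T l ^^ i) y) ` {..<m}"
  proof (intro equalityI subsetI)
    fix z assume "z \<in> (\<lambda>i. (T l ^^ i) y) ` {..<m}"
    then obtain i where "i < m" "z = (T l ^^ i) y" by auto
    then show "z \<in> (\<lambda>i. (T l ^^ (m - 1 - i)) y) ` {..<m}" by (intro image_eqI[of _ _ "m - 1 - i"]) auto
  qed auto
  then show ?thesis by (auto simp: bvecs_def uvecs_def wvecs_def atLeast0LessThan)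
qed

text \<open>One chain pair is split off and the argument continues in its orthogonal complement
  \<open>W1\<close>, which is again invariant and nondegenerate and in which independent sets are
  smaller by at least one.\<close>

theorem symplectic_jordan:
  assumes "subspace W" "\<And>x. x \<in> W \<Longrightarrow> S x \<in> W" "indep_bound W N"
    "\<And>x. x \<in> W \<Longrightarrow> (\<And>y. y \<in> W \<Longrightarrow> b x y = 0) \<Longrightarrow> x = 0"
  shows "\<exists>bs. (\<forall>B\<in>set bs. good_block B \<and> set (bvecs B) \<subseteq> W) \<and>
    sorted_wrt (\<lambda>B B'. \<forall>z\<in>set (bvecs B). \<forall>z'\<in>set (bvecs B'). b z z' = 0) bs \<and>
    W = span (\<Union>B\<in>set bs. set (bvecs B))"
  using assms
proof (induction N arbitrary: W rule: less_induct)
  case (less N)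
  note sub = less.prems(1) and SW = less.prems(2) and bd = less.prems(3) and nd = less.prems(4)
  show ?case
  proof (cases "W = {0}")
    case True
    then show ?thesis by (intro exI[of _ "[]"]) auto
  next
    case False
    then obtain z where z: "z \<in> W" "z \<noteq> 0" using subspace_0[OF sub] by blast
    have "\<exists>l m x y. m \<ge> 1 \<and> x \<in> W \<and> y \<in> W \<and> (T l ^^ m) x = 0 \<and> (T l ^^ m) y = 0 \<and>
    (\<forall>i. b x ((T l ^^ i) y) = (if i = m - 1 then 1 else 0))"
      by (rule chain_pair[OF sub SW bd nd z])
    then obtain l m x y where xy: "m \<ge> 1" "x \<in> W" "y \<in> W" "(T l ^^ m) x = 0" "(T l ^^ m) y = 0"
      and h: "\<And>i. b x ((T l ^^ i) y) = (if i = m - 1 then 1 else 0)" by blast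
    define B where "B = (l, m, x, y)"
    have good: "good_block B" unfolding good_block_def B_def using xy h by simp
    have BW: "set (bvecs B) \<subseteq> W" unfolding B_def set_bvecs using W_T[OF sub SW] xy by auto
    define W1 where "W1 = {v \<in> W. \<forall>i. b v ((T l ^^ i) x) = 0 \<and> b v ((T l ^^ i) y) = 0}"
    have W1W: "W1 \<subseteq> W" unfolding W1_def by auto
    have sub1: "subspace W1"
      unfolding W1_def by (rule subspaceI) (use sub in \<open>auto simp: subspace_def b_add b_scale\<close>)
    have SW1: "S v \<in> W1" if "v \<in> W1" for v
    proof -
      have "b (S v) ((T l ^^ i) u) = b v ((T l ^^ Suc i) u) + l * b v ((T l ^^ i) u)" for i u
        unfolding b_S S_T[of "(T l ^^ i) u" l] b_add_right b_scale_right by simp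
      then show ?thesis using that SW unfolding W1_def by (auto simp del: funpow.simps)
    qed
    have decomp: "\<exists>p\<in>span (set (bvecs B)). v - p \<in> W1" if v: "v \<in> W" for v
    proof -
      \<comment> \<open>The orthogonal projection of \<open>v\<close> to the block: as the chains
        are dual in reverse order, the coefficient of \<open>T^i x\<close> is the pairing with
        \<open>T^(m-1-i) y\<close> and conversely, with a sign.\<close>
      define p where "p = (\<Sum>i<m. b v ((T l ^^ (m - 1 - i)) y) *s (T l ^^ i) x) + (\<Sum>i<m. (- b v ((T l ^^ (m - 1 - i)) x)) *s (T l ^^ i) y)"
      have pW: "p \<in> span (set (bvecs B))"
        unfolding p_def B_def set_bvecs by (intro span_add span_sum span_scale span_base) auto
      then have "p \<in> W" using span_minimal[OF BW sub] by blast
      have h': "b y ((T l ^^ i) x) = (if i = m - 1 then -1 else 0)" for i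
        using h[of i] b_skew[of "(T l ^^ i) y" x] b_T_pow[of i l y x] by simp
      have 1: "b p ((T l ^^ j) y) = b v ((T l ^^ j) y)" for j
      proof (cases "j < m")
        case True
        have "b p ((T l ^^ j) y) = (\<Sum>i<m. b v ((T l ^^ (m - 1 - i)) y) * (if i + j = m - 1 then 1 else 0))"
          unfolding p_def b_add b_sum b_scale b_T_pow2 b_T_same h by simp
        also have "\<dots> = (\<Sum>i<m. if i = m - 1 - j then b v ((T l ^^ (m - 1 - i)) y) else 0)"
          by (rule sum.cong) (use True in auto)
        also have "\<dots> = b v ((T l ^^ j) y)" using True by (simp add: sum.delta)
        finally show ?thesis .
      next
        case False
        then show ?thesis using T_pow_ge[OF xy(5), of j] by simp
      qed
      have 2: "b p ((T l ^^ j) x) = b v ((T l ^^ j) x)" for j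
      proof (cases "j < m")
        case True
        have "b p ((T l ^^ j) x) = (\<Sum>i<m. (- b v ((T l ^^ (m - 1 - i)) x)) * (if i + j = m - 1 then -1 else 0))"
          unfolding p_def b_add b_sum b_scale b_T_pow2 b_T_same h' by simp
        also have "\<dots> = (\<Sum>i<m. if i = m - 1 - j then b v ((T l ^^ (m - 1 - i)) x) else 0)"
          by (rule sum.cong) (use True in auto)
        also have "\<dots> = b v ((T l ^^ j) x)" using True by (simp add: sum.delta)
        finally show ?thesis .
      next
        case False
        then show ?thesis using T_pow_ge[OF xy(4), of j] by simp
      qed
      have "v - p \<in> W1" unfolding W1_def using v \<open>p \<in> W\<close> 1 2 by (auto simp: b_diff intro: subspace_diff[OF sub])
      then show ?thesis using pW by blast
    qed
    have W1_orth: "b v u = 0" if v: "v \<in> W1" and u: "u \<in> span (set (bvecs B))" for v u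
      using u
    proof (induction rule: span_induct_alt)
      case (step c a w)
      then have "b v a = 0" using v unfolding W1_def B_def set_bvecs by auto
      then show ?case using step by (simp add: b_add_right b_scale_right)
    qed simp
    have nd1: "v = 0" if v: "v \<in> W1" and o: "\<And>u. u \<in> W1 \<Longrightarrow> b v u = 0" for v
    proof (rule nd)
      show "v \<in> W" using v W1W by blast
      fix u assume "u \<in> W"
      then obtain p where p: "p \<in> span (set (bvecs B))" "u - p \<in> W1" using decomp by blast
      have "b v u = b v p + b v (u - p)" by (simp add: b_add_right[symmetric])
      then show "b v u = 0" using o[OF p(2)] W1_orth[OF v p(1)] by simp
    qed
    \<comment> \<open>\<open>x\<close> pairs to 1 with the end of the \<open>y\<close> chain, so it
      lies outside \<open>W1\<close> and enlarges every independent subset of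
      \<open>W1\<close>.\<close>
    have bd1: "finite s \<and> card s + 1 \<le> N" if s: "independent s" "s \<subseteq> W1" for s
    proof -
      have "b x ((T l ^^ (m - 1)) y) \<noteq> 0" using h[of "m - 1"] by simp
      then have "x \<notin> W1" unfolding W1_def by blast
      then have xs: "x \<notin> span s" using span_minimal[OF s(2) sub1] by blast
      have "independent (insert x s)" by (rule independent_insertI[OF xs s(1)])
      moreover have "insert x s \<subseteq> W" using s W1W xy by blast
      ultimately have "finite (insert x s) \<and> card (insert x s) \<le> N" by (rule bd[unfolded indep_bound_def, rule_format])
      moreover have "x \<notin> s" using xs span_base by blast
      ultimately show ?thesis using card_insert_disjoint[of s x] by auto
    qed
    have N: "N > 0" using bd1[of "{}"] independent_empty by simp
    have bd1': "indep_bound W1 (N - 1)" unfolding indep_bound_def using bd1 by fastforce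
    have "\<exists>bs. (\<forall>B\<in>set bs. good_block B \<and> set (bvecs B) \<subseteq> W1) \<and>
      sorted_wrt (\<lambda>B B'. \<forall>z\<in>set (bvecs B). \<forall>z'\<in>set (bvecs B'). b z z' = 0) bs \<and>
      W1 = span (\<Union>B\<in>set bs. set (bvecs B))"
      by (rule less.IH[OF _ sub1 SW1 bd1' nd1]) (use N in auto)
    then obtain bs where bs: "\<And>B. B \<in> set bs \<Longrightarrow> good_block B \<and> set (bvecs B) \<subseteq> W1"
      "sorted_wrt (\<lambda>B B'. \<forall>z\<in>set (bvecs B). \<forall>z'\<in>set (bvecs B'). b z z' = 0) bs"
      "W1 = span (\<Union>B\<in>set bs. set (bvecs B))" by blast
    have "sorted_wrt (\<lambda>B B'. \<forall>z\<in>set (bvecs B). \<forall>z'\<in>set (bvecs B'). b z z' = 0) (B # bs)"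
    proof -
      have "b z z' = 0" if "z \<in> set (bvecs B)" "B' \<in> set bs" "z' \<in> set (bvecs B')" for z z' B'
      proof -
        have "z' \<in> W1" using that bs(1) by blast
        then show ?thesis using W1_orth[of z' z] that(1) span_base b_skew[of z z'] by (metis neg_equal_0_iff_equal)
      qed
      then show ?thesis using bs(2) by auto
    qed
    moreover have "W = span (\<Union>B\<in>set (B # bs). set (bvecs B))"
    proof
      show "span (\<Union>B\<in>set (B # bs). set (bvecs B)) \<subseteq> W"
      proof (rule span_minimal[OF _ sub])
        have "set (bvecs B') \<subseteq> W" if "B' \<in> set (B # bs)" for B'
          using that BW bs(1) W1W by (metis order_trans set_ConsD)
        then show "(\<Union>B\<in>set (B # bs). set (bvecs B)) \<subseteq> W" by blast
      qed
      show "W \<subseteq> span (\<Union>B\<in>set (B # bs). set (bvecs B))"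
      proof
        fix v assume "v \<in> W"
        then obtain p where p: "p \<in> span (set (bvecs B))" "v - p \<in> W1" using decomp by blast
        have "p \<in> span (\<Union>B\<in>set (B # bs). set (bvecs B))" by (rule subsetD[OF span_mono p(1)]) auto
        moreover have "v - p \<in> span (\<Union>B\<in>set (B # bs). set (bvecs B))"
          by (rule subsetD[OF span_mono]) (use p(2) bs(3) in auto)
        ultimately have "p + (v - p) \<in> span (\<Union>B\<in>set (B # bs). set (bvecs B))" by (rule span_add)
        then show "v \<in> span (\<Union>B\<in>set (B # bs). set (bvecs B))" by simp
      qed
    qed
    moreover have "\<forall>B'\<in>set (B # bs). good_block B' \<and> set (bvecs B') \<subseteq> W"
      using good BW bs(1) W1W by (metis order_trans set_ConsD)
    ultimately show ?thesis by blast
  qed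
qed

end

section \<open>Coordinate vectors, independent lists and Gram matrices\<close>

definition cscale :: "complex \<Rightarrow> (nat \<Rightarrow> complex) \<Rightarrow> (nat \<Rightarrow> complex)" where
  "cscale c v = (\<lambda>i. c * v i)"

lemma cscale_apply [simp]: "cscale c v i = c * v i" by (simp add: cscale_def)

interpretation cv: vector_space cscale
  by standard (auto simp: fun_eq_iff algebra_simps)

lemma sum_fun_apply: "(sum f A) i = (\<Sum>k\<in>A. f k i)" for f :: "'a \<Rightarrow> nat \<Rightarrow> complex"
  by (induction A rule: infinite_finite_induct) auto

text \<open>Vectors of length \<open>N\<close> as functions vanishing from \<open>N\<close> on. The
  original space thereby becomes a subset of the bordered one, with no embedding map.\<close>

definition CS :: "nat \<Rightarrow> (nat \<Rightarrow> complex) set" where "CS N = {v. \<forall>i\<ge>N. v i = 0}"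

definition unit_fun :: "nat \<Rightarrow> nat \<Rightarrow> complex" where "unit_fun i = (\<lambda>j. if j = i then 1 else 0)"

lemma CS_subspace: "cv.subspace (CS N)"
  by (rule cv.subspaceI) (auto simp: CS_def)

lemma CS_expand: assumes "v \<in> CS N" shows "v = (\<Sum>i<N. cscale (v i) (unit_fun i))"
proof
  fix j
  have "(\<Sum>i<N. cscale (v i) (unit_fun i)) j = (\<Sum>i<N. if i = j then v i else 0)"
    unfolding sum_fun_apply by (rule sum.cong) (auto simp: unit_fun_def)
  also have "\<dots> = v j" using assms by (auto simp: CS_def sum.delta)
  finally show "v j = (\<Sum>i<N. cscale (v i) (unit_fun i)) j" by simp
qed

lemma unit_fun_CS: "i < N \<Longrightarrow> unit_fun i \<in> CS N" by (auto simp: unit_fun_def CS_def)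

lemma CS_indep_bound:
  assumes "cv.independent s" "s \<subseteq> CS N" shows "finite s \<and> card s \<le> N"
proof -
  have "CS N \<subseteq> cv.span (unit_fun ` {..<N})"
  proof
    fix v assume "v \<in> CS N"
    then have "v = (\<Sum>i<N. cscale (v i) (unit_fun i))" by (rule CS_expand)
    also have "\<dots> \<in> cv.span (unit_fun ` {..<N})"
      by (intro cv.span_sum cv.span_scale cv.span_base) auto
    finally show "v \<in> cv.span (unit_fun ` {..<N})" .
  qed
  then have "finite s \<and> card s \<le> card (unit_fun ` {..<N})"
    using assms by (intro cv.independent_span_bound) auto
  moreover have "card (unit_fun ` {..<N}) \<le> N" using card_image_le[of "{..<N}" unit_fun] by simp
  ultimately show ?thesis by simp
qed

text \<open>Independence of a list, so that order and repetitions are respected when the vectors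
  become columns of a matrix.\<close>

definition list_indep :: "(nat \<Rightarrow> complex) list \<Rightarrow> bool" where
  "list_indep vs \<longleftrightarrow> (\<forall>z. (\<Sum>j<length vs. cscale (z j) (vs ! j)) = 0 \<longrightarrow> (\<forall>j<length vs. z j = 0))"

lemma list_indep_iff: "list_indep vs \<longleftrightarrow> distinct vs \<and> cv.independent (set vs)"
proof
  assume ind: "list_indep vs"
  have dist: "distinct vs"
  proof (rule ccontr)
    assume "\<not> distinct vs"
    then obtain i j where ij: "i < length vs" "j < length vs" "i \<noteq> j" "vs ! i = vs ! j"
      by (auto simp: distinct_conv_nth)
    define z where "z k = (if k = i then 1 else if k = j then -1 else (0::complex))" for k
    have "(\<Sum>k<length vs. cscale (z k) (vs ! k)) = (\<Sum>k\<in>{i, j}. cscale (z k) (vs ! k))"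
      by (rule sum.mono_neutral_right) (use ij in \<open>auto simp: z_def fun_eq_iff\<close>)
    also have "\<dots> = 0" using ij by (auto simp: z_def fun_eq_iff)
    finally have "z i = 0" using ind ij unfolding list_indep_def by blast
    then show False by (simp add: z_def)
  qed
  moreover have "cv.independent (set vs)"
  proof
    assume "cv.dependent (set vs)"
    then obtain u where u: "\<exists>v\<in>set vs. u v \<noteq> 0" "(\<Sum>v\<in>set vs. cscale (u v) v) = 0"
      using cv.dependent_finite[of "set vs"] by auto
    have "(\<Sum>j<length vs. cscale (u (vs ! j)) (vs ! j)) = (\<Sum>v\<in>set vs. cscale (u v) v)"
      using dist by (intro sum.reindex_bij_betw bij_betw_nth) auto
    then have "\<forall>j<length vs. u (vs ! j) = 0" using ind u(2) unfolding list_indep_def by metis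
    then show False using u(1) by (auto simp: in_set_conv_nth)
  qed
  ultimately show "distinct vs \<and> cv.independent (set vs)" ..
next
  assume a: "distinct vs \<and> cv.independent (set vs)"
  show "list_indep vs" unfolding list_indep_def
  proof (intro allI impI)
    fix z j assume z: "(\<Sum>j<length vs. cscale (z j) (vs ! j)) = 0" and j: "j < length vs"
    have inj: "inj_on (\<lambda>j. vs ! j) {..<length vs}" using a by (auto simp: inj_on_def nth_eq_iff_index_eq)
    define u where "u v = z (the_inv_into {..<length vs} (\<lambda>j. vs ! j) v)" for v
    have uj: "u (vs ! j) = z j" if "j < length vs" for j
      unfolding u_def using the_inv_into_f_f[OF inj, of j] that by simp
    have "(\<Sum>v\<in>set vs. cscale (u v) v) = (\<Sum>j<length vs. cscale (u (vs ! j)) (vs ! j))"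
      using a by (intro sum.reindex_bij_betw[symmetric] bij_betw_nth) auto
    also have "\<dots> = 0" using z uj by simp
    finally have "\<forall>v\<in>set vs. u v = 0" using a cv.dependent_finite[of "set vs"] by blast
    then have "u (vs ! j) = 0" using j by simp
    then show "z j = 0" using uj j by simp
  qed
qed

lemma list_indep_unit: "list_indep (map unit_fun [0..<N])"
  unfolding list_indep_def
proof (intro allI impI)
  fix z j assume z: "(\<Sum>j<length (map unit_fun [0..<N]). cscale (z j) (map unit_fun [0..<N] ! j)) = 0"
    and j: "j < length (map unit_fun [0..<N])"
  have "0 = (\<Sum>i<N. cscale (z i) (unit_fun i)) j" using z by (simp add: fun_eq_iff)
  also have "\<dots> = (\<Sum>i<N. if i = j then z i else 0)"
    unfolding sum_fun_apply by (rule sum.cong) (auto simp: unit_fun_def)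
  also have "\<dots> = z j" using j by (simp add: sum.delta)
  finally show "z j = 0" by simp
qed

lemma list_indep_span_length:
  assumes "list_indep vs" "set vs \<subseteq> CS N" "CS N \<subseteq> cv.span (set vs)" shows "length vs = N"
proof (rule antisym)
  show "length vs \<le> N" using assms(1,2) CS_indep_bound[of "set vs" N] list_indep_iff distinct_card by metis
  have "cv.independent (unit_fun ` {..<N})" and d: "distinct (map unit_fun [0..<N])"
    using list_indep_unit[of N] unfolding list_indep_iff by (auto simp: atLeast0LessThan)
  moreover have "unit_fun ` {..<N} \<subseteq> cv.span (set vs)" using assms(3) unit_fun_CS by blast
  ultimately have "card (unit_fun ` {..<N}) \<le> card (set vs)"
    using cv.independent_span_bound[of "set vs"] by auto
  moreover have "card (unit_fun ` {..<N}) = N" using distinct_card[OF d] by (simp add: atLeast0LessThan)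
  ultimately show "N \<le> length vs" using card_length[of vs] by simp
qed

definition cmat :: "nat \<Rightarrow> (nat \<Rightarrow> complex) list \<Rightarrow> complex mat" where
  "cmat N vs = mat N (length vs) (\<lambda>(i, j). (vs ! j) i)"

lemma cmat_carrier [simp]: "cmat N vs \<in> carrier_mat N (length vs)" by (simp add: cmat_def)

lemma cmat_det_nz:
  assumes "list_indep vs" "set vs \<subseteq> CS N" "length vs = N" shows "det (cmat N vs) \<noteq> 0"
proof
  assume "det (cmat N vs) = 0"
  then obtain v where v: "v \<in> carrier_vec N" "v \<noteq> 0\<^sub>v N" "cmat N vs *\<^sub>v v = 0\<^sub>v N"
    using det_0_iff_vec_prod_zero_field[of "cmat N vs" N] assms(3) cmat_carrier by metis
  have "(\<Sum>j<length vs. cscale (v $ j) (vs ! j)) = 0"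
  proof
    fix i
    show "(\<Sum>j<length vs. cscale (v $ j) (vs ! j)) i = 0 i"
    proof (cases "i < N")
      case True
      have "(cmat N vs *\<^sub>v v) $ i = (\<Sum>j<N. (vs ! j) i * v $ j)"
        using True v(1) assms(3) by (simp add: cmat_def scalar_prod_def atLeast0LessThan)
      then show ?thesis using v(3) True assms(3) by (simp add: sum_fun_apply mult.commute)
    next
      case False
      then have "(vs ! j) i = 0" if "j < length vs" for j using that assms(2) nth_mem unfolding CS_def by fastforce
      then show ?thesis by (simp add: sum_fun_apply)
    qed
  qed
  then have "\<forall>j<N. v $ j = 0" using assms unfolding list_indep_def by blast
  then have "v = 0\<^sub>v N" using v(1) by (intro eq_vecI) auto
  then show False using v(2) by simp
qed

definition bil :: "nat \<Rightarrow> complex mat \<Rightarrow> (nat \<Rightarrow> complex) \<Rightarrow> (nat \<Rightarrow> complex) \<Rightarrow> complex" where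
  "bil N M v w = (\<Sum>i<N. \<Sum>j<N. v i * M $$ (i, j) * w j)"

definition mapp :: "nat \<Rightarrow> complex mat \<Rightarrow> (nat \<Rightarrow> complex) \<Rightarrow> (nat \<Rightarrow> complex)" where
  "mapp N M v = (\<lambda>i. if i < N then \<Sum>j<N. M $$ (i, j) * v j else 0)"

lemma bil_linear:
  "bil N M (v + v') w = bil N M v w + bil N M v' w" "bil N M (cscale c v) w = c * bil N M v w"
  "bil N M w (v + v') = bil N M w v + bil N M w v'" "bil N M w (cscale c v) = c * bil N M w v"
proof -
  show "bil N M (v + v') w = bil N M v w + bil N M v' w"
    by (simp add: bil_def distrib_right sum.distrib)
  show "bil N M (cscale c v) w = c * bil N M v w"
    by (simp add: bil_def sum_distrib_left mult.assoc)
  show "bil N M w (v + v') = bil N M w v + bil N M w v'"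
    by (simp add: bil_def distrib_left sum.distrib)
  show "bil N M w (cscale c v) = c * bil N M w v"
    by (simp add: bil_def sum_distrib_left ac_simps)
qed

lemma bil_zero [simp]: "bil N M 0 w = 0" "bil N M w 0 = 0" by (simp_all add: bil_def)

lemma bil_sum:
  "bil N M (sum f A) w = (\<Sum>k\<in>A. bil N M (f k) w)" "bil N M w (sum f A) = (\<Sum>k\<in>A. bil N M w (f k))"
  by (induction A rule: infinite_finite_induct) (auto simp: bil_linear)

lemma bil_diff: "bil N M (v - v') w = bil N M v w - bil N M v' w" "bil N M w (v - v') = bil N M w v - bil N M w v'"
  using bil_linear(1)[of N M "v - v'" v' w] bil_linear(3)[of N M w "v - v'" v'] by simp_all

lemma mapp_linear: "mapp N M (v + w) = mapp N M v + mapp N M w" "mapp N M (cscale c v) = cscale c (mapp N M v)"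
  by (auto simp: mapp_def fun_eq_iff sum.distrib sum_distrib_left distrib_left distrib_right ac_simps)

lemma mapp_CS: "mapp N M v \<in> CS N" by (simp add: mapp_def CS_def)

lemma bil_skew:
  assumes "\<And>i j. i < N \<Longrightarrow> j < N \<Longrightarrow> M $$ (j, i) = - M $$ (i, j)"
  shows "bil N M w v = - bil N M v w"
proof -
  have "bil N M w v = (\<Sum>j<N. \<Sum>i<N. w i * M $$ (i, j) * v j)" unfolding bil_def by (rule sum.swap)
  also have "\<dots> = (\<Sum>j<N. \<Sum>i<N. - (v j * M $$ (j, i) * w i))"
  proof (intro sum.cong refl)
    fix j i assume "j \<in> {..<N}" "i \<in> {..<N}"
    then show "w i * M $$ (i, j) * v j = - (v j * M $$ (j, i) * w i)" using assms[of i j] by simp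
  qed
  finally show ?thesis by (simp add: bil_def sum_negf)
qed

lemma bil_mapp:
  assumes "B \<in> carrier_mat N N" "C \<in> carrier_mat N N"
  shows "bil N B v (mapp N C w) = bil N (B * C) v w"
proof -
  have "bil N B v (mapp N C w) = (\<Sum>i<N. \<Sum>j<N. \<Sum>k<N. v i * B $$ (i, j) * C $$ (j, k) * w k)"
    by (simp add: bil_def mapp_def sum_distrib_left mult.assoc)
  also have "\<dots> = (\<Sum>i<N. \<Sum>k<N. \<Sum>j<N. v i * B $$ (i, j) * C $$ (j, k) * w k)"
    by (intro sum.cong refl sum.swap)
  also have "\<dots> = bil N (B * C) v w"
    unfolding bil_def using assms
    by (intro sum.cong refl) (simp add: scalar_prod_def sum_distrib_left sum_distrib_right mult.assoc atLeast0LessThan)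
  finally show ?thesis .
qed

definition gram :: "('v \<Rightarrow> 'w \<Rightarrow> complex) \<Rightarrow> 'v list \<Rightarrow> 'w list \<Rightarrow> complex mat" where
  "gram f vs ws = mat (length vs) (length ws) (\<lambda>(i, j). f (vs ! i) (ws ! j))"

lemma gram_carrier [simp]: "gram f vs ws \<in> carrier_mat (length vs) (length ws)"
  "dim_row (gram f vs ws) = length vs" "dim_col (gram f vs ws) = length ws"
  by (simp_all add: gram_def)

text \<open>Congruence by the matrix of basis vectors is evaluation of the form on that basis; this
  turns a basis into a witness for \<open>has_jk_decomposition\<close>.\<close>

lemma gram_bil:
  assumes A: "A \<in> carrier_mat N N"
  shows "transpose_mat (cmat N vs) * A * cmat N vs = gram (bil N A) vs vs"
proof (rule eq_matI)
  fix i j assume "i < dim_row (gram (bil N A) vs vs)" "j < dim_col (gram (bil N A) vs vs)"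
  then have ij: "i < length vs" "j < length vs" by auto
  have "(transpose_mat (cmat N vs) * A * cmat N vs) $$ (i, j) =
    (\<Sum>k<N. (\<Sum>l<N. (vs ! i) l * A $$ (l, k)) * (vs ! j) k)"
    using ij A by (simp add: cmat_def scalar_prod_def atLeast0LessThan)
  also have "\<dots> = (\<Sum>k<N. \<Sum>l<N. (vs ! i) l * A $$ (l, k) * (vs ! j) k)" by (simp add: sum_distrib_right)
  also have "\<dots> = bil N A (vs ! i) (vs ! j)" unfolding bil_def by (rule sum.swap)
  finally show "(transpose_mat (cmat N vs) * A * cmat N vs) $$ (i, j) = gram (bil N A) vs vs $$ (i, j)"
    using ij by (simp add: gram_def)
qed (use A in \<open>auto simp: cmat_def\<close>)

lemma gram_append:
  "gram f (us @ vs) (us' @ vs') = four_block_mat (gram f us us') (gram f us vs') (gram f vs us') (gram f vs vs')"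
  by (rule eq_matI) (auto simp: gram_def nth_append)

lemma gram_zero: "(\<And>u v. u \<in> set us \<Longrightarrow> v \<in> set vs \<Longrightarrow> f u v = 0) \<Longrightarrow> gram f us vs = 0\<^sub>m (length us) (length vs)"
  by (rule eq_matI) (auto simp: gram_def)

text \<open>Vanishing in both orders is asked for because nothing is assumed about the symmetry of
  \<open>f\<close>.\<close>

lemma gram_concat:
  assumes "sorted_wrt (\<lambda>us vs. \<forall>u\<in>set us. \<forall>v\<in>set vs. f u v = 0 \<and> f v u = 0) vss"
  shows "gram f (concat vss) (concat vss) = block_diag (map (\<lambda>vs. gram f vs vs) vss)"
  using assms
proof (induction vss)
  case Nil
  then show ?case by (simp add: gram_def) (rule eq_matI, auto)
next
  case (Cons vs vss)
  have "gram f vs (concat vss) = 0\<^sub>m (length vs) (length (concat vss))"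
    by (rule gram_zero) (use Cons.prems in auto)
  moreover have "gram f (concat vss) vs = 0\<^sub>m (length (concat vss)) (length vs)"
    by (rule gram_zero) (use Cons.prems in auto)
  moreover have IH: "gram f (concat vss) (concat vss) = block_diag (map (\<lambda>vs. gram f vs vs) vss)"
    using Cons by simp
  ultimately show ?case by (simp add: gram_append Let_def IH[symmetric])
qed

lemma gram_kernel:
  assumes A: "A \<in> carrier_mat N N" and z: "(\<Sum>j<length vs. cscale (z j) (vs ! j)) = 0"
  shows "gram (bil N A) vs vs *\<^sub>v Matrix.vec (length vs) z = 0\<^sub>v (length vs)"
proof (rule eq_vecI)
  fix i assume "i < dim_vec (0\<^sub>v (length vs) :: complex Matrix.vec)"
  then have i: "i < length vs" by simp
  have "(gram (bil N A) vs vs *\<^sub>v Matrix.vec (length vs) z) $ i = (\<Sum>j<length vs. bil N A (vs ! i) (vs ! j) * z j)"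
    using i by (simp add: gram_def scalar_prod_def atLeast0LessThan)
  also have "\<dots> = bil N A (vs ! i) (\<Sum>j<length vs. cscale (z j) (vs ! j))"
    by (simp add: bil_sum bil_linear mult.commute)
  also have "\<dots> = 0" unfolding z by simp
  finally show "(gram (bil N A) vs vs *\<^sub>v Matrix.vec (length vs) z) $ i = 0\<^sub>v (length vs) $ i" using i by simp
qed simp

text \<open>The coefficients of a linear relation form a kernel vector of the Gram matrix.\<close>

lemma gram_det_indep:
  assumes A: "A \<in> carrier_mat N N" and d: "det (gram (bil N A) vs vs) \<noteq> 0"
  shows "list_indep vs"
  unfolding list_indep_def
proof (intro allI impI)
  fix z j assume z: "(\<Sum>j<length vs. cscale (z j) (vs ! j)) = 0" and j: "j < length vs"
  have "Matrix.vec (length vs) z = 0\<^sub>v (length vs)"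
    using gram_kernel[OF A z] d det_0_iff_vec_prod_zero_field[OF gram_carrier(1), of "bil N A" vs] vec_carrier by blast
  then show "z j = 0" using j by (metis index_vec index_zero_vec(1))
qed

lemma det_skew_pair_block_1: "det (skew_pair_block (1\<^sub>m m)) \<noteq> 0"
proof -
  let ?M = "skew_pair_block (1\<^sub>m m :: complex mat)"
  have M: "?M \<in> carrier_mat (m + m) (m + m)" by (auto simp: skew_pair_block_def)
  have "?M * ?M = - 1\<^sub>m (m + m)"
    unfolding skew_pair_block_def
    by (subst mult_four_block_mat[of _ m m _ m _ m _ _ m _ m]) (auto intro!: eq_matI)
  then have "det ?M * det ?M = det (- 1\<^sub>m (m + m) :: complex mat)" using det_mult[OF M M] by simp
  also have "\<dots> \<noteq> 0" using det_0_negate[of "1\<^sub>m (m + m) :: complex mat" "m + m"] by simp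
  finally show ?thesis by auto
qed

lemma block_diag_carrier:
  assumes "\<And>M. M \<in> set Ms \<Longrightarrow> dim_row M = dim_col M"
  shows "block_diag Ms \<in> carrier_mat (sum_list (map dim_row Ms)) (sum_list (map dim_row Ms))"
  using assms by (induction Ms) (auto simp: Let_def)

lemma det_block_diag:
  assumes "\<And>M. M \<in> set Ms \<Longrightarrow> dim_row M = dim_col M"
  shows "det (block_diag Ms) = prod_list (map det Ms)"
  using assms
proof (induction Ms)
  case (Cons M Ms)
  let ?k = "sum_list (map dim_row Ms)"
  have R: "block_diag Ms \<in> carrier_mat ?k ?k" using block_diag_carrier Cons by auto
  have "det (block_diag (M # Ms)) = det M * det (block_diag Ms)"
    using R Cons.prems[of M]
    by (simp add: Let_def) (rule det_four_block_mat_upper_right_zero[of _ "dim_row M" _ ?k], auto)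
  then show ?case using Cons by simp
qed (simp add: det_dim_zero)

declare cscale_apply [simp del]

context skew_selfadjoint
begin

abbreviation jblock :: "complex \<times> nat \<times> 'v \<times> 'v \<Rightarrow> jk_block" where
  "jblock B \<equiv> Jord (Some (fst B)) (fst (snd B))"

lemma length_uvecs [simp]: "length (uvecs B) = fst (snd B)" "length (wvecs B) = fst (snd B)"
  by (auto simp: uvecs_def wvecs_def split: prod.splits)

text \<open>\<open>T\<close> moves each chain one step down, so evaluating \<open>b v (S w)\<close>
  on dual chains gives the eigenvalue on the diagonal and ones just above it, which is the canonical
  cell.\<close>

lemma gram_block:
  assumes "good_block B"
  shows "gram b (bvecs B) (bvecs B) = snd (jk_pair (jblock B))"
    and "gram (\<lambda>v w. b v (S w)) (bvecs B) (bvecs B) = fst (jk_pair (jblock B))"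
proof -
  obtain l m x y where B: "B = (l, m, x, y)" by (cases B) auto
  have h: "m \<ge> 1" "(T l ^^ m) x = 0" "(T l ^^ m) y = 0"
    "\<And>i. b x ((T l ^^ i) y) = (if i = m - 1 then 1 else 0)"
    using assms by (auto simp: good_block_def B)
  have S_pow: "S ((T l ^^ i) v) = (T l ^^ Suc i) v + l *s (T l ^^ i) v" for i v
    by (simp add: S_T[of _ l])
  have xy: "b ((T l ^^ i) x) ((T l ^^ (m - 1 - j)) y) = (if i = j then 1 else 0)" if "i < m" "j < m" for i j
    unfolding b_T_pow2 h using that by auto
  have xSy: "b ((T l ^^ i) x) (S ((T l ^^ (m - 1 - j)) y)) = (if i = j then l else if j = i + 1 then 1 else 0)" if "i < m" "j < m" for i j
  proof -
    have "b ((T l ^^ i) x) (S ((T l ^^ (m - 1 - j)) y)) = (if i + Suc (m - 1 - j) = m - 1 then 1 else 0) + l * (if i = j then 1 else 0)"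
      unfolding S_pow b_add_right b_scale_right xy[OF that] by (simp only: b_T_pow2 h)
    also have "i + Suc (m - 1 - j) = m - 1 \<longleftrightarrow> j = i + 1" using that by auto
    finally show ?thesis by auto
  qed
  have yx: "b v w = - b w v" for v w by (rule b_skew)
  have ySx: "b v (S w) = - b w (S v)" for v w
    using b_S[of v w] b_skew[of "S v" w] by simp
  have same: "b ((T l ^^ i) v) ((T l ^^ j) v) = 0" "b ((T l ^^ i) v) (S ((T l ^^ j) v)) = 0" for i j v
    unfolding S_pow b_add_right b_scale_right b_T_pow2 b_T_same by simp_all
  have uw: "gram b (uvecs B) (wvecs B) = 1\<^sub>m m" "gram (\<lambda>v w. b v (S w)) (uvecs B) (wvecs B) = jordan_cell l m"
    using xy xSy by (auto intro!: eq_matI simp: gram_def B uvecs_def wvecs_def jordan_cell_def)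
  have wu: "gram b (wvecs B) (uvecs B) = - transpose_mat (gram b (uvecs B) (wvecs B))"
    "gram (\<lambda>v w. b v (S w)) (wvecs B) (uvecs B) = - transpose_mat (gram (\<lambda>v w. b v (S w)) (uvecs B) (wvecs B))"
    by (rule eq_matI; simp add: gram_def; rule yx ySx)+
  have uu: "gram b (uvecs B) (uvecs B) = 0\<^sub>m m m" "gram (\<lambda>v w. b v (S w)) (uvecs B) (uvecs B) = 0\<^sub>m m m"
    "gram b (wvecs B) (wvecs B) = 0\<^sub>m m m" "gram (\<lambda>v w. b v (S w)) (wvecs B) (wvecs B) = 0\<^sub>m m m"
    using same by (auto intro!: eq_matI simp: gram_def B uvecs_def wvecs_def)
  show "gram b (bvecs B) (bvecs B) = snd (jk_pair (jblock B))"
    unfolding bvecs_def gram_append wu uu uw by (simp add: skew_pair_block_def B)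
  show "gram (\<lambda>v w. b v (S w)) (bvecs B) (bvecs B) = fst (jk_pair (jblock B))"
    unfolding bvecs_def gram_append wu uu uw by (simp add: skew_pair_block_def B jordan_cell_def)
qed

text \<open>Blocks orthogonal for \<open>b\<close> are therefore orthogonal for the form
  \<open>b v (S w)\<close> as well.\<close>

lemma S_bvecs_span:
  assumes "good_block B" "z \<in> set (bvecs B)" shows "S z \<in> span (set (bvecs B))"
proof -
  obtain l m x y where B: "B = (l, m, x, y)" by (cases B) auto
  have h: "(T l ^^ m) x = 0" "(T l ^^ m) y = 0" using assms by (auto simp: good_block_def B)
  have key: "S ((T l ^^ i) v) \<in> span (set (bvecs B))" if v: "v = x \<or> v = y" and i: "i < m" for i v
  proof -
    have "(T l ^^ Suc i) v \<in> span (set (bvecs B))"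
    proof (cases "Suc i < m")
      case True
      then show ?thesis using v unfolding B set_bvecs by (intro span_base) blast
    next
      case False
      then have "(T l ^^ Suc i) v = 0" using h v T_pow_ge[of m l v "Suc i"] by auto
      then show ?thesis by (simp only: span_zero)
    qed
    moreover have "(T l ^^ i) v \<in> span (set (bvecs B))"
      using v i unfolding B set_bvecs by (intro span_base) blast
    moreover have "S ((T l ^^ i) v) = (T l ^^ Suc i) v + l *s (T l ^^ i) v" by (simp add: S_T[of _ l])
    ultimately show ?thesis by (simp only: span_add span_scale)
  qed
  show ?thesis using assms(2) key unfolding B set_bvecs by auto
qed

end

text \<open>Matrix version of the abstract setting, with \<open>Bi\<close> the inverse of
  \<open>B\<close> and \<open>Bi * A\<close> as operator.\<close>

locale pencil =
  fixes N :: nat and A B Bi :: "complex mat"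
  assumes A: "A \<in> carrier_mat N N" and B: "B \<in> carrier_mat N N" and Bi: "Bi \<in> carrier_mat N N"
    and A_skew: "\<And>i j. i < N \<Longrightarrow> j < N \<Longrightarrow> A $$ (j, i) = - A $$ (i, j)"
    and B_skew: "\<And>i j. i < N \<Longrightarrow> j < N \<Longrightarrow> B $$ (j, i) = - B $$ (i, j)"
    and BBi: "B * Bi = 1\<^sub>m N" and BiB: "Bi * B = 1\<^sub>m N"
begin

lemma bil_B_S: "bil N B v (mapp N (Bi * A) w) = bil N A v w"
proof -
  have "B * (Bi * A) = A" using A B Bi BBi by (simp flip: assoc_mult_mat)
  then show ?thesis using bil_mapp[of B N "Bi * A"] A B Bi by simp
qed

sublocale skew_selfadjoint cscale "mapp N (Bi * A)" "bil N B"
proof unfold_locales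
  fix x y :: "nat \<Rightarrow> complex"
  show "bil N B (mapp N (Bi * A) x) y = bil N B x (mapp N (Bi * A) y)"
    using bil_skew[OF B_skew, where v = y and w = "mapp N (Bi * A) x"] bil_skew[OF A_skew, where v = y and w = x]
    by (simp add: bil_B_S) 
  show "bil N B y x = - bil N B x y" by (rule bil_skew[OF B_skew])
qed (simp_all add: mapp_linear bil_linear)

text \<open>Testing against \<open>Bi\<close> applied to a unit vector reads off one coordinate of
  \<open>x\<close>.\<close>

lemma bil_B_nondeg: assumes "x \<in> CS N" "\<And>y. y \<in> CS N \<Longrightarrow> bil N B x y = 0" shows "x = 0"
proof
  fix i
  show "x i = 0 i"
  proof (cases "i < N")
    case True
    have "0 = bil N B x (mapp N Bi (unit_fun i))" using assms(2) mapp_CS by simp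
    also have "\<dots> = bil N (1\<^sub>m N) x (unit_fun i)" using bil_mapp[OF B Bi] BBi by simp
    also have "\<dots> = (\<Sum>k<N. \<Sum>j<N. if j = i then if k = i then x i else 0 else 0)"
      unfolding bil_def by (intro sum.cong refl) (auto simp: unit_fun_def)
    also have "\<dots> = x i" using True by (simp add: sum.delta)
    finally show ?thesis by simp
  next
    case False
    then show ?thesis using assms(1) by (simp add: CS_def)
  qed
qed

theorem pencil_blocks:
  obtains bs where "\<And>D. D \<in> set bs \<Longrightarrow> good_block D" "\<And>D. D \<in> set bs \<Longrightarrow> set (bvecs D) \<subseteq> CS N"
    "sorted_wrt (\<lambda>D D'. \<forall>z\<in>set (bvecs D). \<forall>z'\<in>set (bvecs D'). bil N B z z' = 0) bs"
    "CS N = cv.span (\<Union>D\<in>set bs. set (bvecs D))"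
proof -
  have bd: "indep_bound (CS N) N" unfolding indep_bound_def using CS_indep_bound by blast
  have "\<exists>bs. (\<forall>B\<in>set bs. good_block B \<and> set (bvecs B) \<subseteq> CS N) \<and>
    sorted_wrt (\<lambda>D D'. \<forall>z\<in>set (bvecs D). \<forall>z'\<in>set (bvecs D'). bil N B z z' = 0) bs \<and>
    CS N = cv.span (\<Union>B\<in>set bs. set (bvecs B))"
    by (rule symplectic_jordan[OF CS_subspace mapp_CS bd bil_B_nondeg])
  then show ?thesis using that by blast
qed

end

section \<open>Jordan normal form of the operator of a pencil\<close>

lemma sum_lessThan_add: "(\<Sum>i<m + k. f i) = (\<Sum>i<m. f i) + (\<Sum>i<k. f (m + i))" for f :: "nat \<Rightarrow> 'a::comm_monoid_add"
  by (induction k) (simp_all add: add.assoc)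

lemma mult_index:
  assumes "A \<in> carrier_mat n m" "B \<in> carrier_mat m k" "i < n" "j < k"
  shows "(A * B) $$ (i, j) = (\<Sum>l<m. A $$ (i, l) * B $$ (l, j))"
  using assms by (simp add: scalar_prod_def atLeast0LessThan)

context pencil
begin

abbreviation S where "S \<equiv> mapp N (Bi * A)"

lemma S_alt: "bil N B v (S w) = bil N A v w" by (rule bil_B_S)

text \<open>\<open>J\<close> is the matrix of the operator on the list, with images in the columns.
  It connects the blocks to the library notion \<open>jordan_nf\<close>, from which sizes can be
  counted.\<close>

definition act :: "(nat \<Rightarrow> complex) list \<Rightarrow> complex mat \<Rightarrow> bool" where
  "act vs J \<longleftrightarrow> J \<in> carrier_mat (length vs) (length vs) \<and>
     (\<forall>j<length vs. S (vs ! j) = (\<Sum>i<length vs. cscale (J $$ (i, j)) (vs ! i)))"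

lemma act_append:
  assumes "act vs J" "act ws G"
  shows "act (vs @ ws) (four_block_mat J (0\<^sub>m (dim_row J) (dim_col G)) (0\<^sub>m (dim_row G) (dim_col J)) G)"
proof -
  let ?F = "four_block_mat J (0\<^sub>m (dim_row J) (dim_col G)) (0\<^sub>m (dim_row G) (dim_col J)) G"
  have c: "J \<in> carrier_mat (length vs) (length vs)" "G \<in> carrier_mat (length ws) (length ws)"
    using assms by (auto simp: act_def)
  have "S ((vs @ ws) ! j) = (\<Sum>i<length vs + length ws. cscale (?F $$ (i, j)) ((vs @ ws) ! i))"
    if j: "j < length vs + length ws" for j
  proof (cases "j < length vs")
    case True
    have "(\<Sum>i<length vs. cscale (?F $$ (i, j)) ((vs @ ws) ! i)) = (\<Sum>i<length vs. cscale (J $$ (i, j)) (vs ! i))"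
      by (rule sum.cong) (use c True in \<open>auto simp: nth_append\<close>)
    moreover have "(\<Sum>i<length ws. cscale (?F $$ (length vs + i, j)) ((vs @ ws) ! (length vs + i))) = 0"
      by (rule sum.neutral) (use c True in \<open>auto simp: nth_append fun_eq_iff cscale_apply\<close>)
    ultimately show ?thesis using assms(1) True unfolding sum_lessThan_add by (simp add: act_def nth_append)
  next
    case False
    have "(\<Sum>i<length vs. cscale (?F $$ (i, j)) ((vs @ ws) ! i)) = 0"
      by (rule sum.neutral) (use c False j in \<open>auto simp: nth_append fun_eq_iff cscale_apply\<close>)
    moreover have "(\<Sum>i<length ws. cscale (?F $$ (length vs + i, j)) ((vs @ ws) ! (length vs + i))) =
      (\<Sum>i<length ws. cscale (G $$ (i, j - length vs)) (ws ! i))"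
      by (rule sum.cong) (use c False j in \<open>auto simp: nth_append\<close>)
    ultimately show ?thesis using assms(2) False j unfolding sum_lessThan_add by (simp add: act_def nth_append)
  qed
  then show ?thesis unfolding act_def using c by simp
qed

text \<open>The library's Jordan blocks carry ones above the diagonal, so the chain has to start
  with the eigenvector.\<close>

lemma act_jordan_block:
  assumes "length vs = m" "\<And>j. j < m \<Longrightarrow> S (vs ! j) = cscale l (vs ! j) + (if j = 0 then 0 else vs ! (j - 1))"
  shows "act vs (jordan_block m l)"
proof -
  have "S (vs ! j) = (\<Sum>i<m. cscale (jordan_block m l $$ (i, j)) (vs ! i))" if j: "j < m" for j
  proof -
    have "(\<Sum>i<m. cscale (jordan_block m l $$ (i, j)) (vs ! i)) =
      (\<Sum>i<m. (if i = j then cscale l (vs ! i) else 0) + (if Suc i = j then vs ! i else 0))"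
      by (rule sum.cong) (use j in \<open>auto simp: fun_eq_iff cscale_apply\<close>)
    also have "\<dots> = cscale l (vs ! j) + (\<Sum>i<m. if Suc i = j then vs ! i else 0)"
      using j by (simp add: sum.distrib sum.delta)
    also have "(\<Sum>i<m. if Suc i = j then vs ! i else 0) = (\<Sum>i<m. if j \<noteq> 0 \<and> i = j - 1 then vs ! i else 0)"
      by (rule sum.cong) auto
    also have "\<dots> = (if j = 0 then 0 else vs ! (j - 1))" using j by (auto simp: sum.delta)
    finally show ?thesis using assms(2)[OF j] by (simp only:)
  qed
  then show ?thesis using assms(1) by (simp add: act_def jordan_block_def)
qed

text \<open>\<open>wvecs\<close> already starts at its eigenvector, whereas \<open>uvecs\<close> has
  to be reversed.\<close>

definition jvecs :: "complex \<times> nat \<times> (nat \<Rightarrow> complex) \<times> (nat \<Rightarrow> complex) \<Rightarrow> (nat \<Rightarrow> complex) list" where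
  "jvecs D = rev (uvecs D) @ wvecs D"

text \<open>As an operator, a skew block of half-size \<open>m\<close> consists of two Jordan blocks
  of size \<open>m\<close>.\<close>

definition jsizes :: "complex \<times> nat \<times> (nat \<Rightarrow> complex) \<times> (nat \<Rightarrow> complex) \<Rightarrow> (nat \<times> complex) list" where
  "jsizes D = [(fst (snd D), fst D), (fst (snd D), fst D)]"

lemma act_chain:
  assumes "(T l ^^ m) y = 0"
  shows "act (map (\<lambda>i. (T l ^^ (m - 1 - i)) y) [0..<m]) (jordan_block m l)"
proof (rule act_jordan_block)
  fix j assume j: "j < m"
  have "S ((T l ^^ (m - 1 - j)) y) = (T l ^^ Suc (m - 1 - j)) y + cscale l ((T l ^^ (m - 1 - j)) y)"
    by (simp add: S_T[of _ l])
  moreover have "(T l ^^ Suc (m - 1 - j)) y = (if j = 0 then 0 else (T l ^^ (m - 1 - (j - 1))) y)"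
  proof (cases "j = 0")
    case True
    then have "Suc (m - 1 - j) = m" using j by auto
    then show ?thesis using assms True by (simp only: if_True refl)
  next
    case False
    then have "Suc (m - 1 - j) = m - 1 - (j - 1)" using j by auto
    then show ?thesis using False by (simp only: if_False)
  qed
  ultimately show "S (map (\<lambda>i. (T l ^^ (m - 1 - i)) y) [0..<m] ! j) = cscale l (map (\<lambda>i. (T l ^^ (m - 1 - i)) y) [0..<m] ! j) +
    (if j = 0 then 0 else map (\<lambda>i. (T l ^^ (m - 1 - i)) y) [0..<m] ! (j - 1))"
    using j less_imp_diff_less[OF j, of 1] by (cases "j = 0") (simp_all add: add.commute)
qed simp

lemma act_jvecs:
  assumes "\<And>D. D \<in> set bs \<Longrightarrow> good_block D"
  shows "act (concat (map jvecs bs)) (jordan_matrix (concat (map jsizes bs)))"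
  using assms
proof (induction bs)
  case Nil
  then show ?case by (simp add: act_def jordan_matrix_def)
next
  case (Cons D bs)
  obtain l m x y where D: "D = (l, m, x, y)" by (cases D) auto
  have "good_block (l, m, x, y)" using Cons.prems[of D] by (simp add: D)
  then have h: "(T l ^^ m) x = 0" "(T l ^^ m) y = 0" unfolding good_block_def by auto
  have r: "rev (uvecs D) = map (\<lambda>i. (T l ^^ (m - 1 - i)) x) [0..<m]"
    by (rule nth_equalityI) (auto simp: uvecs_def D rev_nth)
  have w: "wvecs D = map (\<lambda>i. (T l ^^ (m - 1 - i)) y) [0..<m]" by (simp add: wvecs_def D)
  have IH: "act (concat (map jvecs bs)) (jordan_matrix (concat (map jsizes bs)))" using Cons by auto
  have "act (rev (uvecs D) @ (wvecs D @ concat (map jvecs bs))) (jordan_matrix ((m, l) # (m, l) # concat (map jsizes bs)))"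
    unfolding jordan_matrix_def list.map diag_block_mat.simps Let_def prod.case
    using act_append[OF act_chain[OF h(1)] act_append[OF act_chain[OF h(2)] IH]]
    unfolding r w jordan_matrix_def .
  moreover have "concat (map jvecs (D # bs)) = rev (uvecs D) @ (wvecs D @ concat (map jvecs bs))"
    by (simp add: jvecs_def[of D])
  moreover have "concat (map jsizes (D # bs)) = (m, l) # (m, l) # concat (map jsizes bs)"
    by (simp add: jsizes_def[of "(l, m, x, y)"] D)
  ultimately show ?case by (simp only:)
qed

lemma act_similar:
  assumes "act vs J" "list_indep vs" "set vs \<subseteq> CS N" "length vs = N"
  shows "similar_mat (Bi * A) J"
proof -
  let ?P = "cmat N vs"
  have P: "?P \<in> carrier_mat N N" and J: "J \<in> carrier_mat N N" and BA: "Bi * A \<in> carrier_mat N N"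
    using assms A Bi cmat_carrier[of N vs] by (auto simp: act_def)
  have "det ?P \<noteq> 0" using cmat_det_nz assms by blast
  from det_non_zero_imp_unit[OF P this] obtain Q where Q: "Q \<in> carrier_mat N N" "?P * Q = 1\<^sub>m N" "Q * ?P = 1\<^sub>m N"
    by (auto simp: Units_def ring_mat_simps)
  have comm: "(Bi * A) * ?P = ?P * J"
  proof (rule eq_matI)
    fix i j assume "i < dim_row (?P * J)" "j < dim_col (?P * J)"
    then have ij: "i < N" "j < N" using J P by auto
    have "((Bi * A) * ?P) $$ (i, j) = (\<Sum>k<N. (Bi * A) $$ (i, k) * ?P $$ (k, j))"
      by (rule mult_index[OF BA P ij])
    also have "\<dots> = S (vs ! j) i" using ij assms(4) by (simp add: mapp_def cmat_def)
    also have "\<dots> = (\<Sum>k<N. cscale (J $$ (k, j)) (vs ! k)) i" using assms(1,4) ij by (simp add: act_def)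
    also have "\<dots> = (\<Sum>k<N. ?P $$ (i, k) * J $$ (k, j))"
      unfolding sum_fun_apply using ij assms(4) by (intro sum.cong) (auto simp: cmat_def mult.commute cscale_apply)
    also have "\<dots> = (?P * J) $$ (i, j)" using ij P J by (simp add: scalar_prod_def atLeast0LessThan)
    finally show "((Bi * A) * ?P) $$ (i, j) = (?P * J) $$ (i, j)" .
  qed (use BA P J in auto)
  have "Bi * A = (Bi * A) * (?P * Q)" using Q(2) right_mult_one_mat[OF BA] by simp
  also have "\<dots> = ((Bi * A) * ?P) * Q" using BA P Q by (simp add: assoc_mult_mat[of _ N N _ N _ N])
  also have "\<dots> = ?P * J * Q" unfolding comm ..
  finally show ?thesis using BA P J Q by (intro similar_matI[of _ _ ?P Q N]) auto
qed

lemma blocks_gram: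
  assumes "\<And>D. D \<in> set bs \<Longrightarrow> good_block D"
    "sorted_wrt (\<lambda>D D'. \<forall>z\<in>set (bvecs D). \<forall>z'\<in>set (bvecs D'). bil N B z z' = 0) bs"
  shows "det (gram (bil N B) (concat (map bvecs bs)) (concat (map bvecs bs))) \<noteq> 0"
proof -
  have "gram (bil N B) (concat (map bvecs bs)) (concat (map bvecs bs)) = block_diag (map (\<lambda>vs. gram (bil N B) vs vs) (map bvecs bs))"
  proof (rule gram_concat)
    show "sorted_wrt (\<lambda>us vs. \<forall>u\<in>set us. \<forall>v\<in>set vs. bil N B u v = 0 \<and> bil N B v u = 0) (map bvecs bs)"
      unfolding sorted_wrt_map
      by (rule sorted_wrt_mono_rel[OF _ assms(2)]) (metis b_skew neg_equal_0_iff_equal)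
  qed
  also have "map (\<lambda>vs. gram (bil N B) vs vs) (map bvecs bs) = map (\<lambda>D. snd (jk_pair (jblock D))) bs"
    using gram_block(1) assms(1) by simp
  also have "det (block_diag (map (\<lambda>D. snd (jk_pair (jblock D))) bs)) = prod_list (map det (map (\<lambda>D. snd (jk_pair (jblock D))) bs))"
    by (rule det_block_diag) (auto simp: skew_pair_block_def)
  also have "\<dots> \<noteq> 0" by (auto simp: prod_list_zero_iff det_skew_pair_block_1)
  finally show ?thesis .
qed

text \<open>Ties the skew block sizes to invariants of the matrix \<open>Bi * A\<close>: its
  characteristic polynomial and the dimensions of its generalized eigenspaces.\<close>

theorem blocks_jordan_nf:
  assumes bs: "\<And>D. D \<in> set bs \<Longrightarrow> good_block D" "\<And>D. D \<in> set bs \<Longrightarrow> set (bvecs D) \<subseteq> CS N"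
    "sorted_wrt (\<lambda>D D'. \<forall>z\<in>set (bvecs D). \<forall>z'\<in>set (bvecs D'). bil N B z z' = 0) bs"
    "CS N = cv.span (\<Union>D\<in>set bs. set (bvecs D))"
  shows "jordan_nf (Bi * A) (concat (map jsizes bs))"
proof -
  have ind: "list_indep (concat (map bvecs bs))" using gram_det_indep[OF B blocks_gram[OF bs(1,3)]] .
  have CSc: "set (concat (map bvecs bs)) \<subseteq> CS N" using UN_least[OF bs(2)] by simp
  have len: "length (concat (map bvecs bs)) = N"
    by (rule list_indep_span_length[OF ind CSc]) (use bs(4) in simp)
  have ms: "mset (concat (map jvecs bs)) = mset (concat (map bvecs bs))"
    by (induction bs) (auto simp: jvecs_def bvecs_def)
  have st: "set (concat (map jvecs bs)) = set (concat (map bvecs bs))" using mset_eq_setD[OF ms] .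
  have "list_indep (concat (map jvecs bs))"
    using ind unfolding list_indep_iff st using mset_eq_imp_distinct_iff[OF ms] by blast
  then have "similar_mat (Bi * A) (jordan_matrix (concat (map jsizes bs)))"
    using act_similar[OF act_jvecs[OF bs(1)]] CSc st len mset_eq_length[OF ms] by auto
  moreover have "0 \<notin> fst ` set (concat (map jsizes bs))"
    using bs(1) by (fastforce simp: jsizes_def good_block_def)
  ultimately show ?thesis by (simp add: jordan_nf_def)
qed

end

section \<open>Pfaffians\<close>

lemma prod_even_odd: "(\<Prod>j<2 * m. f j) = (\<Prod>i<m. f (2 * i) * f (2 * i + 1))" for f :: "nat \<Rightarrow> 'a::comm_monoid_mult"
  by (induction m) (simp_all add: mult.assoc)

text \<open>The Pfaffian without its normalizing denominator.\<close>

definition pf_sum :: "nat \<Rightarrow> complex mat \<Rightarrow> complex" where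
  "pf_sum m M = (\<Sum>\<sigma> | \<sigma> permutes {..<2*m}. of_int (sign \<sigma>) * (\<Prod>i<m. M $$ (\<sigma> (2*i), \<sigma> (2*i+1))))"

lemma pfaffian_pf_sum: "M \<in> carrier_mat (2 * m) (2 * m) \<Longrightarrow> pfaffian M = pf_sum m M / (2 ^ m * of_nat (fact m))"
proof -
  assume "M \<in> carrier_mat (2 * m) (2 * m)"
  then have "dim_row M div 2 = m" by simp
  then show ?thesis by (simp only: pfaffian_def pf_sum_def Let_def)
qed

lemma congruence_index:
  fixes X M :: "complex mat"
  assumes X: "X \<in> carrier_mat N N" and M: "M \<in> carrier_mat N N" and ab: "a < N" "b < N"
  shows "(X * M * transpose_mat X) $$ (a, b) = (\<Sum>(c, d)\<in>{..<N} \<times> {..<N}. M $$ (c, d) * (X $$ (a, c) * X $$ (b, d)))"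
proof -
  have "(X * M * transpose_mat X) $$ (a, b) = (\<Sum>d<N. (\<Sum>c<N. X $$ (a, c) * M $$ (c, d)) * X $$ (b, d))"
    using X M ab mult_index[OF mult_carrier_mat[OF X M], of "transpose_mat X" N a b] mult_index[OF X M]
    by (simp del: index_mult_mat)
  also have "\<dots> = (\<Sum>d<N. \<Sum>c<N. M $$ (c, d) * (X $$ (a, c) * X $$ (b, d)))"
    unfolding sum_distrib_right by (intro sum.cong refl) (simp add: ac_simps)
  also have "\<dots> = (\<Sum>c<N. \<Sum>d<N. M $$ (c, d) * (X $$ (a, c) * X $$ (b, d)))" by (rule sum.swap)
  finally show ?thesis by (simp add: sum.cartesian_product)
qed

text \<open>The analogue of the product rule for determinants: expand all entries of the congruent
  matrix, collect a determinant for each choice \<open>g\<close> of index pairs, and keep the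
  choices that form a permutation.\<close>

lemma pf_sum_congruence:
  assumes X: "X \<in> carrier_mat (2 * m) (2 * m)" and M: "M \<in> carrier_mat (2 * m) (2 * m)"
  shows "pf_sum m (X * M * transpose_mat X) = det X * pf_sum m M"
proof -
  let ?N = "2 * m"
  let ?P = "{..<?N} \<times> {..<?N}"
  let ?G = "PiE {..<m} (\<lambda>_. ?P)"
  \<comment> \<open>The pairs of \<open>g\<close> written out as one sequence of \<open>2 m\<close>
    column indices of \<open>X\<close>.\<close>
  define \<tau> where "\<tau> g j = (if even j then fst (g (j div 2)) else snd (g (j div 2)))" for g :: "nat \<Rightarrow> nat \<times> nat" and j
  define Y where "Y g = mat ?N ?N (\<lambda>(j, i). X $$ (i, \<tau> g j))" for g
  have \<tau>_in: "\<tau> g j < ?N" if "g \<in> ?G" "j < ?N" for g j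
  proof -
    have "j div 2 < m" using that by auto
    then have "g (j div 2) \<in> ?P" using that(1) by blast
    then show ?thesis by (auto simp: \<tau>_def mem_Times_iff)
  qed
  have perms: "{..<?N} = {0..<?N}" by auto
  have detY: "det (Y g) = (\<Sum>\<sigma> | \<sigma> permutes {..<?N}. of_int (sign \<sigma>) * (\<Prod>i<m. X $$ (\<sigma> (2*i), fst (g i)) * X $$ (\<sigma> (2*i+1), snd (g i))))" for g
  proof -
    have "det (Y g) = (\<Sum>\<sigma> | \<sigma> permutes {..<?N}. of_int (sign \<sigma>) * (\<Prod>j<?N. Y g $$ (j, \<sigma> j)))"
      by (subst det_def'[of _ ?N]) (auto simp: Y_def perms intro!: sum.cong)
    also have "\<dots> = (\<Sum>\<sigma> | \<sigma> permutes {..<?N}. of_int (sign \<sigma>) * (\<Prod>j<?N. X $$ (\<sigma> j, \<tau> g j)))"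
    proof (intro sum.cong refl arg_cong2[where f = "(*)"] prod.cong)
      fix \<sigma> j assume "\<sigma> \<in> {\<sigma>. \<sigma> permutes {..<?N}}" "j \<in> {..<?N}"
      then show "Y g $$ (j, \<sigma> j) = X $$ (\<sigma> j, \<tau> g j)" using permutes_in_image[of \<sigma> "{..<?N}" j] by (simp add: Y_def)
    qed
    also have "\<dots> = (\<Sum>\<sigma> | \<sigma> permutes {..<?N}. of_int (sign \<sigma>) * (\<Prod>i<m. X $$ (\<sigma> (2*i), fst (g i)) * X $$ (\<sigma> (2*i+1), snd (g i))))"
      unfolding prod_even_odd by (simp add: \<tau>_def)
    finally show ?thesis .
  qed
  have "pf_sum m (X * M * transpose_mat X) = (\<Sum>\<sigma> | \<sigma> permutes {..<?N}. of_int (sign \<sigma>) *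
      (\<Prod>i<m. \<Sum>p\<in>?P. M $$ p * (X $$ (\<sigma> (2*i), fst p) * X $$ (\<sigma> (2*i+1), snd p))))"
    unfolding pf_sum_def
  proof (intro sum.cong refl arg_cong2[where f = "(*)"] prod.cong)
    fix \<sigma> i assume "\<sigma> \<in> {\<sigma>. \<sigma> permutes {..<?N}}" "i \<in> {..<m}"
    then have "\<sigma> (2 * i) < ?N" "\<sigma> (2 * i + 1) < ?N"
      using permutes_in_image[of \<sigma> "{..<?N}"] by auto
    then show "(X * M * transpose_mat X) $$ (\<sigma> (2 * i), \<sigma> (2 * i + 1)) =
      (\<Sum>p\<in>?P. M $$ p * (X $$ (\<sigma> (2*i), fst p) * X $$ (\<sigma> (2*i+1), snd p)))"
      using congruence_index[OF X M, of "\<sigma> (2 * i)" "\<sigma> (2 * i + 1)"] by (simp add: case_prod_beta del: index_mult_mat)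
  qed
  also have "\<dots> = (\<Sum>\<sigma> | \<sigma> permutes {..<?N}. of_int (sign \<sigma>) *
      (\<Sum>g\<in>?G. \<Prod>i<m. M $$ g i * (X $$ (\<sigma> (2*i), fst (g i)) * X $$ (\<sigma> (2*i+1), snd (g i)))))"
    by (subst prod_sum_PiE) auto
  also have "\<dots> = (\<Sum>g\<in>?G. (\<Prod>i<m. M $$ g i) * det (Y g))"
    unfolding detY sum_distrib_left
    by (subst sum.swap) (simp add: prod.distrib ac_simps)
  \<comment> \<open>A repeated index gives \<open>Y g\<close> two equal rows, so only injective
    choices contribute; these are the permutations, and \<open>Y g\<close> is then a row permutation
    of the transpose of \<open>X\<close>.\<close>
  also have "\<dots> = (\<Sum>g\<in>{g\<in>?G. inj_on (\<tau> g) {..<?N}}. (\<Prod>i<m. M $$ g i) * det (Y g))"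
  proof (rule sum.mono_neutral_right)
    show "finite ?G" by (auto intro: finite_PiE)
    show "\<forall>g\<in>?G - {g\<in>?G. inj_on (\<tau> g) {..<?N}}. (\<Prod>i<m. M $$ g i) * det (Y g) = 0"
    proof
      fix g assume "g \<in> ?G - {g\<in>?G. inj_on (\<tau> g) {..<?N}}"
      then obtain i j where ij: "i < ?N" "j < ?N" "i \<noteq> j" "\<tau> g i = \<tau> g j" by (auto simp: inj_on_def)
      have "det (Y g) = 0"
        by (rule det_identical_rows[of _ ?N i j]) (use ij in \<open>auto simp: Y_def intro!: eq_vecI\<close>)
      then show "(\<Prod>i<m. M $$ g i) * det (Y g) = 0" by simp
    qed
  qed auto
  also have "\<dots> = (\<Sum>\<sigma> | \<sigma> permutes {..<?N}. det X * (of_int (sign \<sigma>) * (\<Prod>i<m. M $$ (\<sigma> (2*i), \<sigma> (2*i+1)))))"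
  proof (rule sum.reindex_bij_witness[where j = "\<lambda>g j. if j < ?N then \<tau> g j else j"
        and i = "\<lambda>\<sigma>. restrict (\<lambda>i. (\<sigma> (2*i), \<sigma> (2*i+1))) {..<m}"])
    fix g assume g: "g \<in> {g\<in>?G. inj_on (\<tau> g) {..<?N}}"
    let ?s = "\<lambda>j. if j < ?N then \<tau> g j else j"
    show "restrict (\<lambda>i. (?s (2*i), ?s (2*i+1))) {..<m} = g"
    proof
      fix i show "restrict (\<lambda>i. (?s (2*i), ?s (2*i+1))) {..<m} i = g i"
        using g PiE_arb[of g "{..<m}" "\<lambda>_. ?P" i] by (cases "i < m") (auto simp: \<tau>_def)
    qed
    have "inj_on (\<tau> g) {..<?N}" "\<tau> g ` {..<?N} \<subseteq> {..<?N}" using g \<tau>_in by auto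
    then have "bij_betw (\<tau> g) {..<?N} {..<?N}" by (simp add: bij_betw_def endo_inj_surj)
    then have "bij_betw ?s {..<?N} {..<?N}" using bij_betw_cong[of "{..<?N}" "\<tau> g" ?s "{..<?N}"] by simp
    then have perm: "?s permutes {..<?N}" by (rule bij_imp_permutes) auto
    then show "?s \<in> {\<sigma>. \<sigma> permutes {..<?N}}" by simp
    have "Y g = mat ?N ?N (\<lambda>(i, j). transpose_mat X $$ (?s i, j))"
      unfolding Y_def by (rule eq_matI) (use X g \<tau>_in in auto)
    then have "det (Y g) = of_int (sign ?s) * det X"
      using det_permute_rows[of "transpose_mat X" ?N ?s] perm X det_transpose[OF X] by (simp add: perms)
    moreover have "(\<Prod>i<m. M $$ (?s (2*i), ?s (2*i+1))) = (\<Prod>i<m. M $$ g i)"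
      by (rule prod.cong) (auto simp: \<tau>_def)
    ultimately show "det X * (of_int (sign ?s) * (\<Prod>i<m. M $$ (?s (2*i), ?s (2*i+1)))) = (\<Prod>i<m. M $$ g i) * det (Y g)"
      by simp
  next
    fix \<sigma> assume s: "\<sigma> \<in> {\<sigma>. \<sigma> permutes {..<?N}}"
    let ?g = "restrict (\<lambda>i. (\<sigma> (2*i), \<sigma> (2*i+1))) {..<m}"
    have lt: "\<sigma> j < ?N" if "j < ?N" for j using s permutes_in_image[of \<sigma> "{..<?N}" j] that by auto
    have t: "\<tau> ?g j = \<sigma> j" if "j < ?N" for j
    proof -
      have "j div 2 < m" using that by auto
      then show ?thesis by (cases "even j") (auto simp: \<tau>_def elim!: oddE evenE)
    qed
    show "(\<lambda>j. if j < ?N then \<tau> ?g j else j) = \<sigma>"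
      using t s permutes_not_in[of \<sigma> "{..<?N}"] by (auto simp: fun_eq_iff)
    have "?g \<in> ?G" using lt by auto
    moreover have "inj_on (\<tau> ?g) {..<?N}"
      using inj_on_cong[of "{..<?N}" "\<tau> ?g" \<sigma>] t permutes_inj_on s by auto
    ultimately show "?g \<in> {g\<in>?G. inj_on (\<tau> g) {..<?N}}" by blast
  qed
  finally show ?thesis by (simp add: pf_sum_def sum_distrib_left)
qed

lemma pf_sum_zero_row:
  assumes "r < 2 * m" "\<And>j. j < 2 * m \<Longrightarrow> M $$ (r, j) = 0" "\<And>j. j < 2 * m \<Longrightarrow> M $$ (j, r) = 0"
  shows "pf_sum m M = 0"
  unfolding pf_sum_def
proof (rule sum.neutral, rule ballI)
  fix \<sigma> assume "\<sigma> \<in> {\<sigma>. \<sigma> permutes {..<2 * m}}"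
  then have s: "\<sigma> permutes {..<2 * m}" by simp
  then obtain j where j: "j < 2 * m" "\<sigma> j = r" using assms(1) permutes_image[OF s] by (metis imageE lessThan_iff)
  have lt: "\<sigma> j < 2 * m" if "j < 2 * m" for j using permutes_in_image[OF s, of j] that by auto
  let ?i = "j div 2"
  have i: "?i < m" using j by auto
  have "M $$ (\<sigma> (2 * ?i), \<sigma> (2 * ?i + 1)) = 0"
  proof (cases "even j")
    case True
    then have "2 * ?i = j" by simp
    then show ?thesis using j assms(2) lt[of "2 * ?i + 1"] i by simp
  next
    case False
    then have "2 * ?i + 1 = j" by simp
    then show ?thesis using j assms(3) lt[of "2 * ?i"] i by simp
  qed
  then have "(\<Prod>i<m. M $$ (\<sigma> (2 * i), \<sigma> (2 * i + 1))) = 0" using i by (intro prod_zero) auto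
  then show "of_int (sign \<sigma>) * (\<Prod>i<m. M $$ (\<sigma> (2 * i), \<sigma> (2 * i + 1))) = 0" by simp
qed

text \<open>A kernel vector replaces one row of the identity; after congruence that row and column
  vanish. This covers the singular matrices, which the normal form below excludes.\<close>

lemma skew_vec_0:
  assumes M: "M \<in> carrier_mat N N" and sk: "\<And>i j. i < N \<Longrightarrow> j < N \<Longrightarrow> M $$ (j, i) = - M $$ (i, j)" and d: "det M = 0"
  shows "\<exists>X r. X \<in> carrier_mat N N \<and> det X \<noteq> (0::complex) \<and> r < N \<and>
    (\<forall>j<N. (X * M * transpose_mat X) $$ (r, j) = 0 \<and> (X * M * transpose_mat X) $$ (j, r) = 0)"
proof -
  obtain v where v: "v \<in> carrier_vec N" "v \<noteq> 0\<^sub>v N" "M *\<^sub>v v = 0\<^sub>v N"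
    using d det_0_iff_vec_prod_zero_field[OF M] by blast
  then obtain r where r: "r < N" "v $ r \<noteq> 0" by (metis eq_vecI carrier_vecD index_zero_vec)
  define X where "X = mat N N (\<lambda>(i, j). if i = r then v $ j else if i = j then 1 else 0)"
  have X: "X \<in> carrier_mat N N" by (simp add: X_def)
  have Mv: "(\<Sum>d<N. M $$ (c, d) * v $ d) = 0" if "c < N" for c
  proof -
    have "(M *\<^sub>v v) $ c = (\<Sum>d<N. M $$ (c, d) * v $ d)"
      using that M v(1) by (simp add: scalar_prod_def atLeast0LessThan)
    then show ?thesis using v(3) that by simp
  qed
  have col: "(X * M * transpose_mat X) $$ (j, r) = 0" if j: "j < N" for j
  proof -
    have "(X * M * transpose_mat X) $$ (j, r) = (\<Sum>c<N. \<Sum>d<N. M $$ (c, d) * (X $$ (j, c) * X $$ (r, d)))"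
      using congruence_index[OF X M j r(1)] by (simp add: sum.cartesian_product)
    also have "\<dots> = (\<Sum>c<N. X $$ (j, c) * (\<Sum>d<N. M $$ (c, d) * v $ d))"
      unfolding sum_distrib_left using r by (intro sum.cong refl) (simp add: X_def)
    also have "\<dots> = 0" using Mv by simp
    finally show ?thesis .
  qed
  have row: "(X * M * transpose_mat X) $$ (r, j) = 0" if j: "j < N" for j
  proof -
    have "(X * M * transpose_mat X) $$ (r, j) = (\<Sum>c<N. \<Sum>d<N. M $$ (c, d) * (X $$ (r, c) * X $$ (j, d)))"
      using congruence_index[OF X M r(1) j] by (simp add: sum.cartesian_product)
    also have "\<dots> = (\<Sum>d<N. \<Sum>c<N. M $$ (c, d) * (X $$ (r, c) * X $$ (j, d)))" by (rule sum.swap)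
    also have "\<dots> = (\<Sum>d<N. - X $$ (j, d) * (\<Sum>c<N. M $$ (d, c) * v $ c))"
      unfolding sum_distrib_left
    proof (intro sum.cong refl)
      fix d c assume "d \<in> {..<N}" "c \<in> {..<N}"
      then show "M $$ (c, d) * (X $$ (r, c) * X $$ (j, d)) = - X $$ (j, d) * (M $$ (d, c) * v $ c)"
        using sk[of d c] r by (simp add: X_def)
    qed
    also have "\<dots> = 0" using Mv by simp
    finally show ?thesis .
  qed
  have "det X \<noteq> 0"
  proof
    assume "det X = 0"
    then obtain w where w: "w \<in> carrier_vec N" "w \<noteq> 0\<^sub>v N" "X *\<^sub>v w = 0\<^sub>v N"
      using det_0_iff_vec_prod_zero_field[OF X] by blast
    have Xw: "(\<Sum>j<N. X $$ (i, j) * w $ j) = 0" if "i < N" for i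
    proof -
      have "(X *\<^sub>v w) $ i = (\<Sum>j<N. X $$ (i, j) * w $ j)"
        using that X w(1) by (simp add: scalar_prod_def atLeast0LessThan)
      then show ?thesis using w(3) that by simp
    qed
    have nr: "w $ i = 0" if "i < N" "i \<noteq> r" for i
    proof -
      have "(\<Sum>j<N. X $$ (i, j) * w $ j) = (\<Sum>j<N. if j = i then w $ j else 0)"
        by (rule sum.cong) (use that in \<open>auto simp: X_def\<close>)
      then show ?thesis using Xw[OF that(1)] that by (simp add: sum.delta)
    qed
    have "(\<Sum>j<N. X $$ (r, j) * w $ j) = (\<Sum>j<N. if j = r then v $ r * w $ r else 0)"
      by (rule sum.cong) (use nr r in \<open>auto simp: X_def\<close>)
    then have "w $ r = 0" using Xw[OF r(1)] r by (simp add: sum.delta)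
    then have "w $ i = 0" if "i < N" for i using nr[OF that] by (cases "i = r") auto
    then have "w = 0\<^sub>v N" using w(1) by (intro eq_vecI) auto
    then show False using w(2) by simp
  qed
  then show ?thesis using X r row col by blast
qed

definition std_skew :: "nat \<Rightarrow> complex mat" where
  "std_skew m = block_diag (replicate m (skew_pair_block (1\<^sub>m 1)))"

text \<open>The nondegenerate form is paired with the zero form: the operator is then zero, all
  chains have length one, and the block theorem yields hyperbolic planes.\<close>

lemma skew_normal_form:
  assumes M: "M \<in> carrier_mat N N" and sk: "\<And>i j. i < N \<Longrightarrow> j < N \<Longrightarrow> M $$ (j, i) = - M $$ (i, j)" and d: "det M \<noteq> 0"
  shows "\<exists>P k. N = 2 * k \<and> P \<in> carrier_mat N N \<and> det P \<noteq> 0 \<and> transpose_mat P * M * P = std_skew k"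
proof -
  from det_non_zero_imp_unit[OF M d] obtain Mi where Mi: "Mi \<in> carrier_mat N N" "M * Mi = 1\<^sub>m N" "Mi * M = 1\<^sub>m N"
    by (auto simp: Units_def ring_mat_simps)
  interpret pencil N "0\<^sub>m N N" M Mi
    by unfold_locales (auto simp: M Mi intro: sk)
  have S0: "mapp N (Mi * 0\<^sub>m N N) v = 0" for v
    using Mi by (auto simp: mapp_def fun_eq_iff)
  obtain bs where bs: "\<And>D. D \<in> set bs \<Longrightarrow> good_block D" "\<And>D. D \<in> set bs \<Longrightarrow> set (bvecs D) \<subseteq> CS N"
    "sorted_wrt (\<lambda>D D'. \<forall>z\<in>set (bvecs D). \<forall>z'\<in>set (bvecs D'). bil N M z z' = 0) bs"
    "CS N = cv.span (\<Union>D\<in>set bs. set (bvecs D))"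
    using pencil_blocks by blast
  let ?vs = "concat (map bvecs bs)"
  \<comment> \<open>\<open>T l\<close> is multiplication by \<open>- l\<close>, so on a nonzero
    \<open>y\<close> all its positive powers vanish or none does; a chain longer than one would
    contradict its normalization.\<close>
  have m1: "fst (snd D) = 1" if "D \<in> set bs" for D
  proof -
    obtain l m x y where D: "D = (l, m, x, y)" by (cases D) auto
    have "good_block (l, m, x, y)" using bs(1)[OF that] by (simp add: D)
    then have g: "m \<ge> 1" "(T l ^^ m) y = 0" "bil N M x ((T l ^^ (m - 1)) y) = 1" unfolding good_block_def by auto
    have T: "T l v = cscale (- l) v" for v by (simp add: T_def S0 fun_eq_iff cscale_apply)
    have Tp: "(T l ^^ i) y = cscale ((- l) ^ i) y" for i
      by (induction i) (simp_all add: T)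
    have "y \<noteq> 0" using g(3) by auto
    have "m = 1"
    proof (rule ccontr)
      assume "m \<noteq> 1"
      then have "(T l ^^ (m - 1)) y = 0 \<longleftrightarrow> l = 0 \<or> y = 0" "(T l ^^ m) y = 0 \<longleftrightarrow> l = 0 \<or> y = 0"
        using g(1) unfolding Tp by (auto simp: fun_eq_iff cscale_apply)
      then show False using g by auto
    qed
    then show ?thesis by (simp add: D)
  qed
  have ind: "list_indep ?vs" using gram_det_indep[OF M blocks_gram[OF bs(1,3)]] .
  have CSc: "set ?vs \<subseteq> CS N" using UN_least[OF bs(2)] by simp
  have len: "length ?vs = N"
    by (rule list_indep_span_length[OF ind CSc]) (use bs(4) in simp)
  have len2: "length ?vs = 2 * length bs"
    using m1 by (induction bs) (auto simp: bvecs_def)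
  have "transpose_mat (cmat N ?vs) * M * cmat N ?vs = gram (bil N M) ?vs ?vs" by (rule gram_bil[OF M])
  also have "\<dots> = block_diag (map (\<lambda>vs. gram (bil N M) vs vs) (map bvecs bs))"
  proof (rule gram_concat)
    show "sorted_wrt (\<lambda>us vs. \<forall>u\<in>set us. \<forall>v\<in>set vs. bil N M u v = 0 \<and> bil N M v u = 0) (map bvecs bs)"
      unfolding sorted_wrt_map
      by (rule sorted_wrt_mono_rel[OF _ bs(3)]) (metis b_skew neg_equal_0_iff_equal)
  qed
  also have "map (\<lambda>vs. gram (bil N M) vs vs) (map bvecs bs) = map (\<lambda>D. skew_pair_block (1\<^sub>m 1)) bs"
    using gram_block(1) bs(1) m1 by simp
  also have "\<dots> = replicate (length bs) (skew_pair_block (1\<^sub>m 1))" by (simp add: map_replicate_const)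
  finally have "transpose_mat (cmat N ?vs) * M * cmat N ?vs = std_skew (length bs)" by (simp add: std_skew_def)
  moreover have "cmat N ?vs \<in> carrier_mat N N" using cmat_carrier[of N ?vs] len by simp
  moreover have "N = 2 * length bs" using len len2 by simp
  ultimately show ?thesis using cmat_det_nz[OF ind CSc len]
    by (intro exI[of _ "cmat N ?vs"] exI[of _ "length bs"]) simp
qed

text \<open>The constant below is \<open>1\<close>; only its existence matters here.\<close>

lemma pfaffian_square:
  "\<exists>g. \<forall>M. M \<in> carrier_mat (2 * m) (2 * m) \<longrightarrow> (\<forall>i<2*m. \<forall>j<2*m. M $$ (j, i) = - M $$ (i, j)) \<longrightarrow>
    pfaffian M ^ 2 = g * det M"
proof -
  define g where "g = pf_sum m (std_skew m) ^ 2 / det (std_skew m) / (2 ^ m * of_nat (fact m)) ^ 2"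
  have "pfaffian M ^ 2 = g * det M"
    if M: "M \<in> carrier_mat (2 * m) (2 * m)" and sk: "\<And>i j. i < 2 * m \<Longrightarrow> j < 2 * m \<Longrightarrow> M $$ (j, i) = - M $$ (i, j)" for M
  proof (cases "det M = 0")
    case True
    obtain X r where X: "X \<in> carrier_mat (2 * m) (2 * m)" "det X \<noteq> 0" "r < 2 * m"
      "\<forall>j<2 * m. (X * M * transpose_mat X) $$ (r, j) = 0 \<and> (X * M * transpose_mat X) $$ (j, r) = 0"
      using skew_vec_0[OF M sk True] by blast
    have "pf_sum m (X * M * transpose_mat X) = 0" by (rule pf_sum_zero_row[OF X(3)]) (use X(4) in auto)
    then have "pf_sum m M = 0" using pf_sum_congruence[OF X(1) M] X(2) by simp
    then show ?thesis using True pfaffian_pf_sum[OF M] by simp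
  next
    case False
    obtain P k where P: "2 * m = 2 * k" "P \<in> carrier_mat (2 * m) (2 * m)" "det P \<noteq> 0" "transpose_mat P * M * P = std_skew k"
      using skew_normal_form[OF M sk False] by blast
    then have k: "k = m" by simp
    have PT: "transpose_mat P \<in> carrier_mat (2 * m) (2 * m)" using P by simp
    have "pf_sum m (std_skew m) = det P * pf_sum m M"
      using pf_sum_congruence[OF PT M] P(4) det_transpose[OF P(2)] k by simp
    moreover have "det (std_skew m) = det P * det M * det P"
      using P k det_mult[OF mult_carrier_mat[OF PT M] P(2)] det_mult[OF PT M] det_transpose[OF P(2)] by simp
    ultimately show ?thesis unfolding g_def pfaffian_pf_sum[OF M] using P(3) False
      by (simp add: field_simps power2_eq_square)
  qed
  then show ?thesis by blast
qed

section \<open>Homogeneous polynomials and invariants\<close>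

definition pd :: "nat \<Rightarrow> mp \<Rightarrow> mp" where "pd i f = poly (pderiv (vexpand i f)) (mvar i)"

lemma pd_simps [simp]:
  "pd i (mconst a) = 0" "pd i (mvar j) = (if i = j then 1 else 0)" "pd i 0 = 0" "pd i 1 = 0"
  "pd i (f + g) = pd i f + pd i g" "pd i (f - g) = pd i f - pd i g" "pd i (- f) = - pd i f"
  by (auto simp: pd_def pderiv_add pderiv_diff pderiv_minus pderiv_pCons)

lemma pd_mult: "pd i (f * g) = pd i f * g + f * pd i g"
  by (simp add: pd_def pderiv_mult algebra_simps)

lemma pd_sum [simp]: "pd i (sum f A) = (\<Sum>k\<in>A. pd i (f k))"
  by (induction A rule: infinite_finite_induct) auto

lemma has_derivative_ev:
  "((\<lambda>t. ev f (x(i := x i + t))) has_field_derivative ev (pd i f) x) (at 0)"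
proof (induction f rule: mp_induct)
  case (mvar j)
  have "((\<lambda>t. x i + t) has_field_derivative 1) (at 0)" by (auto intro!: derivative_eq_intros)
  then show ?case by (cases "i = j") auto
next
  case (add f g)
  then show ?case using DERIV_add by fastforce
next
  case (mult f g)
  then show ?case using DERIV_mult[OF mult(1,2)] by (simp add: pd_mult algebra_simps)
qed auto

lemma pdiff_ev: "pdiff i (ev f) x = ev (pd i f) x"
  unfolding pdiff_def by (rule DERIV_imp_deriv[OF has_derivative_ev])

text \<open>Scaling all variables by a parameter multiplies \<open>f\<close> by its
  \<open>d\<close>-th power. The zero polynomial counts for every \<open>d\<close>.\<close>

definition homog :: "nat \<Rightarrow> mp \<Rightarrow> bool" where "homog d f \<longleftrightarrow> hc f = monom f d"

lemma homog_0 [simp]: "homog d 0" by (simp add: homog_def)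
lemma homog_mconst [simp]: "homog 0 (mconst a)" by (simp add: homog_def monom_0)
lemma homog_1 [simp]: "homog 0 1" by (simp add: homog_def monom_0 one_pCons)
lemma homog_mvar [simp]: "homog (Suc 0) (mvar i)" by (simp add: homog_def monom_0 monom_Suc)
lemma homog_add: "homog d f \<Longrightarrow> homog d g \<Longrightarrow> homog d (f + g)" by (simp add: homog_def add_monom)
lemma homog_uminus: "homog d f \<Longrightarrow> homog d (- f)" by (simp add: homog_def minus_monom)
lemma homog_sum: "(\<And>i. i \<in> A \<Longrightarrow> homog d (f i)) \<Longrightarrow> homog d (sum f A)"
  by (induction A rule: infinite_finite_induct) (auto intro: homog_add)
lemma homog_mult: "homog d f \<Longrightarrow> homog e g \<Longrightarrow> homog (d + e) (f * g)" by (simp add: homog_def mult_monom)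
lemma homog_power: "homog d f \<Longrightarrow> homog (k * d) (f ^ k)"
  by (induction k) (auto intro: homog_mult)
lemma homog_prod: "(\<And>i. i \<in> A \<Longrightarrow> homog (e i) (f i)) \<Longrightarrow> homog (sum e A) (prod f A)"
  by (induction A rule: infinite_finite_induct) (auto intro: homog_mult)

lemma homog_ev: "homog d f \<Longrightarrow> ev f (\<lambda>i. t * x i) = t ^ d * ev f x"
  using ev_hc[of f t x] by (simp add: homog_def poly_monom mult.commute flip: mconst_power)

lemma homog_unique: "homog d f \<Longrightarrow> homog e f \<Longrightarrow> f \<noteq> 0 \<Longrightarrow> d = e"
  unfolding homog_def by (metis degree_monom_eq)

lemma homog_mdeg: "homog d f \<Longrightarrow> f \<noteq> 0 \<Longrightarrow> mdeg f = d"
  by (simp add: homog_def mdeg_def degree_monom_eq)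

lemma homog_0_const: assumes "homog 0 f" shows "\<exists>a. f = mconst a"
proof -
  have "mdeg f = 0" using assms using homog_mdeg[OF assms] by (cases "f = 0") (auto simp: mdeg_def)
  then show ?thesis using mdeg_0_const by blast
qed

text \<open>Lowest indices add and degrees add in a domain; both sums equal \<open>d\<close>, so
  each factor has only one term.\<close>

lemma mult_eq_monom:
  fixes p q :: "'a::idom poly"
  assumes pq: "p * q = monom c d" and c: "c \<noteq> 0"
  shows "\<exists>a. a \<le> d \<and> p = monom (coeff p a) a \<and> q = monom (coeff q (d - a)) (d - a)"
proof -
  have nz: "p \<noteq> 0" "q \<noteq> 0" using pq c by auto
  define i where "i = (LEAST i. coeff p i \<noteq> 0)"
  define j where "j = (LEAST j. coeff q j \<noteq> 0)"
  have i: "coeff p i \<noteq> 0" "\<And>k. k < i \<Longrightarrow> coeff p k = 0"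
    unfolding i_def using LeastI[of "\<lambda>i. coeff p i \<noteq> 0" "degree p"] nz not_less_Least by auto
  have j: "coeff q j \<noteq> 0" "\<And>k. k < j \<Longrightarrow> coeff q k = 0"
    unfolding j_def using LeastI[of "\<lambda>i. coeff q i \<noteq> 0" "degree q"] nz not_less_Least by auto
  have "coeff (p * q) (i + j) = (\<Sum>k\<le>i + j. coeff p k * coeff q (i + j - k))" by (simp add: coeff_mult)
  also have "\<dots> = (\<Sum>k\<in>{i}. coeff p k * coeff q (i + j - k))"
  proof (rule sum.mono_neutral_right)
    show "\<forall>k\<in>{..i + j} - {i}. coeff p k * coeff q (i + j - k) = 0"
    proof
      fix k assume "k \<in> {..i + j} - {i}"
      then have "k < i \<or> i + j - k < j" by auto
      then show "coeff p k * coeff q (i + j - k) = 0" using i(2) j(2) by auto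
    qed
  qed auto
  also have "\<dots> \<noteq> 0" using i j by simp
  finally have ij: "i + j = d" unfolding pq by (auto split: if_splits)
  have "degree p + degree q = d" using degree_mult_eq[OF nz] pq c by (simp add: degree_monom_eq)
  moreover have "i \<le> degree p" "j \<le> degree q" using i j le_degree by auto
  ultimately have deg: "degree p = i" "degree q = j" using ij by auto
  have "p = monom (coeff p i) i"
    by (rule poly_eqI) (use i deg coeff_eq_0 in \<open>metis coeff_monom linorder_neqE_nat\<close>)
  moreover have "q = monom (coeff q j) j"
    by (rule poly_eqI) (use j deg coeff_eq_0 in \<open>metis coeff_monom linorder_neqE_nat\<close>)
  ultimately show ?thesis using ij by (intro exI[of _ i]) auto
qed

text \<open>The scaling homomorphism turns the factorization into one of a monomial, whose factors
  are monomials.\<close>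

lemma homog_factor:
  assumes "homog d (f * g)" "f * g \<noteq> 0"
  shows "\<exists>a\<le>d. homog a f \<and> homog (d - a) g"
proof -
  have "hc f * hc g = monom (f * g) d" using assms(1) by (simp add: homog_def)
  from mult_eq_monom[OF this assms(2)] obtain a where a: "a \<le> d" "hc f = monom (coeff (hc f) a) a"
    "hc g = monom (coeff (hc g) (d - a)) (d - a)" by blast
  have "f = coeff (hc f) a" using a(2) poly_hc_1[of f] by (metis mult.right_neutral poly_monom power_one)
  moreover have "g = coeff (hc g) (d - a)" using a(3) poly_hc_1[of g] by (metis mult.right_neutral poly_monom power_one)
  ultimately show ?thesis unfolding homog_def using a by metis
qed

text \<open>Turns divisibility of \<open>{x_l, f}\<close> by \<open>f\<close> into a scalar weight,
  as the bracket with a coordinate preserves degree.\<close>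

lemma homog_dvd_same:
  assumes "homog d f" "homog d g" "f \<noteq> 0" "f dvd g" shows "\<exists>a. g = mconst a * f"
proof (cases "g = 0")
  case True
  then show ?thesis by (intro exI[of _ 0]) (simp add: mconst_hom)
next
  case False
  obtain h where h: "g = f * h" using assms by blast
  obtain a where a: "a \<le> d" "homog a f" "homog (d - a) h" using homog_factor[of d f h] assms h False by auto
  then have "a = d" using homog_unique assms by blast
  then show ?thesis using a(3) homog_0_const h by (metis diff_self_eq_0 mult.commute)
qed

lemma homog_hc_coeff: "homog m (coeff (hc f) m)"
proof (induction f arbitrary: m rule: mp_induct)
  case (mconst a)
  then show ?case by (cases m) auto
next
  case (mvar i)
  then show ?case by (auto simp: coeff_pCons split: nat.splits)
next
  case (add f g)
  then show ?case by (auto intro: homog_add)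
next
  case (mult f g)
  have "homog (k + (m - k)) (coeff (hc f) k * coeff (hc g) (m - k))" for k by (intro homog_mult mult)
  then show ?case by (auto simp: coeff_mult intro!: homog_sum) (metis le_add_diff_inverse)
qed

lemma hc_coeff_polys: "f \<in> polys n \<Longrightarrow> coeff (hc f) m \<in> polys n"
proof (induction arbitrary: m rule: polys_induct)
  case (mconst a)
  then show ?case by (cases m) auto
next
  case (mvar i)
  then show ?case by (auto simp: coeff_pCons split: nat.splits)
qed (auto simp: coeff_mult)

lemma sum_hc_coeff: "f = (\<Sum>m\<le>mdeg f. coeff (hc f) m)"
  using poly_hc_1[of f] unfolding poly_altdef mdeg_def by simp

text \<open>Euler's operator is the derivative in \<open>s\<close> of \<open>f(s x)\<close> at
  \<open>s = 1\<close>.\<close>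

lemma euler:
  assumes "f \<in> polys n" shows "(\<Sum>i<n. mvar i * pd i f) = poly (pderiv (hc f)) 1"
  using assms
proof (induction rule: polys_induct)
  case (mconst a)
  then show ?case by (simp add: pderiv_pCons)
next
  case (mvar j)
  have "(\<Sum>i<n. mvar i * (if i = j then 1 else 0)) = (\<Sum>i<n. if i = j then mvar j else 0)" by (intro sum.cong) auto
  then show ?case using mvar by (simp add: pderiv_pCons sum.delta)
next
  case (add f g)
  then show ?case by (simp add: pderiv_add distrib_left sum.distrib)
next
  case (mult f g)
  have "(\<Sum>i<n. mvar i * pd i (f * g)) = (\<Sum>i<n. mvar i * pd i f) * g + f * (\<Sum>i<n. mvar i * pd i g)"
  proof -
    have "(\<Sum>i<n. mvar i * pd i (f * g)) = (\<Sum>i<n. (mvar i * pd i f) * g + f * (mvar i * pd i g))"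
      by (intro sum.cong refl) (simp add: pd_mult algebra_simps)
    then show ?thesis by (simp only: sum.distrib sum_distrib_left sum_distrib_right)
  qed
  then show ?case using mult by (simp add: pderiv_mult algebra_simps)
qed

lemma euler_homog:
  assumes "f \<in> polys n" "homog d f" shows "(\<Sum>i<n. mvar i * pd i f) = of_nat d * f"
  unfolding euler[OF assms(1)] using assms(2) by (simp add: homog_def pderiv_monom poly_monom)

text \<open>Differentiation lowers degrees by one, which the shift by \<open>pCons 0\<close>
  compensates.\<close>

lemma pd_hc: "pd i (coeff (hc f) m) = coeff (pCons 0 (hc (pd i f))) m"
proof (induction f arbitrary: m rule: mp_induct)
  case (mconst a)
  then show ?case by (cases m) (auto simp: coeff_pCons split: nat.splits)
next
  case (mvar j)
  then show ?case by (auto simp: coeff_pCons split: nat.splits)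
next
  case (add f g)
  then show ?case by (cases m) auto
next
  case (mult f g)
  have "pd i (coeff (hc (f * g)) m) = (\<Sum>k\<le>m. coeff (pCons 0 (hc (pd i f))) k * coeff (hc g) (m - k)) +
      (\<Sum>k\<le>m. coeff (hc f) k * coeff (pCons 0 (hc (pd i g))) (m - k))"
    by (simp add: coeff_mult pd_mult mult sum.distrib)
  also have "\<dots> = coeff (pCons 0 (hc (pd i f)) * hc g + hc f * pCons 0 (hc (pd i g))) m"
    by (simp only: coeff_mult coeff_add)
  also have "pCons 0 (hc (pd i f)) * hc g + hc f * pCons 0 (hc (pd i g)) = pCons 0 (hc (pd i (f * g)))"
    by (simp add: pd_mult)
  finally show ?case .
qed

lemma homog_pd: assumes "homog d f" shows "homog (d - 1) (pd i f)"
proof -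
  have "pCons 0 (hc (pd i f)) = monom (pd i f) d"
  proof (rule poly_eqI)
    fix m show "coeff (pCons 0 (hc (pd i f))) m = coeff (monom (pd i f) d) m"
      unfolding pd_hc[symmetric] using assms by (auto simp: homog_def)
  qed
  then show ?thesis
    by (cases d) (auto simp: homog_def monom_0 monom_Suc)
qed

lemma polyfun_le_mdeg:
  "polyfun_le n d h \<Longrightarrow> \<exists>g\<in>polys n. ev g = h \<and> mdeg g \<le> d"
proof (induction rule: polyfun_le.induct)
  case (pfl_const d a)
  show ?case by (rule bexI[of _ "mconst a"]) (auto simp: fun_eq_iff)
next
  case (pfl_var i d)
  then show ?case by (intro bexI[of _ "mvar i"]) (auto simp: fun_eq_iff mdeg_def)
next
  case (pfl_add d f g)
  then obtain f' g' where "f'\<in>polys n" "g'\<in>polys n" "ev f' = f" "ev g' = g" "mdeg f' \<le> d" "mdeg g' \<le> d" by blast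
  then show ?case by (intro bexI[of _ "f' + g'"]) (auto simp: fun_eq_iff mdeg_def intro: degree_add_le)
next
  case (pfl_mult d1 f d2 g d)
  then obtain f' g' where fg: "f'\<in>polys n" "g'\<in>polys n" "ev f' = f" "ev g' = g" "mdeg f' \<le> d1" "mdeg g' \<le> d2" by blast
  then have "mdeg (f' * g') \<le> d" using pfl_mult.hyps degree_mult_le[of "hc f'" "hc g'"] by (auto simp: mdeg_def)
  then show ?case using fg by (intro bexI[of _ "f' * g'"]) (auto simp: fun_eq_iff)
qed

lemma polyfun_le_sum:
  assumes "finite A" "\<And>i. i \<in> A \<Longrightarrow> polyfun_le n d (f i)" shows "polyfun_le n d (\<lambda>x. \<Sum>i\<in>A. f i x)"
  using assms by (induction A rule: finite_induct) (auto intro: polyfun_le.intros)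

lemma polyfun_le_hc_coeff: "f \<in> polys n \<Longrightarrow> polyfun_le n m (ev (coeff (hc f) m))"
proof (induction arbitrary: m rule: polys_induct)
  case (mconst a)
  have "\<exists>b. ev (coeff (hc (mconst a)) m) = (\<lambda>x. b)" by (cases m) (auto simp: fun_eq_iff)
  then show ?case by (auto intro: pfl_const)
next
  case (mvar i)
  have "ev (coeff (hc (mvar i)) m) = (if m = 1 then (\<lambda>x. x i) else (\<lambda>x. 0))"
    by (auto simp: coeff_pCons fun_eq_iff split: nat.splits)
  then show ?case using mvar by (auto intro: polyfun_le.intros)
next
  case (add f g)
  have "ev (coeff (hc (f + g)) m) = (\<lambda>x. ev (coeff (hc f) m) x + ev (coeff (hc g) m) x)" by (simp add: fun_eq_iff)
  then show ?case using add by (simp add: pfl_add)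
next
  case (mult f g)
  have "ev (coeff (hc (f * g)) m) = (\<lambda>x. \<Sum>k\<le>m. ev (coeff (hc f) k) x * ev (coeff (hc g) (m - k)) x)"
    by (simp add: fun_eq_iff coeff_mult)
  moreover have "polyfun_le n m (\<lambda>x. ev (coeff (hc f) k) x * ev (coeff (hc g) (m - k)) x)" if "k \<le> m" for k
    by (rule pfl_mult[OF mult(3,4)]) (use that in auto)
  then have "polyfun_le n m (\<lambda>x. \<Sum>k\<le>m. ev (coeff (hc f) k) x * ev (coeff (hc g) (m - k)) x)"
    by (intro polyfun_le_sum) auto
  ultimately show ?case by (simp only:)
qed

text \<open>The degree of the statement is a least bound over representations. A homogeneous
  polynomial can be built within the bound \<open>d\<close>, and no representation undercuts the
  degree seen by scaling.\<close>

lemma polydeg_homog: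
  assumes "f \<in> polys n" "homog d f" "f \<noteq> 0" shows "polydeg n (ev f) = d"
  unfolding polydeg_def
proof (rule Least_equality)
  show "polyfun_le n d (ev f)" using polyfun_le_hc_coeff[OF assms(1), of d] assms(2) by (simp add: homog_def)
next
  fix e assume "polyfun_le n e (ev f)"
  then obtain g where "ev g = ev f" "mdeg g \<le> e" using polyfun_le_mdeg by blast
  then show "d \<le> e" using homog_mdeg[OF assms(2,3)] by (simp add: ev_inject)
qed

text \<open>\<open>ham n c l\<close> is the Lie--Poisson bracket with the \<open>l\<close>-th coordinate.\<close>

definition PM :: "nat \<Rightarrow> (nat \<Rightarrow> nat \<Rightarrow> nat \<Rightarrow> complex) \<Rightarrow> nat \<Rightarrow> nat \<Rightarrow> mp" where
  "PM n c i j = (\<Sum>k<n. mconst (c i j k) * mvar k)"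

definition ham :: "nat \<Rightarrow> (nat \<Rightarrow> nat \<Rightarrow> nat \<Rightarrow> complex) \<Rightarrow> nat \<Rightarrow> mp \<Rightarrow> mp" where
  "ham n c l f = (\<Sum>j<n. PM n c l j * pd j f)"

lemma PM_polys: "PM n c i j \<in> polys n" unfolding PM_def by (auto intro!: polys_sum)

lemma homog_PM: "homog 1 (PM n c i j)"
  unfolding PM_def using homog_mult[OF homog_mconst homog_mvar] by (intro homog_sum) simp

lemma ham_simps [simp]:
  "ham n c l 0 = 0" "ham n c l (mconst a) = 0" "ham n c l (f + g) = ham n c l f + ham n c l g"
  "ham n c l (f - g) = ham n c l f - ham n c l g" "ham n c l (- f) = - ham n c l f"
  by (simp_all add: ham_def distrib_left sum.distrib right_diff_distrib sum_subtractf sum_negf)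

lemma ham_mult: "ham n c l (f * g) = ham n c l f * g + f * ham n c l g"
proof -
  have "ham n c l (f * g) = (\<Sum>j<n. (PM n c l j * pd j f) * g + f * (PM n c l j * pd j g))"
    unfolding ham_def by (intro sum.cong refl) (simp add: pd_mult algebra_simps)
  then show ?thesis by (simp only: ham_def sum.distrib sum_distrib_left sum_distrib_right)
qed

lemma ham_mvar: "j < n \<Longrightarrow> ham n c l (mvar j) = PM n c l j"
  unfolding ham_def by (simp add: if_distrib sum.delta cong: if_cong)

lemma ham_sum [simp]: "ham n c l (sum f A) = (\<Sum>k\<in>A. ham n c l (f k))"
  by (induction A rule: infinite_finite_induct) auto

lemma ham_mconst_mult: "ham n c l (mconst a * f) = mconst a * ham n c l f"
  by (simp add: ham_mult)

lemma ham_power: "ham n c l (f ^ Suc k) = of_nat (Suc k) * f ^ k * ham n c l f"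
  by (induction k) (simp_all add: ham_mult algebra_simps)

lemma homog_ham: assumes "homog d f" shows "homog d (ham n c l f)"
proof (cases d)
  case 0
  then obtain a where "f = mconst a" using assms homog_0_const by blast
  then show ?thesis by simp
next
  case (Suc e)
  have "homog (1 + e) (PM n c l j * pd j f)" for j
    using homog_mult[OF homog_PM homog_pd[OF assms, of j], of n c l j] Suc by simp
  then show ?thesis unfolding ham_def using Suc by (intro homog_sum) simp
qed

text \<open>Bracketing with a coordinate preserves degrees, so the homogeneous components of an
  invariant are invariant.\<close>

lemma ham_hc: "ham n c l (coeff (hc f) m) = coeff (hc (ham n c l f)) m"
proof -
  have "ham n c l f = (\<Sum>k\<le>mdeg f. ham n c l (coeff (hc f) k))"
    using arg_cong[OF sum_hc_coeff[of f], of "ham n c l"] by simp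
  also have "hc \<dots> = (\<Sum>k\<le>mdeg f. monom (ham n c l (coeff (hc f) k)) k)"
    using homog_ham[OF homog_hc_coeff] by (simp add: homog_def)
  finally have "coeff (hc (ham n c l f)) m = (\<Sum>k\<le>mdeg f. if k = m then ham n c l (coeff (hc f) k) else 0)"
    by (simp add: coeff_sum)
  also have "\<dots> = ham n c l (coeff (hc f) m)"
    by (auto simp: sum.delta mdeg_def coeff_eq_0)
  finally show ?thesis ..
qed

lemma lp_bracket_ev: "lp_bracket n c (ev g) (ev f) x = ev (\<Sum>i<n. pd i g * ham n c i f) x"
  by (simp add: lp_bracket_def pdiff_ev ham_def PM_def sum_distrib_left ac_simps)

text \<open>The bracket depends on \<open>g\<close> only through its partial derivatives, so the
  coordinates suffice as test functions.\<close>

lemma invariant_iff: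
  assumes "f \<in> polys n" shows "ev f \<in> invariant_polys n c \<longleftrightarrow> (\<forall>l<n. ham n c l f = 0)"
proof
  assume inv: "ev f \<in> invariant_polys n c"
  show "\<forall>l<n. ham n c l f = 0"
  proof (intro allI impI)
    fix l assume l: "l < n"
    have "polyfun n (ev (mvar l))" using polys_X[OF l] by (simp add: polys_def)
    then have "lp_bracket n c (ev (mvar l)) (ev f) x = 0" for x
      using inv unfolding invariant_polys_def by blast
    then have "ev (\<Sum>i<n. pd i (mvar l) * ham n c i f) x = 0" for x unfolding lp_bracket_ev .
    moreover have "(\<Sum>i<n. pd i (mvar l) * ham n c i f) = (\<Sum>i<n. if i = l then ham n c i f else 0)"
      by (intro sum.cong) auto
    ultimately show "ham n c l f = 0" using l by (intro ev_inject_fun) (simp only: sum.delta finite_lessThan lessThan_iff if_True ev_simps(1))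
  qed
next
  assume h: "\<forall>l<n. ham n c l f = 0"
  have "lp_bracket n c g (ev f) x = 0" if g: "polyfun n g" for g x
  proof -
    obtain g' where "ev g' = g" using polyfun_ex_polys[OF g] by blast
    then have "lp_bracket n c g (ev f) x = ev (\<Sum>i<n. pd i g' * ham n c i f) x" using lp_bracket_ev by blast
    also have "(\<Sum>i<n. pd i g' * ham n c i f) = 0" using h by simp
    finally show ?thesis by simp
  qed
  then show "ev f \<in> invariant_polys n c" using assms by (simp add: invariant_polys_def polys_def)
qed

text \<open>The eigenvalues for the coordinate functions are the components of a weight, which the
  absence of proper semi-invariants forces to vanish.\<close>

lemma semi_invariant_weight_0:
  assumes ns: "no_proper_semi_invariants n c" and f: "f \<in> polys n" "f \<noteq> 0"
    and h: "\<And>l. l < n \<Longrightarrow> \<exists>a. ham n c l f = mconst a * f" and l: "l < n"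
  shows "ham n c l f = 0"
proof -
  obtain chi where chi: "\<And>l. l < n \<Longrightarrow> ham n c l f = mconst (chi l) * f" using h by metis
  have "semi_invariant_wt n c (ev f) chi" unfolding semi_invariant_wt_def
  proof (intro conjI allI impI)
    show "polyfun n (ev f)" using f by (simp add: polys_def)
    show "ev f \<noteq> (\<lambda>x. 0)" using f(2) mp_nonzero_ex by metis
    fix g x assume "polyfun n g"
    then obtain g' where g': "ev g' = g" using polyfun_ex_polys by blast
    have "(\<Sum>i<n. pd i g' * ham n c i f) = (\<Sum>i<n. mconst (chi i) * pd i g') * f"
      by (simp add: chi sum_distrib_left sum_distrib_right algebra_simps)
    then show "lp_bracket n c g (ev f) x = (\<Sum>i<n. chi i * pdiff i g x) * ev f x"
      using lp_bracket_ev[of n c g' f x] by (simp add: g'[symmetric] pdiff_ev)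
  qed
  then have "chi l = 0" using ns l unfolding no_proper_semi_invariants_def by blast
  then show ?thesis using chi[OF l] by (simp add: mconst_hom)
qed

section \<open>Corank one, bordered matrices and cofactors\<close>

lemma rank_pred_kernel:
  fixes A :: "complex mat"
  assumes A: "A \<in> carrier_mat n n" and r: "vec_space.rank n A = n - 1" and n: "n \<ge> 1"
    and v: "v \<in> carrier_vec n" "A *\<^sub>v v = 0\<^sub>v n" "v \<noteq> 0\<^sub>v n" and w: "w \<in> carrier_vec n" "A *\<^sub>v w = 0\<^sub>v n"
  shows "\<exists>c. w = c \<cdot>\<^sub>v v"
proof -
  interpret vec_space "TYPE(complex)" n .
  obtain S where S: "maximal S (\<lambda>T. T \<subseteq> set (cols A) \<and> lin_indpt T)"
    using maximal_exists_superset[of "set (cols A)" "\<lambda>T. T \<subseteq> set (cols A) \<and> lin_indpt T" "{}"]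
    by (auto simp: lin_dep_def)
  have Sc: "S \<subseteq> set (cols A)" "lin_indpt S" "card S = n - 1"
    using S rank_card_indpt[OF A S] r by (auto simp: maximal_def)
  have "S \<subseteq> col A ` {..<n}" using Sc(1) A by (auto simp: cols_def)
  then obtain J where J: "J \<subseteq> {..<n}" "inj_on (col A) J" "S = col A ` J" unfolding subset_image_inj by blast
  have cJ: "card J = n - 1" using Sc(3) J card_image by metis
  have fJ: "finite J" using J(1) finite_subset by blast
  have "card ({..<n} - J) = 1" using card_Diff_subset[OF fJ J(1)] cJ n by simp
  then obtain j0 where j0: "{..<n} - J = {j0}" using card_1_singletonE by blast
  have j0n: "j0 < n" using j0 by auto
  define js where "js = sorted_list_of_set J"
  have js: "set js = J" "distinct js" using fJ by (auto simp: js_def)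
  define C where "C = mat_of_cols n (map (col A) js)"
  have C: "C \<in> carrier_mat n (length js)" by (simp add: C_def mat_of_cols_def)
  have cc: "cols C = map (col A) js" unfolding C_def by (rule cols_mat_of_cols) (use A in auto)
  have dC: "distinct (cols C)" using cc js J(2) by (simp add: distinct_map)
  have sC: "set (cols C) = S" using cc js J(3) by simp
  \<comment> \<open>The \<open>n - 1\<close> independent columns leave out a single index
    \<open>j0\<close>; a kernel vector with zero entry there is a relation among these columns. So
    kernel vectors are determined by their entry at \<open>j0\<close>.\<close>
  have key: "u = 0\<^sub>v n" if u: "u \<in> carrier_vec n" "A *\<^sub>v u = 0\<^sub>v n" "u $ j0 = 0" for u :: "complex Matrix.vec"
  proof (rule ccontr)
    assume nz: "u \<noteq> 0\<^sub>v n"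
    define z where "z = Matrix.vec (length js) (\<lambda>k. u $ (js ! k))"
    have z: "z \<in> carrier_vec (length js)" by (simp add: z_def)
    have "\<exists>i<n. u $ i \<noteq> 0"
    proof (rule ccontr)
      assume "\<not> ?thesis"
      then have "u = 0\<^sub>v n" using u(1) by (intro eq_vecI) auto
      then show False using nz by simp
    qed
    then obtain i where i: "i < n" "u $ i \<noteq> 0" by blast
    then have "i \<noteq> j0" using u(3) by metis
    then have "i \<in> J" using j0 i(1) by blast
    then obtain k where k: "k < length js" "js ! k = i" using js by (metis in_set_conv_nth)
    then have "z $ k \<noteq> 0" using i by (simp add: z_def)
    then have znz: "z \<noteq> 0\<^sub>v (length js)" using k by auto
    have "C *\<^sub>v z = 0\<^sub>v n"
    proof (rule eq_vecI)
      fix a assume "a < dim_vec (0\<^sub>v n :: complex Matrix.vec)"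
      then have a: "a < n" by simp
      have "(C *\<^sub>v z) $ a = (\<Sum>k<length js. C $$ (a, k) * z $ k)"
        using a C by (simp add: scalar_prod_def z_def atLeast0LessThan)
      also have "\<dots> = (\<Sum>k<length js. A $$ (a, js ! k) * u $ (js ! k))"
      proof (intro sum.cong refl)
        fix k assume "k \<in> {..<length js}"
        moreover then have "js ! k < n" using js J nth_mem by blast
        ultimately show "C $$ (a, k) * z $ k = A $$ (a, js ! k) * u $ (js ! k)"
          using a A by (simp add: C_def z_def mat_of_cols_def)
      qed
      also have "\<dots> = (\<Sum>j\<in>J. A $$ (a, j) * u $ j)"
        using js by (intro sum.reindex_bij_betw bij_betw_nth) auto
      also have "\<dots> = (\<Sum>j<n. A $$ (a, j) * u $ j)"
        by (rule sum.mono_neutral_left) (use J j0 u(3) in auto)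
      also have "\<dots> = (A *\<^sub>v u) $ a" using a A u(1) by (simp add: scalar_prod_def atLeast0LessThan)
      finally show "(C *\<^sub>v z) $ a = 0\<^sub>v n $ a" using u(2) by simp
    qed (use C in simp)
    then have "lin_dep (set (cols C))" using lin_depI[OF C z znz _ dC] by blast
    then show False using Sc(2) sC by simp
  qed
  have v0: "v $ j0 \<noteq> 0" using key[OF v(1,2)] v(3) by blast
  define c where "c = w $ j0 / v $ j0"
  have "w - c \<cdot>\<^sub>v v = 0\<^sub>v n"
  proof (rule key)
    show "w - c \<cdot>\<^sub>v v \<in> carrier_vec n" using v w by auto
    show "A *\<^sub>v (w - c \<cdot>\<^sub>v v) = 0\<^sub>v n"
      using A v w mult_minus_distrib_mat_vec[OF A w(1), of "c \<cdot>\<^sub>v v"] mult_mat_vec[OF A v(1), of c] by simp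
    show "(w - c \<cdot>\<^sub>v v) $ j0 = 0" using v w j0n v0 by (simp add: c_def)
  qed
  then have z: "(w - c \<cdot>\<^sub>v v) $ i = 0" if "i < n" for i using that by simp
  have "w = c \<cdot>\<^sub>v v"
  proof (rule eq_vecI)
    fix i assume "i < dim_vec (c \<cdot>\<^sub>v v)"
    then show "w $ i = (c \<cdot>\<^sub>v v) $ i" using z[of i] v w by simp
  qed (use v w in simp)
  then show ?thesis by blast
qed

text \<open>The sign in the last row keeps a skew matrix skew. The determinant is the quadratic form
  of the cofactors in \<open>e\<close>; for a skew matrix of odd order and corank one it tests
  whether \<open>e\<close> is nonzero on the kernel.\<close>

definition bord :: "nat \<Rightarrow> 'a::comm_ring_1 mat \<Rightarrow> (nat \<Rightarrow> 'a) \<Rightarrow> 'a mat" where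
  "bord n A e = mat (Suc n) (Suc n) (\<lambda>(i, j). if i < n \<and> j < n then A $$ (i, j) else if i < n then e i else if j < n then - e j else 0)"

lemma bord_carrier [simp]: "bord n A e \<in> carrier_mat (Suc n) (Suc n)" by (simp add: bord_def)

lemma det_bord:
  assumes A: "A \<in> carrier_mat n n" and n: "n \<ge> 1"
  shows "det (bord n A e) = (\<Sum>i<n. \<Sum>j<n. e i * e j * cofactor A i j)"
proof -
  let ?M = "bord n A e"
  have "det ?M = (\<Sum>j<Suc n. ?M $$ (n, j) * cofactor ?M n j)" by (rule laplace_expansion_row[OF bord_carrier]) simp
  also have "\<dots> = (\<Sum>j<n. - e j * cofactor ?M n j)" by (simp add: bord_def)
  also have "\<dots> = (\<Sum>j<n. \<Sum>i<n. e i * e j * cofactor A i j)"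
  proof (rule sum.cong[OF refl])
    fix j assume "j \<in> {..<n}"
    then have j: "j < n" by simp
    let ?D = "mat_delete ?M n j"
    have D: "?D \<in> carrier_mat n n" by (simp add: mat_delete_def bord_def)
    have "det ?D = (\<Sum>i<n. ?D $$ (i, n - 1) * cofactor ?D i (n - 1))"
      by (rule laplace_expansion_column[OF D]) (use n in simp)
    also have "\<dots> = (\<Sum>i<n. e i * ((-1) ^ (i + (n - 1)) * det (mat_delete A i j)))"
    proof (rule sum.cong[OF refl])
      fix i assume "i \<in> {..<n}"
      then have i: "i < n" by simp
      have "\<not> n - Suc 0 < j" using j by simp
      then have "?D $$ (i, n - 1) = e i" using i j n by (simp add: mat_delete_def bord_def)
      moreover have "mat_delete ?D i (n - 1) = mat_delete A i j"
        by (rule eq_matI) (use A i j n in \<open>auto simp: mat_delete_def bord_def\<close>)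
      ultimately show "?D $$ (i, n - 1) * cofactor ?D i (n - 1) = e i * ((-1) ^ (i + (n - 1)) * det (mat_delete A i j))"
        by (simp add: cofactor_def)
    qed
    finally have "- e j * cofactor ?M n j = (\<Sum>i<n. - e j * (-1) ^ (n + j) * (e i * ((-1) ^ (i + (n - 1)) * det (mat_delete A i j))))"
      by (simp add: cofactor_def sum_distrib_left mult.assoc)
    also have "\<dots> = (\<Sum>i<n. e i * e j * cofactor A i j)"
    proof (rule sum.cong[OF refl])
      fix i
      \<comment> \<open>The last row contributes the exponent \<open>n + j\<close>, the last column
        of the minor \<open>i + (n - 1)\<close>; the total has parity opposite to
        \<open>i + j\<close>, which cancels the minus sign of \<open>- e j\<close>.\<close>
      have "(-1 :: 'a) ^ (n + j) * (-1) ^ (i + (n - 1)) = (-1) ^ (2 * (n - 1) + (i + j) + 1)"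
        unfolding power_add[symmetric] by (rule arg_cong[where f = "(^) (-1)"]) (use n in simp)
      also have "\<dots> = - ((-1) ^ (i + j))" by (simp add: power_add power_mult)
      finally have s: "(-1 :: 'a) ^ (n + j) * (-1) ^ (i + (n - 1)) = - ((-1) ^ (i + j))" .
      have "- e j * (-1) ^ (n + j) * (e i * ((-1) ^ (i + (n - 1)) * det (mat_delete A i j)))
        = - (e i * e j * det (mat_delete A i j)) * ((-1 :: 'a) ^ (n + j) * (-1) ^ (i + (n - 1)))" by (simp add: algebra_simps)
      also have "\<dots> = e i * e j * cofactor A i j" unfolding s by (simp add: cofactor_def algebra_simps)
      finally show "- e j * (-1) ^ (n + j) * (e i * ((-1) ^ (i + (n - 1)) * det (mat_delete A i j))) = e i * e j * cofactor A i j" .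
    qed
    finally show "- e j * cofactor ?M n j = (\<Sum>i<n. e i * e j * cofactor A i j)" .
  qed
  also have "\<dots> = (\<Sum>i<n. \<Sum>j<n. e i * e j * cofactor A i j)" by (rule sum.swap)
  finally show ?thesis .
qed

text \<open>Exchanging the deleted row and column gives the negative transpose of a matrix of order
  \<open>n - 1\<close>; for odd \<open>n\<close> the cofactors are therefore symmetric.\<close>

lemma cofactor_skew:
  assumes A: "A \<in> carrier_mat n n" and sk: "\<And>i j. i < n \<Longrightarrow> j < n \<Longrightarrow> A $$ (j, i) = - A $$ (i, j)"
    and ij: "i < n" "j < n"
  shows "cofactor A j i = (-1) ^ (n - 1) * cofactor (A :: 'a::comm_ring_1 mat) i j"
proof -
  have "mat_delete A j i = - 1 \<cdot>\<^sub>m transpose_mat (mat_delete A i j)"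
  proof (rule eq_matI)
    fix a b assume "a < dim_row (- 1 \<cdot>\<^sub>m transpose_mat (mat_delete A i j))" "b < dim_col (- 1 \<cdot>\<^sub>m transpose_mat (mat_delete A i j))"
    then have ab: "a < n - 1" "b < n - 1" using A by auto
    let ?a = "if a < j then a else Suc a" and ?b = "if b < i then b else Suc b"
    have "A $$ (?a, ?b) = - A $$ (?b, ?a)" by (rule sk) (use ab in auto)
    then show "mat_delete A j i $$ (a, b) = (- 1 \<cdot>\<^sub>m transpose_mat (mat_delete A i j)) $$ (a, b)"
      using ab A by (simp add: mat_delete_def)
  qed (use A in auto)
  then have "det (mat_delete A j i) = (- 1) ^ (n - 1) * det (transpose_mat (mat_delete A i j))"
    using A by simp
  also have "det (transpose_mat (mat_delete A i j)) = det (mat_delete A i j)"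
    by (rule det_transpose[of _ "n - 1"]) (use A mat_delete_carrier in auto)
  finally show ?thesis by (simp add: cofactor_def add.commute)
qed

lemma submatrix_principal_delete:
  assumes A: "A \<in> carrier_mat n n" and i: "i < n"
  shows "submatrix A ({..<n} - {i}) ({..<n} - {i}) = mat_delete A i i"
proof -
  let ?I = "{..<n} - {i}"
  have "{k. k < n \<and> k \<in> ?I} = ?I" by auto
  then have c: "card {k. k < n \<and> k \<in> ?I} = n - 1" using i by simp
  have pick: "pick ?I k = (if k < i then k else Suc k)" if k: "k < n - 1" for k
  proof -
    let ?k = "if k < i then k else Suc k"
    have "?k \<in> ?I" using k by auto
    then have "pick ?I (card {a \<in> ?I. a < ?k}) = ?k" by (rule pick_card_in_set)
    moreover have "{a \<in> ?I. a < ?k} = (if k < i then {..<k} else {..<Suc k} - {i})" using k by auto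
    then have "card {a \<in> ?I. a < ?k} = k" by (auto split: if_splits)
    ultimately show ?thesis by simp
  qed
  show ?thesis
    by (rule eq_matI) (use A c pick in \<open>auto simp: submatrix_def mat_delete_def\<close>)
qed

lemma det_replace_row:
  assumes M: "M \<in> carrier_mat n n" and k: "k < n"
  shows "det (mat n n (\<lambda>(i, j). if i = k then r j else M $$ (i, j))) = (\<Sum>j<n. r j * cofactor M k j)"
proof -
  let ?N = "mat n n (\<lambda>(i, j). if i = k then r j else M $$ (i, j))"
  have "det ?N = (\<Sum>j<n. ?N $$ (k, j) * cofactor ?N k j)" by (rule laplace_expansion_row) (use k in auto)
  also have "\<dots> = (\<Sum>j<n. r j * cofactor M k j)"
  proof (rule sum.cong[OF refl])
    fix j assume j: "j \<in> {..<n}"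
    have "mat_delete ?N k j = mat_delete M k j"
      by (rule eq_matI) (use M k in \<open>auto simp: mat_delete_def\<close>)
    then show "?N $$ (k, j) * cofactor ?N k j = r j * cofactor M k j" using j k by (simp add: cofactor_def)
  qed
  finally show ?thesis .
qed

text \<open>By the Leibniz rule, the terms in which \<open>D\<close> meets row \<open>k\<close> form
  the determinant with row \<open>k\<close> replaced by its derivative.\<close>

lemma derivation_det:
  fixes D :: "'a::comm_ring_1 \<Rightarrow> 'a"
  assumes M: "M \<in> carrier_mat n n" and D_add: "\<And>a b. D (a + b) = D a + D b" and D_mult: "\<And>a b. D (a * b) = D a * b + a * D b"
  shows "D (det M) = (\<Sum>i<n. \<Sum>j<n. D (M $$ (i, j)) * cofactor M i j)"
proof -
  have D0: "D 0 = 0" using D_add[of 0 0] by simp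
  have D1: "D 1 = 0" using D_mult[of 1 1] by simp
  have Dm: "D (- a) = - D a" for a using minus_unique[of "D a" "D (- a)"] D_add[of a "- a"] D0 by simp
  have Ds: "D (sum f A) = (\<Sum>i\<in>A. D (f i))" for f and A :: "'b set"
    by (induction A rule: infinite_finite_induct) (auto simp: D0 D_add)
  have Dsg: "D (of_int (sign \<sigma>)) = 0" for \<sigma> :: "nat \<Rightarrow> nat" using D1 Dm[of 1] by (auto simp: sign_def)
  have Dp: "D (prod f A) = (\<Sum>k\<in>A. D (f k) * prod f (A - {k}))" if "finite A" for f and A :: "nat set"
    using that
  proof (induction A rule: finite_induct)
    case (insert x A)
    have "(\<Sum>k\<in>A. D (f k) * prod f (insert x A - {k})) = (\<Sum>k\<in>A. f x * (D (f k) * prod f (A - {k})))"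
    proof (rule sum.cong[OF refl])
      fix k assume k: "k \<in> A"
      then have "insert x A - {k} = insert x (A - {k})" using insert by auto
      then show "D (f k) * prod f (insert x A - {k}) = f x * (D (f k) * prod f (A - {k}))"
        using insert by (simp add: algebra_simps)
    qed
    then show ?case using insert by (simp add: D_mult sum_distrib_left)
  qed (simp add: D1)
  have perms: "{0..<n} = {..<n}" by auto
  have "D (det M) = (\<Sum>\<sigma> | \<sigma> permutes {..<n}. of_int (sign \<sigma>) * (\<Sum>k<n. D (M $$ (k, \<sigma> k)) * (\<Prod>i\<in>{..<n} - {k}. M $$ (i, \<sigma> i))))"
    unfolding det_def'[OF M] Ds perms D_mult Dsg Dp[OF finite_lessThan] by simp
  also have "\<dots> = (\<Sum>k<n. \<Sum>\<sigma> | \<sigma> permutes {..<n}. of_int (sign \<sigma>) * (D (M $$ (k, \<sigma> k)) * (\<Prod>i\<in>{..<n} - {k}. M $$ (i, \<sigma> i))))"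
    unfolding sum_distrib_left by (rule sum.swap)
  also have "\<dots> = (\<Sum>k<n. det (mat n n (\<lambda>(i, j). if i = k then D (M $$ (k, j)) else M $$ (i, j))))"
  proof (rule sum.cong[OF refl])
    fix k assume "k \<in> {..<n}"
    then have k: "k < n" by simp
    let ?N = "mat n n (\<lambda>(i, j). if i = k then D (M $$ (k, j)) else M $$ (i, j))"
    have "det ?N = (\<Sum>\<sigma> | \<sigma> permutes {..<n}. of_int (sign \<sigma>) * (\<Prod>i<n. ?N $$ (i, \<sigma> i)))"
      by (subst det_def'[of _ n]) (auto simp: perms)
    also have "\<dots> = (\<Sum>\<sigma> | \<sigma> permutes {..<n}. of_int (sign \<sigma>) * (D (M $$ (k, \<sigma> k)) * (\<Prod>i\<in>{..<n} - {k}. M $$ (i, \<sigma> i))))"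
    proof (intro sum.cong refl arg_cong2[where f = "(*)"])
      fix \<sigma> assume "\<sigma> \<in> {\<sigma>. \<sigma> permutes {..<n}}"
      then have lt: "\<sigma> i < n" if "i < n" for i using permutes_in_image[of \<sigma> "{..<n}" i] that by simp
      have "(\<Prod>i<n. ?N $$ (i, \<sigma> i)) = ?N $$ (k, \<sigma> k) * (\<Prod>i\<in>{..<n} - {k}. ?N $$ (i, \<sigma> i))"
        using k by (intro prod.remove) auto
      also have "(\<Prod>i\<in>{..<n} - {k}. ?N $$ (i, \<sigma> i)) = (\<Prod>i\<in>{..<n} - {k}. M $$ (i, \<sigma> i))"
        by (rule prod.cong) (use lt in auto)
      finally show "(\<Prod>i<n. ?N $$ (i, \<sigma> i)) = D (M $$ (k, \<sigma> k)) * (\<Prod>i\<in>{..<n} - {k}. M $$ (i, \<sigma> i))"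
        using k lt by simp
    qed
    finally show "(\<Sum>\<sigma> | \<sigma> permutes {..<n}. of_int (sign \<sigma>) * (D (M $$ (k, \<sigma> k)) * (\<Prod>i\<in>{..<n} - {k}. M $$ (i, \<sigma> i)))) = det ?N" by simp
  qed
  also have "\<dots> = (\<Sum>k<n. \<Sum>j<n. D (M $$ (k, j)) * cofactor M k j)"
    using det_replace_row[OF M] by simp
  finally show ?thesis .
qed

lemma homog_det:
  assumes M: "M \<in> carrier_mat m m" and h: "\<And>i j. i < m \<Longrightarrow> j < m \<Longrightarrow> homog 1 (M $$ (i, j))"
  shows "homog m (det M)"
  unfolding det_def'[OF M]
proof (rule homog_sum)
  fix \<sigma> assume "\<sigma> \<in> {\<sigma>. \<sigma> permutes {0..<m}}"
  then have lt: "\<sigma> i < m" if "i < m" for i using permutes_in_image[of \<sigma> "{0..<m}" i] that by simp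
  have "homog (\<Sum>i\<in>{0..<m}. 1) (\<Prod>i = 0..<m. M $$ (i, \<sigma> i))"
    by (rule homog_prod) (use h lt in auto)
  then have "homog m (\<Prod>i = 0..<m. M $$ (i, \<sigma> i))" by simp
  then show "homog m (of_int (sign \<sigma>) * (\<Prod>i = 0..<m. M $$ (i, \<sigma> i)))"
    by (auto simp: sign_def intro: homog_uminus)
qed

lemma ev_det: "ev (det M) x = det (map_mat (\<lambda>f. ev f x) M)"
proof -
  interpret comm_ring_hom "\<lambda>f. ev f x" by unfold_locales auto
  show ?thesis by simp
qed

lemma polys_det: assumes "M \<in> carrier_mat m m" "\<And>i j. i < m \<Longrightarrow> j < m \<Longrightarrow> M $$ (i, j) \<in> polys n" shows "det M \<in> polys n"
proof -
  have "of_int k \<in> polys n" for k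
    by (cases k rule: int_diff_cases) (metis ev_inject_fun ev_of_int ev_simps(6) of_int_of_nat_eq polys_K of_int_diff)
  then show ?thesis unfolding det_def'[OF assms(1)]
  proof (intro polys_sum polys_mult polys_prod)
    fix \<sigma> i assume "\<sigma> \<in> {\<sigma>. \<sigma> permutes {0..<m}}" "i \<in> {0..<m}"
    then show "M $$ (i, \<sigma> i) \<in> polys n" using permutes_in_image[of \<sigma> "{0..<m}" i] assms(2) by simp
  qed
qed

section \<open>Lie algebras of index one\<close>

instance mp :: ring_char_0
proof
  show "inj (of_nat :: nat \<Rightarrow> mp)" by (rule injI) (metis ev_of_nat of_nat_eq_iff)
qed

text \<open>A kernel vector on which the border vanishes extends by 0 to a kernel vector of the
  bordered matrix.\<close>

lemma bord_kernel:
  fixes A :: "'a::idom mat"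
  assumes A: "A \<in> carrier_mat n n" and d: "det (bord n A e) \<noteq> 0"
    and h: "\<And>i. i < n \<Longrightarrow> (\<Sum>j<n. A $$ (i, j) * h j) = 0" and eh: "(\<Sum>j<n. e j * h j) = 0" and i: "i < n"
  shows "h i = 0"
proof -
  let ?v = "Matrix.vec (Suc n) (\<lambda>i. if i < n then h i else 0)"
  have "bord n A e *\<^sub>v ?v = 0\<^sub>v (Suc n)"
  proof (rule eq_vecI)
    fix i assume "i < dim_vec (0\<^sub>v (Suc n) :: 'a Matrix.vec)"
    then have i: "i < Suc n" by simp
    have "(bord n A e *\<^sub>v ?v) $ i = (\<Sum>j<n. bord n A e $$ (i, j) * h j)"
      using i by (simp add: scalar_prod_def bord_def atLeast0LessThan)
    also have "\<dots> = 0"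
    proof (cases "i < n")
      case True
      then show ?thesis using h[OF True] by (simp add: bord_def)
    next
      case False
      then have "(\<Sum>j<n. bord n A e $$ (i, j) * h j) = - (\<Sum>j<n. e j * h j)"
        unfolding sum_negf[symmetric] by (intro sum.cong) (use i in \<open>auto simp: bord_def\<close>)
      then show ?thesis using eh by simp
    qed
    finally show "(bord n A e *\<^sub>v ?v) $ i = 0\<^sub>v (Suc n) $ i" using i by simp
  qed (simp add: bord_def)
  then have "?v = 0\<^sub>v (Suc n)" using d det_0_iff_vec_prod_zero[OF bord_carrier, of n A e] vec_carrier by blast
  then have "?v $ i = 0\<^sub>v (Suc n) $ i" by (simp only:)
  then show ?thesis using i by simp
qed

lemma PM_skew: assumes "lie_sc n c" "i < n" "j < n" shows "PM n c j i = - PM n c i j"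
proof -
  have "c j i k = - c i j k" if "k < n" for k
    using assms that unfolding lie_sc_def by blast
  then have "mconst (c j i k) * mvar k = - (mconst (c i j k) * mvar k)" if "k < n" for k
    using that by (simp add: mconst_hom)
  then show ?thesis unfolding PM_def sum_negf[symmetric] by (intro sum.cong) auto
qed

definition AM :: "nat \<Rightarrow> (nat \<Rightarrow> nat \<Rightarrow> nat \<Rightarrow> complex) \<Rightarrow> mp mat" where
  "AM n c = mat n n (\<lambda>(i, j). PM n c i j)"

lemma AM_carrier [simp]: "AM n c \<in> carrier_mat n n" by (simp add: AM_def)
lemma AM_index [simp]: "i < n \<Longrightarrow> j < n \<Longrightarrow> AM n c $$ (i, j) = PM n c i j" by (simp add: AM_def)
lemma Amat_carrier [simp]: "Amat n c x \<in> carrier_mat n n" by (simp add: Amat_def)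
lemma ev_PM: "ev (PM n c i j) x = (\<Sum>k<n. c i j k * x k)" by (simp add: PM_def)
lemma Amat_index: "i < n \<Longrightarrow> j < n \<Longrightarrow> Amat n c x $$ (i, j) = ev (PM n c i j) x" by (simp add: Amat_def ev_PM)
lemma map_AM: "map_mat (\<lambda>f. ev f x) (AM n c) = Amat n c x"
  by (rule eq_matI) (auto simp: AM_def Amat_def ev_PM)

lemma map_bord: "A \<in> carrier_mat n n \<Longrightarrow> map_mat (\<lambda>f. ev f x) (bord n A e) = bord n (map_mat (\<lambda>f. ev f x) A) (\<lambda>i. ev (e i) x)"
  by (rule eq_matI) (auto simp: bord_def)

text \<open>The Jacobi identity says that the structure matrix transforms as a bilinear form.\<close>

lemma ham_PM:
  assumes lie: "lie_sc n c" and l: "l < n" and i: "i < n" and j: "j < n"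
  shows "ham n c l (PM n c i j) = (\<Sum>m<n. mconst (c l i m) * PM n c m j) + (\<Sum>m<n. mconst (c l j m) * PM n c i m)"
proof (rule ev_inject_fun)
  fix x
  have sk: "\<And>i j k. i < n \<Longrightarrow> j < n \<Longrightarrow> k < n \<Longrightarrow> c i j k = - c j i k"
    and jac: "\<And>i j l s. i < n \<Longrightarrow> j < n \<Longrightarrow> l < n \<Longrightarrow> s < n \<Longrightarrow>
      (\<Sum>m<n. c i j m * c m l s + c j l m * c m i s + c l i m * c m j s) = 0"
    using lie unfolding lie_sc_def by blast+
  have "ham n c l (PM n c i j) = (\<Sum>k<n. mconst (c i j k) * PM n c l k)"
    unfolding PM_def[of n c i j] ham_sum ham_mconst_mult by (intro sum.cong refl) (simp add: ham_mvar)
  then have "ev (ham n c l (PM n c i j)) x = (\<Sum>k<n. c i j k * (\<Sum>s<n. c l k s * x s))" by (simp add: ev_PM)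
  also have "\<dots> = (\<Sum>s<n. (\<Sum>m<n. c i j m * c l m s) * x s)"
    unfolding sum_distrib_left sum_distrib_right by (subst sum.swap) (simp add: mult.assoc)
  also have "\<dots> = (\<Sum>s<n. (\<Sum>m<n. c l i m * c m j s) * x s + (\<Sum>m<n. c l j m * c i m s) * x s)"
  proof (rule sum.cong[OF refl])
    fix s assume "s \<in> {..<n}"
    then have s: "s < n" by simp
    have "c i j m * c l m s = - (c i j m * c m l s)" "c l j m * c i m s = c j l m * c m i s" if "m < n" for m
      using sk[OF l that s] sk[OF l j that] sk[OF i that s] by simp_all
    then have "(\<Sum>m<n. c i j m * c l m s) = - (\<Sum>m<n. c i j m * c m l s)"
      "(\<Sum>m<n. c l j m * c i m s) = (\<Sum>m<n. c j l m * c m i s)"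
      by (auto simp: sum_negf[symmetric] intro!: sum.cong)
    moreover have "(\<Sum>m<n. c i j m * c m l s) + (\<Sum>m<n. c j l m * c m i s) + (\<Sum>m<n. c l i m * c m j s) = 0"
      using jac[OF i j l s] by (simp add: sum.distrib)
    ultimately have "(\<Sum>m<n. c i j m * c l m s) = (\<Sum>m<n. c l i m * c m j s) + (\<Sum>m<n. c l j m * c i m s)"
    proof -
      assume *: "(\<Sum>m<n. c i j m * c l m s) = - (\<Sum>m<n. c i j m * c m l s)"
        "(\<Sum>m<n. c l j m * c i m s) = (\<Sum>m<n. c j l m * c m i s)"
        "(\<Sum>m<n. c i j m * c m l s) + (\<Sum>m<n. c j l m * c m i s) + (\<Sum>m<n. c l i m * c m j s) = 0"
      have "- a = z + y" if "a + y + z = 0" for a y z :: complex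
        using that by (simp add: neg_eq_iff_add_eq_0 ac_simps)
      from this[OF *(3)] show ?thesis using *(1,2) by simp
    qed
    then show "(\<Sum>m<n. c i j m * c l m s) * x s = (\<Sum>m<n. c l i m * c m j s) * x s + (\<Sum>m<n. c l j m * c i m s) * x s"
      by (simp add: distrib_right)
  qed
  also have "\<dots> = (\<Sum>m<n. c l i m * (\<Sum>s<n. c m j s * x s)) + (\<Sum>m<n. c l j m * (\<Sum>s<n. c i m s * x s))"
    unfolding sum.distrib sum_distrib_left sum_distrib_right
    by (rule arg_cong2[where f = "(+)"]; subst sum.swap; simp add: mult.assoc)
  finally show "ev (ham n c l (PM n c i j)) x = ev ((\<Sum>m<n. mconst (c l i m) * PM n c m j) + (\<Sum>m<n. mconst (c l j m) * PM n c i m)) x"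
    by (simp add: ev_PM)
qed

locale index_one =
  fixes n :: nat and c :: "nat \<Rightarrow> nat \<Rightarrow> nat \<Rightarrow> complex"
  assumes lie: "lie_sc n c" and ind: "lie_index n c = 1"
begin

lemma n_pos: "n \<ge> 1" using ind by (auto simp: lie_index_def)

lemma rank_facts:
  "\<exists>x. vec_space.rank n (Amat n c x) = n - 1" "vec_space.rank n (Amat n c x) \<le> n - 1"
proof -
  let ?r = "\<lambda>x. vec_space.rank n (Amat n c x)"
  have le: "?r x \<le> n" for x using vec_space.rank_le_nc[of "Amat n c x" n n] by simp
  have fin: "finite (range ?r)" by (rule finite_subset[of _ "{..n}"]) (use le in auto)
  have M: "Max (range ?r) = n - 1" using ind by (simp add: lie_index_def)
  have "Max (range ?r) \<in> range ?r" by (rule Max_in[OF fin]) auto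
  then show "\<exists>x. ?r x = n - 1" using M by auto
  show "?r x \<le> n - 1" using Max_ge[OF fin, of "?r x"] M by simp
qed

lemma det_Amat: "det (Amat n c x) = 0"
  using rank_facts(2)[of x] vec_space.det_rank_iff[OF Amat_carrier, of n c x] n_pos by auto

lemma det_AM: "det (AM n c) = 0"
  by (rule ev_inject_fun) (simp add: ev_det map_AM det_Amat)

lemma PM_sk: "i < n \<Longrightarrow> j < n \<Longrightarrow> PM n c j i = - PM n c i j" using PM_skew[OF lie] .

text \<open>At a point of maximal rank choose a coordinate \<open>i0\<close> in which a kernel
  vector is nonzero and border by that unit vector. The bordered matrix is nonsingular there, so its
  determinant is a nonzero polynomial.\<close>

lemma ex_bord: "\<exists>e. det (bord n (AM n c) (\<lambda>i. mconst (e i))) \<noteq> 0"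
proof -
  obtain x where x: "vec_space.rank n (Amat n c x) = n - 1" using rank_facts(1) by blast
  obtain v where v: "v \<in> carrier_vec n" "v \<noteq> 0\<^sub>v n" "Amat n c x *\<^sub>v v = 0\<^sub>v n"
    using det_0_iff_vec_prod_zero_field[OF Amat_carrier, of n c x] det_Amat by blast
  have "\<exists>i<n. v $ i \<noteq> 0"
  proof (rule ccontr)
    assume "\<not> ?thesis"
    then have "v = 0\<^sub>v n" using v(1) by (intro eq_vecI) auto
    then show False using v(2) by simp
  qed
  then obtain i0 where i0: "i0 < n" "v $ i0 \<noteq> 0" by blast
  define e where "e i = (if i = i0 then 1 else (0::complex))" for i
  have esum: "(\<Sum>i<n. e i * g i) = g i0" for g :: "nat \<Rightarrow> complex"
    using i0 by (simp add: e_def if_distrib[of "\<lambda>a. a * _"] sum.delta cong: if_cong)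
  let ?A = "Amat n c x" and ?B = "bord n (Amat n c x) e"
  have Av: "(\<Sum>j<n. ?A $$ (i, j) * v $ j) = 0" if "i < n" for i
  proof -
    have "(?A *\<^sub>v v) $ i = (\<Sum>j<n. ?A $$ (i, j) * v $ j)"
      using that v(1) carrier_matD[OF Amat_carrier, of n c x] by (simp add: scalar_prod_def atLeast0LessThan)
    then show ?thesis using v(3) that by simp
  qed
  have Ask: "?A $$ (j, i) = - ?A $$ (i, j)" if "i < n" "j < n" for i j
    using that PM_sk[OF that] by (simp add: Amat_index)
  have "det ?B \<noteq> 0"
  proof
    assume "det ?B = 0"
    then obtain u where u: "u \<in> carrier_vec (Suc n)" "u \<noteq> 0\<^sub>v (Suc n)" "?B *\<^sub>v u = 0\<^sub>v (Suc n)"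
      using det_0_iff_vec_prod_zero_field[OF bord_carrier, of n ?A e] by blast
    have Bu: "(\<Sum>j<Suc n. ?B $$ (i, j) * u $ j) = 0" if "i < Suc n" for i
    proof -
      have "(?B *\<^sub>v u) $ i = (\<Sum>j<Suc n. ?B $$ (i, j) * u $ j)"
        using that u(1) carrier_matD[OF bord_carrier, of n ?A e] by (simp add: scalar_prod_def atLeast0LessThan)
      then show ?thesis using u(3) that by simp
    qed
    have top: "(\<Sum>j<n. ?A $$ (i, j) * u $ j) + e i * u $ n = 0" if "i < n" for i
      using Bu[of i] that by (simp add: bord_def)
    have bot: "u $ i0 = 0"
      using Bu[of n] esum[of "\<lambda>j. u $ j"] by (simp add: bord_def sum_negf)
    \<comment> \<open>Pairing the upper equations with \<open>v\<close> removes the part with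
      \<open>A\<close>, by skewness, and leaves \<open>v $ i0 * u $ n = 0\<close>.\<close>
    have "(\<Sum>i<n. v $ i * ((\<Sum>j<n. ?A $$ (i, j) * u $ j) + e i * u $ n)) = 0" using top by simp
    moreover have "(\<Sum>i<n. v $ i * (\<Sum>j<n. ?A $$ (i, j) * u $ j)) = (\<Sum>j<n. - u $ j * (\<Sum>i<n. ?A $$ (j, i) * v $ i))"
      unfolding sum_distrib_left
    proof (subst sum.swap, intro sum.cong refl)
      fix i j assume "i \<in> {..<n}" "j \<in> {..<n}"
      then show "v $ j * (?A $$ (j, i) * u $ i) = - u $ i * (?A $$ (i, j) * v $ j)" using Ask[of i j] by simp
    qed
    moreover have "(\<Sum>i<n. v $ i * (e i * u $ n)) = v $ i0 * u $ n"
      using esum[of "\<lambda>i. v $ i * u $ n"] by (simp add: ac_simps)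
    ultimately have "v $ i0 * u $ n = 0" using Av by (simp add: distrib_left sum.distrib)
    then have un: "u $ n = 0" using i0 by simp
    let ?w = "Matrix.vec n (\<lambda>i. u $ i)"
    have "?A *\<^sub>v ?w = 0\<^sub>v n"
    proof (rule eq_vecI)
      fix i assume "i < dim_vec (0\<^sub>v n :: complex Matrix.vec)"
      then show "(?A *\<^sub>v ?w) $ i = 0\<^sub>v n $ i" using top[of i] un carrier_matD[OF Amat_carrier, of n c x]
        by (simp add: scalar_prod_def atLeast0LessThan)
    qed (simp add: Amat_def)
    then obtain a where a: "?w = a \<cdot>\<^sub>v v"
      using rank_pred_kernel[OF Amat_carrier x n_pos v(1,3,2)] vec_carrier by blast
    have "?w $ i0 = a * v $ i0" unfolding a using i0 v(1) by simp
    then have "a = 0" using bot i0 by simp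
    then have "u $ i = 0" if "i < n" for i
      using a that v(1) by (metis index_smult_vec(1) carrier_vecD index_vec mult_zero_left)
    then have "u $ i = 0" if "i < Suc n" for i using un that less_antisym by blast
    then have "u = 0\<^sub>v (Suc n)" using u(1) by (intro eq_vecI) auto
    then show False using u(2) by simp
  qed
  then have "ev (det (bord n (AM n c) (\<lambda>i. mconst (e i)))) x \<noteq> 0" by (simp add: ev_det map_bord map_AM)
  then show ?thesis by (intro exI[of _ e]) auto
qed

text \<open>With \<open>E\<close> the linear functional of a nonsingular border,
  \<open>E g * h - E h * g\<close> lies in the kernel and in the zero set of \<open>E\<close>, hence
  vanishes: the kernel has rank one over the fractions.\<close>

lemma kernel_parallel:
  assumes g: "\<And>i. i < n \<Longrightarrow> (\<Sum>j<n. PM n c i j * g j) = 0" and h: "\<And>i. i < n \<Longrightarrow> (\<Sum>j<n. PM n c i j * h j) = 0"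
    and ij: "i < n" "j < n"
  shows "g i * h j = g j * h i"
proof -
  obtain e where e: "det (bord n (AM n c) (\<lambda>i. mconst (e i))) \<noteq> 0" using ex_bord by blast
  define E where "E f = (\<Sum>j<n. mconst (e j) * f j)" for f :: "nat \<Rightarrow> mp"
  have ker0: "f i = 0" if "\<And>i. i < n \<Longrightarrow> (\<Sum>j<n. PM n c i j * f j) = 0" "E f = 0" "i < n" for f i
    by (rule bord_kernel[OF AM_carrier e]) (use that in \<open>auto simp: E_def\<close>)
  have par: "E g * h i = E h * g i" if i: "i < n" for i
  proof -
    define y where "y j = E g * h j - E h * g j" for j
    have "(\<Sum>j<n. PM n c i j * y j) = E g * (\<Sum>j<n. PM n c i j * h j) - E h * (\<Sum>j<n. PM n c i j * g j)" for i
      by (simp add: y_def sum_distrib_left sum_subtractf algebra_simps)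
    then have "(\<Sum>j<n. PM n c i j * y j) = 0" if "i < n" for i using g[OF that] h[OF that] by simp
    moreover have "E (\<lambda>j. a * h j - b * g j) = a * E h - b * E g" for a b
      by (simp add: E_def sum_distrib_left sum_subtractf algebra_simps)
    then have "E y = E g * E h - E h * E g" unfolding y_def .
    ultimately have "y i = 0" using ker0[of y i] i by simp
    then show ?thesis by (simp add: y_def)
  qed
  show ?thesis
  proof (cases "E g = 0")
    case True
    then have "g i = 0" "g j = 0" using ker0[of g] g ij by auto
    then show ?thesis by simp
  next
    case False
    have "E g * (g i * h j) = E g * (g j * h i)"
    proof -
      have "E g * (g i * h j) = g i * (E g * h j)" by (simp add: ac_simps)
      also have "\<dots> = g i * (E h * g j)" by (simp only: par[OF ij(2)])
      also have "\<dots> = g j * (E h * g i)" by (simp add: ac_simps)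
      also have "\<dots> = g j * (E g * h i)" by (simp only: par[OF ij(1)])
      finally show ?thesis by (simp add: ac_simps)
    qed
    then show ?thesis using False by simp
  qed
qed

text \<open>The rows of the cofactor matrix lie in the kernel, so they are multiples
  \<open>r i\<close> of one primitive vector \<open>Q\<close>; symmetry of the cofactors makes
  \<open>r\<close> proportional to \<open>Q\<close> as well. The degrees follow because the
  cofactors are minors of order \<open>n - 1\<close> with linear entries.\<close>

theorem kernel_structure:
  obtains Q k m e where "\<And>i. i < n \<Longrightarrow> Q i \<in> polys n" "k \<in> polys n" "coprime_family n Q"
    "\<And>i. i < n \<Longrightarrow> (\<Sum>j<n. PM n c i j * Q j) = 0" "k \<noteq> 0"
    "\<And>i j. i < n \<Longrightarrow> j < n \<Longrightarrow> cofactor (AM n c) i j = k * Q i * Q j" "odd n"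
    "homog e k" "\<And>i. i < n \<Longrightarrow> homog m (Q i)" "e + 2 * m = n - 1"
proof -
  let ?A = "AM n c"
  let ?a = "\<lambda>i j. cofactor ?A i j"
  have adj: "(\<Sum>j<n. PM n c i j * ?a l j) = 0" if "i < n" "l < n" for i l
  proof -
    have "(?A * adj_mat ?A) $$ (i, l) = (\<Sum>j<n. ?A $$ (i, j) * adj_mat ?A $$ (j, l))"
      using mult_index[OF AM_carrier adj_mat(1)[OF AM_carrier] that] .
    moreover have "\<dots> = (\<Sum>j<n. PM n c i j * ?a l j)"
      by (intro sum.cong refl) (use that in \<open>simp add: adj_mat_def AM_def\<close>)
    ultimately show ?thesis using adj_mat(2)[OF AM_carrier, of n c] det_AM that by simp
  qed
  obtain e0 where "det (bord n ?A (\<lambda>i. mconst (e0 i))) \<noteq> 0" using ex_bord by blast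
  then have "(\<Sum>i<n. \<Sum>j<n. mconst (e0 i) * mconst (e0 j) * ?a i j) \<noteq> 0"
    unfolding det_bord[OF AM_carrier n_pos] .
  then have "\<exists>i<n. \<exists>j<n. ?a i j \<noteq> 0"
  proof (rule contrapos_np)
    assume "\<not> (\<exists>i<n. \<exists>j<n. ?a i j \<noteq> 0)"
    then show "(\<Sum>i<n. \<Sum>j<n. mconst (e0 i) * mconst (e0 j) * ?a i j) = 0" by (intro sum.neutral ballI) auto
  qed
  then obtain i0 j0 where ij0: "i0 < n" "j0 < n" "?a i0 j0 \<noteq> 0" by blast
  have ex: "\<exists>j<n. ?a i0 j \<noteq> 0" using ij0 by blast
  obtain d Q where dQ: "d \<noteq> 0" "\<forall>j<n. ?a i0 j = d * Q j" "coprime_family n Q"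
    using coprime_family_ex[OF ex] by blast
  have AQ: "(\<Sum>j<n. PM n c i j * Q j) = 0" if "i < n" for i
  proof -
    have "d * (\<Sum>j<n. PM n c i j * Q j) = (\<Sum>j<n. PM n c i j * ?a i0 j)"
      unfolding sum_distrib_left by (intro sum.cong refl) (use dQ in \<open>simp add: algebra_simps\<close>)
    then show ?thesis using adj[OF that ij0(1)] dQ(1) by simp
  qed
  have "\<exists>r. \<forall>j<n. ?a l j = r * Q j" if "l < n" for l
    by (rule parallel_coprime[OF dQ(3)]) (rule kernel_parallel[OF AQ adj[OF _ that]])
  then obtain r where r: "\<And>l j. l < n \<Longrightarrow> j < n \<Longrightarrow> ?a l j = r l * Q j" by metis
  have sym: "?a j i = (-1) ^ (n - 1) * ?a i j" if "i < n" "j < n" for i j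
    by (rule cofactor_skew[OF AM_carrier _ that]) (simp only: AM_index, rule PM_sk)
  \<comment> \<open>For even \<open>n\<close> the cofactors \<open>r i * Q j\<close> would form a
    skew matrix; its zero diagonal then contradicts the nonzero entry at
    \<open>(i0, j0)\<close>.\<close>
  have oddn: "odd n"
  proof (rule ccontr)
    assume "\<not> odd n"
    then have "odd (n - 1)" using n_pos by auto
    then have sk: "r j * Q i = - (r i * Q j)" if "i < n" "j < n" for i j
      using sym[OF that] r that by simp
    have rq: "r i * Q i = 0" if "i < n" for i using sk[OF that that] by (simp add: eq_neg_iff_add_eq_0 flip: mult_2)
    have Qj0: "Q j0 \<noteq> 0" and ri0: "r i0 \<noteq> 0" using ij0 r by auto
    then have "r j0 = 0" "Q i0 = 0" using rq[OF ij0(2)] rq[OF ij0(1)] by auto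
    then show False using sk[OF ij0(1,2)] Qj0 ri0 by simp
  qed
  then have "even (n - 1)" by simp
  then have sym': "r j * Q i = r i * Q j" if "i < n" "j < n" for i j
    using sym[OF that] r that by simp
  have "\<exists>k. \<forall>i<n. r i = k * Q i"
    by (rule parallel_coprime[OF dQ(3)]) (use sym' in \<open>simp add: mult.commute\<close>)
  then obtain k where k: "\<And>i. i < n \<Longrightarrow> r i = k * Q i" by blast
  have cof: "?a i j = k * Q i * Q j" if "i < n" "j < n" for i j using r k that by simp
  have k0: "k \<noteq> 0" and Q0: "Q i0 \<noteq> 0" using cof ij0 by auto
  have dim: "mat_delete ?A i j \<in> carrier_mat (n - 1) (n - 1)" for i j by (rule mat_delete_carrier[OF AM_carrier])
  have ent: "\<exists>i' j'. i' < n \<and> j' < n \<and> mat_delete ?A i j $$ (a, b) = PM n c i' j'" if "a < n - 1" "b < n - 1" for i j a b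
    using that by (intro exI[of _ "if a < i then a else Suc a"] exI[of _ "if b < j then b else Suc b"]) (auto simp: mat_delete_def AM_def)
  have hom: "homog (n - 1) (?a i j)" for i j
  proof -
    have "homog (n - 1) (det (mat_delete ?A i j))"
      by (rule homog_det[OF dim]) (use ent homog_PM in metis)
    then show ?thesis unfolding cofactor_def by (cases "even (i + j)") (auto intro: homog_uminus)
  qed
  have pol: "?a i j \<in> polys n" for i j
  proof -
    have "det (mat_delete ?A i j) \<in> polys n"
      by (rule polys_det[OF dim]) (use ent PM_polys in metis)
    then show ?thesis unfolding cofactor_def by (cases "even (i + j)") auto
  qed
  have aQ: "?a i i = k * (Q i * Q i)" if "i < n" for i using cof[OF that that] by simp
  have Qp: "Q i \<in> polys n" if "i < n" for i
  proof (cases "Q i = 0")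
    case False
    show ?thesis by (rule polys_factor[OF pol[of i i]]) (use aQ[OF that] k0 False in auto)
  qed simp
  have kp: "k \<in> polys n" by (rule polys_factor[OF pol[of i0 i0]]) (use aQ[OF ij0(1)] k0 Q0 in auto)
  obtain e where e: "e \<le> n - 1" "homog e k" "homog (n - 1 - e) (Q i0 * Q i0)"
    using homog_factor[of "n - 1" k "Q i0 * Q i0"] hom[of i0 i0] aQ[OF ij0(1)] k0 Q0 by auto
  \<comment> \<open>The degree of \<open>Q i\<close> is half of what \<open>k\<close> leaves of
    \<open>n - 1\<close>, hence the same for all nonzero \<open>Q i\<close>.\<close>
  have half: "\<exists>m. homog m (Q i) \<and> e + 2 * m = n - 1" if i: "i < n" "Q i \<noteq> 0" for i
  proof -
    have "homog (n - 1) (k * (Q i * Q i))" using hom[of i i] aQ[OF i(1)] by simp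
    then obtain e' where e': "e' \<le> n - 1" "homog e' k" "homog (n - 1 - e') (Q i * Q i)"
      using homog_factor[of "n - 1" k "Q i * Q i"] k0 i by auto
    then have "e' = e" using homog_unique e k0 by blast
    obtain b where b: "b \<le> n - 1 - e" "homog b (Q i)" "homog (n - 1 - e - b) (Q i)"
      using homog_factor[of "n - 1 - e" "Q i" "Q i"] e' \<open>e' = e\<close> i by auto
    then have "b = n - 1 - e - b" using homog_unique i by blast
    then show ?thesis using b e(1) by (intro exI[of _ b]) auto
  qed
  obtain m where m: "e + 2 * m = n - 1" using half[OF ij0(1) Q0] by blast
  have "homog m (Q i)" if "i < n" for i
  proof (cases "Q i = 0")
    case False
    then obtain m' where "homog m' (Q i)" "e + 2 * m' = n - 1" using half[OF \<open>i < n\<close>] by blast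
    moreover then have "m' = m" using m by simp
    ultimately show ?thesis by simp
  qed simp
  then show ?thesis using that Qp kp dQ(3) AQ k0 cof oddn e(2) m by blast
qed

end

text \<open>\<open>Q\<close> is the primitive kernel vector of the structure matrix, and \<open>k\<close> will turn out to be \<open>p\<^sup>2\<close> up to a scalar.\<close>

locale index_one_kernel = index_one +
  fixes Q :: "nat \<Rightarrow> mp" and k :: mp and m e :: nat
  assumes Q_polys: "\<And>i. i < n \<Longrightarrow> Q i \<in> polys n" and k_polys: "k \<in> polys n" and Q_cop: "coprime_family n Q"
    and AQ: "\<And>i. i < n \<Longrightarrow> (\<Sum>j<n. PM n c i j * Q j) = 0" and k_nz: "k \<noteq> 0"
    and cof: "\<And>i j. i < n \<Longrightarrow> j < n \<Longrightarrow> cofactor (AM n c) i j = k * Q i * Q j" and n_odd: "odd n"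
    and k_homog: "homog e k" and Q_homog: "\<And>i. i < n \<Longrightarrow> homog m (Q i)" and degs: "e + 2 * m = n - 1"
begin

lemma Q_nonzero: "\<exists>i<n. Q i \<noteq> 0"
proof (rule ccontr)
  assume "\<not> ?thesis"
  then have "\<forall>i<n. 0 dvd Q i" by auto
  then have "(0::mp) dvd 1" using Q_cop unfolding coprime_family_def by blast
  then show False by simp
qed

text \<open>Cofactors of the form \<open>k * Q i * Q j\<close> turn the quadratic form of the border
  into a square.\<close>

lemma det_bord_AM: "det (bord n (AM n c) f) = k * (\<Sum>i<n. f i * Q i) ^ 2"
proof -
  have "det (bord n (AM n c) f) = (\<Sum>i<n. \<Sum>j<n. f i * f j * (k * Q i * Q j))"
    unfolding det_bord[OF AM_carrier n_pos] by (intro sum.cong refl) (simp add: cof)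
  also have "\<dots> = (\<Sum>i<n. \<Sum>j<n. k * ((f i * Q i) * (f j * Q j)))"
    by (intro sum.cong refl) (simp add: algebra_simps)
  also have "\<dots> = k * (\<Sum>i<n. \<Sum>j<n. (f i * Q i) * (f j * Q j))" by (simp only: sum_distrib_left)
  also have "\<dots> = k * ((\<Sum>i<n. f i * Q i) * (\<Sum>j<n. f j * Q j))" by (simp only: sum_product)
  finally show ?thesis by (simp add: power2_eq_square)
qed

text \<open>The bordered matrix transforms like the structure matrix up to its border, and the cofactors along the
  border are multiples of \<open>k\<close>; hence Jacobi's formula shows that \<open>k\<close> divides its own derivatives.\<close>

lemma k_dvd_ham: assumes l: "l < n" shows "k dvd ham n c l k"
proof (rule coprime_family_square_dvd[OF Q_cop k_nz])
  \<comment> \<open>Coprimality of the squares removes the factor \<open>Q i0 ^ 2\<close>, so each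
    border by a unit vector can be treated on its own.\<close>
  fix i0 assume i0: "i0 < n"
  show "k dvd ham n c l k * Q i0 ^ 2"
  proof (cases "Q i0 = 0")
    case False
    define f where "f i = (if i = i0 then 1 else (0::mp))" for i
    have fsum: "(\<Sum>i<n. f i * g i) = g i0" for g :: "nat \<Rightarrow> mp"
      using i0 by (simp add: f_def if_distrib[of "\<lambda>a. a * _"] sum.delta cong: if_cong)
    let ?M = "bord n (AM n c) f"
    have M: "?M \<in> carrier_mat (Suc n) (Suc n)" by simp
    have Mi: "?M $$ (i, j) = PM n c i j" "?M $$ (i, n) = f i" "?M $$ (n, j) = - f j" "?M $$ (n, n) = 0"
      if "i < n" "j < n" for i j using that by (auto simp: bord_def)
    have detM: "det ?M = k * Q i0 ^ 2" unfolding det_bord_AM fsum ..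
    have adj1: "(\<Sum>j<Suc n. ?M $$ (a, j) * cofactor ?M b j) = (if a = b then det ?M else 0)" if "a < Suc n" "b < Suc n" for a b
    proof -
      have "(?M * adj_mat ?M) $$ (a, b) = (\<Sum>j<Suc n. ?M $$ (a, j) * adj_mat ?M $$ (j, b))"
        by (rule mult_index[OF M adj_mat(1)[OF M] that])
      also have "\<dots> = (\<Sum>j<Suc n. ?M $$ (a, j) * cofactor ?M b j)"
        by (intro sum.cong refl) (use that in \<open>simp add: adj_mat_def bord_def\<close>)
      finally have "(?M * adj_mat ?M) $$ (a, b) = (\<Sum>j<Suc n. ?M $$ (a, j) * cofactor ?M b j)" .
      moreover have "(?M * adj_mat ?M) $$ (a, b) = (if a = b then det ?M else 0)"
        unfolding adj_mat(2)[OF M] using that by simp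
      ultimately show ?thesis by (simp only:)
    qed
    have adj2: "(\<Sum>i<Suc n. ?M $$ (i, a) * cofactor ?M i b) = (if a = b then det ?M else 0)" if "a < Suc n" "b < Suc n" for a b
    proof -
      have "(adj_mat ?M * ?M) $$ (b, a) = (\<Sum>i<Suc n. adj_mat ?M $$ (b, i) * ?M $$ (i, a))"
        by (rule mult_index[OF adj_mat(1)[OF M] M that(2,1)])
      also have "\<dots> = (\<Sum>i<Suc n. ?M $$ (i, a) * cofactor ?M i b)"
        by (intro sum.cong refl) (use that in \<open>simp add: adj_mat_def bord_def mult.commute\<close>)
      finally have "(adj_mat ?M * ?M) $$ (b, a) = (\<Sum>i<Suc n. ?M $$ (i, a) * cofactor ?M i b)" .
      moreover have "(adj_mat ?M * ?M) $$ (b, a) = (if a = b then det ?M else 0)"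
        unfolding adj_mat(3)[OF M] using that by simp
      ultimately show ?thesis by (simp only:)
    qed
    have QP: "(\<Sum>i<n. Q i * PM n c i j) = 0" if "j < n" for j
    proof -
      have "(\<Sum>i<n. Q i * PM n c i j) = - (\<Sum>i<n. PM n c j i * Q i)"
        unfolding sum_negf[symmetric]
      proof (intro sum.cong refl)
        fix i assume "i \<in> {..<n}"
        then show "Q i * PM n c i j = - (PM n c j i * Q i)" using PM_sk[of j i] that by (simp add: mult.commute)
      qed
      then show ?thesis using AQ[OF that] by simp
    qed
    \<comment> \<open>Contract the adjugate identity with \<open>Q\<close>: the part of the
      structure matrix vanishes and only the border term \<open>Q i0\<close> remains, which can be
      cancelled.\<close>
    have cof1: "cofactor ?M b n = k * Q i0 * Q b" if b: "b < n" for b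
    proof -
      have "det ?M * Q b = (\<Sum>i<n. Q i * (if i = b then det ?M else 0))" using b by (simp add: if_distrib sum.delta cong: if_cong)
      also have "\<dots> = (\<Sum>i<n. Q i * (\<Sum>j<Suc n. ?M $$ (i, j) * cofactor ?M b j))"
        by (intro sum.cong refl) (use adj1 b in simp)
      also have "\<dots> = (\<Sum>j<Suc n. (\<Sum>i<n. Q i * ?M $$ (i, j)) * cofactor ?M b j)"
        unfolding sum_distrib_left sum_distrib_right by (subst sum.swap) (simp add: mult.assoc)
      also have "\<dots> = (\<Sum>j<n. (\<Sum>i<n. Q i * ?M $$ (i, j)) * cofactor ?M b j) + (\<Sum>i<n. Q i * ?M $$ (i, n)) * cofactor ?M b n" by simp
      also have "(\<Sum>j<n. (\<Sum>i<n. Q i * ?M $$ (i, j)) * cofactor ?M b j) = 0"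
        by (intro sum.neutral) (use QP Mi(1) in simp)
      also have "(\<Sum>i<n. Q i * ?M $$ (i, n)) = Q i0"
        using fsum[of Q] Mi(2) by (simp add: mult.commute)
      finally have "Q i0 * cofactor ?M b n = det ?M * Q b" by simp
      also have "\<dots> = Q i0 * (k * Q i0 * Q b)" unfolding detM by (simp only: power2_eq_square ac_simps)
      finally have "Q i0 * cofactor ?M b n = Q i0 * (k * Q i0 * Q b)" .
      then show ?thesis using False mult_left_cancel by blast
    qed
    have cof2: "cofactor ?M n b = - (k * Q i0 * Q b)" if b: "b < n" for b
    proof -
      have "det ?M * Q b = (\<Sum>j<n. Q j * (if j = b then det ?M else 0))" using b by (simp add: if_distrib sum.delta cong: if_cong)
      also have "\<dots> = (\<Sum>j<n. Q j * (\<Sum>i<Suc n. ?M $$ (i, j) * cofactor ?M i b))"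
        by (intro sum.cong refl) (use adj2 b in simp)
      also have "\<dots> = (\<Sum>i<Suc n. (\<Sum>j<n. ?M $$ (i, j) * Q j) * cofactor ?M i b)"
        unfolding sum_distrib_left sum_distrib_right by (subst sum.swap) (simp add: ac_simps)
      also have "\<dots> = (\<Sum>i<n. (\<Sum>j<n. ?M $$ (i, j) * Q j) * cofactor ?M i b) + (\<Sum>j<n. ?M $$ (n, j) * Q j) * cofactor ?M n b" by simp
      also have "(\<Sum>i<n. (\<Sum>j<n. ?M $$ (i, j) * Q j) * cofactor ?M i b) = 0"
        by (intro sum.neutral) (use AQ Mi(1) in simp)
      also have "(\<Sum>j<n. ?M $$ (n, j) * Q j) = - Q i0"
        using fsum[of Q] Mi(3)[OF i0] by (simp add: sum_negf)
      finally have "Q i0 * cofactor ?M n b = Q i0 * (- (k * Q i0 * Q b))" unfolding detM by (simp add: power2_eq_square algebra_simps)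
      then show ?thesis using False by (simp only: mult_cancel_left) simp
    qed
    have kdet: "k dvd det ?M" unfolding detM by simp
    \<comment> \<open>Products of the structure matrix with cofactors reduce to
      \<open>det ?M\<close> and a border cofactor, both multiples of \<open>k\<close>.\<close>
    have d1: "k dvd (\<Sum>j<n. PM n c a j * cofactor ?M b j)" if "a < n" "b < n" for a b
    proof -
      have "(\<Sum>j<n. PM n c a j * cofactor ?M b j) = (if a = b then det ?M else 0) - f a * cofactor ?M b n"
        unfolding eq_diff_eq using adj1[of a b] that Mi by simp
      moreover have "k dvd f a * cofactor ?M b n" unfolding cof1[OF that(2)] by (simp add: dvd_mult)
      ultimately show ?thesis using kdet by (auto intro: dvd_diff)
    qed
    have d2: "k dvd (\<Sum>i<n. PM n c i a * cofactor ?M i b)" if "a < n" "b < n" for a b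
    proof -
      have "(\<Sum>i<n. PM n c i a * cofactor ?M i b) = (if a = b then det ?M else 0) + f a * cofactor ?M n b"
        unfolding diff_eq_eq[symmetric] using adj2[of a b] that Mi by simp
      moreover have "k dvd f a * cofactor ?M n b" unfolding cof2[OF that(2)] by (simp add: dvd_mult)
      ultimately show ?thesis using kdet by (auto intro: dvd_add)
    qed
    have Df: "ham n c l (f i) = 0" for i using ham_simps(2)[of n c l 1] by (simp add: f_def mconst_hom)
    have "ham n c l (det ?M) = (\<Sum>i<Suc n. \<Sum>j<Suc n. ham n c l (?M $$ (i, j)) * cofactor ?M i j)"
      by (rule derivation_det[OF M]) (simp_all add: ham_mult)
    also have "\<dots> = (\<Sum>i<n. \<Sum>j<n. ham n c l (PM n c i j) * cofactor ?M i j)"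
      using Mi Df i0 by simp
    also have "\<dots> = (\<Sum>i<n. \<Sum>j<n. \<Sum>a<n. mconst (c l i a) * (PM n c a j * cofactor ?M i j))
        + (\<Sum>i<n. \<Sum>j<n. \<Sum>a<n. mconst (c l j a) * (PM n c i a * cofactor ?M i j))"
      by (simp add: ham_PM[OF lie l] sum.distrib distrib_right sum_distrib_right mult.assoc)
    also have "(\<Sum>i<n. \<Sum>j<n. \<Sum>a<n. mconst (c l i a) * (PM n c a j * cofactor ?M i j))
        = (\<Sum>i<n. \<Sum>a<n. mconst (c l i a) * (\<Sum>j<n. PM n c a j * cofactor ?M i j))"
      unfolding sum_distrib_left by (intro sum.cong refl sum.swap)
    also have "(\<Sum>i<n. \<Sum>j<n. \<Sum>a<n. mconst (c l j a) * (PM n c i a * cofactor ?M i j))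
        = (\<Sum>j<n. \<Sum>a<n. mconst (c l j a) * (\<Sum>i<n. PM n c i a * cofactor ?M i j))"
      unfolding sum_distrib_left by (subst sum.swap, intro sum.cong refl sum.swap)
    finally have D: "ham n c l (det ?M) = (\<Sum>i<n. \<Sum>a<n. mconst (c l i a) * (\<Sum>j<n. PM n c a j * cofactor ?M i j))
        + (\<Sum>j<n. \<Sum>a<n. mconst (c l j a) * (\<Sum>i<n. PM n c i a * cofactor ?M i j))" .
    have "k dvd ham n c l (det ?M)"
      unfolding D
    proof (rule dvd_add)
      show "k dvd (\<Sum>i<n. \<Sum>a<n. mconst (c l i a) * (\<Sum>j<n. PM n c a j * cofactor ?M i j))"
        by (rule dvd_sum, rule dvd_sum, rule dvd_mult, rule d1) auto
      show "k dvd (\<Sum>j<n. \<Sum>a<n. mconst (c l j a) * (\<Sum>i<n. PM n c i a * cofactor ?M i j))"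
        by (rule dvd_sum, rule dvd_sum, rule dvd_mult, rule d2) auto
    qed
    moreover have "ham n c l (det ?M) = ham n c l k * Q i0 ^ 2 + k * ham n c l (Q i0 ^ 2)" unfolding detM ham_mult ..
    ultimately show ?thesis by (metis add.commute dvd_add_right_iff dvd_triv_left)
  qed simp
qed

end

section \<open>The fundamental semi-invariant and the algebra of invariants\<close>

locale lie_setup = index_one_kernel +
  fixes p :: "(nat \<Rightarrow> complex) \<Rightarrow> complex"
  assumes nosemi: "no_proper_semi_invariants n c" and pg: "fundamental_semi_invariant n c p"
    and noncst: "\<not> (\<exists>a. p = (\<lambda>x. a))"
begin

lemma half: "2 * ((n - 1) div 2) = n - 1" using n_odd by simp

lemma PF_ex:
  assumes i: "i < n"
  shows "\<exists>g\<in>polys n. \<forall>x. ev g x = pfaffian (mat_delete (Amat n c x) i i)"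
proof -
  let ?m = "(n - 1) div 2"
  let ?D = "mat_delete (AM n c) i i"
  define g where "g = mconst (1 / (2 ^ ?m * of_nat (fact ?m))) *
    (\<Sum>\<sigma> | \<sigma> permutes {..<2 * ?m}. mconst (of_int (sign \<sigma>)) * (\<Prod>a<?m. ?D $$ (\<sigma> (2 * a), \<sigma> (2 * a + 1))))"
  have lt: "\<sigma> a < n - 1" if "\<sigma> permutes {..<2 * ?m}" "a < 2 * ?m" for \<sigma> a
    using permutes_in_image[OF that(1), of a] that(2) half by simp
  have D: "?D $$ (a, b) \<in> polys n" "ev (?D $$ (a, b)) x = mat_delete (Amat n c x) i i $$ (a, b)" if "a < n - 1" "b < n - 1" for a b x
    using that by (auto simp: mat_delete_def AM_def Amat_def ev_PM PM_polys)
  have "g \<in> polys n" unfolding g_def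
  proof (intro polys_mult polys_sum polys_prod polys_K)
    fix \<sigma> a assume "\<sigma> \<in> {\<sigma>. \<sigma> permutes {..<2 * ?m}}" "a \<in> {..<?m}"
    then show "?D $$ (\<sigma> (2 * a), \<sigma> (2 * a + 1)) \<in> polys n" by (intro D lt) auto
  qed
  moreover have "ev g x = pfaffian (mat_delete (Amat n c x) i i)" for x
  proof -
    have "mat_delete (Amat n c x) i i \<in> carrier_mat (2 * ?m) (2 * ?m)"
      unfolding half by (rule mat_delete_carrier[OF Amat_carrier])
    then have "pfaffian (mat_delete (Amat n c x) i i) = pf_sum ?m (mat_delete (Amat n c x) i i) / (2 ^ ?m * of_nat (fact ?m))"
      by (rule pfaffian_pf_sum)
    moreover have "pf_sum ?m (mat_delete (Amat n c x) i i) =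
      (\<Sum>\<sigma> | \<sigma> permutes {..<2 * ?m}. of_int (sign \<sigma>) * (\<Prod>a<?m. ev (?D $$ (\<sigma> (2 * a), \<sigma> (2 * a + 1))) x))"
      unfolding pf_sum_def
    proof (intro sum.cong refl arg_cong2[where f = "(*)"] prod.cong)
      fix \<sigma> a assume "\<sigma> \<in> {\<sigma>. \<sigma> permutes {..<2 * ?m}}" "a \<in> {..<?m}"
      then show "mat_delete (Amat n c x) i i $$ (\<sigma> (2 * a), \<sigma> (2 * a + 1)) = ev (?D $$ (\<sigma> (2 * a), \<sigma> (2 * a + 1))) x"
        by (intro D(2)[symmetric] lt) auto
    qed
    ultimately show ?thesis by (simp add: g_def)
  qed
  ultimately show ?thesis by blast
qed

text \<open>Index one leaves principal submatrices of order \<open>n - 1\<close>, so each is given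
  by the one deleted index \<open>i\<close>.\<close>

definition PF :: "nat \<Rightarrow> mp" where
  "PF i = (SOME g. g \<in> polys n \<and> (\<forall>x. ev g x = pfaffian (mat_delete (Amat n c x) i i)))"

lemma PF: assumes "i < n" shows "PF i \<in> polys n" "ev (PF i) x = pfaffian (mat_delete (Amat n c x) i i)"
  using someI_ex[of "\<lambda>g. g \<in> polys n \<and> (\<forall>x. ev g x = pfaffian (mat_delete (Amat n c x) i i))"] PF_ex[OF assms]
  unfolding PF_def[symmetric] by blast+

lemma principal_pfaffians_PF: "principal_pfaffians n c = {ev (PF i) | i. i < n}"
proof (intro equalityI subsetI)
  fix h assume "h \<in> principal_pfaffians n c"
  then obtain I where I: "I \<subseteq> {..<n}" "card I = n - 1" "h = (\<lambda>x. pfaffian (submatrix (Amat n c x) I I))"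
    unfolding principal_pfaffians_def ind by blast
  have "card ({..<n} - I) = 1" using I n_pos by (subst card_Diff_subset) (auto intro: finite_subset)
  then obtain i where i: "{..<n} - I = {i}" using card_1_singletonE by blast
  then have i': "i < n" "I = {..<n} - {i}" using I(1) by auto
  have "h = ev (PF i)"
    unfolding I(3) i'(2) by (rule ext) (simp only: PF(2)[OF i'(1)] submatrix_principal_delete[OF Amat_carrier i'(1)])
  then show "h \<in> {ev (PF i) | i. i < n}" using i'(1) by blast
next
  fix h assume "h \<in> {ev (PF i) | i. i < n}"
  then obtain i where i: "i < n" "h = ev (PF i)" by blast
  then have "h = (\<lambda>x. pfaffian (submatrix (Amat n c x) ({..<n} - {i}) ({..<n} - {i})))"
    using PF(2) submatrix_principal_delete[OF Amat_carrier] by (auto simp: fun_eq_iff)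
  moreover have "card ({..<n} - {i}) = n - 1" using i by simp
  ultimately show "h \<in> principal_pfaffians n c"
    unfolding principal_pfaffians_def ind by blast
qed

definition P :: mp where "P = (SOME f. f \<in> polys n \<and> ev f = p)"

lemma P: "P \<in> polys n" "ev P = p"
proof -
  have "polyfun n p" using pg by (simp add: fundamental_semi_invariant_def is_polygcd_def)
  then have "\<exists>f. f \<in> polys n \<and> ev f = p" using polyfun_ex_polys by blast
  from someI_ex[OF this] show "P \<in> polys n" "ev P = p" unfolding P_def by blast+
qed

lemma P_nonconst: "P \<noteq> mconst a"
proof
  assume "P = mconst a"
  then have "p = (\<lambda>x. a)" using P(2) by (auto simp: fun_eq_iff)
  then show False using noncst by blast
qed

lemma P_nz: "P \<noteq> 0" using P_nonconst[of 0] by (simp add: mconst_hom)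

lemma P_dvd: assumes "i < n" shows "P dvd PF i"
proof -
  have "polydvd n p (ev (PF i))"
    using pg assms unfolding fundamental_semi_invariant_def is_polygcd_def principal_pfaffians_PF by blast
  then obtain h where h: "polyfun n h" "ev (PF i) = (\<lambda>x. p x * h x)" unfolding polydvd_def by blast
  obtain g where "ev g = h" using polyfun_ex_polys[OF h(1)] by blast
  then have "PF i = P * g" by (intro ev_inject_fun) (simp add: h(2) P(2))
  then show ?thesis by simp
qed

lemma P_greatest: assumes q: "q \<in> polys n" and d: "\<And>i. i < n \<Longrightarrow> q dvd PF i" shows "q dvd P"
proof -
  have "polydvd n (ev q) (ev (PF i))" if i: "i < n" for i
  proof -
    obtain h where "PF i = q * h" using d[OF i] by blast
    \<comment> \<open>The quotient may a priori involve further variables; truncating it keeps the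
      equation because \<open>PF i\<close> and \<open>q\<close> are unaffected.\<close>
    then have "PF i = q * rt n h"
      using rt_id[OF PF(1)[OF i]] rt_id[OF q] by (metis rt_def subst_simps(4))
    moreover have "polyfun n (ev (rt n h))" using rt_polys by (simp add: polys_def)
    ultimately show ?thesis unfolding polydvd_def by (metis (no_types, lifting) ev_simps(4) ext)
  qed
  then have "polydvd n (ev q) p"
    using pg q unfolding fundamental_semi_invariant_def is_polygcd_def principal_pfaffians_PF polys_def by blast
  then obtain h where h: "polyfun n h" "p = (\<lambda>x. ev q x * h x)" unfolding polydvd_def by blast
  obtain g where "ev g = h" using polyfun_ex_polys[OF h(1)] by blast
  then have "P = q * g" by (intro ev_inject_fun) (simp add: P(2) h(2)[THEN fun_cong])
  then show ?thesis by simp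
qed

text \<open>The square of a Pfaffian is a constant times the determinant, here a diagonal cofactor;
  the constant is common to all \<open>i\<close> because it depends only on the order.\<close>

lemma PF_square: "\<exists>g. \<forall>i<n. PF i ^ 2 = mconst g * (k * Q i ^ 2)"
proof -
  let ?m = "(n - 1) div 2"
  obtain g where g: "\<And>M. M \<in> carrier_mat (2 * ?m) (2 * ?m) \<Longrightarrow> (\<forall>i<2*?m. \<forall>j<2*?m. M $$ (j, i) = - M $$ (i, j)) \<Longrightarrow>
    pfaffian M ^ 2 = g * det M" using pfaffian_square[of ?m] by blast
  have "PF i ^ 2 = mconst g * (k * Q i ^ 2)" if i: "i < n" for i
  proof (rule ev_inject_fun)
    fix x
    let ?M = "mat_delete (Amat n c x) i i"
    have sk: "?M $$ (b, a) = - ?M $$ (a, b)" if ab: "a < n - 1" "b < n - 1" for a b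
    proof -
      let ?a = "if a < i then a else Suc a" and ?b = "if b < i then b else Suc b"
      have "?a < n" "?b < n" using ab by auto
      from PM_sk[OF this] have E: "ev (PM n c ?b ?a) x = - ev (PM n c ?a ?b) x" by (simp only: ev_simps)
      have idx: "?M $$ (a, b) = ev (PM n c (if a < i then a else Suc a) (if b < i then b else Suc b)) x"
        if "a < n - 1" "b < n - 1" for a b using that by (simp add: mat_delete_def Amat_def ev_PM)
      show ?thesis unfolding idx[OF ab] idx[OF ab(2,1)] by (rule E)
    qed
    have "pfaffian ?M ^ 2 = g * det ?M"
    proof (rule g)
      show "?M \<in> carrier_mat (2 * ?m) (2 * ?m)" unfolding half by (rule mat_delete_carrier[OF Amat_carrier])
      show "\<forall>i<2*?m. \<forall>j<2*?m. ?M $$ (j, i) = - ?M $$ (i, j)" unfolding half using sk by blast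
    qed
    moreover have "det ?M = ev (k * Q i * Q i) x"
    proof -
      have "mat_delete (Amat n c x) i i = map_mat (\<lambda>f. ev f x) (mat_delete (AM n c) i i)"
        by (rule eq_matI) (auto simp: mat_delete_def AM_def Amat_def ev_PM)
      then have "det ?M = ev (det (mat_delete (AM n c) i i)) x" by (simp add: ev_det)
      moreover have "det (mat_delete (AM n c) i i) = cofactor (AM n c) i i" by (simp add: cofactor_def)
      ultimately show ?thesis using cof[OF i i] by simp
    qed
    ultimately show "ev (PF i ^ 2) x = ev (mconst g * (k * Q i ^ 2)) x"
      by (simp add: PF(2)[OF i] power2_eq_square)
  qed
  then show ?thesis by blast
qed

text \<open>Write \<open>PF i = P * G i\<close>. Coprimality of the \<open>Q i\<close> gives
  \<open>P^2 dvd k\<close>; the quotient is, up to a scalar, a square \<open>h^2\<close> with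
  \<open>h\<close> dividing every \<open>G i\<close>. So \<open>P * h\<close> is a common divisor of
  the Pfaffians, and \<open>h\<close> must be a unit.\<close>

lemma k_P: "\<exists>a. a \<noteq> 0 \<and> k = mconst a * P ^ 2"
proof -
  obtain g where g: "\<And>i. i < n \<Longrightarrow> PF i ^ 2 = mconst g * (k * Q i ^ 2)" using PF_square by blast
  have g0: "g \<noteq> 0"
  proof
    assume "g = 0"
    then have "PF i = 0" if "i < n" for i using g[OF that] by (simp add: mconst_hom)
    then have "0 dvd P" by (intro P_greatest) auto
    then show False using P_nz by simp
  qed
  have inv: "mconst (1 / g) * (mconst g * y) = y" for y using g0 by (simp add: mconst_hom(4)[symmetric] mconst_hom(2) flip: mult.assoc)
  define G where "G i = (SOME h. PF i = P * h)" for i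
  have G: "PF i = P * G i" if "i < n" for i
    unfolding G_def by (rule someI_ex) (use P_dvd[OF that] in \<open>auto simp: dvd_def\<close>)
  have PG: "P ^ 2 * G i ^ 2 = mconst g * (k * Q i ^ 2)" if "i < n" for i
    using g[OF that] G[OF that] by (simp add: power_mult_distrib)
  have "P ^ 2 dvd k"
  proof (rule coprime_family_square_dvd[OF Q_cop])
    show "P ^ 2 \<noteq> 0" using P_nz by simp
    fix i assume "i < n"
    have "k * Q i ^ 2 = mconst (1 / g) * (P ^ 2 * G i ^ 2)" unfolding PG[OF \<open>i < n\<close>] inv ..
    then show "P ^ 2 dvd k * Q i ^ 2" by (metis dvd_triv_left mult.left_commute)
  qed
  then obtain k1 where k1: "k = P ^ 2 * k1" by blast
  have k10: "k1 \<noteq> 0" using k_nz k1 by auto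
  have GQ: "G i ^ 2 = (mconst g * k1) * Q i ^ 2" if "i < n" for i
  proof -
    have "P ^ 2 * G i ^ 2 = P ^ 2 * ((mconst g * k1) * Q i ^ 2)" unfolding PG[OF that] k1 by (simp add: ac_simps)
    then show ?thesis using P_nz mult_left_cancel by (metis power_not_zero)
  qed
  obtain i0 where i0: "i0 < n" "Q i0 \<noteq> 0" using Q_nonzero by blast
  have Gd: "\<exists>h. G i = Q i * h \<and> h ^ 2 = mconst g * k1" if i: "i < n" "Q i \<noteq> 0" for i
  proof -
    have "Q i ^ 2 dvd G i ^ 2" unfolding GQ[OF i(1)] by simp
    then have "Q i dvd G i" using square_dvd_square_mp[OF i(2)] by blast
    then obtain h where h: "G i = Q i * h" by blast
    have "Q i ^ 2 * h ^ 2 = Q i ^ 2 * (mconst g * k1)" using GQ[OF i(1)] unfolding h by (simp add: power_mult_distrib mult.commute)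
    then have "h ^ 2 = mconst g * k1" using i(2) mult_left_cancel by (metis power_not_zero)
    then show ?thesis using h by blast
  qed
  obtain h where h: "G i0 = Q i0 * h" "h ^ 2 = mconst g * k1" using Gd[OF i0] by blast
  have h0: "h \<noteq> 0" using h(2) g0 k10 by auto
  have hG: "h dvd G i" if i: "i < n" for i
  proof (cases "Q i = 0")
    case True
    then show ?thesis using GQ[OF i] by simp
  next
    case False
    obtain h' where h': "G i = Q i * h'" "h' ^ 2 = mconst g * k1" using Gd[OF i False] by blast
    then have "h' = h \<or> h' = - h" using h(2) power2_eq_iff by metis
    then show ?thesis using h'(1) by auto
  qed
  have "P * h dvd PF i" if "i < n" for i unfolding G[OF that] using hG[OF that] by (rule mult_dvd_mono[OF dvd_refl])
  moreover have "P * h \<in> polys n"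
  proof (rule polys_factor[OF PF(1)[OF i0(1)]])
    show "PF i0 \<noteq> 0" unfolding G[OF i0(1)] h(1) using P_nz i0 h0 by simp
    show "P * h dvd PF i0" using calculation[OF i0(1)] .
  qed
  ultimately have "P * h dvd P * 1" using P_greatest by simp
  then have "h dvd 1" using P_nz by (simp only: dvd_mult_cancel_left) simp
  then obtain b where b: "b \<noteq> 0" "h = mconst b" using mp_unit_iff by blast
  have "mconst g * k1 = mconst (b ^ 2)" using h(2) b(2) by (simp add: mconst_power)
  then have "k1 = mconst (1 / g) * mconst (b ^ 2)" using inv[of k1] by simp
  then have "k = mconst (b ^ 2 / g) * P ^ 2" unfolding k1 by (simp add: mconst_hom(4)[symmetric] mult.commute)
  then show ?thesis using b(1) g0 by (intro exI[of _ "b ^ 2 / g"]) simp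
qed

definition dP :: nat where "dP = (SOME d. homog d P)"

lemma P_homog: "homog dP P"
proof -
  obtain a where a: "a \<noteq> 0" "k = mconst a * P ^ 2" using k_P by blast
  then have "homog e ((mconst a * P) * P)" using k_homog by (simp add: power2_eq_square mult.assoc)
  then obtain d where "homog (e - d) P" using homog_factor[of e "mconst a * P" P] a(1) P_nz by auto
  then show ?thesis unfolding dP_def by (rule someI)
qed

lemma e_dP: "e = 2 * dP"
proof -
  obtain a where a: "a \<noteq> 0" "k = mconst a * P ^ 2" using k_P by blast
  have "homog (0 + 2 * dP) (mconst a * P ^ 2)" by (intro homog_mult homog_mconst homog_power P_homog)
  then show ?thesis using k_homog k_nz homog_unique a(2) by (metis add_0)
qed

lemma dP_pos: "dP > 0"
proof (rule ccontr)
  assume "\<not> dP > 0"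
  then have "homog 0 P" using P_homog by simp
  then show False using homog_0_const P_nonconst by blast
qed

lemma polydeg_p: "polydeg n p = dP" using polydeg_homog[OF P(1) P_homog P_nz] P(2) by simp

text \<open>Rewritten, \<open>(n + 1) div 2 - dP = m + 1\<close>: this is where the number
  \<open>k\<close> of the statement comes from.\<close>

lemma n_eq: "n = 2 * m + 1 + 2 * dP" using degs e_dP n_pos by linarith

text \<open>As \<open>k\<close> is a scalar times \<open>P^2\<close>, its bracket with a coordinate
  is a scalar times \<open>P * {x_l, P}\<close>; divisibility by \<open>P^2\<close> leaves
  \<open>P dvd {x_l, P}\<close>, and equal degrees make the quotient constant.\<close>

lemma P_semi: assumes l: "l < n" shows "ham n c l P = 0"
proof (rule semi_invariant_weight_0[OF nosemi P(1) P_nz _ l])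
  fix l assume l: "l < n"
  obtain a where a: "a \<noteq> 0" "k = mconst a * P ^ 2" using k_P by blast
  have "ham n c l k = mconst a * (2 * P * ham n c l P)"
    unfolding a(2) ham_mconst_mult by (simp add: power2_eq_square ham_mult algebra_simps)
  moreover have "P ^ 2 dvd ham n c l k" using k_dvd_ham[OF l] unfolding a(2) by (metis dvd_mult_right)
  ultimately have "P * P dvd P * (mconst (2 * a) * ham n c l P)"
    by (simp add: power2_eq_square mconst_hom(4) ac_simps) (metis ev_inject_fun ev_numeral ev_simps(6))
  then have "P dvd mconst (2 * a) * ham n c l P" using P_nz by simp
  then have "P dvd mconst (1 / (2 * a)) * (mconst (2 * a) * ham n c l P)" by (rule dvd_mult)
  then have "P dvd ham n c l P" using a(1) by (simp add: mconst_hom(4)[symmetric] mconst_hom(2) flip: mult.assoc)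
  then show "\<exists>a. ham n c l P = mconst a * P" using homog_dvd_same[OF P_homog homog_ham[OF P_homog] P_nz] by blast
qed

text \<open>The brackets of \<open>g\<close> with the coordinates are the entries of the structure
  matrix applied to the gradient, which thus lies in the kernel.\<close>

lemma invariant_grad:
  assumes "\<And>l. l < n \<Longrightarrow> ham n c l g = 0" shows "\<exists>r. \<forall>i<n. pd i g = r * Q i"
proof (rule parallel_coprime[OF Q_cop])
  fix i j assume "i < n" "j < n"
  then show "Q i * pd j g = Q j * pd i g"
    using kernel_parallel[OF AQ, of "\<lambda>j. pd j g" i j] assms unfolding ham_def by blast
qed

definition f :: mp where "f = (\<Sum>i<n. mvar i * Q i)"

lemma f_polys: "f \<in> polys n" unfolding f_def using Q_polys by (auto intro: polys_X)
lemma f_homog: "homog (Suc m) f"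
  unfolding f_def using homog_mult[OF homog_mvar Q_homog] by (intro homog_sum) simp

text \<open>Euler's identity makes a nonzero multiple of \<open>P\<close> a multiple of
  \<open>f\<close>; here the positive degree of \<open>P\<close> enters, that is, \<open>p\<close>
  being nonconstant.\<close>

lemma f_nz: "f \<noteq> 0"
proof
  assume f0: "f = 0"
  obtain r where r: "\<And>i. i < n \<Longrightarrow> pd i P = r * Q i" using invariant_grad[OF P_semi] by blast
  have "of_nat dP * P = (\<Sum>i<n. mvar i * pd i P)" using euler_homog[OF P(1) P_homog] by simp
  also have "\<dots> = r * f" unfolding f_def sum_distrib_left by (intro sum.cong refl) (simp add: r)
  finally show False using f0 P_nz dP_pos by simp
qed

text \<open>Bracketing the kernel equation of \<open>Q\<close> with \<open>x_l\<close> shows that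
  the Lie derivative of \<open>Q\<close> is again in the kernel, hence by degree a scalar multiple
  of \<open>Q\<close>; contraction with the coordinates gives \<open>{x_l, f} = a f\<close>.\<close>

lemma ham_f: assumes l: "l < n" shows "ham n c l f = 0"
proof (rule semi_invariant_weight_0[OF nosemi f_polys f_nz _ l])
  fix l assume l: "l < n"
  \<comment> \<open>The Lie derivative of \<open>Q\<close>: the bracket on the components plus the
    action of \<open>x_l\<close> on the index.\<close>
  define y where "y j = ham n c l (Q j) + (\<Sum>i<n. mconst (c l i j) * Q i)" for j
  have Ay: "(\<Sum>j<n. PM n c i j * y j) = 0" if i: "i < n" for i
  proof -
    have "0 = ham n c l (\<Sum>j<n. PM n c i j * Q j)" using AQ[OF i] by simp
    also have "\<dots> = (\<Sum>j<n. ham n c l (PM n c i j) * Q j) + (\<Sum>j<n. PM n c i j * ham n c l (Q j))"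
      by (simp add: ham_mult sum.distrib)
    also have "(\<Sum>j<n. ham n c l (PM n c i j) * Q j) = (\<Sum>j<n. (\<Sum>a<n. mconst (c l i a) * (PM n c a j * Q j)) + (\<Sum>a<n. PM n c i a * (mconst (c l j a) * Q j)))"
    proof (rule sum.cong[OF refl])
      fix j assume "j \<in> {..<n}"
      then have j: "j < n" by simp
      show "ham n c l (PM n c i j) * Q j = (\<Sum>a<n. mconst (c l i a) * (PM n c a j * Q j)) + (\<Sum>a<n. PM n c i a * (mconst (c l j a) * Q j))"
        unfolding ham_PM[OF lie l i j] distrib_right sum_distrib_right
        by (intro arg_cong2[where f = "(+)"] sum.cong refl) (simp_all add: ac_simps)
    qed
    also have "\<dots> = (\<Sum>j<n. \<Sum>a<n. mconst (c l i a) * (PM n c a j * Q j)) + (\<Sum>j<n. \<Sum>a<n. PM n c i a * (mconst (c l j a) * Q j))"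
      by (rule sum.distrib)
    also have "(\<Sum>j<n. \<Sum>a<n. mconst (c l i a) * (PM n c a j * Q j)) = (\<Sum>a<n. mconst (c l i a) * (\<Sum>j<n. PM n c a j * Q j))"
      unfolding sum_distrib_left by (rule sum.swap)
    also have "\<dots> = 0" using AQ by simp
    also have "(\<Sum>j<n. \<Sum>a<n. PM n c i a * (mconst (c l j a) * Q j)) = (\<Sum>a<n. PM n c i a * (\<Sum>j<n. mconst (c l j a) * Q j))"
      unfolding sum_distrib_left by (rule sum.swap)
    finally show ?thesis by (simp add: y_def distrib_left sum.distrib add.commute)
  qed
  have "\<exists>r. \<forall>i<n. y i = r * Q i"
    by (rule parallel_coprime[OF Q_cop]) (use kernel_parallel[OF AQ Ay] in blast)
  then obtain r where r: "\<And>i. i < n \<Longrightarrow> y i = r * Q i" by blast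
  have yh: "homog m (y j)" if j: "j < n" for j
  proof -
    have "homog m (mconst (c l i j) * Q i)" if "i < n" for i
      using homog_mult[OF homog_mconst[of "c l i j"] Q_homog[OF that]] by simp
    then show ?thesis unfolding y_def by (intro homog_add homog_ham Q_homog[OF j] homog_sum) simp
  qed
  obtain i0 where i0: "i0 < n" "Q i0 \<noteq> 0" using Q_nonzero by blast
  have "Q i0 dvd y i0" using r[OF i0(1)] by simp
  then obtain a where a: "y i0 = mconst a * Q i0" using homog_dvd_same[OF Q_homog yh] i0 by blast
  then have ra: "r = mconst a" using r[OF i0(1)] i0(2) by simp
  have hQ: "ham n c l (Q j) = mconst a * Q j - (\<Sum>i<n. mconst (c l i j) * Q i)" if "j < n" for j
    using r[OF that] unfolding ra y_def by (simp add: eq_diff_eq)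
  have "ham n c l f = (\<Sum>j<n. PM n c l j * Q j) + (\<Sum>j<n. mvar j * ham n c l (Q j))"
    unfolding f_def by (simp add: ham_mult ham_mvar sum.distrib)
  also have "(\<Sum>j<n. mvar j * ham n c l (Q j)) = (\<Sum>j<n. mvar j * (mconst a * Q j) - mvar j * (\<Sum>i<n. mconst (c l i j) * Q i))"
    by (intro sum.cong refl) (simp add: hQ right_diff_distrib)
  also have "\<dots> = mconst a * f - (\<Sum>j<n. \<Sum>i<n. mvar j * (mconst (c l i j) * Q i))"
    unfolding f_def sum_subtractf sum_distrib_left by (simp add: ac_simps)
  also have "(\<Sum>j<n. \<Sum>i<n. mvar j * (mconst (c l i j) * Q i)) = (\<Sum>i<n. PM n c l i * Q i)"
    unfolding PM_def sum_distrib_right by (subst sum.swap) (simp add: ac_simps)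
  finally have "ham n c l f = mconst a * f" using AQ[OF l] by simp
  then show "\<exists>a. ham n c l f = mconst a * f" by blast
qed

text \<open>Euler's identity for \<open>f\<close> itself determines the factor between its gradient
  and \<open>Q\<close>.\<close>

lemma pd_f: assumes i: "i < n" shows "pd i f = of_nat (Suc m) * Q i"
proof -
  obtain r where r: "\<And>i. i < n \<Longrightarrow> pd i f = r * Q i" using invariant_grad[OF ham_f] by blast
  have "of_nat (Suc m) * f = (\<Sum>i<n. mvar i * pd i f)" using euler_homog[OF f_polys f_homog] by simp
  also have "\<dots> = (\<Sum>i<n. mvar i * (r * Q i))" by (intro sum.cong refl) (simp add: r)
  also have "\<dots> = r * f" unfolding f_def sum_distrib_left by (intro sum.cong refl) (simp add: ac_simps)
  finally have "r = of_nat (Suc m)" using f_nz by simp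
  then show ?thesis using r[OF i] by simp
qed

text \<open>By Euler's identity \<open>d * g = r * f\<close>, so \<open>f\<close> divides
  \<open>g\<close> when \<open>d\<close> is positive; the quotient is an invariant of lower
  degree.\<close>

lemma homog_invariant:
  assumes "g \<in> polys n" "homog d g" "\<And>l. l < n \<Longrightarrow> ham n c l g = 0" "g \<noteq> 0"
  shows "\<exists>a j. a \<noteq> 0 \<and> g = mconst a * f ^ j"
  using assms
proof (induction d arbitrary: g rule: less_induct)
  case (less d)
  show ?case
  proof (cases "d = 0")
    case True
    then obtain a where "g = mconst a" using homog_0_const less.prems by blast
    then show ?thesis using less.prems(4) by (intro exI[of _ a] exI[of _ 0]) auto
  next
    case False
    obtain r where r: "\<And>i. i < n \<Longrightarrow> pd i g = r * Q i" using invariant_grad[of g] less.prems(3) by blast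
    have "of_nat d * g = (\<Sum>i<n. mvar i * pd i g)" using euler_homog less.prems by simp
    also have "\<dots> = (\<Sum>i<n. mvar i * (r * Q i))" by (intro sum.cong refl) (simp add: r)
    also have "\<dots> = r * f" unfolding f_def sum_distrib_left by (intro sum.cong refl) (simp add: ac_simps)
    finally have "mconst (of_nat d) * g = r * f" by (metis ev_inject_fun ev_of_nat ev_simps(6))
    then have "mconst (1 / of_nat d) * (mconst (of_nat d) * g) = mconst (1 / of_nat d) * (r * f)" by simp
    then have g: "g = (mconst (1 / of_nat d) * r) * f"
      using False by (simp add: mconst_hom(4)[symmetric] mconst_hom(2) flip: mult.assoc)
    define h where "h = mconst (1 / of_nat d) * r"
    have gh: "g = h * f" using g h_def by simp
    have h0: "h \<noteq> 0" using gh less.prems(4) by auto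
    have hp: "h \<in> polys n" by (rule polys_factor[OF less.prems(1,4)]) (simp add: gh)
    obtain b where b: "b \<le> d" "homog b h" "homog (d - b) f" using homog_factor[of d h f] less.prems gh by auto
    have "d - b = Suc m" using homog_unique[OF b(3) f_homog f_nz] .
    then have "b < d" by simp
    have "ham n c l h = 0" if l: "l < n" for l
    proof -
      have "ham n c l h * f = 0" using less.prems(3)[OF l] ham_f[OF l] unfolding gh ham_mult by simp
      then show ?thesis using f_nz by simp
    qed
    from less.IH[OF \<open>b < d\<close> hp b(2) this h0] obtain a j where "a \<noteq> 0" "h = mconst a * f ^ j" by blast
    then show ?thesis unfolding gh by (intro exI[of _ a] exI[of _ "Suc j"]) (simp add: ac_simps)
  qed
qed

text \<open>Each homogeneous component is a scalar times a power of \<open>f\<close>.\<close>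

lemma invariant_poly:
  assumes "g \<in> polys n" "\<And>l. l < n \<Longrightarrow> ham n c l g = 0"
  shows "\<exists>q. g = poly (map_poly mconst q) f"
proof -
  have "\<exists>q. coeff (hc g) d = poly (map_poly mconst q) f" for d
  proof (cases "coeff (hc g) d = 0")
    case True
    then show ?thesis by (intro exI[of _ 0]) simp
  next
    case False
    have "ham n c l (coeff (hc g) d) = 0" if "l < n" for l using assms(2)[OF that] by (simp add: ham_hc)
    then obtain a j where "coeff (hc g) d = mconst a * f ^ j"
      using homog_invariant[OF hc_coeff_polys[OF assms(1)] homog_hc_coeff _ False] by blast
    then show ?thesis by (intro exI[of _ "monom a j"]) (simp add: map_poly_monom poly_monom mconst_hom)
  qed
  then obtain q where q: "\<And>d. coeff (hc g) d = poly (map_poly mconst (q d)) f" by metis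
  have hom: "poly (map_poly mconst (p + q)) x = poly (map_poly mconst p) x + poly (map_poly mconst q) x" for p q x
    by (subst poly_add[symmetric], rule arg_cong[where f = "\<lambda>r. poly r x"], rule poly_eqI) (simp add: coeff_map_poly mconst_hom)
  have "(\<Sum>d\<in>D. poly (map_poly mconst (q d)) f) = poly (map_poly mconst (sum q D)) f" if "finite D" for D
    using that by (induction D rule: finite_induct) (simp_all add: hom)
  then have "g = poly (map_poly mconst (\<Sum>d\<le>mdeg g. q d)) f"
    using sum_hc_coeff[of g] by (simp add: q)
  then show ?thesis by blast
qed

lemma ev_poly_mconst: "ev (poly (map_poly mconst q) g) x = poly q (ev g x)"
  by (induction q) (simp_all add: map_poly_pCons mconst_hom)

lemma f_invariant: "ev f \<in> invariant_polys n c"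
  using invariant_iff[OF f_polys] ham_f by blast

lemma invariants_eq: "invariant_polys n c = {(\<lambda>x. poly q (ev f x)) | q. True}"
proof (intro equalityI subsetI)
  fix h assume h: "h \<in> invariant_polys n c"
  then have "polyfun n h" by (simp add: invariant_polys_def)
  then obtain g where g: "g \<in> polys n" "ev g = h" using polyfun_ex_polys by blast
  then have "\<And>l. l < n \<Longrightarrow> ham n c l g = 0" using invariant_iff[OF g(1)] h by blast
  then obtain q where "g = poly (map_poly mconst q) f" using invariant_poly[OF g(1)] by blast
  then have "h = (\<lambda>x. poly q (ev f x))" using g(2) ev_poly_mconst by (metis ext)
  then show "h \<in> {(\<lambda>x. poly q (ev f x)) | q. True}" by blast
next
  fix h assume "h \<in> {(\<lambda>x. poly q (ev f x)) | q. True}"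
  then obtain q where q: "h = (\<lambda>x. poly q (ev f x))" by blast
  let ?g = "poly (map_poly mconst q) f"
  have g: "?g \<in> polys n \<and> (\<forall>l<n. ham n c l ?g = 0)"
    by (induction q) (use f_polys ham_f in \<open>auto simp: map_poly_pCons mconst_hom ham_mult\<close>)
  then have "ev ?g \<in> invariant_polys n c" using invariant_iff by blast
  then show "h \<in> invariant_polys n c" unfolding q using ev_poly_mconst by (metis ext)
qed

text \<open>Let \<open>q\<close> be an irreducible factor of exact multiplicity \<open>j\<close>.
  Vanishing of \<open>{x_l, f}\<close> gives \<open>q dvd {x_l, q}\<close>, so \<open>q\<close> is
  an invariant and therefore a scalar times a power of \<open>f\<close>; hence \<open>f\<close>
  divides \<open>q\<close>.\<close>

lemma f_irreducible: "irreducible f"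
proof -
  have nu: "\<not> f dvd 1" using mp_unit_iff_mdeg[OF f_nz] homog_mdeg[OF f_homog f_nz] by simp
  then obtain q where q: "irreducible q" "q dvd f" using ex_irreducible_dvd f_nz by blast
  have q0: "q \<noteq> 0" and qu: "\<not> q dvd 1" using q(1) by (auto simp: irreducible_def)
  have qp: "q \<in> polys n" by (rule polys_factor[OF f_polys f_nz q(2)])
  have "finite {j. q ^ j dvd f}"
  proof (rule finite_subset)
    show "{j. q ^ j dvd f} \<subseteq> {..mdeg f}"
    proof
      fix j assume "j \<in> {j. q ^ j dvd f}"
      then have "mdeg (q ^ j) \<le> mdeg f" using mdeg_dvd f_nz by blast
      moreover have "mdeg (q ^ j) \<ge> j" for j
      proof (induction j)
        case (Suc j)
        have "mdeg q > 0" using mp_unit_iff_mdeg[OF q0] qu by simp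
        then show ?case using Suc mdeg_mult[OF q0, of "q ^ j"] q0 by simp
      qed simp
      ultimately show "j \<in> {..mdeg f}" by (meson atMost_iff le_trans)
    qed
  qed simp
  then obtain j where j: "q ^ j dvd f" "\<not> q ^ Suc j dvd f"
    using Max_in[of "{j. q ^ j dvd f}"] Max_ge[of "{j. q ^ j dvd f}"] by (metis (mono_tags, lifting) Suc_n_not_le_n empty_iff mem_Collect_eq one_dvd power_0)
  have "j \<noteq> 0" using j(2) q(2) by (cases j) auto
  then obtain j' where j': "j = Suc j'" by (cases j) auto
  obtain h where h: "f = q ^ j * h" using j(1) by blast
  have qh: "\<not> q dvd h" using j(2) unfolding h by (metis mult_dvd_mono dvd_refl power_Suc2)
  obtain b where b: "homog b q"
  proof -
    obtain h' where "f = q * h'" using q(2) by blast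
    then show ?thesis using homog_factor[of "Suc m" q h'] f_homog f_nz that by auto
  qed
  have hq: "ham n c l q = 0" if l: "l < n" for l
  proof (rule semi_invariant_weight_0[OF nosemi qp q0 _ l])
    fix l assume l: "l < n"
    have "0 = of_nat (Suc j') * q ^ j' * ham n c l q * h + q ^ j * ham n c l h"
      using ham_f[OF l] unfolding h ham_mult j' ham_power by simp
    also have "\<dots> = q ^ j' * (of_nat (Suc j') * ham n c l q * h + q * ham n c l h)"
      unfolding j' by (simp add: algebra_simps)
    finally have "of_nat (Suc j') * ham n c l q * h + q * ham n c l h = 0" using q0 by (metis mult_eq_0_iff power_not_zero)
    then have "q dvd (of_nat (Suc j') * ham n c l q) * h" by (metis add_eq_0_iff dvd_minus_iff dvd_triv_left)
    then have "q dvd of_nat (Suc j') * ham n c l q" using irreducible_dvd_mult[OF q(1)] qh by blast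
    moreover have "\<not> q dvd of_nat (Suc j')"
    proof
      assume "q dvd of_nat (Suc j')"
      moreover have "(of_nat (Suc j') :: mp) = mconst (of_nat (Suc j'))" by (rule ev_inject_fun) (simp only: ev_of_nat ev_simps)
      moreover have "mconst (of_nat (Suc j')) dvd 1" unfolding mp_unit_iff by (intro exI[of _ "of_nat (Suc j')"]) (simp only: of_nat_eq_0_iff, simp)
      ultimately show False using qu dvd_trans by metis
    qed
    ultimately have "q dvd ham n c l q" using irreducible_dvd_mult[OF q(1)] by blast
    then show "\<exists>a. ham n c l q = mconst a * q" using homog_dvd_same[OF b homog_ham[OF b] q0] by blast
  qed
  obtain a i where a: "a \<noteq> 0" "q = mconst a * f ^ i" using homog_invariant[OF qp b hq q0] by blast
  have "i \<noteq> 0" using a qu mp_unit_iff by (cases i) auto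
  then have "f dvd q" using a(2) by (cases i) auto
  then obtain u where u: "q = f * u" by blast
  then have "u dvd 1" using q(1) nu unfolding irreducible_def by blast
  then obtain v where v: "u * v = 1" by (metis dvdE)
  show ?thesis unfolding irreducible_def
  proof (intro conjI allI impI)
    show "f \<noteq> 0" by (rule f_nz)
    show "\<not> f dvd 1" by (rule nu)
    fix x y assume "f = x * y"
    then have "q = x * (y * u)" using u by (simp add: mult.assoc)
    then have "x dvd 1 \<or> y * u dvd 1" using q(1) unfolding irreducible_def by blast
    then show "x dvd 1 \<or> y dvd 1" using dvd_mult_left by blast
  qed
qed

lemma P_power: "\<exists>a d. a \<noteq> 0 \<and> P = mconst a * f ^ d \<and> d * Suc m = dP \<and> d \<ge> 1"
proof -
  obtain a d where a: "a \<noteq> 0" "P = mconst a * f ^ d" using homog_invariant[OF P(1) P_homog P_semi P_nz] by blast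
  have "homog (0 + d * Suc m) P" unfolding a(2) by (intro homog_mult homog_mconst homog_power f_homog)
  then have "d * Suc m = dP" using homog_unique[OF _ P_homog P_nz] by simp
  moreover have "d \<ge> 1" using calculation dP_pos by (cases d) auto
  ultimately show ?thesis using a by blast
qed

end

section \<open>Lines in the dual space\<close>

text \<open>Obtained from the reduced row echelon form. \<open>M = L * G\<close> bounds the rank
  from above; \<open>X * M * Y = 1\<close> certifies it from below by constant matrices, which can
  be reused at other points.\<close>

lemma rank_factorization:
  fixes M :: "'a::field mat"
  assumes M: "M \<in> carrier_mat N N"
  shows "\<exists>r L G X Y. kernel_dim M = N - r \<and> r \<le> N \<and> L \<in> carrier_mat N r \<and> G \<in> carrier_mat r N \<and> M = L * G \<and>
    X \<in> carrier_mat r N \<and> Y \<in> carrier_mat N r \<and> X * M * Y = 1\<^sub>m r"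
proof -
  define E where "E = gauss_jordan_single M"
  from gauss_jordan_single[OF M E_def[symmetric]] obtain P Q where E: "E \<in> carrier_mat N N" "row_echelon_form E"
    and PQ: "E = P * M" "P \<in> carrier_mat N N" "Q \<in> carrier_mat N N" "P * Q = 1\<^sub>m N" "Q * P = 1\<^sub>m N" by blast
  obtain f where f: "pivot_fun E f N" using E unfolding row_echelon_form_def by auto
  have dE: "dim_row E = N" using E by simp
  note pv = pivot_funD[OF dE f]
  \<comment> \<open>The pivot value \<open>N\<close> marks a zero row, so \<open>rs\<close> lists
    the nonzero rows.\<close>
  define rs where "rs = filter (\<lambda>i. f i \<noteq> N) [0..<N]"
  define r where "r = length rs"
  have rs: "distinct rs" "set rs = {i. i < N \<and> f i \<noteq> N}" by (auto simp: rs_def)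
  have rsl: "rs ! l < N" "f (rs ! l) < N" if "l < r" for l
    using nth_mem[of l rs] that rs(2) pv(1)[of "rs ! l"] unfolding r_def by auto
  have "length (pivot_positions E) = card (fst ` set (pivot_positions E))"
    using distinct_card[OF pivot_positions(2)[OF E(1) f]] by simp
  also have "fst ` set (pivot_positions E) = set rs" unfolding pivot_positions(1)[OF E(1) f] rs(2) by force
  also have "card (set rs) = r" using distinct_card[OF rs(1)] r_def by simp
  finally have kd: "kernel_dim M = N - r" using M by (simp add: kernel_dim_code E_def)
  have rN: "r \<le> N" unfolding r_def rs_def by (metis diff_zero length_filter_le length_upt)
  define L where "L = mat N r (\<lambda>(a, l). Q $$ (a, rs ! l))"
  define G where "G = mat r N (\<lambda>(l, b). E $$ (rs ! l, b))"
  define X where "X = mat r N (\<lambda>(l, a). P $$ (rs ! l, a))"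
  define Y where "Y = mat N r (\<lambda>(b, l). if b = f (rs ! l) then (1::'a) else 0)"
  have c: "L \<in> carrier_mat N r" "G \<in> carrier_mat r N" "X \<in> carrier_mat r N" "Y \<in> carrier_mat N r"
    by (auto simp: L_def G_def X_def Y_def)
  have "M = Q * E" using PQ M by (simp flip: assoc_mult_mat)
  also have "Q * E = L * G"
  proof (rule eq_matI)
    fix a b assume "a < dim_row (L * G)" "b < dim_col (L * G)"
    then have ab: "a < N" "b < N" using c by auto
    have "(Q * E) $$ (a, b) = (\<Sum>i<N. Q $$ (a, i) * E $$ (i, b))" by (rule mult_index[OF PQ(3) E(1) ab])
    also have "\<dots> = (\<Sum>i\<in>set rs. Q $$ (a, i) * E $$ (i, b))"
      by (rule sum.mono_neutral_right) (use rs(2) pv(2)[of _ b] ab in auto)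
    also have "\<dots> = (\<Sum>l<r. Q $$ (a, rs ! l) * E $$ (rs ! l, b))"
      unfolding r_def using rs(1) by (intro sum.reindex_bij_betw[symmetric] bij_betw_nth) auto
    also have "\<dots> = (\<Sum>l<r. L $$ (a, l) * G $$ (l, b))" using ab by (simp add: L_def G_def)
    also have "\<dots> = (L * G) $$ (a, b)" by (rule mult_index[OF c(1,2) ab, symmetric])
    finally show "(Q * E) $$ (a, b) = (L * G) $$ (a, b)" .
  qed (use PQ E c in auto)
  finally have MLG: "M = L * G" .
  have XM: "(X * M) $$ (l, b) = E $$ (rs ! l, b)" if "l < r" "b < N" for l b
  proof -
    have "(X * M) $$ (l, b) = (\<Sum>a<N. X $$ (l, a) * M $$ (a, b))" by (rule mult_index[OF c(3) M that])
    also have "\<dots> = (\<Sum>a<N. P $$ (rs ! l, a) * M $$ (a, b))" using that by (simp add: X_def)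
    also have "\<dots> = (P * M) $$ (rs ! l, b)" using mult_index[OF PQ(2) M rsl(1)[OF that(1)] that(2)] by simp
    finally show ?thesis using PQ(1) by simp
  qed
  have "X * M * Y = 1\<^sub>m r"
  proof (rule eq_matI)
    fix l l' assume "l < dim_row (1\<^sub>m r :: 'a mat)" "l' < dim_col (1\<^sub>m r :: 'a mat)"
    then have l: "l < r" "l' < r" by auto
    have "(X * M * Y) $$ (l, l') = (\<Sum>b<N. (X * M) $$ (l, b) * Y $$ (b, l'))"
      by (rule mult_index[OF mult_carrier_mat[OF c(3) M] c(4) l])
    also have "\<dots> = (\<Sum>b<N. if b = f (rs ! l') then E $$ (rs ! l, b) else 0)"
      by (rule sum.cong) (use l XM in \<open>auto simp: Y_def\<close>)
    also have "\<dots> = E $$ (rs ! l, f (rs ! l'))" using rsl(2)[OF l(2)] by (simp add: sum.delta)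
    also have "\<dots> = 1\<^sub>m r $$ (l, l')"
    proof (cases "l = l'")
      case True
      then show ?thesis using pv(4)[OF rsl[OF l(1)]] l by simp
    next
      case False
      then have "rs ! l \<noteq> rs ! l'" using l rs(1) nth_eq_iff_index_eq unfolding r_def by blast
      then show ?thesis using pv(5)[OF rsl[OF l(2)] rsl(1)[OF l(1)]] l False by simp
    qed
    finally show "(X * M * Y) $$ (l, l') = 1\<^sub>m r $$ (l, l')" .
  qed (use c M in auto)
  then show ?thesis using kd rN c MLG by blast
qed

text \<open>Padded with zeros to square size, the right factor has a zero row.\<close>

lemma det_mult_narrow:
  fixes A :: "'a::field mat"
  assumes A: "A \<in> carrier_mat r s" and B: "B \<in> carrier_mat s r" and sr: "s < r"
  shows "det (A * B) = 0"
proof -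
  define A' where "A' = mat r r (\<lambda>(i, j). if j < s then A $$ (i, j) else 0)"
  define B' where "B' = mat r r (\<lambda>(i, j). if i < s then B $$ (i, j) else 0)"
  have c: "A' \<in> carrier_mat r r" "B' \<in> carrier_mat r r" by (auto simp: A'_def B'_def)
  have "A * B = A' * B'"
  proof (rule eq_matI)
    fix i j assume "i < dim_row (A' * B')" "j < dim_col (A' * B')"
    then have ij: "i < r" "j < r" using c by auto
    have "(A' * B') $$ (i, j) = (\<Sum>l<r. A' $$ (i, l) * B' $$ (l, j))" by (rule mult_index[OF c ij])
    also have "\<dots> = (\<Sum>l<s. A' $$ (i, l) * B' $$ (l, j))"
      by (rule sum.mono_neutral_right) (use sr ij in \<open>auto simp: A'_def\<close>)
    also have "\<dots> = (\<Sum>l<s. A $$ (i, l) * B $$ (l, j))" by (rule sum.cong) (use sr ij in \<open>auto simp: A'_def B'_def\<close>)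
    also have "\<dots> = (A * B) $$ (i, j)" by (rule mult_index[OF A B ij, symmetric])
    finally show "(A * B) $$ (i, j) = (A' * B') $$ (i, j)" by simp
  qed (use A B c in auto)
  moreover have "det B' = 0"
  proof -
    have "det B' = (\<Sum>j<r. B' $$ (s, j) * cofactor B' s j)" by (rule laplace_expansion_row[OF c(2) sr])
    also have "\<dots> = 0" by (rule sum.neutral) (use sr in \<open>auto simp: B'_def\<close>)
    finally show ?thesis .
  qed
  ultimately show ?thesis using det_mult[OF c] by simp
qed

text \<open>A nonsingular \<open>X * M * Y\<close> of order \<open>r\<close> cannot factor through a
  smaller space. This is semicontinuity of the rank in usable form.\<close>

lemma kernel_dim_le:
  fixes M :: "'a::field mat"
  assumes M: "M \<in> carrier_mat N N" and X: "X \<in> carrier_mat r N" and Y: "Y \<in> carrier_mat N r" and d: "det (X * M * Y) \<noteq> 0"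
  shows "kernel_dim M + r \<le> N"
proof -
  obtain s L G where s: "kernel_dim M = N - s" "s \<le> N" "L \<in> carrier_mat N s" "G \<in> carrier_mat s N" "M = L * G"
    using rank_factorization[OF M] by blast
  have "X * (L * G) = X * L * G" by (rule assoc_mult_mat[OF X s(3,4), symmetric])
  moreover have "X * L * G * Y = (X * L) * (G * Y)" by (rule assoc_mult_mat[OF mult_carrier_mat[OF X s(3)] s(4) Y])
  ultimately have "X * M * Y = (X * L) * (G * Y)" unfolding s(5) by simp
  then have "\<not> s < r" using det_mult_narrow[of "X * L" r s "G * Y"] d s X Y by auto
  then show ?thesis using s by linarith
qed

text \<open>Degree and leading coefficient are read off at infinity: by homogeneity
  \<open>poly q t = t^d * poly w (1 / t)\<close>, where \<open>w\<close> describes the line through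
  \<open>- a\<close> in direction \<open>x\<close>.\<close>

lemma line_poly:
  assumes g: "homog d g"
  shows "\<exists>q. (\<forall>t. poly q t = ev g (\<lambda>i. x i - t * a i)) \<and> degree q \<le> d \<and> coeff q d = (-1) ^ d * ev g a"
proof -
  obtain q where q: "\<And>t. ev g (\<lambda>i. x i + t * - a i) = poly q t" using ev_line[of g x "\<lambda>i. - a i"] by blast
  obtain w where w: "\<And>t. ev g (\<lambda>i. - a i + t * x i) = poly w t" using ev_line[of g "\<lambda>i. - a i" x] by blast
  let ?D = "degree w"
  \<comment> \<open>The reversal of \<open>w\<close>, so that the relation between \<open>q\<close>
    and \<open>w\<close> becomes one between polynomials once powers of \<open>t\<close> are
    cleared.\<close>
  define u where "u = (\<Sum>i\<le>?D. monom (coeff w i) (?D - i))"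
  have u: "poly u t = t ^ ?D * poly w (1 / t)" if "t \<noteq> 0" for t
  proof -
    have "poly u t = (\<Sum>i\<le>?D. coeff w i * t ^ (?D - i))" by (simp add: u_def poly_sum poly_monom)
    also have "\<dots> = (\<Sum>i\<le>?D. t ^ ?D * (coeff w i * (1 / t) ^ i))"
      by (rule sum.cong) (use that in \<open>auto simp: power_diff power_one_over field_simps\<close>)
    finally show ?thesis by (simp add: poly_altdef sum_distrib_left)
  qed
  have "poly (monom 1 ?D * q) t = poly (monom 1 d * u) t" if "t \<noteq> 0" for t
  proof -
    have "poly q t = ev g (\<lambda>i. t * (- a i + (1 / t) * x i))" unfolding q[symmetric]
      by (rule arg_cong[where f = "ev g"]) (use that in \<open>auto simp: field_simps\<close>)
    also have "\<dots> = t ^ d * poly w (1 / t)" using homog_ev[OF g, of t "\<lambda>i. - a i + (1 / t) * x i"] w[of "1 / t"] by simp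
    finally show ?thesis using u[OF that] by (simp add: poly_monom)
  qed
  then have "- {0} \<subseteq> {t. poly (monom 1 ?D * q - monom 1 d * u) t = 0}" by auto
  moreover have "infinite (- {0 :: complex})" using infinite_UNIV_char_0[where 'a = complex] by (simp add: Compl_eq_Diff_UNIV)
  ultimately have "infinite {t. poly (monom 1 ?D * q - monom 1 d * u) t = 0}" using finite_subset by blast
  then have eq: "monom 1 ?D * q = monom 1 d * u" using poly_roots_finite by (metis right_minus_eq)
  have du: "degree u \<le> ?D" unfolding u_def by (rule degree_sum_le) (auto intro: order.trans[OF degree_monom_le])
  have "coeff q i = 0" if "i > d" for i
  proof -
    have "coeff q i = coeff (monom 1 d * u) (?D + i)" unfolding eq[symmetric] by (simp add: coeff_monom_mult)
    also have "\<dots> = coeff u (?D + i - d)" using that by (simp add: coeff_monom_mult)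
    also have "\<dots> = 0" using du that by (intro coeff_eq_0) auto
    finally show ?thesis .
  qed
  then have "degree q \<le> d" by (meson degree_le)
  moreover have "coeff q d = (-1) ^ d * ev g a"
  proof -
    have "coeff q d = coeff (monom 1 d * u) (?D + d)" unfolding eq[symmetric] by (simp add: coeff_monom_mult)
    also have "\<dots> = coeff u ?D" by (simp add: coeff_monom_mult)
    also have "\<dots> = (\<Sum>i\<le>?D. if i = 0 then coeff w i else 0)"
      unfolding u_def coeff_sum by (rule sum.cong) auto
    also have "\<dots> = poly w 0" by (simp add: poly_0_coeff_0 sum.delta)
    also have "\<dots> = ev g (\<lambda>i. -1 * a i)" using w[of 0] by simp
    also have "\<dots> = (-1) ^ d * ev g a" by (rule homog_ev[OF g])
    finally show ?thesis .
  qed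
  moreover have "\<forall>t. poly q t = ev g (\<lambda>i. x i - t * a i)" unfolding q[symmetric] by simp
  ultimately show ?thesis by blast
qed

text \<open>Coordinates of \<open>(x, a, t)\<close> are \<open>0..<n\<close>, \<open>n..<2n\<close> and \<open>2n\<close>; a polynomial on \<open>\<g>*\<close> is pulled back along
  \<open>(x, a, t) \<mapsto> x - t a\<close>.\<close>

definition pull :: "nat \<Rightarrow> mp \<Rightarrow> mp" where
  "pull n = subst (\<lambda>i. if i < n then mvar i - mvar (2 * n) * mvar (n + i) else mvar i)"

text \<open>The inverse substitution; \<open>pull n\<close> is thus a ring automorphism and
  preserves irreducibility.\<close>

definition unpull :: "nat \<Rightarrow> mp \<Rightarrow> mp" where
  "unpull n = subst (\<lambda>i. if i < n then mvar i + mvar (2 * n) * mvar (n + i) else mvar i)"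

lemma unpull_pull: "unpull n (pull n g) = g" "pull n (unpull n g) = g"
  by (rule ev_inject_fun, simp add: pull_def unpull_def, rule arg_cong[where f = "ev g"], auto)+

lemma pull_mult: "pull n (g * h) = pull n g * pull n h" by (simp add: pull_def)
lemma unpull_mult: "unpull n (g * h) = unpull n g * unpull n h" by (simp add: unpull_def)

lemma pull_dvd_iff: "pull n g dvd pull n h \<longleftrightarrow> g dvd h"
proof
  assume "pull n g dvd pull n h"
  then obtain u where "pull n h = pull n g * u" by blast
  then have "h = g * unpull n u" by (metis unpull_mult unpull_pull(1))
  then show "g dvd h" by simp
next
  assume "g dvd h"
  then show "pull n g dvd pull n h" by (metis dvd_def pull_mult)
qed

lemma pull_0_1: "pull n 0 = 0" "pull n 1 = 1" by (simp_all add: pull_def)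

lemma irreducible_pull: assumes "irreducible g" shows "irreducible (pull n g)"
  unfolding irreducible_def
proof (intro conjI allI impI)
  show "pull n g \<noteq> 0" using assms pull_0_1 unpull_pull(1) unfolding irreducible_def by metis
  have u: "pull n h dvd 1 \<longleftrightarrow> h dvd 1" for h using pull_dvd_iff[of n h 1] by (simp add: pull_0_1)
  show "\<not> pull n g dvd 1" using assms u unfolding irreducible_def by blast
  fix a b assume "pull n g = a * b"
  then have "g = unpull n a * unpull n b" by (metis unpull_mult unpull_pull(1))
  then have "unpull n a dvd 1 \<or> unpull n b dvd 1" using assms unfolding irreducible_def by blast
  then show "a dvd 1 \<or> b dvd 1" using u unpull_pull(2) by metis
qed

lemma pull_polys: assumes "g \<in> polys n" shows "pull n g \<in> polys (Suc (2 * n))"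
  unfolding pull_def by (rule polys_subst[OF assms]) (auto intro!: polys_diff polys_mult polys_X)

definition triple :: "nat \<Rightarrow> (nat \<Rightarrow> complex) \<Rightarrow> (nat \<Rightarrow> complex) \<Rightarrow> complex \<Rightarrow> nat \<Rightarrow> complex" where
  "triple n x a t = (\<lambda>i. if i < n then x i else if i < 2 * n then a (i - n) else t)"

lemma triple_nth: "i < n \<Longrightarrow> triple n x a t i = x i" "i < n \<Longrightarrow> triple n x a t (n + i) = a i" "triple n x a t (2 * n) = t"
  by (auto simp: triple_def)

lemma ev_pull: assumes "g \<in> polys n" shows "ev (pull n g) (triple n x a t) = ev g (\<lambda>i. x i - t * a i)"
  unfolding pull_def ev_subst by (rule ev_polys_cong[OF assms]) (simp add: triple_nth)

lemma ev_join: assumes "g \<in> polys (2 * n)" shows "ev g (triple n x a t) = ev g (join_pt n x a)"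
  by (rule ev_polys_cong[OF assms]) (auto simp: triple_def join_pt_def)

section \<open>The hypersurface f(x - t a) = 0\<close>

context lie_setup
begin

abbreviation Fp :: mp where "Fp \<equiv> pull n f"

lemma Fp_polys: "Fp \<in> polys (Suc (2 * n))" by (rule pull_polys[OF f_polys])
lemma Fp_irreducible: "irreducible Fp" by (rule irreducible_pull[OF f_irreducible])

text \<open>At \<open>x = 0\<close> the value is 0 for \<open>t = 0\<close> and \<open>f(a)\<close>
  up to sign for \<open>t = 1\<close>, so the variable \<open>t\<close> really occurs.\<close>

lemma Fp_dg: "dg (2 * n) Fp > 0"
proof (rule ccontr)
  assume "\<not> ?thesis"
  then have F: "Fp \<in> polys (2 * n)" using dg_0_polys[OF Fp_polys] by simp
  obtain a where a: "ev f a \<noteq> 0" using mp_nonzero_ex[OF f_nz] by blast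
  have "ev Fp (triple n (\<lambda>_. 0) a 0) = ev Fp (triple n (\<lambda>_. 0) a 1)" unfolding ev_join[OF F] ..
  then have "ev f (\<lambda>i. 0 * a i) = ev f (\<lambda>i. (-1) * a i)" unfolding ev_pull[OF f_polys] by simp
  then show False using a homog_ev[OF f_homog, of 0 a] homog_ev[OF f_homog, of "-1" a] by simp
qed

text \<open>Elimination gives \<open>u * Fp + v * G = w\<close> with \<open>w\<close> free of
  \<open>t\<close>; on the hypersurface this reads \<open>v * G = w\<close>. As one point of the
  hypersurface with \<open>G\<close> nonzero excludes \<open>Fp dvd G\<close>, a single witness
  settles all roots \<open>t\<close> over generic \<open>(x, a)\<close>.\<close>

lemma generic_nonvanishing:
  assumes G: "G \<in> polys (Suc (2 * n))" and nd: "\<not> Fp dvd G"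
  shows "\<exists>w\<in>polys (2 * n). w \<noteq> 0 \<and> (\<forall>z. ev Fp z = 0 \<longrightarrow> ev w z \<noteq> 0 \<longrightarrow> ev G z \<noteq> 0)"
proof -
  obtain u v w where "u * Fp + v * G = w" "w \<in> polys (2 * n)" "w \<noteq> 0"
    using elimination[OF Fp_polys Fp_irreducible Fp_dg G nd] by blast
  then show ?thesis by (metis (no_types, lifting) add_0 ev_simps(3,4) mult_zero_right)
qed

lemma not_dvd_point: "ev Fp z = 0 \<Longrightarrow> ev G z \<noteq> 0 \<Longrightarrow> \<not> Fp dvd G"
  by (auto simp: dvd_def)

text \<open>The coefficient of \<open>t^(m+1)\<close> is \<open>f(a)\<close> up to sign, so the
  polynomial in \<open>t\<close> is not constant.\<close>

lemma Fp_root: assumes "ev f a \<noteq> 0" shows "\<exists>t. ev Fp (triple n x a t) = 0"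
proof -
  obtain q where q: "\<And>t. poly q t = ev f (\<lambda>i. x i - t * a i)" "degree q \<le> Suc m" "coeff q (Suc m) = (-1) ^ Suc m * ev f a"
    using line_poly[OF f_homog, of x a] by blast
  have "degree q = Suc m" using q(2,3) assms by (metis le_antisym le_degree mult_eq_0_iff power_eq_0_iff neg_equal_0_iff_equal zero_neq_one)
  then have "\<not> constant (poly q)" by (simp add: constant_degree)
  then obtain t where "poly q t = 0" using fundamental_theorem_of_algebra by blast
  then show ?thesis using q(1) ev_pull[OF f_polys] by metis
qed

lemma Fp_zero_ex: "\<exists>z. ev Fp z = 0"
  using Fp_root mp_nonzero_ex[OF f_nz] by blast

text \<open>Choose a point \<open>z0\<close> of the hypersurface where the rank is maximal. The
  constant matrices certifying it give a polynomial \<open>G\<close> with \<open>G(z0)\<close>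
  nonzero, so generically every root has this same rank. Equality of the Jordan tuples rests on
  this.\<close>

lemma generic_kernel_dim:
  assumes M: "M \<in> carrier_mat N N" and ent: "\<And>i j. i < N \<Longrightarrow> j < N \<Longrightarrow> M $$ (i, j) \<in> polys (Suc (2 * n))"
  shows "\<exists>w\<in>polys (2 * n). w \<noteq> 0 \<and> (\<exists>rho. \<forall>z. ev Fp z = 0 \<longrightarrow> ev w z \<noteq> 0 \<longrightarrow> kernel_dim (map_mat (\<lambda>g. ev g z) M) = rho)"
proof -
  let ?M = "\<lambda>z. map_mat (\<lambda>g. ev g z) M"
  let ?K = "\<lambda>z. kernel_dim (?M z)"
  have Mz: "?M z \<in> carrier_mat N N" for z using M by simp
  obtain z0 where z0: "ev Fp z0 = 0" "\<And>z. ev Fp z = 0 \<Longrightarrow> ?K z0 \<le> ?K z"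
    using ex_has_least_nat[of "\<lambda>z. ev Fp z = 0" _ ?K] Fp_zero_ex by blast
  obtain r X Y where r: "?K z0 = N - r" "r \<le> N" "X \<in> carrier_mat r N" "Y \<in> carrier_mat N r" "X * ?M z0 * Y = 1\<^sub>m r"
    using rank_factorization[OF Mz[of z0]] by blast
  define G where "G = det (map_mat mconst X * M * map_mat mconst Y)"
  have XMY: "map_mat mconst X * M * map_mat mconst Y \<in> carrier_mat r r" using r M by auto
  have G: "G \<in> polys (Suc (2 * n))" unfolding G_def
  proof (rule polys_det[OF XMY])
    fix i j assume ij: "i < r" "j < r"
    have X': "map_mat mconst X \<in> carrier_mat r N" and Y': "map_mat mconst Y \<in> carrier_mat N r" using r by auto
    have "(map_mat mconst X * M * map_mat mconst Y) $$ (i, j) = (\<Sum>l<N. (\<Sum>k<N. map_mat mconst X $$ (i, k) * M $$ (k, l)) * map_mat mconst Y $$ (l, j))"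
      unfolding mult_index[OF mult_carrier_mat[OF X' M] Y' ij]
      by (intro sum.cong refl) (use mult_index[OF X' M ij(1)] in simp)
    also have "\<dots> \<in> polys (Suc (2 * n))" using ent ij r by (intro polys_sum polys_mult) auto
    finally show "(map_mat mconst X * M * map_mat mconst Y) $$ (i, j) \<in> polys (Suc (2 * n))" .
  qed
  have evG: "ev G z = det (X * ?M z * Y)" for z
  proof -
    interpret h: comm_ring_hom "\<lambda>g. ev g z" by unfold_locales auto
    have "map_mat (\<lambda>g. ev g z) (map_mat mconst X * M * map_mat mconst Y) = X * ?M z * Y"
      using r M by (subst h.mat_hom_mult[of _ r N _ r], simp_all, subst h.mat_hom_mult[of _ r N _ N], auto intro!: arg_cong2[where f = "(*)"] eq_matI)
    then show ?thesis unfolding G_def ev_det by simp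
  qed
  have "ev G z0 \<noteq> 0" unfolding evG r(5) by simp
  then obtain w where w: "w \<in> polys (2 * n)" "w \<noteq> 0" "\<And>z. ev Fp z = 0 \<Longrightarrow> ev w z \<noteq> 0 \<Longrightarrow> ev G z \<noteq> 0"
    using generic_nonvanishing[OF G not_dvd_point[OF z0(1)]] by blast
  have "?K z = ?K z0" if z: "ev Fp z = 0" "ev w z \<noteq> 0" for z
  proof (rule antisym)
    show "?K z0 \<le> ?K z" using z0(2)[OF z(1)] .
    have "?K z + r \<le> N" by (rule kernel_dim_le[OF Mz r(3,4)]) (use w(3)[OF z] evG in simp)
    then show "?K z \<le> ?K z0" using r by linarith
  qed
  then show ?thesis using w by blast
qed

end

section \<open>The pencil at a generic point\<close>

lemma rsquarefree_card_roots:
  assumes "rsquarefree (p :: complex poly)" shows "card {z. poly p z = 0} = degree p"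
proof -
  have p0: "p \<noteq> 0" using assms by (auto simp: rsquarefree_def)
  have fin: "finite {z. poly p z = 0}" using poly_roots_finite[OF p0] .
  have "Polynomial.smult (lead_coeff p) (\<Prod>z | poly p z = 0. [:- z, 1:]) = p"
    by (rule complex_poly_decompose_rsquarefree[OF assms])
  then have "degree p = degree (Polynomial.smult (lead_coeff p) (\<Prod>z | poly p z = 0. [:- z, 1:]))" by simp
  also have "\<dots> = degree (\<Prod>z | poly p z = 0. [:- z, 1:])" using p0 by simp
  also have "\<dots> = (\<Sum>z | poly p z = 0. degree [:- z, 1:])" by (rule degree_prod_eq_sum_degree) auto
  finally show ?thesis by simp
qed

text \<open>At a generic point both forms are bordered to order \<open>n + 1\<close>, the first one by zero and the second one by a
  unit vector. The second form becomes nondegenerate, so the pair amounts to a self-adjoint operator.\<close>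

locale good_point = lie_setup +
  fixes x a :: "nat \<Rightarrow> complex" and i0 :: nat
  assumes i0: "i0 < n" and fx: "ev f x \<noteq> 0" and fa: "ev f a \<noteq> 0" and Qa: "ev (Q i0) a \<noteq> 0"
    and Qroot: "\<And>t. ev f (\<lambda>i. x i - t * a i) = 0 \<Longrightarrow> ev (Q i0) (\<lambda>i. x i - t * a i) \<noteq> 0"
    and simple: "\<And>t. ev f (\<lambda>i. x i - t * a i) = 0 \<Longrightarrow> (\<Sum>i<n. a i * ev (Q i) (\<lambda>i. x i - t * a i)) \<noteq> 0"
begin

abbreviation "Ax \<equiv> Amat n c x"
abbreviation "Aa \<equiv> Amat n c a"
abbreviation "At \<equiv> bord n Ax (\<lambda>_. 0)"
abbreviation "Bt \<equiv> bord n Aa (unit_fun i0)"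

lemma A_skew: "i < n \<Longrightarrow> j < n \<Longrightarrow> Amat n c z $$ (j, i) = - Amat n c z $$ (i, j)"
proof -
  assume ij: "i < n" "j < n"
  have "ev (PM n c j i) z = - ev (PM n c i j) z" using PM_sk[OF ij] by (simp only: ev_simps)
  then show ?thesis using ij by (simp only: Amat_index)
qed

lemma bord_skew:
  assumes "\<And>i j. i < n \<Longrightarrow> j < n \<Longrightarrow> M $$ (j, i) = - M $$ (i, j)" "i < Suc n" "j < Suc n"
  shows "bord n M w $$ (j, i) = - bord n M w $$ (i, j)"
  using assms(1)[of i j] assms(2,3) by (auto simp: bord_def)

lemma unit_sum: "(\<Sum>i<n. unit_fun i0 i * g i) = g i0" for g :: "nat \<Rightarrow> complex"
  using i0 by (simp add: unit_fun_def if_distrib[of "\<lambda>a. a * _"] sum.delta cong: if_cong)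

lemma det_bord_ev: "det (bord n (Amat n c z) w) = ev k z * (\<Sum>i<n. w i * ev (Q i) z) ^ 2"
proof -
  have "det (bord n (Amat n c z) w) = ev (det (bord n (AM n c) (\<lambda>i. mconst (w i)))) z"
    by (simp add: ev_det map_bord map_AM)
  then show ?thesis by (simp add: det_bord_AM)
qed

lemma k_f: "\<exists>b d. b \<noteq> 0 \<and> k = mconst b * f ^ (2 * d) \<and> d * Suc m = dP \<and> d \<ge> 1"
proof -
  obtain b where b: "b \<noteq> 0" "k = mconst b * P ^ 2" using k_P by blast
  obtain u d where u: "u \<noteq> 0" "P = mconst u * f ^ d" "d * Suc m = dP" "d \<ge> 1" using P_power by blast
  have "k = mconst (b * u ^ 2) * f ^ (2 * d)"
    unfolding b(2) u(2) by (simp add: power_mult_distrib mconst_hom mconst_power power_mult[symmetric] mult.commute)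
  then show ?thesis using b(1) u by (intro exI[of _ "b * u ^ 2"] exI[of _ d]) simp
qed

text \<open>The determinant is \<open>k(a) Q_i0(a)^2\<close>, and \<open>k\<close> is a nonzero
  scalar times a power of \<open>f\<close>.\<close>

lemma det_Bt: "det Bt \<noteq> 0"
  using k_f fa Qa unfolding det_bord_ev unit_sum by auto

definition Bi :: "complex mat" where "Bi = (SOME M. M \<in> carrier_mat (Suc n) (Suc n) \<and> Bt * M = 1\<^sub>m (Suc n) \<and> M * Bt = 1\<^sub>m (Suc n))"

lemma Bi: "Bi \<in> carrier_mat (Suc n) (Suc n)" "Bt * Bi = 1\<^sub>m (Suc n)" "Bi * Bt = 1\<^sub>m (Suc n)"
proof -
  have "\<exists>M. M \<in> carrier_mat (Suc n) (Suc n) \<and> Bt * M = 1\<^sub>m (Suc n) \<and> M * Bt = 1\<^sub>m (Suc n)"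
    using det_non_zero_imp_unit[OF bord_carrier det_Bt] by (auto simp: Units_def ring_mat_simps)
  from someI_ex[OF this] show "Bi \<in> carrier_mat (Suc n) (Suc n)" "Bt * Bi = 1\<^sub>m (Suc n)" "Bi * Bt = 1\<^sub>m (Suc n)"
    unfolding Bi_def by blast+
qed

sublocale pc: pencil "Suc n" At Bt Bi
proof
  show "At \<in> carrier_mat (Suc n) (Suc n)" "Bt \<in> carrier_mat (Suc n) (Suc n)" by (rule bord_carrier)+
  fix i j assume "i < Suc n" "j < Suc n"
  then show "At $$ (j, i) = - At $$ (i, j)" "Bt $$ (j, i) = - Bt $$ (i, j)"
    using bord_skew[OF A_skew] by blast+
qed (rule Bi)+

definition bs where "bs = (SOME bs. (\<forall>D\<in>set bs. pc.good_block D) \<and> (\<forall>D\<in>set bs. set (pc.bvecs D) \<subseteq> CS (Suc n)) \<and>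
    sorted_wrt (\<lambda>D D'. \<forall>z\<in>set (pc.bvecs D). \<forall>z'\<in>set (pc.bvecs D'). bil (Suc n) Bt z z' = 0) bs \<and>
    CS (Suc n) = cv.span (\<Union>D\<in>set bs. set (pc.bvecs D)))"

lemma bs: "\<And>D. D \<in> set bs \<Longrightarrow> pc.good_block D" "\<And>D. D \<in> set bs \<Longrightarrow> set (pc.bvecs D) \<subseteq> CS (Suc n)"
    "sorted_wrt (\<lambda>D D'. \<forall>z\<in>set (pc.bvecs D). \<forall>z'\<in>set (pc.bvecs D'). bil (Suc n) Bt z z' = 0) bs"
    "CS (Suc n) = cv.span (\<Union>D\<in>set bs. set (pc.bvecs D))"
proof -
  have "\<exists>bs. (\<forall>D\<in>set bs. pc.good_block D) \<and> (\<forall>D\<in>set bs. set (pc.bvecs D) \<subseteq> CS (Suc n)) \<and>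
    sorted_wrt (\<lambda>D D'. \<forall>z\<in>set (pc.bvecs D). \<forall>z'\<in>set (pc.bvecs D'). bil (Suc n) Bt z z' = 0) bs \<and>
    CS (Suc n) = cv.span (\<Union>D\<in>set bs. set (pc.bvecs D))"
    by (rule pc.pencil_blocks) blast
  from someI_ex[OF this, folded bs_def]
  show "\<And>D. D \<in> set bs \<Longrightarrow> pc.good_block D" "\<And>D. D \<in> set bs \<Longrightarrow> set (pc.bvecs D) \<subseteq> CS (Suc n)"
    "sorted_wrt (\<lambda>D D'. \<forall>z\<in>set (pc.bvecs D). \<forall>z'\<in>set (pc.bvecs D'). bil (Suc n) Bt z z' = 0) bs"
    "CS (Suc n) = cv.span (\<Union>D\<in>set bs. set (pc.bvecs D))" by blast+
qed

lemma jnf: "jordan_nf (Bi * At) (concat (map pc.jsizes bs))"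
  by (rule pc.blocks_jordan_nf[OF bs])

definition fp :: "complex poly" where
  "fp = (SOME q. (\<forall>t. poly q t = ev f (\<lambda>i. x i - t * a i)) \<and> degree q \<le> Suc m \<and> coeff q (Suc m) = (-1) ^ Suc m * ev f a)"

lemma fp: "poly fp t = ev f (\<lambda>i. x i - t * a i)" "degree fp = Suc m"
proof -
  have *: "(\<forall>t. poly fp t = ev f (\<lambda>i. x i - t * a i)) \<and> degree fp \<le> Suc m \<and> coeff fp (Suc m) = (-1) ^ Suc m * ev f a"
    unfolding fp_def by (rule someI_ex[OF line_poly[OF f_homog]])
  then show "poly fp t = ev f (\<lambda>i. x i - t * a i)" by blast
  have "coeff fp (Suc m) \<noteq> 0" using * fa by simp
  then show "degree fp = Suc m" using * le_degree le_antisym by blast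
qed

definition qp :: "nat \<Rightarrow> complex poly" where
  "qp i = (SOME q. (\<forall>t. poly q t = ev (Q i) (\<lambda>i. x i - t * a i)) \<and> degree q \<le> m \<and> coeff q m = (-1) ^ m * ev (Q i) a)"

lemma qp: assumes "i < n"
  shows "poly (qp i) t = ev (Q i) (\<lambda>i. x i - t * a i)" "degree (qp i) \<le> m" "coeff (qp i) m = (-1) ^ m * ev (Q i) a"
proof -
  have "(\<forall>t. poly (qp i) t = ev (Q i) (\<lambda>i. x i - t * a i)) \<and> degree (qp i) \<le> m \<and> coeff (qp i) m = (-1) ^ m * ev (Q i) a"
    unfolding qp_def by (rule someI_ex[OF line_poly[OF Q_homog[OF assms]]])
  then show "poly (qp i) t = ev (Q i) (\<lambda>i. x i - t * a i)" "degree (qp i) \<le> m" "coeff (qp i) m = (-1) ^ m * ev (Q i) a" by blast+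
qed

lemma ev_line_derivative:
  assumes "g \<in> polys n"
  shows "((\<lambda>t. ev g (\<lambda>i. x i - t * a i)) has_field_derivative - (\<Sum>i<n. a i * ev (pd i g) (\<lambda>i. x i - t * a i))) (at t)"
  using assms
proof (induction rule: polys_induct)
  case (mvar j)
  have "(\<Sum>i<n. a i * ev (pd i (mvar j)) (\<lambda>i. x i - t * a i)) = (\<Sum>i<n. if i = j then a i else 0)"
    by (rule sum.cong) auto
  then have s: "(\<Sum>i<n. a i * ev (pd i (mvar j)) (\<lambda>i. x i - t * a i)) = a j" using mvar by (simp add: sum.delta)
  show ?case unfolding s by (auto intro!: derivative_eq_intros)
next
  case (add f g)
  show ?case using DERIV_add[OF add(3,4)] by (simp add: sum.distrib algebra_simps)
next
  case (mult f g)
  let ?y = "\<lambda>i. x i - t * a i"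
  have "(\<Sum>i<n. a i * ev (pd i (f * g)) ?y) = (\<Sum>i<n. (a i * ev (pd i f) ?y) * ev g ?y + (a i * ev (pd i g) ?y) * ev f ?y)"
    by (intro sum.cong refl) (simp add: pd_mult algebra_simps)
  also have "\<dots> = (\<Sum>i<n. a i * ev (pd i f) ?y) * ev g ?y + (\<Sum>i<n. a i * ev (pd i g) ?y) * ev f ?y"
    by (simp only: sum.distrib sum_distrib_right)
  finally show ?case using DERIV_mult[OF mult(3,4)] by simp
qed auto

text \<open>The derivative of \<open>f\<close> along the line is a nonzero multiple of the sum of
  the \<open>a i * Q i\<close>, which \<open>simple\<close> keeps away from zero at the
  roots.\<close>

lemma fp_rsquarefree: "rsquarefree fp"
  unfolding rsquarefree_roots
proof (intro allI notI)
  fix t assume t: "poly fp t = 0 \<and> poly (pderiv fp) t = 0"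
  let ?y = "\<lambda>i. x i - t * a i"
  have "(poly fp has_field_derivative poly (pderiv fp) t) (at t)" by (rule poly_DERIV)
  moreover have "poly fp = (\<lambda>t. ev f (\<lambda>i. x i - t * a i))" using fp(1) by auto
  ultimately have "poly (pderiv fp) t = - (\<Sum>i<n. a i * ev (pd i f) ?y)"
    using DERIV_unique ev_line_derivative[OF f_polys, of t] by metis
  also have "(\<Sum>i<n. a i * ev (pd i f) ?y) = of_nat (Suc m) * (\<Sum>i<n. a i * ev (Q i) ?y)"
    unfolding sum_distrib_left by (intro sum.cong refl) (simp add: pd_f algebra_simps del: of_nat_Suc)
  finally have "(\<Sum>i<n. a i * ev (Q i) ?y) = 0" using t by (simp del: of_nat_Suc)
  then show False using simple[of t] t fp(1) by auto
qed

definition ts :: "complex list" where "ts = (SOME l. set l = {t. poly fp t = 0} \<and> distinct l)"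

lemma ts: "set ts = {t. poly fp t = 0}" "distinct ts" "length ts = Suc m"
proof -
  have "fp \<noteq> 0" using fp(2) by auto
  then have "finite {t. poly fp t = 0}" by (rule poly_roots_finite)
  then have "\<exists>l. set l = {t. poly fp t = 0} \<and> distinct l" by (rule finite_distinct_list)
  from someI_ex[OF this, folded ts_def] show *: "set ts = {t. poly fp t = 0}" "distinct ts" by auto
  have "length ts = card {t. poly fp t = 0}" using distinct_card[OF *(2)] *(1) by simp
  then show "length ts = Suc m" using rsquarefree_card_roots[OF fp_rsquarefree] fp(2) by simp
qed

lemma ts_nz: "t \<in> set ts \<Longrightarrow> t \<noteq> 0" using ts(1) fp(1)[of 0] fx by auto

text \<open>\<open>Bt * (t - Bi * At)\<close> is up to sign the structure matrix at
  \<open>x - t a\<close> bordered by \<open>- t\<close> times a unit vector, whose determinant is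
  known. The factors \<open>t^2\<close> and \<open>qp i0 ^ 2\<close> come from the border,
  \<open>fp ^ (2 * d)\<close> from \<open>k\<close>.\<close>

lemma char_poly_eq: "\<exists>b d. b \<noteq> 0 \<and> d * Suc m = dP \<and> d \<ge> 1 \<and> k = mconst b * f ^ (2 * d) \<and>
   Polynomial.smult (det Bt) (char_poly (Bi * At)) = Polynomial.smult b ([:0, 1:] ^ 2 * fp ^ (2 * d) * qp i0 ^ 2)"
proof -
  obtain b d where b: "b \<noteq> 0" "k = mconst b * f ^ (2 * d)" "d * Suc m = dP" "d \<ge> 1" using k_f by blast
  have BA: "Bi * At \<in> carrier_mat (Suc n) (Suc n)" using Bi by simp
  have "poly (Polynomial.smult (det Bt) (char_poly (Bi * At))) t = poly (Polynomial.smult b ([:0, 1:] ^ 2 * fp ^ (2 * d) * qp i0 ^ 2)) t" for t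
  proof -
    let ?y = "\<lambda>i. x i - t * a i"
    let ?C = "- char_matrix (Bi * At) t"
    have C: "?C \<in> carrier_mat (Suc n) (Suc n)" by (rule uminus_carrier_mat[OF char_matrix_closed[OF BA]])
    have "poly (Polynomial.smult (det Bt) (char_poly (Bi * At))) t = det Bt * det ?C"
      using char_poly_matrix[OF BA] by simp
    also have "\<dots> = det (Bt * ?C)" using det_mult[OF bord_carrier C] by simp
    also have "Bt * ?C = - bord n (Amat n c ?y) (\<lambda>i. - t * unit_fun i0 i)"
    proof (rule eq_matI)
      fix i j assume "i < dim_row (- bord n (Amat n c ?y) (\<lambda>i. - t * unit_fun i0 i))" "j < dim_col (- bord n (Amat n c ?y) (\<lambda>i. - t * unit_fun i0 i))"
      then have ij: "i < Suc n" "j < Suc n" by (auto simp: bord_def)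
      have "(Bt * ?C) $$ (i, j) = (\<Sum>l<Suc n. Bt $$ (i, l) * ?C $$ (l, j))" by (rule mult_index[OF bord_carrier C ij])
      also have "\<dots> = (\<Sum>l<Suc n. (if l = j then t * Bt $$ (i, l) else 0) - Bt $$ (i, l) * (Bi * At) $$ (l, j))"
        by (rule sum.cong[OF refl]) (use BA ij in \<open>auto simp: char_matrix_def algebra_simps simp del: index_mult_mat\<close>)
      also have "\<dots> = t * Bt $$ (i, j) - (\<Sum>l<Suc n. Bt $$ (i, l) * (Bi * At) $$ (l, j))"
        unfolding sum_subtractf using ij by (simp add: sum.delta del: sum.lessThan_Suc index_mult_mat)
      also have "(\<Sum>l<Suc n. Bt $$ (i, l) * (Bi * At) $$ (l, j)) = (Bt * (Bi * At)) $$ (i, j)"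
        by (rule mult_index[OF bord_carrier BA ij, symmetric])
      also have "Bt * (Bi * At) = (Bt * Bi) * At" by (rule assoc_mult_mat[OF bord_carrier Bi(1) bord_carrier, symmetric])
      also have "\<dots> = At" unfolding Bi by (rule left_mult_one_mat[OF bord_carrier])
      finally show "(Bt * ?C) $$ (i, j) = (- bord n (Amat n c ?y) (\<lambda>i. - t * unit_fun i0 i)) $$ (i, j)"
        using ij by (auto simp: bord_def Amat_def sum_subtractf sum_distrib_left algebra_simps)
    qed (simp_all only: index_uminus_mat carrier_matD[OF mult_carrier_mat[OF bord_carrier C]] carrier_matD[OF bord_carrier])
    \<comment> \<open>The order \<open>n + 1\<close> is even, so the sign disappears.\<close>
    also have "det (- bord n (Amat n c ?y) (\<lambda>i. - t * unit_fun i0 i)) = det (bord n (Amat n c ?y) (\<lambda>i. - t * unit_fun i0 i))"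
    proof -
      have "- bord n (Amat n c ?y) (\<lambda>i. - t * unit_fun i0 i) = (-1) \<cdot>\<^sub>m bord n (Amat n c ?y) (\<lambda>i. - t * unit_fun i0 i)" by (rule eq_matI) auto
      moreover have "even (Suc n)" using n_odd by simp
      ultimately show ?thesis by (simp add: bord_def)
    qed
    also have "\<dots> = ev k ?y * (- t * ev (Q i0) ?y) ^ 2"
      unfolding det_bord_ev using unit_sum[of "\<lambda>i. - t * ev (Q i) ?y"] by (simp add: ac_simps)
    also have "\<dots> = poly (Polynomial.smult b ([:0, 1:] ^ 2 * fp ^ (2 * d) * qp i0 ^ 2)) t"
      unfolding b(2) by (simp add: fp(1) qp(1)[OF i0] power_mult_distrib algebra_simps)
    finally show ?thesis .
  qed
  then have "Polynomial.smult (det Bt) (char_poly (Bi * At)) = Polynomial.smult b ([:0, 1:] ^ 2 * fp ^ (2 * d) * qp i0 ^ 2)"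
    by (intro poly_eq_poly_eq_iff[THEN iffD1] ext)
  then show ?thesis using b by blast
qed

end

section \<open>The Kronecker chain on a generic line\<close>

lemma bil_row: "bil N M v w = (\<Sum>i<N. v i * mapp N M w i)"
  by (simp add: bil_def mapp_def sum_distrib_left mult.assoc)

lemma bil_bord:
  "bil (Suc n) (bord n M e) v w = bil n M v w + (\<Sum>i<n. v i * e i) * w n - v n * (\<Sum>i<n. e i * w i)"
proof -
  have "bil (Suc n) (bord n M e) v w = (\<Sum>i<n. (\<Sum>j<n. v i * M $$ (i, j) * w j) + v i * e i * w n) + (\<Sum>j<n. - (v n * (e j * w j)))"
    unfolding bil_def sum.lessThan_Suc by (simp add: bord_def mult.assoc)
  then show ?thesis by (simp add: bil_def sum.distrib sum_distrib_left sum_distrib_right sum_negf)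
qed

lemma poly_sum_le: "degree p \<le> d \<Longrightarrow> poly p t = (\<Sum>s\<le>d. coeff p s * t ^ s)" for p :: "complex poly"
  unfolding poly_altdef by (rule sum.mono_neutral_left) (auto intro: coeff_eq_0)

lemma mapp_0: "mapp N M 0 = 0" by (simp add: mapp_def fun_eq_iff)

lemma mapp_sum: "mapp N M (sum g A) = (\<Sum>k\<in>A. mapp N M (g k))"
proof (induction A rule: infinite_finite_induct)
  case (insert x F)
  then show ?case by (simp only: sum.insert[OF insert(1,2)] mapp_linear)
qed (simp_all only: sum.infinite sum.empty mapp_0 simp_thms)

context good_point
begin

text \<open>The vector of \<open>t^s\<close>-coefficients of \<open>Q(x - t a)\<close>.\<close>

definition qv :: "nat \<Rightarrow> nat \<Rightarrow> complex" where "qv s = (\<lambda>i. if i < n then coeff (qp i) s else 0)"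

lemma qv_CS: "qv s \<in> CS n" by (simp add: qv_def CS_def)
lemma qv_big: "m < s \<Longrightarrow> qv s = 0"
  using qp(2) by (auto simp: qv_def fun_eq_iff intro!: coeff_eq_0 le_less_trans[OF qp(2)])

lemma qp_relation: assumes i: "i < n"
  shows "(\<Sum>j<n. [:Ax $$ (i, j), - Aa $$ (i, j):] * qp j) = 0"
proof (rule poly_eq_poly_eq_iff[THEN iffD1], rule ext)
  fix t
  let ?y = "\<lambda>i. x i - t * a i"
  have "poly (\<Sum>j<n. [:Ax $$ (i, j), - Aa $$ (i, j):] * qp j) t = (\<Sum>j<n. ev (PM n c i j) ?y * ev (Q j) ?y)"
    unfolding poly_sum
  proof (rule sum.cong[OF refl])
    fix j assume "j \<in> {..<n}"
    then have j: "j < n" by simp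
    have "ev (PM n c i j) ?y = Ax $$ (i, j) - t * Aa $$ (i, j)"
      using i j by (simp add: Amat_index ev_PM sum_subtractf sum_distrib_left algebra_simps)
    then show "poly ([:Ax $$ (i, j), - Aa $$ (i, j):] * qp j) t = ev (PM n c i j) ?y * ev (Q j) ?y"
      by (simp add: qp(1)[OF j] left_diff_distrib mult.assoc)
  qed
  also have "\<dots> = ev (\<Sum>j<n. PM n c i j * Q j) ?y" by simp
  also have "\<dots> = 0" unfolding AQ[OF i] by simp
  finally show "poly (\<Sum>j<n. [:Ax $$ (i, j), - Aa $$ (i, j):] * qp j) t = poly 0 t" by simp
qed

text \<open>Comparison of coefficients in \<open>(A_x - t A_a) Q(x - t a) = 0\<close>: the classical
  singular chain of the pencil.\<close>

lemma qv_relation: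
  "mapp n Ax (qv 0) = 0" "mapp n Ax (qv (Suc s)) = mapp n Aa (qv s)"
proof -
  have rel: "(\<Sum>j<n. Ax $$ (i, j) * coeff (qp j) s) = (\<Sum>j<n. Aa $$ (i, j) * coeff (pCons 0 (qp j)) s)" if "i < n" for i s
  proof -
    have "0 = coeff (\<Sum>j<n. [:Ax $$ (i, j), - Aa $$ (i, j):] * qp j) s" unfolding qp_relation[OF that] by simp
    also have "\<dots> = (\<Sum>j<n. Ax $$ (i, j) * coeff (qp j) s) - (\<Sum>j<n. Aa $$ (i, j) * coeff (pCons 0 (qp j)) s)"
      unfolding coeff_sum sum_subtractf[symmetric]
      by (intro sum.cong refl) (cases s; simp)
    finally show ?thesis by simp
  qed
  show "mapp n Ax (qv 0) = 0" using rel[of _ 0] by (auto simp: mapp_def qv_def fun_eq_iff)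
  show "mapp n Ax (qv (Suc s)) = mapp n Aa (qv s)" using rel[of _ "Suc s"] by (auto simp: mapp_def qv_def fun_eq_iff)
qed

lemma Aa_qv_top: "mapp n Aa (qv m) = 0"
  using qv_relation(2)[of m] qv_big[of "Suc m"] by (simp add: mapp_0)

lemma bil_qv: "bil n Ax v (qv 0) = 0" "bil n Ax v (qv (Suc s)) = bil n Aa v (qv s)" "bil n Aa v (qv m) = 0"
  unfolding bil_row qv_relation Aa_qv_top by simp_all

lemma bil_sk: "bil n Ax w v = - bil n Ax v w" "bil n Aa w v = - bil n Aa v w"
  by (rule bil_skew, rule A_skew, assumption+)+

lemma bil_qv_left: "bil n Ax (qv 0) v = 0" "bil n Ax (qv (Suc s)) v = bil n Aa (qv s) v" "bil n Aa (qv m) v = 0"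
  using bil_qv bil_sk by metis+

text \<open>Indices can be traded, \<open>A_a(q_(r+1), q_s) = A_a(q_r, q_(s+1))\<close>, until the
  first one reaches 0; there the value is \<open>A_x(q_0, q_(s+1)) = 0\<close>.\<close>

lemma qv_isotropic: "bil n Aa (qv r) (qv s) = 0" "bil n Ax (qv r) (qv s) = 0"
proof -
  show 1: "bil n Aa (qv r) (qv s) = 0" for r s
  proof (induction r arbitrary: s)
    case 0
    show ?case using bil_qv(2)[of "qv 0" s] bil_qv_left(1) by metis
  next
    case (Suc r)
    have "bil n Aa (qv (Suc r)) (qv s) = bil n Ax (qv (Suc r)) (qv (Suc s))" by (simp only: bil_qv)
    also have "\<dots> = bil n Aa (qv r) (qv (Suc s))" by (simp only: bil_qv_left)
    finally show ?case using Suc by simp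
  qed
  show "bil n Ax (qv r) (qv s) = 0" by (cases s) (simp_all add: bil_qv 1)
qed

lemma qv_i0: "qv m i0 \<noteq> 0" using qp(3)[OF i0] Qa i0 by (simp add: qv_def)

text \<open>Nonsingularity of the bordered form says that the kernel of \<open>A_a\<close> meets the
  hyperplane of zero \<open>i0\<close>-coordinate only in 0.\<close>

lemma Aa_kernel:
  assumes w: "w \<in> CS n" "mapp n Aa w = 0" "w i0 = 0" shows "w = 0"
proof
  fix i
  show "w i = 0 i"
  proof (cases "i < n")
    case True
    have "w i = 0"
    proof (rule bord_kernel[OF Amat_carrier det_Bt _ _ True])
      show "(\<Sum>j<n. Aa $$ (i, j) * w j) = 0" if "i < n" for i
        using fun_cong[OF w(2), of i] that by (simp add: mapp_def)
      show "(\<Sum>j<n. unit_fun i0 j * w j) = 0" unfolding unit_sum by (rule w(3))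
    qed
    then show ?thesis by simp
  qed (use w(1) in \<open>simp add: CS_def\<close>)
qed

text \<open>A linear relation among the coefficients of the kernel vector can be shifted, so if there is one then the shift has an
  eigenvector \<open>(1, \<mu>, \<mu>\<^sup>2, \<dots>)\<close> among the relations, which is a common zero of the \<open>Q i\<close> on the line.\<close>
lemma qv_indep:
  assumes "(\<Sum>s<Suc m. cscale (z s) (qv s)) = 0" "s < Suc m" shows "z s = 0"
proof -
  define \<kappa> where "\<kappa> s = - qv s i0 / qv m i0" for s
  \<comment> \<open>The last entry is chosen so that the new combination has
    \<open>i0\<close>-coordinate zero; being killed by \<open>A_a\<close>, it then vanishes. So
    relations are mapped to relations.\<close>
  define Sh :: "(nat \<Rightarrow> complex) \<Rightarrow> nat \<Rightarrow> complex" where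
    "Sh z = (\<lambda>s. if s < m then z (Suc s) else if s = m then \<Sum>s<m. z (Suc s) * \<kappa> s else 0)" for z
  define C where "C = {z \<in> CS (Suc m). (\<Sum>s<Suc m. cscale (z s) (qv s)) = 0}"
  have Cmem: "z \<in> C \<longleftrightarrow> z \<in> CS (Suc m) \<and> (\<Sum>s<Suc m. cscale (z s) (qv s)) = 0" for z
    unfolding C_def by (rule mem_Collect_eq)
  have sub: "cv.subspace C"
  proof (rule cv.subspaceI)
    have "(\<Sum>s<Suc m. cscale ((0 :: nat \<Rightarrow> complex) s) (qv s)) = 0"
      by (simp only: zero_fun_apply cv.scale_zero_left sum.neutral_const)
    then show "0 \<in> C" unfolding Cmem using cv.subspace_0[OF CS_subspace] by blast
    show "x + y \<in> C" if "x \<in> C" "y \<in> C" for x y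
    proof -
      have "(\<Sum>s<Suc m. cscale ((x + y) s) (qv s)) = (\<Sum>s<Suc m. cscale (x s) (qv s)) + (\<Sum>s<Suc m. cscale (y s) (qv s))"
        by (simp only: plus_fun_apply cv.scale_left_distrib sum.distrib)
      then show ?thesis using that cv.subspace_add[OF CS_subspace] unfolding Cmem by (simp only: add_0_left simp_thms)
    qed
    show "cscale k x \<in> C" if "x \<in> C" for k x
    proof -
      have "(\<Sum>s<Suc m. cscale (cscale k x s) (qv s)) = cscale k (\<Sum>s<Suc m. cscale (x s) (qv s))"
        by (simp only: cv.scale_sum_right cscale_apply cv.scale_scale)
      then show ?thesis using that cv.subspace_scale[OF CS_subspace] unfolding Cmem by (simp only: cv.scale_zero_right simp_thms)
    qed
  qed
  have shC: "Sh z \<in> C" if z: "z \<in> C" for z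
  proof -
    let ?w = "\<Sum>s<Suc m. cscale (Sh z s) (qv s)"
    have "?w = 0"
    proof (rule Aa_kernel)
      show "?w \<in> CS n" by (intro cv.subspace_sum[OF CS_subspace] cv.subspace_scale[OF CS_subspace] qv_CS)
      have "0 = mapp n Ax (\<Sum>s<Suc m. cscale (z s) (qv s))" using z mapp_0 unfolding Cmem by metis
      also have "\<dots> = (\<Sum>s<Suc m. cscale (z s) (mapp n Ax (qv s)))" by (simp only: mapp_sum mapp_linear)
      also have "\<dots> = (\<Sum>s<m. cscale (z (Suc s)) (mapp n Aa (qv s)))"
        unfolding sum.lessThan_Suc_shift qv_relation by (simp only: cv.scale_zero_right add_0_left)
      also have "\<dots> = (\<Sum>s<m. cscale (Sh z s) (mapp n Aa (qv s)))" by (rule sum.cong) (simp_all add: Sh_def)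
      also have "\<dots> = mapp n Aa ?w"
        by (simp only: mapp_sum mapp_linear sum.lessThan_Suc Aa_qv_top cv.scale_zero_right add_0_right)
      finally show "mapp n Aa ?w = 0" ..
      have "?w i0 = (\<Sum>s<m. Sh z s * qv s i0) + Sh z m * qv m i0"
        by (simp only: sum.lessThan_Suc plus_fun_apply sum_fun_apply cscale_apply)
      also have "Sh z m * qv m i0 = (\<Sum>s<m. z (Suc s) * (\<kappa> s * qv m i0))"
        by (simp add: Sh_def sum_distrib_right mult.assoc)
      also have "\<dots> = (\<Sum>s<m. - (Sh z s * qv s i0))"
      proof (rule sum.cong[OF refl])
        fix s assume "s \<in> {..<m}"
        then have "Sh z s = z (Suc s)" by (simp add: Sh_def)
        moreover have "\<kappa> s * qv m i0 = - qv s i0" using qv_i0 by (simp add: \<kappa>_def)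
        ultimately show "z (Suc s) * (\<kappa> s * qv m i0) = - (Sh z s * qv s i0)" by simp
      qed
      finally show "?w i0 = 0" by (simp only: sum_negf add.right_inverse)
    qed
    moreover have "Sh z \<in> CS (Suc m)" by (simp add: CS_def Sh_def)
    ultimately show ?thesis unfolding Cmem by blast
  qed
  have eig: "\<exists>l. \<exists>y\<in>C. y \<noteq> 0 \<and> Sh y = cscale l y" if z: "z \<in> C" "z \<noteq> 0" for z
  proof -
    \<comment> \<open>With the zero form the shift becomes an instance of the locale, for the sake
      of its eigenvector lemma.\<close>
    interpret sh: skew_selfadjoint cscale Sh "\<lambda>_ _. 0"
      by unfold_locales (auto simp: Sh_def fun_eq_iff cscale_apply sum.distrib sum_distrib_left distrib_right mult.assoc)
    have bd: "sh.indep_bound C (Suc m)"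
      unfolding sh.indep_bound_def using CS_indep_bound[of _ "Suc m"] unfolding C_def by blast
    obtain l y where y: "y \<in> C" "y \<noteq> 0" "sh.T l y = 0" using sh.eigenvector[OF sub shC bd z] by blast
    then have "Sh y = cscale l y" unfolding sh.T_def by (simp only: right_minus_eq)
    then show ?thesis using y by blast
  qed
  have "z = 0" if z: "z \<in> C" for z
  proof (rule ccontr)
    assume "z \<noteq> 0"
    obtain l y where y: "y \<in> C" "y \<noteq> 0" "Sh y = cscale l y" using eig[OF z \<open>z \<noteq> 0\<close>] by blast
    have rec: "y (Suc s) = l * y s" if "s < m" for s
      using fun_cong[OF y(3), of s] that by (simp add: Sh_def cscale_apply)
    have pw: "y s = l ^ s * y 0" if "s \<le> m" for s
      using that by (induction s) (simp_all add: rec)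
    have y0: "y 0 \<noteq> 0"
    proof
      assume "y 0 = 0"
      then have "y s = 0" for s using pw[of s] y(1) by (cases "s \<le> m") (auto simp: C_def CS_def)
      then show False using y(2) by (auto simp: fun_eq_iff)
    qed
    have root: "ev (Q i) (\<lambda>i. x i - l * a i) = 0" if i: "i < n" for i
    proof -
      have "0 = (\<Sum>s<Suc m. cscale (y s) (qv s)) i" using y(1) unfolding Cmem by (metis zero_fun_apply)
      also have "\<dots> = (\<Sum>s\<le>m. y 0 * (coeff (qp i) s * l ^ s))"
        unfolding sum_fun_apply lessThan_Suc_atMost
      proof (rule sum.cong[OF refl])
        fix s assume "s \<in> {..m}"
        then have "y s = l ^ s * y 0" by (intro pw) simp
        then show "cscale (y s) (qv s) i = y 0 * (coeff (qp i) s * l ^ s)" using i by (simp only: cscale_apply qv_def if_True ac_simps)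
      qed
      also have "\<dots> = y 0 * poly (qp i) l"
        unfolding sum_distrib_left[symmetric] poly_sum_le[OF qp(2)[OF i]] ..
      finally show ?thesis using y0 qp(1)[OF i] by simp
    qed
    have "ev f (\<lambda>i. x i - l * a i) = 0" by (simp add: f_def root)
    then show False using Qroot root i0 by blast
  qed
  moreover have "(\<lambda>s. if s < Suc m then z s else 0) \<in> C"
  proof -
    have "(\<Sum>s<Suc m. cscale (if s < Suc m then z s else 0) (qv s)) = (\<Sum>s<Suc m. cscale (z s) (qv s))"
      by (rule sum.cong) simp_all
    then have "(\<Sum>s<Suc m. cscale (if s < Suc m then z s else 0) (qv s)) = 0" using assms(1) by (rule trans)
    moreover have "(\<lambda>s. if s < Suc m then z s else 0) \<in> CS (Suc m)" by (simp add: CS_def)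
    ultimately show ?thesis unfolding Cmem by blast
  qed
  ultimately have "(\<lambda>s. if s < Suc m then z s else 0) = 0" .
  from fun_cong[OF this, of s] show ?thesis using assms(2) by simp
qed

text \<open>Root vectors for a root \<open>t\<close> of \<open>f(x - t a)\<close> have no component along the added coordinate, so they also
  split off the unbordered pair.\<close>
lemma root_vector:
  assumes "(pc.T t ^^ r) z = 0" "z \<in> CS (Suc n)" "t \<in> set ts"
  shows "z n = 0 \<and> z i0 = 0 \<and> (\<forall>s. bil n Aa (qv s) z = 0)"
  using assms(1,2)
proof (induction r arbitrary: z)
  case 0
  then have "z = 0" by (simp only: funpow_0)
  then show ?case by (auto simp: bil_def)
next
  case (Suc r)
  let ?z = "pc.T t z"
  have t0: "t \<noteq> 0" using ts_nz assms(3) .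
  have "?z \<in> CS (Suc n)" unfolding pc.T_def
    using Suc.prems mapp_CS by (intro cv.subspace_diff[OF CS_subspace] cv.subspace_scale[OF CS_subspace]) auto
  moreover have "(pc.T t ^^ r) ?z = 0" using Suc.prems(1) by (simp only: funpow_Suc_right comp_apply)
  ultimately have IH: "?z n = 0" "?z i0 = 0" "\<And>s. bil n Aa (qv s) ?z = 0" using Suc.IH by blast+
  have key: "bil (Suc n) Bt v ?z = bil (Suc n) At v z - t * bil (Suc n) Bt v z" for v
    unfolding pc.T_def bil_diff bil_linear pc.S_alt ..
  have un: "bil n M (unit_fun n) w = 0" for M w by (simp add: bil_def unit_fun_def)
  \<comment> \<open>Testing against the added unit vector isolates the
    \<open>i0\<close>-coordinate.\<close>
  have "- ?z i0 = t * z i0"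
    using key[of "unit_fun n"] unfolding bil_bord unit_sum un by (simp add: unit_fun_def)
  then have zi: "z i0 = 0" using IH(2) t0 by simp
  define U where "U s = bil n Aa (qv s) z" for s
  have qn: "qv s n = 0" for s by (simp add: qv_def)
  have qe: "(\<Sum>i<n. qv s i * unit_fun i0 i) = qv s i0" for s
    using unit_sum[of "qv s"] by (simp add: mult.commute)
  have rel: "0 = bil n Ax (qv s) z - t * (U s + qv s i0 * z n)" for s
    using key[of "qv s"] unfolding bil_bord unit_sum qn qe U_def by (simp add: IH)
  have r0: "t * (U 0 + qv 0 i0 * z n) = 0" using rel[of 0] unfolding bil_qv_left by simp
  have rS: "U s = t * (U (Suc s) + qv (Suc s) i0 * z n)" for s using rel[of "Suc s"] unfolding bil_qv_left U_def by simp
  have Um: "U m = 0" unfolding U_def by (rule bil_qv_left)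
  \<comment> \<open>Weighted by powers of \<open>t\<close> the relations telescope. As
    \<open>U m = 0\<close>, what remains is \<open>z n\<close> times
    \<open>t * Q_i0(x - t a)\<close>, and this factor is nonzero at a root of
    \<open>f\<close>.\<close>
  have tel: "(\<Sum>s\<le>r. t ^ s * (t * (qv s i0 * z n))) = - (t ^ Suc r * U r)" for r
  proof (induction r)
    case 0
    then show ?case using r0 by (simp add: algebra_simps add_eq_0_iff)
  next
    case (Suc r)
    show ?case unfolding sum.atMost_Suc Suc using rS[of r] by (simp add: algebra_simps)
  qed
  have "0 = (\<Sum>s\<le>m. t ^ s * (t * (qv s i0 * z n)))" unfolding tel Um by simp
  also have "\<dots> = t * z n * (\<Sum>s\<le>m. coeff (qp i0) s * t ^ s)"
    unfolding sum_distrib_left using i0 by (intro sum.cong) (auto simp: qv_def)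
  also have "\<dots> = t * z n * poly (qp i0) t" unfolding poly_sum_le[OF qp(2)[OF i0]] ..
  finally have zn: "z n = 0"
    using t0 Qroot[of t] assms(3) unfolding ts(1) by (simp add: qp(1)[OF i0] fp(1))
  have "U s = 0" for s
  proof (induction s)
    case 0
    then show ?case using r0 t0 zn by simp
  next
    case (Suc s)
    then show ?case using rS[of s] t0 zn by simp
  qed
  then show ?case using zn zi unfolding U_def by blast
qed

end

text \<open>Solves \<open>M i j - M j i = a i j\<close> and \<open>M i (j + 1) - M j (i + 1) = b i j\<close> for skew-symmetric \<open>a\<close>, \<open>b\<close>.\<close>
function kron_shift :: "(nat \<Rightarrow> nat \<Rightarrow> complex) \<Rightarrow> (nat \<Rightarrow> nat \<Rightarrow> complex) \<Rightarrow> nat \<Rightarrow> nat \<Rightarrow> complex" where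
  "kron_shift a b i j = (if i = j \<or> j = Suc i then 0
     else if j < i then kron_shift a b j i + a i j
     else kron_shift a b (j - 1) (Suc i) + b i (j - 1))"
  by auto
termination
  \<comment> \<open>The swap keeps the gap and drops the extra 1; the other call narrows the gap by
    two.\<close>
  by (relation "Wellfounded.measure (\<lambda>(a, b, i, j). 2 * (if i < j then j - i else i - j) + (if j < i then 1 else 0))") auto

declare kron_shift.simps [simp del]

lemma kron_shift:
  assumes a: "\<And>i j. a j i = - a i j" and b: "\<And>i j. b j i = - b i j"
  shows "kron_shift a b i j = kron_shift a b j i + a i j"
    and "kron_shift a b i (Suc j) = kron_shift a b j (Suc i) + b i j"
proof -
  have 0: "a i i = 0" "b i i = 0" for i using a[of i i] b[of i i] by simp_all
  have 1: "kron_shift a b i j = kron_shift a b j i + a i j" if "j < i" for i j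
    by (subst kron_shift.simps) (use that 0 in \<open>auto simp: kron_shift.simps[of a b j i]\<close>)
  show "kron_shift a b i j = kron_shift a b j i + a i j"
    using 1[of i j] 1[of j i] a[of i j] 0 by (cases i j rule: linorder_cases) auto
  have 2: "kron_shift a b i (Suc j) = kron_shift a b j (Suc i) + b i j" if "i < j" for i j
    by (subst kron_shift.simps) (use that in auto)
  show "kron_shift a b i (Suc j) = kron_shift a b j (Suc i) + b i j"
    using 2[of i j] 2[of j i] b[of i j] 0 by (cases i j rule: linorder_cases) auto
qed

lemma filter_jsizes:
  "sum_list (map fst (filter (\<lambda>na. snd na = t) (concat (map (\<lambda>D. [(fst (snd D), fst D), (fst (snd D), fst D)]) bs)))) =
   2 * sum_list (map (\<lambda>D. fst (snd D)) (filter (\<lambda>D. fst D = t) bs))"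
  "length (filter ((=) (l, t)) (concat (map (\<lambda>D. [(fst (snd D), fst D), (fst (snd D), fst D)]) bs))) =
   2 * count (mset (map (\<lambda>D. fst (snd D)) (filter (\<lambda>D. fst D = t) bs))) l"
  for bs :: "('a \<times> nat \<times> 'b) list"
  by (induction bs) auto

context good_point
begin

text \<open>Sorted, so that equal multisets of sizes become equal lists.\<close>

definition bsz :: "complex \<Rightarrow> nat list" where
  "bsz t = map (\<lambda>D. fst (snd D)) (sort_key (\<lambda>D. fst (snd D)) (filter (\<lambda>D. fst D = t) bs))"

lemma mset_bsz: "mset (bsz t) = mset (map (\<lambda>D. fst (snd D)) (filter (\<lambda>D. fst D = t) bs))"
  by (simp add: bsz_def)

lemma sorted_bsz: "sorted (bsz t)" by (simp add: bsz_def)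

text \<open>The characteristic polynomial has order \<open>2 * d\<close> at \<open>t\<close>:
  \<open>fp\<close> has a simple root there, while \<open>t\<close> itself and \<open>qp i0\<close>
  do not vanish. Every skew block counts twice in this order.\<close>

lemma bsz_sum:
  assumes "t \<in> set ts" "d * Suc m = dP"
  shows "sum_list (bsz t) = d"
proof -
  obtain b d' where d': "b \<noteq> 0" "d' * Suc m = dP"
    and cp: "Polynomial.smult (det Bt) (char_poly (Bi * At)) = Polynomial.smult b ([:0, 1:] ^ 2 * fp ^ (2 * d') * qp i0 ^ 2)"
    using char_poly_eq by blast
  have dd: "d' = d" using d'(2) assms(2) by (metis mult_right_cancel nat.distinct(1))
  have fp0: "fp \<noteq> 0" and q0: "qp i0 \<noteq> 0" using fp(2) qp(3)[OF i0] Qa by auto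
  have t0: "t \<noteq> 0" using ts_nz assms(1) .
  have root: "poly fp t = 0" using assms(1) ts(1) by simp
  have nz: "[:0, 1:] ^ 2 * fp ^ (2 * d') * qp i0 ^ 2 \<noteq> (0 :: complex poly)" using fp0 q0 by simp
  have of: "Polynomial.order t fp = 1"
    using fp_rsquarefree root fp0 order_root[of fp t] unfolding rsquarefree_def by metis
  have oq: "Polynomial.order t (qp i0) = 0"
    using Qroot[of t] root qp(1)[OF i0] fp(1) by (auto intro: order_0I)
  have ox: "Polynomial.order t [:0, 1:] = 0" using t0 by (auto intro: order_0I)
  have pw: "Polynomial.order t (p ^ r) = r * Polynomial.order t p" if "p \<noteq> 0" for p :: "complex poly" and r
    using that by (induction r) (auto simp: order_mult order_1_eq_0)
  have "Polynomial.order t (char_poly (Bi * At)) = Polynomial.order t (Polynomial.smult (det Bt) (char_poly (Bi * At)))"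
    using det_Bt by (simp add: order_smult)
  also have "\<dots> = Polynomial.order t ([:0, 1:] ^ 2 * fp ^ (2 * d') * qp i0 ^ 2)"
    unfolding cp using d'(1) by (rule order_smult)
  also have "\<dots> = 2 * Polynomial.order t [:0, 1:] + 2 * d' * Polynomial.order t fp + 2 * Polynomial.order t (qp i0)"
    using fp0 q0 nz by (subst order_mult, simp, subst order_mult, simp) (simp add: pw)
  finally have "Polynomial.order t (char_poly (Bi * At)) = 2 * d" unfolding of oq ox dd by simp
  then have "2 * sum_list (map (\<lambda>D. fst (snd D)) (filter (\<lambda>D. fst D = t) bs)) = 2 * d"
    unfolding jordan_nf_order[OF jnf] pc.jsizes_def filter_jsizes by simp
  moreover have "sum_list (bsz t) = sum_list (map (\<lambda>D. fst (snd D)) (filter (\<lambda>D. fst D = t) bs))"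
    using mset_bsz by (metis sum_mset_sum_list)
  ultimately show ?thesis by simp
qed

lemma good: "D \<in> set bs \<Longrightarrow> fst (snd D) \<ge> 1"
  using bs(1)[of D] by (cases D) (auto simp: pc.good_block_def)

lemma bsz_pos: "l \<in> set (bsz t) \<Longrightarrow> 1 \<le> l"
  using good by (auto simp: bsz_def)

text \<open>The right-hand side depends only on dimensions of generalized eigenspaces, which the
  generic rank argument controls.\<close>

lemma bsz_count:
  assumes "l \<noteq> 0" shows "2 * count (mset (bsz t)) l = compute_nr_of_jordan_blocks (Bi * At) t l"
  unfolding compute_nr_of_jordan_blocks[OF jnf assms] pc.jsizes_def filter_jsizes mset_bsz ..

text \<open>Blocks at the roots of \<open>fp\<close> live on the original space. The remaining ones
  have eigenvalue 0 or a zero of \<open>qp i0\<close> and enter only through their orthogonality to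
  the former.\<close>

definition rts where "rts = {D \<in> set bs. fst D \<in> set ts}"
definition RV where "RV = (\<Union>D\<in>rts. set (pc.bvecs D))"
definition OV where "OV = (\<Union>D\<in>set bs - rts. set (pc.bvecs D))"

text \<open>Every vector of a block at a root is a root vector, so the added coordinate vanishes on
  the whole block.\<close>

lemma bvecs_root: assumes "D \<in> rts" "z \<in> set (pc.bvecs D)"
  shows "z \<in> CS n" "\<And>s. bil n Aa (qv s) z = 0" "z i0 = 0"
proof -
  obtain l k u v where D: "D = (l, k, u, v)" by (cases D) auto
  have h: "(pc.T l ^^ k) u = 0" "(pc.T l ^^ k) v = 0" "l \<in> set ts" "D \<in> set bs"
    using bs(1)[of D] assms(1) by (auto simp: rts_def D pc.good_block_def)
  obtain i where "z = (pc.T l ^^ i) u \<or> z = (pc.T l ^^ i) v" using assms(2) unfolding D pc.set_bvecs by blast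
  then have "(pc.T l ^^ k) z = 0"
    using h pc.T_pow_ge[of k l u "k + i"] pc.T_pow_ge[of k l v "k + i"] by (auto simp: funpow_add)
  moreover have zC: "z \<in> CS (Suc n)" using bs(2)[OF h(4)] assms(2) by blast
  ultimately have r: "z n = 0 \<and> z i0 = 0 \<and> (\<forall>s. bil n Aa (qv s) z = 0)" using root_vector h(3) by blast
  have "z i = 0" if "n \<le> i" for i using that zC r by (cases "i = n") (auto simp: CS_def)
  then show "z \<in> CS n" "\<And>s. bil n Aa (qv s) z = 0" "z i0 = 0" using r by (auto simp: CS_def)
qed

lemma bil_CS:
  assumes "v \<in> CS n" "w \<in> CS n"
  shows "bil (Suc n) Bt v w = bil n Aa v w" "bil (Suc n) At v w = bil n Ax v w"
  using assms unfolding bil_bord CS_def by auto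

lemma blocks_orth:
  assumes "D \<in> set bs" "D' \<in> set bs" "D \<noteq> D'" "z \<in> set (pc.bvecs D)" "z' \<in> set (pc.bvecs D')"
  shows "bil (Suc n) Bt z z' = 0"
proof -
  obtain i j where ij: "i < length bs" "j < length bs" "bs ! i = D" "bs ! j = D'" "i \<noteq> j"
    using assms(1-3) by (metis in_set_conv_nth)
  show ?thesis
  proof (cases "i < j")
    case True
    then show ?thesis using bs(3) ij assms(4,5) unfolding sorted_wrt_iff_nth_less by blast
  next
    case False
    then have "bil (Suc n) Bt z' z = 0" using bs(3) ij assms(4,5) unfolding sorted_wrt_iff_nth_less by (meson nat_neq_iff)
    then show ?thesis using pc.b_skew[of z z'] by simp
  qed
qed

lemma OV_RV_orth:
  assumes "v \<in> cv.span OV" "z \<in> cv.span RV"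
  shows "bil (Suc n) Bt v z = 0"
proof -
  have 1: "bil (Suc n) Bt v z = 0" if "v \<in> OV" "z \<in> RV" for v z
    using that blocks_orth unfolding OV_def RV_def rts_def by blast
  have 2: "bil (Suc n) Bt v z = 0" if "v \<in> OV" for v
    using assms(2)
  proof (induction rule: cv.span_induct_alt)
    case (step c y w)
    then show ?case using 1[OF that] by (simp only: bil_linear mult_zero_right add_0_right)
  qed (simp only: bil_zero)
  show ?thesis using assms(1)
  proof (induction rule: cv.span_induct_alt)
    case (step c y w)
    then show ?case using 2 by (simp only: bil_linear mult_zero_right add_0_right)
  qed (simp only: bil_zero)
qed

lemma S_RV: assumes "z \<in> RV" shows "pc.S z \<in> cv.span RV"
proof -
  obtain D where D: "D \<in> rts" "z \<in> set (pc.bvecs D)" using assms by (auto simp: RV_def)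
  then have "pc.S z \<in> cv.span (set (pc.bvecs D))" using pc.S_bvecs_span bs(1) by (auto simp: rts_def)
  moreover have "set (pc.bvecs D) \<subseteq> RV" using D by (auto simp: RV_def)
  ultimately show ?thesis using cv.span_mono by blast
qed

lemma RV_CS: "RV \<subseteq> CS n" using bvecs_root by (auto simp: RV_def)

lemma qv_RV: assumes "z \<in> cv.span RV" shows "bil n Aa (qv s) z = 0"
  using assms
proof (induction rule: cv.span_induct_alt)
  case (step c y w)
  then have "bil n Aa (qv s) y = 0" using bvecs_root by (auto simp: RV_def)
  then show ?case using step by (simp only: bil_linear mult_zero_right add_0_right)
qed (simp only: bil_zero)

lemma qv_RV_x: assumes "z \<in> cv.span RV" shows "bil n Ax (qv s) z = 0"
  using qv_RV[OF assms] by (cases s) (simp_all add: bil_qv_left)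

text \<open>Keep the component of \<open>u\<close> in the blocks that do not belong to roots. It
  stays in the original space because the removed part does, and its pairings with the chain are
  unchanged because the chain is orthogonal to the root blocks.\<close>

lemma split_off_RV:
  assumes u: "u \<in> CS n"
  obtains v where "v \<in> CS n" "\<And>s. bil n Aa v (qv s) = bil n Aa u (qv s)"
    "\<And>z. z \<in> RV \<Longrightarrow> bil n Aa v z = 0" "\<And>z. z \<in> RV \<Longrightarrow> bil n Ax v z = 0"
proof -
  have "u \<in> CS (Suc n)" using u by (auto simp: CS_def)
  also have "CS (Suc n) = cv.span (RV \<union> OV)" unfolding bs(4) RV_def OV_def rts_def by (rule arg_cong[where f = cv.span]) blast
  finally obtain r v where rv: "r \<in> cv.span RV" "v \<in> cv.span OV" "u = r + v" unfolding cv.span_Un by blast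
  have rC: "r \<in> CS n" using rv(1) cv.span_minimal[OF RV_CS CS_subspace] by blast
  have v: "v = u - r" using rv(3) by simp
  have vC: "v \<in> CS n" unfolding v by (rule cv.subspace_diff[OF CS_subspace u rC])
  show ?thesis
  proof
    show "v \<in> CS n" by (rule vC)
    show "bil n Aa v (qv s) = bil n Aa u (qv s)" for s
      using qv_RV[OF rv(1), of s] bil_sk(2)[of r "qv s"] unfolding v bil_diff by simp
    fix z assume z: "z \<in> RV"
    then have zC: "z \<in> CS n" using RV_CS by blast
    show "bil n Aa v z = 0"
      using OV_RV_orth[OF rv(2) cv.span_base[OF z]] unfolding bil_CS[OF vC zC] .
    show "bil n Ax v z = 0"
      using OV_RV_orth[OF rv(2) S_RV[OF z]] unfolding pc.S_alt bil_CS[OF vC zC] .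
  qed
qed

end

section \<open>Assembling the canonical basis\<close>

lemma det_nz_invertible: assumes "P \<in> carrier_mat n n" "det P \<noteq> (0 :: complex)" shows "invertible_mat P"
proof -
  obtain R where "R \<in> carrier_mat n n" "P * R = 1\<^sub>m n" "R * P = 1\<^sub>m n"
    using det_non_zero_imp_unit[OF assms] by (auto simp: Units_def ring_mat_simps)
  then show ?thesis using assms(1) by (auto simp: invertible_mat_def inverts_mat_def intro!: exI[of _ R])
qed

lemma distinct_concat_filter:
  "distinct ts \<Longrightarrow> distinct bs \<Longrightarrow> distinct (concat (map (\<lambda>t. sort_key k (filter (\<lambda>D. g D = t) bs)) ts))"
  by (induction ts) auto

lemma sum_list_concat: "sum_list (concat xss) = sum_list (map sum_list xss)" for xss :: "nat list list"
  by (induction xss) auto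

lemma sum_single: "i < k \<Longrightarrow> (\<Sum>l<k. g l * (if l = i then 1 else 0)) = g i"
  "i < k \<Longrightarrow> (\<Sum>l<k. g l * (if i = l then 1 else 0)) = g i" for g :: "nat \<Rightarrow> complex"
  by (simp_all add: if_distrib sum.delta cong: if_cong)

context good_point
begin

text \<open>The functionals \<open>A_a q_s\<close> with \<open>s < m\<close> are independent: a
  relation would put a combination of these \<open>q_s\<close> into the kernel of
  \<open>A_a\<close>, which \<open>q_m\<close> spans. Hence a dual vector exists.\<close>

lemma dual_vector:
  assumes r: "r < m"
  shows "\<exists>u\<in>CS n. \<forall>s<m. bil n Aa u (qv s) = (if s = r then 1 else 0)"
proof -
  let ?y = "\<lambda>s. mapp n Aa (qv s)"
  have ind: "list_indep (map ?y [0..<m])" unfolding list_indep_def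
  proof (intro allI impI)
    fix z j assume z: "(\<Sum>j<length (map ?y [0..<m]). cscale (z j) (map ?y [0..<m] ! j)) = 0" and j: "j < length (map ?y [0..<m])"
    \<comment> \<open>The coefficient of \<open>q_m\<close>, which \<open>A_a\<close> annihilates,
      is chosen to make the \<open>i0\<close>-coordinate zero.\<close>
    define z' where "z' s = (if s < m then z s else - (\<Sum>s<m. z s * qv s i0) / qv m i0)" for s
    let ?w = "\<Sum>s<Suc m. cscale (z' s) (qv s)"
    have 1: "(\<Sum>s<m. cscale (z' s) (g s)) = (\<Sum>s<m. cscale (z s) (g s))" for g
      by (rule sum.cong) (simp_all add: z'_def)
    have "?w = 0"
    proof (rule Aa_kernel)
      show "?w \<in> CS n" by (intro cv.subspace_sum[OF CS_subspace] cv.subspace_scale[OF CS_subspace] qv_CS)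
      have "mapp n Aa ?w = (\<Sum>s<m. cscale (z s) (?y s))"
        by (simp only: mapp_sum mapp_linear sum.lessThan_Suc Aa_qv_top cv.scale_zero_right add_0_right 1)
      also have "\<dots> = 0" using z by simp
      finally show "mapp n Aa ?w = 0" .
      have "?w i0 = (\<Sum>s<m. cscale (z s) (qv s)) i0 + z' m * qv m i0"
        by (simp only: sum.lessThan_Suc plus_fun_apply cscale_apply 1)
      also have "z' m * qv m i0 = - (\<Sum>s<m. z s * qv s i0)" using qv_i0 by (simp add: z'_def)
      finally show "?w i0 = 0" by (simp only: sum_fun_apply cscale_apply add.right_inverse)
    qed
    then have "z' j = 0" by (rule qv_indep) (use j in simp)
    then show "z j = 0" using j by (simp add: z'_def)
  qed
  then have d: "distinct (map ?y [0..<m])" and i: "cv.independent (?y ` {..<m})"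
    unfolding list_indep_iff by (auto simp: atLeast0LessThan)
  interpret vp: vector_space_pair cscale "(*) :: complex \<Rightarrow> complex \<Rightarrow> complex"
    by unfold_locales (auto simp: algebra_simps)
  obtain g where g: "Vector_Spaces.linear cscale (*) g" "\<And>s. s < m \<Longrightarrow> g (?y s) = (if ?y s = ?y r then 1 else 0)"
    using vp.linear_independent_extend[OF i, of "\<lambda>v. if v = ?y r then 1 else 0"] by auto
  let ?u = "\<lambda>l. if l < n then g (unit_fun l) else 0"
  have "bil n Aa ?u (qv s) = (if s = r then 1 else 0)" if s: "s < m" for s
  proof -
    have "bil n Aa ?u (qv s) = (\<Sum>l<n. ?y s l * g (unit_fun l))" unfolding bil_row by (rule sum.cong) auto
    also have "\<dots> = g (\<Sum>l<n. cscale (?y s l) (unit_fun l))"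
      by (simp only: vp.linear_sum[OF g(1)] vp.linear_scale[OF g(1)])
    also have "\<dots> = g (?y s)" using CS_expand[OF mapp_CS, of n Aa "qv s"] by simp
    also have "\<dots> = (if ?y s = ?y r then 1 else 0)" by (rule g(2)[OF s])
    also have "?y s = ?y r \<longleftrightarrow> s = r" using d s r nth_eq_iff_index_eq[OF d, of s r] by auto
    finally show ?thesis .
  qed
  then show ?thesis by (intro bexI[of _ ?u]) (auto simp: CS_def)
qed

text \<open>In reversed order the chain fits the canonical block: the first form pairs
  \<open>u i\<close> with \<open>wv i\<close>, the second with \<open>wv (i + 1)\<close>.\<close>

definition wv :: "nat \<Rightarrow> nat \<Rightarrow> complex" where "wv j = qv (m - j)"

lemma wv_CS: "wv j \<in> CS n" unfolding wv_def by (rule qv_CS)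

lemma wv_isotropic: "bil n Aa (wv i) (wv j) = 0" "bil n Ax (wv i) (wv j) = 0"
  unfolding wv_def by (rule qv_isotropic)+

lemma wv_RV: "z \<in> RV \<Longrightarrow> bil n Aa (wv j) z = 0" "z \<in> RV \<Longrightarrow> bil n Ax (wv j) z = 0"
  unfolding wv_def using qv_RV qv_RV_x cv.span_base by blast+

lemma dual_wv:
  assumes u: "\<And>s. s < m \<Longrightarrow> bil n Aa u (qv s) = (if s = m - 1 - i then 1 else 0)" and ij: "i < m" "j < Suc m"
  shows "bil n Ax u (wv j) = (if i = j then 1 else 0)" "bil n Aa u (wv j) = (if j = Suc i then 1 else 0)"
proof -
  show "bil n Ax u (wv j) = (if i = j then 1 else 0)"
  proof (cases "j = m")
    case True
    then show ?thesis using ij by (simp add: wv_def bil_qv)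
  next
    case False
    then have *: "m - j = Suc (m - j - 1)" "m - j - 1 < m" using ij by auto
    have "bil n Ax u (wv j) = bil n Aa u (qv (m - j - 1))" unfolding wv_def by (subst *(1)) (rule bil_qv)
    also have "\<dots> = (if m - j - 1 = m - 1 - i then 1 else 0)" by (rule u[OF *(2)])
    also have "m - j - 1 = m - 1 - i \<longleftrightarrow> i = j" using False ij by auto
    finally show ?thesis .
  qed
  show "bil n Aa u (wv j) = (if j = Suc i then 1 else 0)"
  proof (cases "j = 0")
    case True
    then show ?thesis by (simp add: wv_def bil_qv)
  next
    case False
    then have *: "m - j < m" using ij by auto
    have "bil n Aa u (wv j) = (if m - j = m - 1 - i then 1 else 0)" unfolding wv_def by (rule u[OF *])
    also have "m - j = m - 1 - i \<longleftrightarrow> j = Suc i" using False ij by auto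
    finally show ?thesis .
  qed
qed

text \<open>Dual vectors \<open>v i\<close> orthogonal to the root blocks already pair correctly
  with the chain. Adding combinations of the chain, which is isotropic and orthogonal to the root
  blocks, leaves these pairings intact and provides the freedom to make the \<open>u i\<close>
  isotropic for both forms.\<close>

lemma kronecker_basis:
  obtains u where "\<And>i. i < m \<Longrightarrow> u i \<in> CS n"
    "\<And>i j. i < m \<Longrightarrow> j < Suc m \<Longrightarrow> bil n Ax (u i) (wv j) = (if i = j then 1 else 0)"
    "\<And>i j. i < m \<Longrightarrow> j < Suc m \<Longrightarrow> bil n Aa (u i) (wv j) = (if j = Suc i then 1 else 0)"
    "\<And>i j. i < m \<Longrightarrow> j < m \<Longrightarrow> bil n Ax (u i) (u j) = 0" "\<And>i j. i < m \<Longrightarrow> j < m \<Longrightarrow> bil n Aa (u i) (u j) = 0"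
    "\<And>i z. i < m \<Longrightarrow> z \<in> RV \<Longrightarrow> bil n Ax (u i) z = 0" "\<And>i z. i < m \<Longrightarrow> z \<in> RV \<Longrightarrow> bil n Aa (u i) z = 0"
proof -
  let ?P = "\<lambda>i v. v \<in> CS n \<and> (\<forall>s<m. bil n Aa v (qv s) = (if s = m - 1 - i then 1 else 0)) \<and>
    (\<forall>z\<in>RV. bil n Aa v z = 0 \<and> bil n Ax v z = 0)"
  have "\<exists>v. ?P i v" if i: "i < m" for i
  proof -
    obtain u where u: "u \<in> CS n" "\<forall>s<m. bil n Aa u (qv s) = (if s = m - 1 - i then 1 else 0)"
      using dual_vector[of "m - 1 - i"] i by auto
    show ?thesis by (rule split_off_RV[OF u(1)]) (use u(2) in metis)
  qed
  then obtain v where v: "\<And>i. i < m \<Longrightarrow> ?P i (v i)" by metis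
  have vx: "bil n Ax (v i) (wv j) = (if i = j then 1 else 0)"
    and va: "bil n Aa (v i) (wv j) = (if j = Suc i then 1 else 0)" if "i < m" "j < Suc m" for i j
    using dual_wv[of "v i" i j] v[of i] that by blast+
  \<comment> \<open>Isotropy for the two forms reads \<open>K i j - K j i = A_x(v i, v j)\<close>
    and \<open>K i (j + 1) - K j (i + 1) = A_a(v i, v j)\<close>, which \<open>kron_shift\<close>
    solves.\<close>
  define K where "K = kron_shift (\<lambda>i j. bil n Ax (v i) (v j)) (\<lambda>i j. bil n Aa (v i) (v j))"
  have K: "K i j = K j i + bil n Ax (v i) (v j)" "K i (Suc j) = K j (Suc i) + bil n Aa (v i) (v j)" for i j
    unfolding K_def by (rule kron_shift; rule bil_sk)+
  define u where "u i = v i + (\<Sum>l<Suc m. cscale (K i l) (wv l))" for i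
  have uw: "bil n M (u i) (wv j) = bil n M (v i) (wv j)" if "\<And>i j. bil n M (wv i) (wv j) = 0" for M i j
    unfolding u_def bil_linear bil_sum that by simp
  have uu: "bil n M (u i) (u j) = bil n M (v i) (v j) + (\<Sum>l<Suc m. K j l * bil n M (v i) (wv l)) - (\<Sum>l<Suc m. K i l * bil n M (v j) (wv l))"
    if iso: "\<And>i j. bil n M (wv i) (wv j) = 0" and sk: "\<And>v w. bil n M w v = - bil n M v w" for M i j
  proof -
    have "bil n M (u i) (u j) = bil n M (u i) (v j) + (\<Sum>l<Suc m. K j l * bil n M (u i) (wv l))"
      unfolding u_def[of j] bil_linear bil_sum ..
    also have "bil n M (u i) (v j) = bil n M (v i) (v j) + (\<Sum>l<Suc m. K i l * bil n M (wv l) (v j))"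
      unfolding u_def bil_linear bil_sum ..
    also have "(\<Sum>l<Suc m. K i l * bil n M (wv l) (v j)) = - (\<Sum>l<Suc m. K i l * bil n M (v j) (wv l))"
      unfolding sum_negf[symmetric] by (intro sum.cong refl) (metis sk mult_minus_right)
    finally show ?thesis unfolding uw[OF iso] by simp
  qed
  show ?thesis
  proof
    fix i assume i: "i < m"
    show "u i \<in> CS n" unfolding u_def
      using v[OF i] by (intro cv.subspace_add[OF CS_subspace] cv.subspace_sum[OF CS_subspace] cv.subspace_scale[OF CS_subspace] wv_CS) blast
    show "bil n Ax (u i) (wv j) = (if i = j then 1 else 0)" if "j < Suc m" for j
      unfolding uw[OF wv_isotropic(2)] by (rule vx[OF i that])
    show "bil n Aa (u i) (wv j) = (if j = Suc i then 1 else 0)" if "j < Suc m" for j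
      unfolding uw[OF wv_isotropic(1)] by (rule va[OF i that])
    show "bil n Ax (u i) (u j) = 0" if j: "j < m" for j
    proof -
      have "(\<Sum>l<Suc m. K j l * bil n Ax (v i) (wv l)) = (\<Sum>l<Suc m. K j l * (if i = l then 1 else 0))"
        by (rule sum.cong[OF refl]) (use vx[OF i] in auto)
      also have "\<dots> = K j i" by (rule sum_single) (use i in simp)
      finally have 1: "(\<Sum>l<Suc m. K j l * bil n Ax (v i) (wv l)) = K j i" .
      have "(\<Sum>l<Suc m. K i l * bil n Ax (v j) (wv l)) = (\<Sum>l<Suc m. K i l * (if j = l then 1 else 0))"
        by (rule sum.cong[OF refl]) (use vx[OF j] in auto)
      also have "\<dots> = K i j" by (rule sum_single) (use j in simp)
      finally show ?thesis unfolding uu[OF wv_isotropic(2) bil_sk(1)] 1 using K(1)[of i j] by (simp only: add.commute diff_self)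
    qed
    show "bil n Aa (u i) (u j) = 0" if j: "j < m" for j
    proof -
      have "(\<Sum>l<Suc m. K j l * bil n Aa (v i) (wv l)) = (\<Sum>l<Suc m. K j l * (if l = Suc i then 1 else 0))"
        by (rule sum.cong[OF refl]) (use va[OF i] in auto)
      also have "\<dots> = K j (Suc i)" by (rule sum_single) (use i in simp)
      finally have 1: "(\<Sum>l<Suc m. K j l * bil n Aa (v i) (wv l)) = K j (Suc i)" .
      have "(\<Sum>l<Suc m. K i l * bil n Aa (v j) (wv l)) = (\<Sum>l<Suc m. K i l * (if l = Suc j then 1 else 0))"
        by (rule sum.cong[OF refl]) (use va[OF j] in auto)
      also have "\<dots> = K i (Suc j)" by (rule sum_single) (use j in simp)
      finally show ?thesis unfolding uu[OF wv_isotropic(1) bil_sk(2)] 1 using K(2)[of i j] by (simp only: add.commute diff_self)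
    qed
    fix z assume z: "z \<in> RV"
    show "bil n Ax (u i) z = 0" unfolding u_def bil_linear bil_sum wv_RV[OF z] using v[OF i] z by simp
    show "bil n Aa (u i) z = 0" unfolding u_def bil_linear bil_sum wv_RV[OF z] using v[OF i] z by simp
  qed
qed

text \<open>Root blocks in the order of the final list: grouped by root, sizes increasing.\<close>

definition bsel where
  "bsel = concat (map (\<lambda>t. sort_key (\<lambda>D. fst (snd D)) (filter (\<lambda>D. fst D = t) bs)) ts)"

lemma set_bsel: "set bsel = rts" by (auto simp: bsel_def rts_def)

text \<open>A repeated block would be orthogonal to itself, against the normalization of its
  chains.\<close>

lemma distinct_bs: "distinct bs"
proof (rule ccontr)
  assume "\<not> distinct bs"
  then obtain i j where ij: "i < length bs" "j < length bs" "i < j" "bs ! i = bs ! j"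
    unfolding distinct_conv_nth by (metis nat_neq_iff)
  let ?D = "bs ! i"
  have D: "?D \<in> set bs" using ij by auto
  obtain l k u v where e: "?D = (l, k, u, v)" by (cases ?D) auto
  have g: "k \<ge> 1" "bil (Suc n) Bt u ((pc.T l ^^ (k - 1)) v) = 1"
    using bs(1)[OF D] unfolding e pc.good_block_def by auto
  have "u = (pc.T l ^^ 0) u" by simp
  then have "u \<in> set (pc.bvecs ?D)" "(pc.T l ^^ (k - 1)) v \<in> set (pc.bvecs ?D)"
    using g(1) unfolding e pc.set_bvecs by (force, auto)
  then have "bil (Suc n) Bt u ((pc.T l ^^ (k - 1)) v) = 0"
    using bs(3) ij unfolding sorted_wrt_iff_nth_less by metis
  then show False using g(2) by simp
qed

lemma bsel_orth: "sorted_wrt (\<lambda>D D'. \<forall>z\<in>set (pc.bvecs D). \<forall>z'\<in>set (pc.bvecs D'). bil (Suc n) Bt z z' = 0) bsel"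
proof -
  have "distinct bsel" unfolding bsel_def by (rule distinct_concat_filter[OF ts(2) distinct_bs])
  then show ?thesis
    unfolding sorted_wrt_iff_nth_less
  proof (intro allI impI ballI)
    fix i j z z' assume h: "i < j" "j < length bsel" "z \<in> set (pc.bvecs (bsel ! i))" "z' \<in> set (pc.bvecs (bsel ! j))"
    then have "bsel ! i \<noteq> bsel ! j" using \<open>distinct bsel\<close> by (simp add: nth_eq_iff_index_eq)
    moreover have "bsel ! i \<in> set bs" "bsel ! j \<in> set bs"
      using h nth_mem[of _ bsel] unfolding set_bsel rts_def by auto
    ultimately show "bil (Suc n) Bt z z' = 0" using blocks_orth h by blast
  qed
qed

text \<open>On vectors without added coordinate the bordered forms agree with the original
  ones.\<close>

lemma block_gram_x:
  assumes "D \<in> rts"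
  shows "gram (bil n Aa) (pc.bvecs D) (pc.bvecs D) = snd (jk_pair (pc.jblock D))"
    "gram (bil n Ax) (pc.bvecs D) (pc.bvecs D) = fst (jk_pair (pc.jblock D))"
proof -
  have g: "pc.good_block D" using bs(1) assms by (auto simp: rts_def)
  have C: "pc.bvecs D ! i \<in> CS n" if "i < length (pc.bvecs D)" for i
    using bvecs_root(1)[OF assms nth_mem[OF that]] .
  have "gram (bil n Aa) (pc.bvecs D) (pc.bvecs D) = gram (bil (Suc n) Bt) (pc.bvecs D) (pc.bvecs D)"
    by (rule eq_matI) (simp_all add: gram_def bil_CS C)
  then show "gram (bil n Aa) (pc.bvecs D) (pc.bvecs D) = snd (jk_pair (pc.jblock D))"
    using pc.gram_block(1)[OF g] by simp
  have "gram (bil n Ax) (pc.bvecs D) (pc.bvecs D) = gram (\<lambda>v w. bil (Suc n) Bt v (pc.S w)) (pc.bvecs D) (pc.bvecs D)"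
    by (rule eq_matI) (simp_all only: gram_def pc.S_alt bil_CS C index_mat prod.case dim_row_mat dim_col_mat)
  then show "gram (bil n Ax) (pc.bvecs D) (pc.bvecs D) = fst (jk_pair (pc.jblock D))"
    using pc.gram_block(2)[OF g] by simp
qed

lemma bvecs_length: "length (pc.bvecs D) = 2 * fst (snd D)"
  by (simp add: pc.bvecs_def)

text \<open>With the \<open>m\<close> and \<open>m + 1\<close> vectors of the Kronecker part this
  makes \<open>n\<close> vectors in all.\<close>

lemma bsel_length:
  "sum_list (map (\<lambda>D. length (pc.bvecs D)) bsel) = 2 * dP"
proof -
  obtain d where d: "d * Suc m = dP" using char_poly_eq by blast
  have "sum_list (map (\<lambda>D. length (pc.bvecs D)) bsel) = (\<Sum>t\<leftarrow>ts. 2 * sum_list (bsz t))"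
    unfolding bsel_def bvecs_length map_concat sum_list_concat map_map comp_def bsz_def by (simp add: sum_list_const_mult)
  also have "\<dots> = (\<Sum>t\<leftarrow>ts. 2 * d)" using bsz_sum[OF _ d] by (intro arg_cong[where f = sum_list] map_cong) auto
  also have "\<dots> = 2 * dP" by (simp add: sum_list_triv ts(3) d[symmetric] algebra_simps)
  finally show ?thesis .
qed

text \<open>The basis consists of the dual vectors, the reversed chain and the root blocks.
  Kronecker part and blocks are mutually orthogonal for both forms, so the Gram matrices are block
  diagonal.\<close>

theorem jk_decomposition:
  "has_jk_decomposition n Ax Aa (Kron (Suc m) # concat (map (\<lambda>t. map (Jord (Some t)) (bsz t)) ts))"
proof -
  obtain u where u: "\<And>i. i < m \<Longrightarrow> u i \<in> CS n"
    "\<And>i j. i < m \<Longrightarrow> j < Suc m \<Longrightarrow> bil n Ax (u i) (wv j) = (if i = j then 1 else 0)"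
    "\<And>i j. i < m \<Longrightarrow> j < Suc m \<Longrightarrow> bil n Aa (u i) (wv j) = (if j = Suc i then 1 else 0)"
    "\<And>i j. i < m \<Longrightarrow> j < m \<Longrightarrow> bil n Ax (u i) (u j) = 0" "\<And>i j. i < m \<Longrightarrow> j < m \<Longrightarrow> bil n Aa (u i) (u j) = 0"
    "\<And>i z. i < m \<Longrightarrow> z \<in> RV \<Longrightarrow> bil n Ax (u i) z = 0" "\<And>i z. i < m \<Longrightarrow> z \<in> RV \<Longrightarrow> bil n Aa (u i) z = 0"
    using kronecker_basis by blast
  define us ws rs where "us = map u [0..<m]" and "ws = map wv [0..<Suc m]" and "rs = concat (map pc.bvecs bsel)"
  define vs where "vs = us @ ws @ rs"
  have len: "length us = m" "length ws = Suc m" "length rs = 2 * dP"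
    using bsel_length by (simp_all add: us_def ws_def rs_def length_concat comp_def del: upt_Suc)
  have lv: "length vs = n" unfolding vs_def using n_eq by (simp add: len)
  have rRV: "set rs = RV" by (simp add: rs_def set_bsel RV_def)
  have vC: "set vs \<subseteq> CS n"
    unfolding vs_def using u(1) wv_CS RV_CS rRV by (auto simp: us_def ws_def simp del: upt_Suc)
  have nu: "us ! i = u i" if "i < m" for i using that by (simp add: us_def)
  have nw: "ws ! i = wv i" if "i < Suc m" for i using that by (simp add: ws_def del: upt_Suc)
  have wu: "gram (bil n M) ws us = - transpose_mat (gram (bil n M) us ws)" if "\<And>v w. bil n M w v = - bil n M v w" for M
    by (rule eq_matI) (simp_all add: gram_def, rule that)
  have kron: "gram (bil n Ax) (us @ ws) (us @ ws) = fst (jk_pair (Kron (Suc m)))"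
    "gram (bil n Aa) (us @ ws) (us @ ws) = snd (jk_pair (Kron (Suc m)))"
  proof -
    have "gram (bil n Ax) us us = 0\<^sub>m m m" "gram (bil n Aa) us us = 0\<^sub>m m m"
      "gram (bil n Ax) ws ws = 0\<^sub>m (Suc m) (Suc m)" "gram (bil n Aa) ws ws = 0\<^sub>m (Suc m) (Suc m)"
      by (rule eq_matI; simp add: gram_def len nu nw u wv_isotropic)+
    moreover have "gram (bil n Ax) us ws = mat m (Suc m) (\<lambda>(i, j). if j = i then 1 else 0)"
      "gram (bil n Aa) us ws = mat m (Suc m) (\<lambda>(i, j). if j = i + 1 then 1 else 0)"
      by (rule eq_matI; simp add: gram_def len nu nw u)+
    ultimately show "gram (bil n Ax) (us @ ws) (us @ ws) = fst (jk_pair (Kron (Suc m)))"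
      "gram (bil n Aa) (us @ ws) (us @ ws) = snd (jk_pair (Kron (Suc m)))"
      unfolding gram_append wu[OF bil_sk(1)] wu[OF bil_sk(2)] by (simp_all add: skew_pair_block_def)
  qed
  have orth: "bil n Ax v z = 0 \<and> bil n Ax z v = 0 \<and> bil n Aa v z = 0 \<and> bil n Aa z v = 0"
    if v: "v \<in> set (us @ ws)" and z: "z \<in> RV" for v z
  proof -
    have "bil n Ax v z = 0 \<and> bil n Aa v z = 0"
      using v u(6,7)[OF _ z] wv_RV[OF z] by (auto simp: us_def ws_def simp del: upt_Suc)
    then show ?thesis using bil_sk[of v z] by simp
  qed
  have orth2: "bil n Aa z z' = 0 \<and> bil n Aa z' z = 0 \<and> bil n Ax z z' = 0 \<and> bil n Ax z' z = 0"
    if D: "D \<in> rts" "D' \<in> rts" and o: "\<And>z z'. z \<in> set (pc.bvecs D) \<Longrightarrow> z' \<in> set (pc.bvecs D') \<Longrightarrow> bil (Suc n) Bt z z' = 0"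
      and z: "z \<in> set (pc.bvecs D)" "z' \<in> set (pc.bvecs D')" for D D' z z'
  proof -
    have C: "z \<in> CS n" "z' \<in> CS n" using bvecs_root(1) D z by blast+
    have sp: "bil (Suc n) Bt z y = 0" if "y \<in> cv.span (set (pc.bvecs D'))" for y
      using that
    proof (induction rule: cv.span_induct_alt)
      case (step c y w)
      then show ?case using o[OF z(1)] by (simp only: bil_linear mult_zero_right add_0_right)
    qed (simp only: bil_zero)
    have "pc.S z' \<in> cv.span (set (pc.bvecs D'))" using pc.S_bvecs_span z(2) bs(1) D(2) by (auto simp: rts_def)
    then have "bil n Ax z z' = 0" using sp unfolding bil_CS(2)[OF C, symmetric] pc.S_alt[symmetric] by blast
    moreover have "bil n Aa z z' = 0" using o[OF z] unfolding bil_CS(1)[OF C] .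
    ultimately show ?thesis using bil_sk[of z z'] by simp
  qed
  have vsc: "vs = concat ((us @ ws) # map pc.bvecs bsel)" by (simp add: vs_def rs_def)
  have sw: "sorted_wrt (\<lambda>us vs. \<forall>u\<in>set us. \<forall>v\<in>set vs. (bil n Aa u v = 0 \<and> bil n Aa v u = 0) \<and> (bil n Ax u v = 0 \<and> bil n Ax v u = 0))
      ((us @ ws) # map pc.bvecs bsel)"
  proof -
    have "sorted_wrt (\<lambda>us vs. \<forall>u\<in>set us. \<forall>v\<in>set vs. (bil n Aa u v = 0 \<and> bil n Aa v u = 0) \<and> (bil n Ax u v = 0 \<and> bil n Ax v u = 0))
      (map pc.bvecs bsel)"
      unfolding sorted_wrt_map
      by (rule sorted_wrt_mono_rel[OF _ bsel_orth]) (use orth2 set_bsel in blast)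
    moreover have "z \<in> RV" if "ys \<in> set (map pc.bvecs bsel)" "z \<in> set ys" for ys z
      using that by (auto simp: set_bsel RV_def)
    ultimately show ?thesis unfolding sorted_wrt.simps using orth by blast
  qed
  have ga: "gram (bil n Aa) vs vs = block_diag (map (\<lambda>vs. gram (bil n Aa) vs vs) ((us @ ws) # map pc.bvecs bsel))"
    unfolding vsc by (rule gram_concat[OF sorted_wrt_mono_rel[OF _ sw]]) blast
  have gx: "gram (bil n Ax) vs vs = block_diag (map (\<lambda>vs. gram (bil n Ax) vs vs) ((us @ ws) # map pc.bvecs bsel))"
    unfolding vsc by (rule gram_concat[OF sorted_wrt_mono_rel[OF _ sw]]) blast
  let ?L = "Kron (Suc m) # concat (map (\<lambda>t. map (Jord (Some t)) (bsz t)) ts)"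
  have jb: "map pc.jblock bsel = concat (map (\<lambda>t. map (Jord (Some t)) (bsz t)) ts)"
    unfolding bsel_def map_concat map_map comp_def bsz_def
    by (intro arg_cong[where f = concat] map_cong refl) auto
  have L: "?L = Kron (Suc m) # map pc.jblock bsel" unfolding jb ..
  have ma: "map (\<lambda>vs. gram (bil n Aa) vs vs) ((us @ ws) # map pc.bvecs bsel) = map (snd \<circ> jk_pair) ?L"
    unfolding L using block_gram_x(1) kron(2) set_bsel by auto
  have mx: "map (\<lambda>vs. gram (bil n Ax) vs vs) ((us @ ws) # map pc.bvecs bsel) = map (fst \<circ> jk_pair) ?L"
    unfolding L using block_gram_x(2) kron(1) set_bsel by auto
  \<comment> \<open>The Kronecker part is degenerate, so the Gram determinant gives no information.
    Pairing with \<open>wv (i + 1)\<close> isolates the coefficient of \<open>u i\<close>, pairing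
    with \<open>u i\<close> that of \<open>wv (i + 1)\<close>; the coefficient of
    \<open>wv 0\<close> is found from the \<open>i0\<close>-coordinate, which vanishes on the root
    blocks.\<close>
  have ind: "list_indep vs" unfolding list_indep_def
  proof (intro allI impI)
    fix z j assume z: "(\<Sum>j<length vs. cscale (z j) (vs ! j)) = 0" and j: "j < length vs"
    let ?U = "\<Sum>i<m. cscale (z i) (u i)" and ?W = "\<Sum>i<Suc m. cscale (z (m + i)) (wv i)"
    let ?R = "\<Sum>i<length rs. cscale (z (m + (Suc m + i))) (rs ! i)"
    have lv': "length vs = m + (Suc m + length rs)" by (simp add: vs_def len)
    have "?U = (\<Sum>i<m. cscale (z i) (vs ! i))"
      by (rule sum.cong) (simp_all add: vs_def nth_append len nu)
    moreover have "?W = (\<Sum>i<Suc m. cscale (z (m + i)) (vs ! (m + i)))"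
      by (rule sum.cong) (simp_all add: vs_def nth_append len nw)
    moreover have "?R = (\<Sum>i<length rs. cscale (z (m + (Suc m + i))) (vs ! (m + (Suc m + i))))"
      by (rule sum.cong) (simp_all add: vs_def nth_append len)
    ultimately have eq: "?U + (?W + ?R) = 0" using z unfolding lv' sum_lessThan_add by (simp only:)
    have Rsp: "?R \<in> cv.span RV"
      by (intro cv.span_sum cv.span_scale cv.span_base) (use rRV nth_mem in blast)
    have RM: "bil n Aa v ?R = 0" if "v \<in> set (us @ ws)" for v
      unfolding bil_sum bil_linear by (rule sum.neutral) (use orth[OF that] rRV nth_mem in fastforce)
    have wU: "bil n Aa (wv (Suc i)) ?U = - z i" if i: "i < m" for i
    proof -
      have "bil n Aa (wv (Suc i)) ?U = (\<Sum>l<m. z l * bil n Aa (wv (Suc i)) (u l))" unfolding bil_sum bil_linear ..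
      also have "\<dots> = (\<Sum>l<m. - (z l * (if i = l then 1 else 0)))"
      proof (rule sum.cong[OF refl])
        fix l assume "l \<in> {..<m}"
        then show "z l * bil n Aa (wv (Suc i)) (u l) = - (z l * (if i = l then 1 else 0))"
          using u(3)[of l "Suc i"] i bil_sk(2)[of "wv (Suc i)" "u l"] by simp
      qed
      also have "\<dots> = - z i" unfolding sum_negf sum_single(2)[OF i] ..
      finally show ?thesis .
    qed
    have zu: "z i = 0" if i: "i < m" for i
    proof -
      have "wv (Suc i) \<in> set (us @ ws)" using i by (simp add: ws_def del: upt_Suc)
      then have "0 = bil n Aa (wv (Suc i)) ?U + (bil n Aa (wv (Suc i)) ?W + 0)"
        using arg_cong[OF eq, of "bil n Aa (wv (Suc i))"] RM unfolding bil_linear(3) by (simp only: bil_zero)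
      moreover have "bil n Aa (wv (Suc i)) ?W = 0" unfolding bil_sum bil_linear wv_isotropic by simp
      ultimately show ?thesis unfolding wU[OF i] by simp
    qed
    have U0: "?U = 0" by (rule sum.neutral) (simp add: zu)
    have zw: "z (m + Suc i) = 0" if i: "i < m" for i
    proof -
      have "u i \<in> set (us @ ws)" using i by (simp add: us_def)
      then have "0 = bil n Aa (u i) ?W"
        using arg_cong[OF eq, of "bil n Aa (u i)"] RM unfolding U0 add_0_left bil_linear(3) by (simp only: bil_zero add_0_right)
      also have "\<dots> = (\<Sum>l<Suc m. z (m + l) * (if l = Suc i then 1 else 0))"
        unfolding bil_sum bil_linear by (rule sum.cong[OF refl]) (use u(3)[OF i] in auto)
      also have "\<dots> = z (m + Suc i)" by (rule sum_single) (use i in simp)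
      finally show ?thesis by simp
    qed
    have W0: "?W = cscale (z m) (wv 0)"
    proof -
      have "?W = cscale (z m) (wv 0) + (\<Sum>i<m. cscale (z (m + Suc i)) (wv (Suc i)))"
        unfolding sum.lessThan_Suc_shift by (simp only: add_0_right)
      also have "(\<Sum>i<m. cscale (z (m + Suc i)) (wv (Suc i))) = 0"
        by (rule sum.neutral) (simp add: zw del: add_Suc_right)
      finally show ?thesis by (simp only: add_0_right)
    qed
    have "y i0 = 0" if "y \<in> cv.span RV" for y
      using that
    proof (induction rule: cv.span_induct_alt)
      case (step c y w)
      then have "y i0 = 0" using bvecs_root(3) by (auto simp: RV_def)
      then show ?case using step by (simp add: cscale_apply)
    qed simp
    then have R0: "?R i0 = 0" using Rsp by blast
    have eq2: "cscale (z m) (wv 0) + ?R = 0" using eq unfolding U0 W0 by (simp only: add_0_left)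
    have "z m * wv 0 i0 + ?R i0 = 0"
      using fun_cong[OF eq2, of i0] by (simp only: plus_fun_apply cscale_apply zero_fun_apply)
    then have "z m * qv m i0 = 0" unfolding R0 wv_def by (simp only: add_0_right diff_zero)
    then have zm: "z m = 0" using qv_i0 by simp
    have R00: "?R = 0" using eq unfolding U0 W0 zm by (simp only: cv.scale_zero_left add_0_left)
    have li: "list_indep rs" unfolding rs_def
    proof (rule gram_det_indep[OF bord_carrier pc.blocks_gram[OF _ bsel_orth]])
      show "pc.good_block D" if "D \<in> set bsel" for D using that bs(1) by (auto simp: set_bsel rts_def)
    qed
    have zr: "z (m + (Suc m + i)) = 0" if "i < length rs" for i
      by (rule li[unfolded list_indep_def, rule_format, of "\<lambda>i. z (m + (Suc m + i))", OF R00 that])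
    show "z j = 0"
    proof (cases "j < m")
      case True
      then show ?thesis by (rule zu)
    next
      case False
      define i where "i = j - m"
      have ji: "j = m + i" using False by (simp add: i_def)
      show ?thesis
      proof (cases "i < Suc m")
        case True
        show ?thesis
        proof (cases i)
          case 0
          then show ?thesis using zm ji by simp
        next
          case (Suc l)
          then show ?thesis using zw[of l] ji True by simp
        qed
      next
        case False
        then have e: "i = Suc m + (i - Suc m)" by simp
        have "i - Suc m < length rs" using j ji False unfolding lv' by linarith
        then show ?thesis unfolding ji by (subst e) (rule zr)
      qed
    qed
  qed
  have "det (cmat n vs) \<noteq> 0" by (rule cmat_det_nz[OF ind vC lv])
  moreover have cc: "cmat n vs \<in> carrier_mat n n" using cmat_carrier[of n vs] unfolding lv .
  ultimately have "invertible_mat (cmat n vs)" using det_nz_invertible by blast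
  then show ?thesis
    unfolding has_jk_decomposition_def using cc gram_bil[OF Amat_carrier[of n c x], of vs] gram_bil[OF Amat_carrier[of n c a], of vs]
    unfolding ga gx ma mx by blast
qed

end

section \<open>Genericity\<close>

lemma smult_smult_mat: "a \<cdot>\<^sub>m (b \<cdot>\<^sub>m M) = (a * b) \<cdot>\<^sub>m M" for a :: "'a::comm_ring_1"
  by (rule eq_matI) (auto simp: mult.assoc)

lemma one_smult_mat: "1 \<cdot>\<^sub>m M = M" for M :: "'a::comm_ring_1 mat"
  by (rule eq_matI) auto

lemma pow_smult_mat:
  fixes a :: "'a::comm_ring_1"
  assumes "M \<in> carrier_mat N N" shows "(a \<cdot>\<^sub>m M) ^\<^sub>m j = a ^ j \<cdot>\<^sub>m (M ^\<^sub>m j)"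
proof (induction j)
  case (Suc j)
  have "(a \<cdot>\<^sub>m M) ^\<^sub>m Suc j = (a ^ j \<cdot>\<^sub>m (M ^\<^sub>m j)) * (a \<cdot>\<^sub>m M)" by (simp add: Suc)
  also have "\<dots> = a \<cdot>\<^sub>m ((a ^ j \<cdot>\<^sub>m (M ^\<^sub>m j)) * M)"
    using assms by (intro mult_smult_distrib[of _ N N _ N]) auto
  also have "(a ^ j \<cdot>\<^sub>m (M ^\<^sub>m j)) * M = a ^ j \<cdot>\<^sub>m (M ^\<^sub>m j * M)"
    using assms by (intro mult_smult_assoc_mat[of _ N N _ N]) auto
  finally show ?case by (simp add: smult_smult_mat)
qed (use assms in auto)

lemma kernel_dim_smult:
  fixes M :: "'a::field mat"
  assumes "M \<in> carrier_mat N N" "a \<noteq> 0" shows "kernel_dim (a \<cdot>\<^sub>m M) = kernel_dim M"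
proof -
  have "a \<cdot>\<^sub>m M *\<^sub>v v = 0\<^sub>v N \<longleftrightarrow> M *\<^sub>v v = 0\<^sub>v N" if "v \<in> carrier_vec N" for v
  proof -
    have "a \<cdot>\<^sub>m M *\<^sub>v v = a \<cdot>\<^sub>v (M *\<^sub>v v)" using assms(1) that by auto
    then show ?thesis using assms by (auto simp: vec_eq_iff)
  qed
  then have "mat_kernel (a \<cdot>\<^sub>m M) = mat_kernel M" using assms(1) by (auto simp: mat_kernel_def)
  then show ?thesis by (simp add: kernel_dim_def)
qed

lemma pow_mat_polys:
  assumes M: "M \<in> carrier_mat N N" and h: "\<And>i j. i < N \<Longrightarrow> j < N \<Longrightarrow> M $$ (i, j) \<in> polys K"
  shows "i < N \<Longrightarrow> j < N \<Longrightarrow> (M ^\<^sub>m l) $$ (i, j) \<in> polys K"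
proof (induction l arbitrary: i j)
  case 0
  then show ?case using M by simp
next
  case (Suc l)
  have "(M ^\<^sub>m l * M) $$ (i, j) = (\<Sum>r<N. (M ^\<^sub>m l) $$ (i, r) * M $$ (r, j))"
    by (rule mult_index[OF pow_carrier_mat[OF M] M Suc.prems])
  also have "\<dots> \<in> polys K" using Suc h by (intro polys_sum polys_mult) auto
  finally show ?case by simp
qed

text \<open>\<open>R\<close> holds outside a proper hypersurface of pairs. Since \<open>mp\<close>
  is a domain, two such conditions can be combined by multiplying the equations.\<close>

definition generic :: "nat \<Rightarrow> ((nat \<Rightarrow> complex) \<Rightarrow> (nat \<Rightarrow> complex) \<Rightarrow> bool) \<Rightarrow> bool" where
  "generic n R \<longleftrightarrow> (\<exists>w\<in>polys (2 * n). w \<noteq> 0 \<and> (\<forall>x a. ev w (join_pt n x a) \<noteq> 0 \<longrightarrow> R x a))"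

lemma generic_conj: assumes "generic n R" "generic n R'" shows "generic n (\<lambda>x a. R x a \<and> R' x a)"
proof -
  obtain w w' where "w \<in> polys (2 * n)" "w \<noteq> 0" "\<forall>x a. ev w (join_pt n x a) \<noteq> 0 \<longrightarrow> R x a"
    "w' \<in> polys (2 * n)" "w' \<noteq> 0" "\<forall>x a. ev w' (join_pt n x a) \<noteq> 0 \<longrightarrow> R' x a"
    using assms unfolding generic_def by blast
  then show ?thesis unfolding generic_def by (intro bexI[of _ "w * w'"]) auto
qed

lemma generic_mono: "generic n R \<Longrightarrow> (\<And>x a. R x a \<Longrightarrow> R' x a) \<Longrightarrow> generic n R'"
  unfolding generic_def by blast

lemma generic_point: assumes "generic n R" shows "\<exists>x a. R x a"
proof -
  obtain w where w: "w \<in> polys (2 * n)" "w \<noteq> 0" "\<forall>x a. ev w (join_pt n x a) \<noteq> 0 \<longrightarrow> R x a"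
    using assms unfolding generic_def by blast
  obtain z where z: "ev w z \<noteq> 0" using mp_nonzero_ex[OF w(2)] by blast
  have "ev w z = ev w (join_pt n z (\<lambda>i. z (n + i)))" by (rule ev_polys_cong[OF w(1)]) (simp add: join_pt_def)
  then show ?thesis using w(3) z by auto
qed

lemma generic_all_le:
  fixes R :: "nat \<Rightarrow> nat \<Rightarrow> (nat \<Rightarrow> complex) \<Rightarrow> (nat \<Rightarrow> complex) \<Rightarrow> bool"
  assumes "\<And>j. \<exists>rho. generic n (R j rho)"
  shows "\<exists>rho. generic n (\<lambda>x a. \<forall>j\<le>L. R j (rho j) x a)"
proof -
  obtain rho where rho: "\<And>j. generic n (R j (rho j))" using assms by metis
  have "generic n (\<lambda>x a. \<forall>j\<le>L. R j (rho j) x a)"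
  proof (induction L)
    case 0
    then show ?case using rho[of 0] by simp
  next
    case (Suc L)
    show ?case by (rule generic_mono[OF generic_conj[OF Suc rho[of "Suc L"]]]) (auto simp: le_Suc_eq)
  qed
  then show ?thesis by blast
qed

lemma generic_fst: assumes "g \<in> polys n" "g \<noteq> 0" shows "generic n (\<lambda>x a. ev g x \<noteq> 0)"
proof -
  have "ev g (join_pt n x a) = ev g x" for x a by (rule ev_polys_cong[OF assms(1)]) (simp add: join_pt_def)
  then show ?thesis unfolding generic_def using assms polys_mono[OF assms(1), of "2 * n"] by (intro bexI[of _ g]) auto
qed

text \<open>Pullback along the projection of a pair \<open>(x, a)\<close> to
  \<open>a\<close>.\<close>

definition shift :: "nat \<Rightarrow> mp \<Rightarrow> mp" where "shift n = subst (\<lambda>i. mvar (n + i))"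

lemma shift_polys: "g \<in> polys n \<Longrightarrow> shift n g \<in> polys (2 * n)"
  unfolding shift_def by (rule polys_subst) (auto intro: polys_X)

lemma ev_shift: "ev (shift n g) z = ev g (\<lambda>i. z (n + i))" by (simp add: shift_def)

lemma generic_snd: assumes "g \<in> polys n" "g \<noteq> 0" shows "generic n (\<lambda>x a. ev g a \<noteq> 0)"
proof -
  have e: "ev (shift n g) (join_pt n x a) = ev g a" for x a
    unfolding ev_shift by (rule arg_cong[where f = "ev g"]) (simp add: join_pt_def)
  obtain a where "ev g a \<noteq> 0" using mp_nonzero_ex[OF assms(2)] by blast
  then have "shift n g \<noteq> 0" using e[of _ a] by force
  then show ?thesis unfolding generic_def using shift_polys[OF assms(1)] e by (intro bexI[of _ "shift n g"]) auto
qed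

context lie_setup
begin

lemma generic_root:
  assumes "w \<in> polys (2 * n)" "w \<noteq> 0" "\<And>z. ev Fp z = 0 \<Longrightarrow> ev w z \<noteq> 0 \<Longrightarrow> R z"
  shows "generic n (\<lambda>x a. \<forall>t. ev f (\<lambda>i. x i - t * a i) = 0 \<longrightarrow> R (triple n x a t))"
  unfolding generic_def using assms ev_join[OF assms(1)] ev_pull[OF f_polys] by (intro bexI[of _ w]) auto

text \<open>\<open>f\<close> has degree \<open>m + 1\<close>, a nonzero \<open>Q i\<close> only
  degree \<open>m\<close>.\<close>

lemma not_dvd_Q: assumes "i < n" "Q i \<noteq> 0" shows "\<not> Fp dvd pull n (Q i)"
  unfolding pull_dvd_iff
  using mdeg_dvd[of f "Q i"] homog_mdeg[OF f_homog f_nz] homog_mdeg[OF Q_homog[OF assms(1)] assms(2)] assms(2) by auto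

lemma generic_good_point:
  assumes i0: "i0 < n" "Q i0 \<noteq> 0"
  shows "generic n (\<lambda>x a. good_point n c Q k m e p x a i0)"
proof -
  have 1: "generic n (\<lambda>x a. ev f x \<noteq> 0)" by (rule generic_fst[OF f_polys f_nz])
  have 2: "generic n (\<lambda>x a. ev f a \<noteq> 0)" by (rule generic_snd[OF f_polys f_nz])
  have 3: "generic n (\<lambda>x a. ev (Q i0) a \<noteq> 0)" by (rule generic_snd[OF Q_polys[OF i0(1)] i0(2)])
  obtain w where w: "w \<in> polys (2 * n)" "w \<noteq> 0" "\<And>z. ev Fp z = 0 \<Longrightarrow> ev w z \<noteq> 0 \<Longrightarrow> ev (pull n (Q i0)) z \<noteq> 0"
    using generic_nonvanishing[OF pull_polys[OF Q_polys[OF i0(1)]] not_dvd_Q[OF i0]] by blast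
  have 4: "generic n (\<lambda>x a. \<forall>t. ev f (\<lambda>i. x i - t * a i) = 0 \<longrightarrow> ev (Q i0) (\<lambda>i. x i - t * a i) \<noteq> 0)"
    using generic_root[OF w(1,2), of "\<lambda>z. ev (pull n (Q i0)) z \<noteq> 0"] w(3) unfolding ev_pull[OF Q_polys[OF i0(1)]] by blast
  \<comment> \<open>Up to the factor \<open>m + 1\<close>, the derivative of \<open>f\<close> at
    \<open>x - t a\<close> in direction \<open>a\<close>; nonzero at a root means that the root is
    simple.\<close>
  define G where "G = (\<Sum>i<n. mvar (n + i) * pull n (Q i))"
  have G: "G \<in> polys (Suc (2 * n))" unfolding G_def
    by (intro polys_sum polys_mult pull_polys Q_polys polys_X) auto
  have evG: "ev G (triple n x a t) = (\<Sum>i<n. a i * ev (Q i) (\<lambda>i. x i - t * a i))" for x a t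
    unfolding G_def ev_sum by (rule sum.cong[OF refl]) (simp add: triple_nth ev_pull[OF Q_polys])
  obtain x a where xa: "ev f a \<noteq> 0" "\<And>t. ev f (\<lambda>i. x i - t * a i) = 0 \<Longrightarrow> ev (Q i0) (\<lambda>i. x i - t * a i) \<noteq> 0"
    using generic_point[OF generic_conj[OF 2 4]] by blast
  obtain t where "ev Fp (triple n x a t) = 0" using Fp_root[OF xa(1)] by blast
  then have t: "ev f (\<lambda>i. x i - t * a i) = 0" using ev_pull[OF f_polys] by simp
  define y where "y = (\<lambda>i. x i - t * a i)"
  \<comment> \<open>The witness keeps the point \<open>y\<close> on \<open>f = 0\<close> where
    \<open>Q i0\<close> is nonzero, but takes the unit vector \<open>i0\<close> as direction and
    \<open>t = 0\<close>.\<close>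
  have "ev Fp (triple n y (unit_fun i0) 0) = 0" using t unfolding ev_pull[OF f_polys] y_def by simp
  moreover have "ev G (triple n y (unit_fun i0) 0) \<noteq> 0"
  proof -
    have "ev G (triple n y (unit_fun i0) 0) = (\<Sum>i<n. if i = i0 then ev (Q i) y else 0)"
      unfolding evG by (rule sum.cong) (auto simp: unit_fun_def)
    also have "\<dots> = ev (Q i0) y" using i0(1) by (simp add: sum.delta)
    finally show ?thesis using xa(2)[OF t] by (simp add: y_def)
  qed
  ultimately have "\<not> Fp dvd G" by (rule not_dvd_point)
  then obtain w' where w': "w' \<in> polys (2 * n)" "w' \<noteq> 0" "\<And>z. ev Fp z = 0 \<Longrightarrow> ev w' z \<noteq> 0 \<Longrightarrow> ev G z \<noteq> 0"
    using generic_nonvanishing[OF G] by blast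
  have 5: "generic n (\<lambda>x a. \<forall>t. ev f (\<lambda>i. x i - t * a i) = 0 \<longrightarrow> (\<Sum>i<n. a i * ev (Q i) (\<lambda>i. x i - t * a i)) \<noteq> 0)"
    using generic_root[OF w'(1,2), of "\<lambda>z. ev G z \<noteq> 0"] w'(3) unfolding evG by blast
  show ?thesis
    by (rule generic_mono[OF generic_conj[OF generic_conj[OF generic_conj[OF 1 2] generic_conj[OF 3 4]] 5]], unfold_locales)
      (use i0 in auto)
qed

text \<open>The inverse of the bordered second form is not polynomial in \<open>a\<close>, so the
  adjugate takes its place. This multiplies the characteristic matrix by the nonzero determinant,
  which does not affect the kernels of its powers. \<open>R\<close> ranges over inverses because the
  generic rank is fixed before a point is chosen.\<close>

lemma generic_gen_eigenspace:
  assumes i0: "i0 < n"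
  shows "\<exists>rho. generic n (\<lambda>x a. \<forall>t. ev f (\<lambda>i. x i - t * a i) = 0 \<longrightarrow>
    (\<forall>R. R \<in> carrier_mat (Suc n) (Suc n) \<longrightarrow> det (bord n (Amat n c a) (unit_fun i0)) \<noteq> 0 \<longrightarrow>
      bord n (Amat n c a) (unit_fun i0) * R = 1\<^sub>m (Suc n) \<longrightarrow>
      dim_gen_eigenspace (R * bord n (Amat n c x) (\<lambda>_. 0)) t j = rho))"
proof -
  let ?N = "Suc n"
  define AtM :: "mp mat" where "AtM = bord n (AM n c) (\<lambda>_. 0)"
  define BtM where "BtM = bord n (map_mat (shift n) (AM n c)) (\<lambda>i. mconst (unit_fun i0 i))"
  define M where "M = AtM - mvar (2 * n) \<cdot>\<^sub>m BtM"
  define W where "W = (adj_mat BtM * M) ^\<^sub>m j"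
  have At: "AtM \<in> carrier_mat ?N ?N" and Bt: "BtM \<in> carrier_mat ?N ?N" unfolding AtM_def BtM_def by (rule bord_carrier)+
  have Mc: "M \<in> carrier_mat ?N ?N" unfolding M_def using At Bt by auto
  note ad = adj_mat[OF Bt]
  have AtP: "AtM $$ (i, j) \<in> polys (Suc (2 * n))" if "i < ?N" "j < ?N" for i j
    using that polys_mono[OF PM_polys, of n "Suc (2 * n)"] by (auto simp: AtM_def bord_def)
  have BtP: "BtM $$ (i, j) \<in> polys (Suc (2 * n))" if "i < ?N" "j < ?N" for i j
  proof -
    have "- mconst u \<in> polys (Suc (2 * n))" for u using polys_K[of "- u"] by (simp add: mconst_hom)
    then show ?thesis
      using that polys_mono[OF shift_polys[OF PM_polys], of n "Suc (2 * n)"] by (auto simp: BtM_def bord_def carrier_matD[OF AM_carrier])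
  qed
  have MP: "M $$ (i, j) \<in> polys (Suc (2 * n))" if "i < ?N" "j < ?N" for i j
  proof -
    have "M $$ (i, j) = AtM $$ (i, j) - mvar (2 * n) * BtM $$ (i, j)" using that At Bt by (simp add: M_def)
    also have "\<dots> \<in> polys (Suc (2 * n))" by (intro polys_diff polys_mult AtP BtP polys_X that) simp
    finally show ?thesis .
  qed
  have adP: "adj_mat BtM $$ (i, j) \<in> polys (Suc (2 * n))" if ij: "i < ?N" "j < ?N" for i j
  proof -
    have "det (mat_delete BtM j i) \<in> polys (Suc (2 * n))"
    proof (rule polys_det)
      show "mat_delete BtM j i \<in> carrier_mat n n" using mat_delete_carrier[OF Bt, of j i] by simp
      show "mat_delete BtM j i $$ (u, v) \<in> polys (Suc (2 * n))" if "u < n" "v < n" for u v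
        using that Bt by (auto simp: mat_delete_def intro!: BtP)
    qed
    moreover have "(- 1) ^ (j + i) \<in> polys (Suc (2 * n))"
      using polys_K[of "(- 1) ^ (j + i)"] by (simp add: mconst_hom mconst_power)
    ultimately show ?thesis using ij Bt by (simp add: adj_mat_def cofactor_def polys_mult)
  qed
  have adM: "adj_mat BtM * M \<in> carrier_mat ?N ?N" using ad(1) Mc by auto
  have adMP: "(adj_mat BtM * M) $$ (i, j) \<in> polys (Suc (2 * n))" if "i < ?N" "j < ?N" for i j
    unfolding mult_index[OF ad(1) Mc that] by (intro polys_sum polys_mult adP MP that) auto
  have Wc: "W \<in> carrier_mat ?N ?N" unfolding W_def by (rule pow_carrier_mat[OF adM])
  obtain w rho where w: "w \<in> polys (2 * n)" "w \<noteq> 0"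
      "\<And>z. ev Fp z = 0 \<Longrightarrow> ev w z \<noteq> 0 \<Longrightarrow> kernel_dim (map_mat (\<lambda>g. ev g z) W) = rho"
    using generic_kernel_dim[OF Wc] pow_mat_polys[OF adM adMP] unfolding W_def by blast
  have key: "dim_gen_eigenspace (R * bord n (Amat n c x) (\<lambda>_. 0)) t j = kernel_dim (map_mat (\<lambda>g. ev g (triple n x a t)) W)"
    if R: "R \<in> carrier_mat ?N ?N" and d: "det (bord n (Amat n c a) (unit_fun i0)) \<noteq> 0"
      and BR: "bord n (Amat n c a) (unit_fun i0) * R = 1\<^sub>m ?N" for x a t R
  proof -
    let ?z = "triple n x a t"
    let ?h = "\<lambda>g. ev g ?z"
    let ?A = "bord n (Amat n c x) (\<lambda>_. 0)" and ?B = "bord n (Amat n c a) (unit_fun i0)"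
    interpret h: comm_ring_hom ?h by unfold_locales auto
    have hA: "map_mat ?h AtM = ?A"
    proof -
      have "Amat n c ?z = Amat n c x" by (rule eq_matI) (auto simp: Amat_def triple_nth)
      then show ?thesis unfolding AtM_def map_bord[OF AM_carrier] map_AM by simp
    qed
    have hB: "map_mat ?h BtM = ?B"
    proof -
      have "map_mat ?h (map_mat (shift n) (AM n c)) = Amat n c a"
        by (rule eq_matI) (auto simp: ev_shift ev_PM Amat_def triple_nth carrier_matD[OF AM_carrier])
      then show ?thesis unfolding BtM_def by (subst map_bord) (simp_all add: AM_def)
    qed
    have hM: "map_mat ?h M = ?A - t \<cdot>\<^sub>m ?B"
      unfolding hA[symmetric] hB[symmetric] M_def using At Bt by (intro eq_matI) (auto simp: triple_nth)
    let ?J = "map_mat ?h (adj_mat BtM)"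
    have J: "?J \<in> carrier_mat ?N ?N" using ad(1) by simp
    have "?J * ?B = map_mat ?h (adj_mat BtM * BtM)" unfolding hB[symmetric] by (rule h.mat_hom_mult[OF ad(1) Bt, symmetric])
    also have "\<dots> = det ?B \<cdot>\<^sub>m 1\<^sub>m ?N"
      unfolding ad(3) hB[symmetric] ev_det[symmetric] by (rule eq_matI) auto
    finally have JB: "?J * ?B = det ?B \<cdot>\<^sub>m 1\<^sub>m ?N" .
    have Bc: "?B \<in> carrier_mat ?N ?N" and Ac: "?A \<in> carrier_mat ?N ?N" by (rule bord_carrier)+
    have "?J = ?J * (?B * R)" unfolding BR using J by simp
    also have "\<dots> = (?J * ?B) * R" by (rule assoc_mult_mat[OF J Bc R, symmetric])
    also have "\<dots> = det ?B \<cdot>\<^sub>m R" unfolding JB using mult_smult_assoc_mat[of "1\<^sub>m ?N" ?N ?N R ?N] R by simp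
    finally have JR: "?J = det ?B \<cdot>\<^sub>m R" .
    have "1\<^sub>m ?N = (1 / det ?B) \<cdot>\<^sub>m (?J * ?B)" unfolding JB using d by (intro eq_matI) auto
    also have "\<dots> = (1 / det ?B) \<cdot>\<^sub>m (det ?B \<cdot>\<^sub>m (R * ?B))" unfolding JR mult_smult_assoc_mat[OF R Bc] ..
    also have "\<dots> = R * ?B" using d by (simp add: smult_smult_mat one_smult_mat)
    finally have RB: "R * ?B = 1\<^sub>m ?N" ..
    have RA: "R * ?A \<in> carrier_mat ?N ?N" by (rule mult_carrier_mat[OF R Ac])
    have "map_mat ?h (adj_mat BtM * M) = ?J * (?A - t \<cdot>\<^sub>m ?B)"
      unfolding hM[symmetric] by (rule h.mat_hom_mult[OF ad(1) Mc])
    also have "\<dots> = det ?B \<cdot>\<^sub>m (R * (?A - t \<cdot>\<^sub>m ?B))"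
      unfolding JR by (rule mult_smult_assoc_mat[OF R minus_carrier_mat[OF smult_carrier_mat[OF Bc]]])
    also have "R * (?A - t \<cdot>\<^sub>m ?B) = R * ?A - R * (t \<cdot>\<^sub>m ?B)"
      by (rule mult_minus_distrib_mat[OF R Ac smult_carrier_mat[OF Bc]])
    also have "R * (t \<cdot>\<^sub>m ?B) = t \<cdot>\<^sub>m (R * ?B)" by (rule mult_smult_distrib[OF R Bc])
    also have "\<dots> = t \<cdot>\<^sub>m 1\<^sub>m ?N" unfolding RB ..
    also have "R * ?A - t \<cdot>\<^sub>m 1\<^sub>m ?N = char_matrix (R * ?A) t"
      using carrier_matD[OF RA] unfolding char_matrix_def by (intro eq_matI) simp_all
    finally have e: "map_mat ?h (adj_mat BtM * M) = det ?B \<cdot>\<^sub>m char_matrix (R * ?A) t" .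
    have C: "char_matrix (R * ?A) t \<in> carrier_mat ?N ?N" by (rule char_matrix_closed[OF RA])
    have "map_mat ?h W = det ?B ^ j \<cdot>\<^sub>m (char_matrix (R * ?A) t ^\<^sub>m j)"
      unfolding W_def h.mat_hom_pow[OF adM] e by (rule pow_smult_mat[OF C])
    then show ?thesis
      unfolding dim_gen_eigenspace_def using kernel_dim_smult[OF pow_carrier_mat[OF C], of "det ?B ^ j"] d by simp
  qed
  have "generic n (\<lambda>x a. \<forall>t. ev f (\<lambda>i. x i - t * a i) = 0 \<longrightarrow> kernel_dim (map_mat (\<lambda>g. ev g (triple n x a t)) W) = rho)"
    by (rule generic_root[OF w])
  then show ?thesis using key by (intro exI[of _ rho], elim generic_mono) auto
qed

end

context lie_setup
begin

text \<open>Numbers of blocks of each size are second differences of the dimensions of generalized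
  eigenspaces. Sizes do not exceed \<open>d\<close>, so the dimensions up to exponent
  \<open>d + 1\<close> suffice, which is a finite set of generic conditions.\<close>

lemma generic_jk:
  assumes d: "d * Suc m = dP"
  shows "\<exists>ns. (\<forall>l\<in>set ns. 1 \<le> l) \<and> sum_list ns = d \<and>
    generic n (\<lambda>x a. \<exists>ts. distinct ts \<and> length ts = Suc m \<and>
      has_jk_decomposition n (Amat n c x) (Amat n c a) (Kron (Suc m) # concat (map (\<lambda>t. map (Jord (Some t)) ns) ts)))"
proof -
  obtain i0 where i0: "i0 < n" "Q i0 \<noteq> 0" using Q_nonzero by blast
  obtain rho where rho: "generic n (\<lambda>x a. \<forall>j\<le>Suc d. \<forall>t. ev f (\<lambda>i. x i - t * a i) = 0 \<longrightarrow>
    (\<forall>R. R \<in> carrier_mat (Suc n) (Suc n) \<longrightarrow> det (bord n (Amat n c a) (unit_fun i0)) \<noteq> 0 \<longrightarrow>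
      bord n (Amat n c a) (unit_fun i0) * R = 1\<^sub>m (Suc n) \<longrightarrow>
      dim_gen_eigenspace (R * bord n (Amat n c x) (\<lambda>_. 0)) t j = rho j))"
    using generic_all_le[where L = "Suc d", where R = "\<lambda>j rho x a. \<forall>t. ev f (\<lambda>i. x i - t * a i) = 0 \<longrightarrow>
    (\<forall>R. R \<in> carrier_mat (Suc n) (Suc n) \<longrightarrow> det (bord n (Amat n c a) (unit_fun i0)) \<noteq> 0 \<longrightarrow>
      bord n (Amat n c a) (unit_fun i0) * R = 1\<^sub>m (Suc n) \<longrightarrow>
      dim_gen_eigenspace (R * bord n (Amat n c x) (\<lambda>_. 0)) t j = rho)", OF generic_gen_eigenspace[OF i0(1)]] by blast
  note gen = generic_conj[OF generic_good_point[OF i0] rho]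
  let ?H = "\<lambda>x a. good_point n c Q k m e p x a i0 \<and> (\<forall>j\<le>Suc d. \<forall>t. ev f (\<lambda>i. x i - t * a i) = 0 \<longrightarrow>
    (\<forall>R. R \<in> carrier_mat (Suc n) (Suc n) \<longrightarrow> det (bord n (Amat n c a) (unit_fun i0)) \<noteq> 0 \<longrightarrow>
      bord n (Amat n c a) (unit_fun i0) * R = 1\<^sub>m (Suc n) \<longrightarrow>
      dim_gen_eigenspace (R * bord n (Amat n c x) (\<lambda>_. 0)) t j = rho j))"
  \<comment> \<open>The second difference counts Jordan blocks of size \<open>l\<close>; it is
    halved because they come in pairs. Sizes 0 and above \<open>d\<close> do not occur.\<close>
  define M where "M l = (if l = 0 \<or> d < l then 0 else (2 * rho l - rho (l - 1) - rho (Suc l)) div 2)" for l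
  have ex: "\<exists>ts bsz. distinct ts \<and> length ts = Suc m \<and>
      has_jk_decomposition n (Amat n c x) (Amat n c a) (Kron (Suc m) # concat (map (\<lambda>t. map (Jord (Some t)) (bsz t)) ts)) \<and>
      (\<forall>t\<in>set ts. sorted (bsz t) \<and> (\<forall>l\<in>set (bsz t). 1 \<le> l) \<and> sum_list (bsz t) = d \<and> count (mset (bsz t)) = M)"
    if H: "?H x a" for x a
  proof -
    interpret g: good_point n c Q k m e p x a i0 using H by blast
    have "count (mset (g.bsz t)) l = M l" if t: "t \<in> set g.ts" for t l
    proof (cases "l = 0 \<or> d < l")
      case True
      have "l \<notin> set (g.bsz t)"
      proof
        assume l: "l \<in> set (g.bsz t)"
        have "l \<ge> 1" by (rule g.bsz_pos[OF l])
        moreover have "l \<le> d" using member_le_sum_list[OF l] g.bsz_sum[OF t d] by simp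
        ultimately show False using True by auto
      qed
      then show ?thesis using True by (simp add: M_def count_mset_0_iff)
    next
      case False
      have dim: "dim_gen_eigenspace (g.Bi * g.At) t j = rho j" if "j \<le> Suc d" for j
        using H that t g.Bi g.det_Bt unfolding g.ts(1) g.fp(1) by blast
      have le: "l - 1 \<le> Suc d" using False by linarith
      have "2 * count (mset (g.bsz t)) l = 2 * rho l - rho (l - 1) - rho (Suc l)"
        using g.bsz_count[of l t] False dim[of l] dim[of "l - 1", OF le] dim[of "Suc l"] unfolding compute_nr_of_jordan_blocks_def by simp
      then show ?thesis using False unfolding M_def by (metis nonzero_mult_div_cancel_left zero_neq_numeral)
    qed
    then have "\<forall>t\<in>set g.ts. sorted (g.bsz t) \<and> (\<forall>l\<in>set (g.bsz t). 1 \<le> l) \<and> sum_list (g.bsz t) = d \<and> count (mset (g.bsz t)) = M"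
      using g.sorted_bsz g.bsz_pos g.bsz_sum[OF _ d] by auto
    then show ?thesis using g.ts g.jk_decomposition by blast
  qed
  \<comment> \<open>One generic point fixes the list \<open>ns\<close>; at any other one, and at
    every root, the multiplicities are the same function \<open>M\<close>.\<close>
  obtain x0 a0 where "?H x0 a0" using generic_point[OF gen] by blast
  from ex[OF this] obtain ts0 :: "complex list" and bsz0 where b0: "length ts0 = Suc m"
    "\<forall>t\<in>set ts0. sorted (bsz0 t) \<and> (\<forall>l\<in>set (bsz0 t). 1 \<le> l) \<and> sum_list (bsz0 t) = d \<and> count (mset (bsz0 t)) = M" by blast
  define ns where "ns = bsz0 (hd ts0)"
  have "hd ts0 \<in> set ts0" using b0(1) by (intro hd_in_set) auto
  then have ns: "sorted ns" "\<forall>l\<in>set ns. 1 \<le> l" "sum_list ns = d" "count (mset ns) = M" using b0(2) unfolding ns_def by blast+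
  have "\<exists>ts. distinct ts \<and> length ts = Suc m \<and>
      has_jk_decomposition n (Amat n c x) (Amat n c a) (Kron (Suc m) # concat (map (\<lambda>t. map (Jord (Some t)) ns) ts))"
    if H: "?H x a" for x a
  proof -
    obtain ts bsz where ts: "distinct ts" "length ts = Suc m"
      "has_jk_decomposition n (Amat n c x) (Amat n c a) (Kron (Suc m) # concat (map (\<lambda>t. map (Jord (Some t)) (bsz t)) ts))"
      "\<forall>t\<in>set ts. sorted (bsz t) \<and> (\<forall>l\<in>set (bsz t). 1 \<le> l) \<and> sum_list (bsz t) = d \<and> count (mset (bsz t)) = M"
      using ex[OF H] by blast
    have "bsz t = ns" if "t \<in> set ts" for t
    proof -
      have "mset (bsz t) = mset ns" using ts(4) ns(4) that by (intro multiset_eqI) auto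
      then show ?thesis using ts(4) that ns(1) by (metis properties_for_sort sorted_sort_id)
    qed
    then have e: "map (\<lambda>t. map (Jord (Some t)) (bsz t)) ts = map (\<lambda>t. map (Jord (Some t)) ns) ts" by simp
    show ?thesis using ts(1-3) unfolding e by blast
  qed
  note generic_mono[OF gen this]
  then show ?thesis using ns(2,3) by (intro exI[of _ ns] conjI)
qed

end

theorem theorem27:
  fixes n :: nat and c :: "nat \<Rightarrow> nat \<Rightarrow> nat \<Rightarrow> complex"
    and p :: "(nat \<Rightarrow> complex) \<Rightarrow> complex" and k :: int
  assumes lie: "lie_sc n c"
    and nosemi: "no_proper_semi_invariants n c"
    and ind: "lie_index n c = 1"
    and pg: "fundamental_semi_invariant n c p"
    and noncst: "\<not> (\<exists>a. p = (\<lambda>x. a))"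
    and k_def: "k = (int n + int (lie_index n c)) div 2 - int (polydeg n p)"
  shows "\<exists>f (d::nat) (a::complex).
           f \<in> invariant_polys n c \<and> \<not> (\<exists>b. f = (\<lambda>x. b)) \<and>
           invariant_polys n c = {(\<lambda>x. poly q (f x)) | q. True} \<and>
           int (polydeg n f) = k \<and>
           p = (\<lambda>x. a * f x ^ d) \<and>
           (\<exists>ns :: nat list. (\<forall>m\<in>set ns. 1 \<le> m) \<and> sum_list ns = d \<and>
              d = polydeg n p div polydeg n f \<and>
              (\<exists>U. zariski_open_pairs n U \<and> U \<noteq> {} \<and>
                 (\<forall>(x,a')\<in>U. \<exists>lams :: complex option list.
                    distinct lams \<and> int (length lams) = k \<and>
                    has_jk_decomposition n (Amat n c x) (Amat n c a')
                      (Kron (nat k) # concat (map (\<lambda>lam. map (Jord lam) ns) lams)))))"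
proof -
  interpret i: index_one n c using lie ind by unfold_locales
  obtain Q \<kappa> m e where "index_one_kernel n c Q \<kappa> m e"
  proof (rule i.kernel_structure)
    fix Q \<kappa> m e assume "\<And>i. i < n \<Longrightarrow> Q i \<in> polys n" "\<kappa> \<in> polys n" "coprime_family n Q"
      "\<And>i. i < n \<Longrightarrow> (\<Sum>j<n. PM n c i j * Q j) = 0" "\<kappa> \<noteq> 0"
      "\<And>i j. i < n \<Longrightarrow> j < n \<Longrightarrow> cofactor (AM n c) i j = \<kappa> * Q i * Q j" "odd n"
      "homog e \<kappa>" "\<And>i. i < n \<Longrightarrow> homog m (Q i)" "e + 2 * m = n - 1"
    then have "index_one_kernel n c Q \<kappa> m e" by unfold_locales
    then show thesis by (rule that)
  qed
  then interpret s: lie_setup n c Q \<kappa> m e p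
    using nosemi pg noncst by (intro lie_setup.intro lie_setup_axioms.intro)
  let ?f = "ev s.f"
  have dm: "polydeg n ?f = Suc m" by (rule polydeg_homog[OF s.f_polys s.f_homog s.f_nz])
  \<comment> \<open>By \<open>n_eq\<close>, \<open>(n + 1) div 2 - deg p = m + 1\<close>.\<close>
  have k: "k = int (Suc m)" using s.n_eq unfolding k_def ind s.polydeg_p by simp
  obtain a d where ad: "s.P = mconst a * s.f ^ d" "d * Suc m = s.dP" using s.P_power by blast
  obtain ns where ns: "\<forall>l\<in>set ns. 1 \<le> l" "sum_list ns = d"
    and gen: "generic n (\<lambda>x a. \<exists>ts. distinct ts \<and> length ts = Suc m \<and>
      has_jk_decomposition n (Amat n c x) (Amat n c a) (Kron (Suc m) # concat (map (\<lambda>t. map (Jord (Some t)) ns) ts)))"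
    using s.generic_jk[OF ad(2)] by blast
  obtain w where w: "w \<in> polys (2 * n)" "w \<noteq> 0" "\<And>x a. ev w (join_pt n x a) \<noteq> 0 \<Longrightarrow> \<exists>ts. distinct ts \<and> length ts = Suc m \<and>
      has_jk_decomposition n (Amat n c x) (Amat n c a) (Kron (Suc m) # concat (map (\<lambda>t. map (Jord (Some t)) ns) ts))"
    using gen unfolding generic_def by blast
  \<comment> \<open>A single nonvanishing condition already describes the nonempty open set.\<close>
  define U where "U = {(x, a). ev w (join_pt n x a) \<noteq> 0}"
  have "zariski_open_pairs n U"
    unfolding zariski_open_pairs_def using w(1) by (intro exI[of _ "{ev w}"]) (auto simp: U_def polys_def)
  moreover have "U \<noteq> {}"
  proof -
    have "generic n (\<lambda>x a. ev w (join_pt n x a) \<noteq> 0)" unfolding generic_def using w(1,2) by blast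
    then show ?thesis using generic_point unfolding U_def by blast
  qed
  moreover have "\<exists>lams :: complex option list. distinct lams \<and> int (length lams) = k \<and>
      has_jk_decomposition n (Amat n c x) (Amat n c a') (Kron (nat k) # concat (map (\<lambda>lam. map (Jord lam) ns) lams))"
    if "(x, a') \<in> U" for x a'
  proof -
    have "ev w (join_pt n x a') \<noteq> 0" using that by (simp add: U_def)
    then obtain ts where ts: "distinct ts" "length ts = Suc m"
      "has_jk_decomposition n (Amat n c x) (Amat n c a') (Kron (Suc m) # concat (map (\<lambda>t. map (Jord (Some t)) ns) ts))"
      using w(3) by blast
    \<comment> \<open>The eigenvalues are the roots of a polynomial of full degree
      \<open>m + 1\<close>, so all of them are finite.\<close>
    have "distinct (map Some ts)" using ts(1) by (simp add: distinct_map)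
    moreover have "has_jk_decomposition n (Amat n c x) (Amat n c a') (Kron (nat k) # concat (map (\<lambda>lam. map (Jord lam) ns) (map Some ts)))"
      using ts(3) unfolding k nat_int map_map comp_def .
    ultimately show ?thesis using ts(2) k by (intro exI[of _ "map Some ts"]) simp
  qed
  moreover have "\<not> (\<exists>b. ?f = (\<lambda>x. b))"
  proof
    assume "\<exists>b. ?f = (\<lambda>x. b)"
    then obtain b where "?f = (\<lambda>x. b)" by blast
    then have "s.f = mconst b" by (intro ev_inject_fun) simp
    then have "homog 0 s.f" by simp
    then show False using homog_unique[OF _ s.f_homog s.f_nz] by blast
  qed
  moreover have "p = (\<lambda>x. a * ?f x ^ d)"
  proof -
    have "p = ev s.P" by (rule s.P(2)[symmetric])
    also have "\<dots> = (\<lambda>x. a * ?f x ^ d)" unfolding ad(1) by (rule ext) simp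
    finally show ?thesis .
  qed
  moreover have "d = polydeg n p div polydeg n ?f" unfolding s.polydeg_p dm ad(2)[symmetric] by (simp del: mult_Suc_right)
  moreover have "int (polydeg n ?f) = k" unfolding dm k ..
  ultimately show ?thesis
    using s.f_invariant s.invariants_eq ns by (intro exI[of _ ?f] exI[of _ d] exI[of _ a] conjI exI[of _ ns] exI[of _ U]) auto
qed

end
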